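(* Let $L>0$ and $K>0$. There is $\zeta_0$ (depending only on $L,K$) such that for every $\zeta\ge\zeta_0$ there is a constant $c$ (depending only on $\zeta,L,K$) such that the following holds for all integers $n\ge1$ and $\ell_1\ge\ell_2\ge1$. Set $d=\left\lceil\frac{n^{2/5}}{(\ell_1\ell_2)^{1/5}}\right\rceil$ and $\tau=\sqrt{\zeta d}$, suppose $d\,\ell_1\le K n$, and let $\psi_\tau(\mathcal D_N)$ be the test described in the context. Then for every $\varepsilon\ge c\,\frac{(\ell_1\ell_2)^{1/5}}{n^{2/5}}$, $$\sup_{p\in\mathcal P'_{0,[0,1],\chi^2}(L)}\mathbb E_p[\psi_\tau(\mathcal D_N)]\le\frac1{10},$$ $$\sup_{p\in\{p\in\mathcal Q'_{0,[0,1],\mathrm{TV}}(L):\ \inf_{q\in\mathcal P'_{0,[0,1]}}\|p-q\|_1\ge\varepsilon\}}\mathbb E_p[1-\psi_\tau(\mathcal D_N)]\le\frac1{10}+\exp(-n/8).$$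
   Context: Notation: $[\ell]=\{1,\dots,\ell\}$; $\|p-q\|_1=\int|\frac{dp}{d\nu}-\frac{dq}{d\nu}|d\nu$ for a common dominating measure $\nu$; $d_{\chi^2}(p,q)=\int(\frac{dp}{dq}-1)^2dq$ if $p\ll q$, $\infty$ otherwise. A supremum over the empty set is $0$. $\mathcal E'_{0,[0,1]}$ is the set of distributions $p=p_{X,Y,Z}$ of triples such that $Z$ has a distribution $p_Z$ supported on $[0,1]$ and absolutely continuous with respect to Lebesgue measure, and for almost all $z$ the conditional distribution $p_{X,Y|Z=z}$ is supported on $[\ell_1]\times[\ell_2]$. $\mathcal P'_{0,[0,1]}$ is the subset with $X$ and $Y$ conditionally independent given $Z$, and $\mathcal Q'_{0,[0,1]}=\mathcal E'_{0,[0,1]}\setminus\mathcal P'_{0,[0,1]}$. Conditions at every $z$ refer to a suitable version of the conditional distributions. - $\mathcal P'_{0,[0,1],\chi^2}(L)$: those $p\in\mathcal P'_{0,[0,1]}$ with $d_{\chi^2}(p_{X|Z=z},p_{X|Z=z'})\le L|z-z'|$ and $d_{\chi^2}(p_{Y|Z=z},p_{Y|Z=z'})\le L|z-z'|$ for all $z,z'\in[0,1]$. - $\mathcal Q'_{0,[0,1],\mathrm{TV}}(L)$: those $p\in\mathcal Q'_{0,[0,1]}$ with $\|p_{X,Y|Z=z}-p_{X,Y|Z=z'}\|_1\le L|z-z'|$ for all $z,z'\in[0,1]$. Weighted U-statistic $U_W(\mathcal D)$: let $\mathcal D$ consist of at least $4$ ordered observations $(X_i',Y_i')\in[\ell_1]\times[\ell_2]$.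 Discarding at most three of them, assume their number is $\sigma=4+4t$ with $t\ge0$ an integer. Let $t_1=\min(t,\ell_1)$, $t_2=\min(t,\ell_2)$ and split: $\mathcal D_{X'}=\{X_i':1\le i\le t_1\}$, $\mathcal D_{Y'}=\{Y_i':t_1+1\le i\le t_1+t_2\}$, $\mathcal D_{X',Y'}=\{(X_i',Y_i'):2t+1\le i\le\sigma\}$. Let $a_x$ be the number of occurrences of $x$ in $\mathcal D_{X'}$, $a'_y$ the number of occurrences of $y$ in $\mathcal D_{Y'}$, and define $a_{xy}$ by $1+a_{xy}=(1+a_x)(1+a'_y)$. Put $\phi_{ij}(xy)=\mathbf 1(X'_i=x,Y'_i=y)-\mathbf 1(X'_i=x)\mathbf 1(Y'_j=y)$ and, for distinct indices $i,j,k,l$ of observations in $\mathcal D_{X',Y'}$, $$h^{\mathbf a}_{ijkl}=\frac1{4!}\sum_\pi\sum_{x\in[\ell_1],y\in[\ell_2]}\frac{\phi_{\pi_1\pi_2}(xy)\phi_{\pi_3\pi_4}(xy)}{1+a_{xy}},$$ the sum over all permutations $\pi$ of $(i,j,k,l)$. Then $U_W(\mathcal D)=\binom{2t+4}4^{-1}\sum_{i<j<k<l}h^{\mathbf a}_{ijkl}$, the sum over indices in $\mathcal D_{X',Y'}$. Test: we observe $n$ i.i.d. triples $(X_i,Y_i,Z_i)\sim p$. Independently draw $N\sim\mathrm{Poi}(n/2)$; if $N>n$ accept the null hypothesis (the test takes value $0$). If $N\le n$, take an arbitrary $N$ of the samples (say the first $N$), $\mathcal D_N=\{(X_i,Y_i,Z_i)\}_{i\in[N]}$.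 Partition $[0,1]$ into $d$ intervals $C_1,\dots,C_d$ of length $1/d$; let $\mathcal D_m=\{(X_i,Y_i):Z_i\in C_m,\ i\in[N]\}$, $\sigma_m=|\mathcal D_m|$, $U_m=U_W(\mathcal D_m)$ when $\sigma_m\ge4$, $\omega_m=\sqrt{\min(\sigma_m,\ell_1)\min(\sigma_m,\ell_2)}$, and $$T=\sum_{m\in[d]}\mathbf 1(\sigma_m\ge4)\,\sigma_m\omega_mU_m,\qquad \psi_\tau(\mathcal D_N)=\mathbf 1(T\ge\tau).$$ Expectations $\mathbb E_p$ are over both the data and $N$. *)

theory Defs
  imports "HOL-Probability.Probability" "HOL-Combinatorics.Permutations"
begin

section \<open>Distances between distributions\<close>

text \<open>
  The first argument of \<open>l1_dist\<close> is a common dominating measure; the value does not depend on the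
  choice among sigma-finite ones.
\<close>

definition l1_dist :: "'a measure \<Rightarrow> 'a measure \<Rightarrow> 'a measure \<Rightarrow> real" where
  "l1_dist \<nu> p q = (\<integral>x. \<bar>enn2real (RN_deriv \<nu> p x) - enn2real (RN_deriv \<nu> q x)\<bar> \<partial>\<nu>)"

definition chi2_div :: "'a measure \<Rightarrow> 'a measure \<Rightarrow> ennreal" where
  "chi2_div p q =
     (if absolutely_continuous q p
      then (\<integral>\<^sup>+x. ennreal ((enn2real (RN_deriv q p x) - 1)\<^sup>2) \<partial>q)
      else \<infinity>)"

section \<open>Classes of distributions of (X, Y, Z)\<close>

type_synonym triple = "nat \<times> nat \<times> real"

definition X_of :: "triple \<Rightarrow> nat" where "X_of s = fst s"
definition Y_of :: "triple \<Rightarrow> nat" where "Y_of s = fst (snd s)"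
definition Z_of :: "triple \<Rightarrow> real" where "Z_of s = snd (snd s)"
definition XY_of :: "triple \<Rightarrow> nat \<times> nat" where "XY_of s = (X_of s, Y_of s)"

text \<open>
  Distributions of triples live on the sigma-algebra of \<open>ref_measure\<close>. Since X and Y are discrete
  and the law of Z is absolutely continuous, \<open>ref_measure\<close> also dominates every element of the
  class \<open>E_class\<close> below, and serves as the common dominating measure for the L1 distance on it.
\<close>

definition ref_measure :: "triple measure" where
  "ref_measure = count_space UNIV \<Otimes>\<^sub>M (count_space UNIV \<Otimes>\<^sub>M lborel)"

definition Z_law :: "triple measure \<Rightarrow> real measure" where
  "Z_law p = distr p borel Z_of"

text \<open>
  \<open>cond_version p f \<kappa>\<close>: the kernel \<open>\<kappa>\<close> is a version of the conditional distribution of the discrete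
  variable \<open>f\<close> given Z under \<open>p\<close>.
\<close>

definition cond_version ::
    "triple measure \<Rightarrow> (triple \<Rightarrow> 'w::countable) \<Rightarrow> (real \<Rightarrow> 'w pmf) \<Rightarrow> bool" where
  "cond_version p f \<kappa> \<longleftrightarrow>
     (\<forall>w. (\<lambda>z. pmf (\<kappa> z) w) \<in> borel_measurable borel) \<and>
     (\<forall>w. \<forall>B\<in>sets borel.
        measure p {s \<in> space p. f s = w \<and> Z_of s \<in> B} = (\<integral>z\<in>B. pmf (\<kappa> z) w \<partial>Z_law p))"

definition E_class :: "nat \<Rightarrow> nat \<Rightarrow> triple measure set" where
  "E_class l1 l2 =
     {p. prob_space p \<and> sets p = sets ref_measure \<and>
         (AE z in Z_law p. z \<in> {0..1}) \<and>
         absolutely_continuous lborel (Z_law p) \<and>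
         (\<exists>\<kappa>. cond_version p XY_of \<kappa> \<and>
              (AE z in Z_law p. set_pmf (\<kappa> z) \<subseteq> {1..l1} \<times> {1..l2}))}"

definition P_class :: "nat \<Rightarrow> nat \<Rightarrow> triple measure set" where
  "P_class l1 l2 =
     {p \<in> E_class l1 l2.
        \<exists>\<kappa>. cond_version p XY_of \<kappa> \<and>
            (AE z in Z_law p. \<kappa> z = pair_pmf (map_pmf fst (\<kappa> z)) (map_pmf snd (\<kappa> z)))}"

definition Q_class :: "nat \<Rightarrow> nat \<Rightarrow> triple measure set" where
  "Q_class l1 l2 = E_class l1 l2 - P_class l1 l2"

definition P_chi2 :: "nat \<Rightarrow> nat \<Rightarrow> real \<Rightarrow> triple measure set" where
  "P_chi2 l1 l2 L =
     {p \<in> P_class l1 l2.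
        (\<exists>\<kappa>. cond_version p X_of \<kappa> \<and>
             (\<forall>z\<in>{0..1}. \<forall>z'\<in>{0..1}.
                chi2_div (measure_pmf (\<kappa> z)) (measure_pmf (\<kappa> z')) \<le> ennreal (L * \<bar>z - z'\<bar>))) \<and>
        (\<exists>\<kappa>. cond_version p Y_of \<kappa> \<and>
             (\<forall>z\<in>{0..1}. \<forall>z'\<in>{0..1}.
                chi2_div (measure_pmf (\<kappa> z)) (measure_pmf (\<kappa> z')) \<le> ennreal (L * \<bar>z - z'\<bar>)))}"

definition Q_TV :: "nat \<Rightarrow> nat \<Rightarrow> real \<Rightarrow> triple measure set" where
  "Q_TV l1 l2 L =
     {p \<in> Q_class l1 l2.
        \<exists>\<kappa>. cond_version p XY_of \<kappa> \<and>
            (\<forall>z\<in>{0..1}. \<forall>z'\<in>{0..1}.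
               l1_dist (count_space UNIV) (measure_pmf (\<kappa> z)) (measure_pmf (\<kappa> z')) \<le> L * \<bar>z - z'\<bar>)}"

definition Q_TV_far :: "nat \<Rightarrow> nat \<Rightarrow> real \<Rightarrow> real \<Rightarrow> triple measure set" where
  "Q_TV_far l1 l2 L \<epsilon> =
     {p \<in> Q_TV l1 l2 L. (INF q\<in>P_class l1 l2. l1_dist ref_measure p q) \<ge> \<epsilon>}"

section \<open>The weighted U-statistic\<close>

text \<open>
  Observations are numbered from 1. The statistic uses the first \<open>4 + 4 * ustat_t D\<close> entries of the
  list \<open>D\<close> and discards the (at most three) remaining ones.
\<close>

definition obs_X :: "(nat \<times> nat) list \<Rightarrow> nat \<Rightarrow> nat" where "obs_X D i = fst (D ! (i - 1))"
definition obs_Y :: "(nat \<times> nat) list \<Rightarrow> nat \<Rightarrow> nat" where "obs_Y D i = snd (D ! (i - 1))"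

definition ustat_t :: "(nat \<times> nat) list \<Rightarrow> nat" where
  "ustat_t D = (length D - 4) div 4"

definition weight_X :: "nat \<Rightarrow> (nat \<times> nat) list \<Rightarrow> nat \<Rightarrow> nat" where
  "weight_X l1 D x = card {i \<in> {1..min (ustat_t D) l1}. obs_X D i = x}"

definition weight_Y :: "nat \<Rightarrow> nat \<Rightarrow> (nat \<times> nat) list \<Rightarrow> nat \<Rightarrow> nat" where
  "weight_Y l1 l2 D y =
     (let t1 = min (ustat_t D) l1; t2 = min (ustat_t D) l2
      in card {i \<in> {t1 + 1..t1 + t2}. obs_Y D i = y})"

text \<open>The weight \<open>a\<close> determined by \<open>1 + a x y = (1 + weight_X x) * (1 + weight_Y y)\<close>.\<close>

definition weight_XY :: "nat \<Rightarrow> nat \<Rightarrow> (nat \<times> nat) list \<Rightarrow> nat \<Rightarrow> nat \<Rightarrow> nat" where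
  "weight_XY l1 l2 D x y = (1 + weight_X l1 D x) * (1 + weight_Y l1 l2 D y) - 1"

definition phi :: "(nat \<times> nat) list \<Rightarrow> nat \<Rightarrow> nat \<Rightarrow> nat \<Rightarrow> nat \<Rightarrow> real" where
  "phi D i j x y =
     of_bool (obs_X D i = x \<and> obs_Y D i = y) - of_bool (obs_X D i = x) * of_bool (obs_Y D j = y)"

text \<open>Only used for distinct \<open>i, j, k, l\<close>, where the sum has 24 terms.\<close>

definition h_kernel ::
    "nat \<Rightarrow> nat \<Rightarrow> (nat \<times> nat) list \<Rightarrow> nat \<Rightarrow> nat \<Rightarrow> nat \<Rightarrow> nat \<Rightarrow> real" where
  "h_kernel l1 l2 D i j k l =
     1 / fact 4 *
     (\<Sum>\<pi> | \<pi> permutes {i, j, k, l}. \<Sum>x\<in>{1..l1}. \<Sum>y\<in>{1..l2}.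
        phi D (\<pi> i) (\<pi> j) x y * phi D (\<pi> k) (\<pi> l) x y / (1 + real (weight_XY l1 l2 D x y)))"

definition U_W :: "nat \<Rightarrow> nat \<Rightarrow> (nat \<times> nat) list \<Rightarrow> real" where
  "U_W l1 l2 D =
     (let t = ustat_t D
      in 1 / real ((2 * t + 4) choose 4) *
         (\<Sum>(i, j, k, l) | 2 * t + 1 \<le> i \<and> i < j \<and> j < k \<and> k < l \<and> l \<le> 4 + 4 * t.
            h_kernel l1 l2 D i j k l))"

section \<open>The test\<close>

text \<open>
  The partition of the unit interval into half-open cells, the last one closed. How endpoints are
  assigned is immaterial because the law of Z is absolutely continuous.
\<close>

definition cell :: "nat \<Rightarrow> nat \<Rightarrow> real set" where
  "cell d m = {real (m - 1) / real d..<real m / real d} \<union> (if m = d then {1} else {})"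

text \<open>Samples are functions on \<open>{1..n}\<close>; \<open>N\<close> observations means the first \<open>N\<close> of them.\<close>

definition cell_data :: "nat \<Rightarrow> (nat \<Rightarrow> triple) \<Rightarrow> nat \<Rightarrow> nat \<Rightarrow> (nat \<times> nat) list" where
  "cell_data d S N m = map (\<lambda>i. XY_of (S i)) (filter (\<lambda>i. Z_of (S i) \<in> cell d m) [1..<N + 1])"

text \<open>Here \<open>\<sigma>\<close> is the full cell count, before \<open>U_W\<close> discards observations.\<close>

definition T_stat :: "nat \<Rightarrow> nat \<Rightarrow> nat \<Rightarrow> (nat \<Rightarrow> triple) \<Rightarrow> nat \<Rightarrow> real" where
  "T_stat l1 l2 d S N =
     (\<Sum>m\<in>{1..d}.
        let D = cell_data d S N m;
            \<sigma> = length D;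
            \<omega> = sqrt (real (min \<sigma> l1) * real (min \<sigma> l2))
        in of_bool (\<sigma> \<ge> 4) * real \<sigma> * \<omega> * U_W l1 l2 D)"

definition psi ::
    "nat \<Rightarrow> nat \<Rightarrow> nat \<Rightarrow> nat \<Rightarrow> real \<Rightarrow> (nat \<Rightarrow> triple) \<Rightarrow> nat \<Rightarrow> real" where
  "psi n l1 l2 d \<tau> S N = (if N \<le> n then of_bool (T_stat l1 l2 d S N \<ge> \<tau>) else 0)"

definition expect :: "nat \<Rightarrow> triple measure \<Rightarrow> ((nat \<Rightarrow> triple) \<Rightarrow> nat \<Rightarrow> real) \<Rightarrow> real" where
  "expect n p f =
     (\<integral>(S, N). f S N \<partial>((\<Pi>\<^sub>M i\<in>{1..n}. p) \<Otimes>\<^sub>M measure_pmf (poisson_pmf (real n / 2))))"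

definition num_cells :: "nat \<Rightarrow> nat \<Rightarrow> nat \<Rightarrow> nat" where
  "num_cells n l1 l2 = nat \<lceil>real n powr (2 / 5) / real (l1 * l2) powr (1 / 5)\<rceil>"

end

theory Submission
  imports Defs
begin

text \<open>
  Fix the number \<open>N \<le> n\<close> of observations and condition on the cell labels: then the cells are
  independent and each of them carries an i.i.d. sample of the averaged law \<open>q\<close> of its cell, so
  the Poissonization only serves to make \<open>n/4 \<le> N \<le> n\<close> likely. Conditioning also on the
  observations that define the weights, the U-statistic of a cell is an unbiased estimator of
  \<open>D = \<Sum> \<Delta>\<^sup>2 / (1 + a)\<close>, where \<open>\<Delta>\<close> is the difference between \<open>q\<close> and the product of its marginals. Its
  kernel is a bilinear form in point masses, and its decomposition into a centred linear part and
  a degenerate part bounds the variance by a multiple of \<open>D \<surd>b / s + b / s\<^sup>2\<close>, where \<open>s\<close> is the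
  number of observations used and \<open>b\<close> the sum of the squared weighted norms of \<open>q\<close> and of the product.

  Under the null hypothesis \<open>\<Delta>\<close> is the covariance, over the cell, of the conditional
  probabilities of \<open>X\<close> and \<open>Y\<close>. By convexity the chi-squared condition bounds the variances of
  these probabilities relative to the marginals by \<open>L / d\<close>, and since the weights satisfy
  \<open>E (1 + a\<^sub>x)\<^sup>-\<^sup>2 \<le> 2 / ((t\<^sub>1 + 1) q\<^sub>X(x))\<^sup>2\<close>, the second moment of the statistic is of order \<open>d\<close>. Under the
  alternative, comparison of \<open>p\<close> with the law that on each cell is the product of the averaged
  marginals shows that \<open>\<Sum> P(C\<^sub>m) \<parallel>\<Delta>\<^sub>m\<parallel>\<^sub>1 \<ge> 3 \<epsilon> / 4\<close>. The Cauchy-Schwarz inequality turns this into a lower bound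
  for the conditional mean of the statistic that holds for all values of the weights.
\<close>

section \<open>Expectations over finitely supported distributions\<close>

text \<open>Even under the null hypothesis the statistic has a positive mean, because mixing over a
  cell creates dependence. With \<open>\<kappa> = L / d\<close> this mean is of order
  \<open>\<kappa>^2 * (\<Sum> \<sigma> / \<omega>)\<close>, and by \<open>d * l1 \<le> K * n\<close>
  the sum is at most of order \<open>x^(5/2)\<close>, where
  \<open>x = n^(2/5) / (l1 * l2)^(1/5)\<close>. The mean is thus at most of order
  \<open>sqrt d\<close>, which is also the standard deviation contributed by \<open>d\<close> cells
  of bounded variance. This balance dictates the number of cells and the threshold
  \<open>sqrt (\<zeta> * d)\<close>. The obstacle is that the variance depends on random weights and
  the signal on random cell counts. The weighted norms are controlled only in expectation, and
  single cells may receive too few observations. Both losses are summed over the cells and bounded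
  by Markov's inequality, which avoids any concentration statement uniform in the cells. The
  statistic sees a triple only through its cell, X and Y. The sample is therefore replaced by a
  finitely supported product law, under which every function is integrable.\<close>

abbreviation E_pmf :: "'a pmf \<Rightarrow> ('a \<Rightarrow> real) \<Rightarrow> real" where
  "E_pmf p f \<equiv> measure_pmf.expectation p f"

abbreviation (input) fin_supp :: "'a pmf \<Rightarrow> bool" where "fin_supp p \<equiv> finite (set_pmf p)"

lemma E_pmf_add: "fin_supp p \<Longrightarrow> E_pmf p (\<lambda>x. f x + g x) = E_pmf p f + E_pmf p g"
  by (intro Bochner_Integration.integral_add integrable_measure_pmf_finite)

lemma E_pmf_diff: "fin_supp p \<Longrightarrow> E_pmf p (\<lambda>x. f x - g x) = E_pmf p f - E_pmf p g"
  by (intro Bochner_Integration.integral_diff integrable_measure_pmf_finite)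

lemma E_pmf_sum: "fin_supp p \<Longrightarrow> E_pmf p (\<lambda>x. \<Sum>i\<in>I. f i x) = (\<Sum>i\<in>I. E_pmf p (f i))"
  by (intro Bochner_Integration.integral_sum integrable_measure_pmf_finite)

lemma E_pmf_mono:
  assumes "fin_supp p" "\<And>x. x \<in> set_pmf p \<Longrightarrow> f x \<le> g x"
  shows "E_pmf p f \<le> E_pmf p g"
  using assms by (intro integral_mono_AE integrable_measure_pmf_finite) (auto simp: AE_measure_pmf_iff)

lemma E_pmf_cong: "(\<And>x. x \<in> set_pmf p \<Longrightarrow> f x = g x) \<Longrightarrow> E_pmf p f = E_pmf p g"
  by (intro integral_cong_AE) (auto simp: AE_measure_pmf_iff)

lemma E_pmf_nonneg: "(\<And>x. x \<in> set_pmf p \<Longrightarrow> 0 \<le> f x) \<Longrightarrow> 0 \<le> E_pmf p f"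
  by (intro integral_nonneg_AE) (auto simp: AE_measure_pmf_iff)

lemma E_pmf_const [simp]: "E_pmf p (\<lambda>_. c) = c"
  by simp

lemma E_pmf_le_const:
  assumes "fin_supp p" "\<And>x. x \<in> set_pmf p \<Longrightarrow> f x \<le> c"
  shows "E_pmf p f \<le> c"
  using E_pmf_mono[OF assms(1), of f "\<lambda>_. c"] assms by simp

lemma E_pmf_point:
  assumes "fin_supp p"
  shows "E_pmf p (\<lambda>x. of_bool (x = a) * c) = pmf p a * c"
proof -
  have "E_pmf p (\<lambda>x. of_bool (x = a) * c) = (\<Sum>x\<in>{a}. (of_bool (x = a) * c) * pmf p x)"
    by (rule integral_measure_pmf_real) (auto split: if_splits)
  then show ?thesis by simp
qed

lemma E_pmf_on:
  assumes "finite G" "set_pmf p \<subseteq> G"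
  shows "E_pmf p f = (\<Sum>a\<in>G. pmf p a * f a)"
proof -
  have "E_pmf p f = (\<Sum>a\<in>G. f a * pmf p a)"
    by (rule integral_measure_pmf_real) (use assms in auto)
  then show ?thesis by (simp add: mult.commute)
qed

lemma E_pmf_bind:
  assumes "fin_supp p" "\<And>x. x \<in> set_pmf p \<Longrightarrow> fin_supp (q x)"
  shows "E_pmf (bind_pmf p q) f = E_pmf p (\<lambda>x. E_pmf (q x) f)"
proof -
  have "E_pmf (bind_pmf p q) f = (\<Sum>a\<in>set_pmf p. pmf p a *\<^sub>R E_pmf (q a) f)"
    by (rule pmf_expectation_bind) (use assms in auto)
  also have "\<dots> = E_pmf p (\<lambda>x. E_pmf (q x) f)"
    by (simp add: E_pmf_on[OF assms(1) order_refl])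
  finally show ?thesis .
qed

lemma E_pmf_pair:
  assumes "fin_supp p" "fin_supp q"
  shows "E_pmf (pair_pmf p q) f = E_pmf p (\<lambda>a. E_pmf q (\<lambda>b. f (a, b)))"
  unfolding pair_pmf_def using assms
  by (subst E_pmf_bind) (auto simp: E_pmf_bind)

lemma E_pmf_sq_le:
  assumes "fin_supp p"
  shows "(E_pmf p f)\<^sup>2 \<le> E_pmf p (\<lambda>x. (f x)\<^sup>2)"
proof -
  have "0 \<le> E_pmf p (\<lambda>x. (f x - E_pmf p f)\<^sup>2)" by (rule E_pmf_nonneg) simp
  also have "E_pmf p (\<lambda>x. (f x - E_pmf p f)\<^sup>2) = E_pmf p (\<lambda>x. (f x)\<^sup>2 - 2 * E_pmf p f * f x + (E_pmf p f)\<^sup>2)"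
    by (simp add: power2_eq_square algebra_simps)
  also have "\<dots> = E_pmf p (\<lambda>x. (f x)\<^sup>2) - (E_pmf p f)\<^sup>2"
    using assms by (simp add: E_pmf_add E_pmf_diff power2_eq_square)
  finally show ?thesis by simp
qed

section \<open>Product laws and functions of few coordinates\<close>

lemma fin_supp_Pi [intro, simp]:
  assumes "finite J" "\<And>i. i \<in> J \<Longrightarrow> fin_supp (Q i)"
  shows "fin_supp (Pi_pmf J d Q)"
  using assms by (auto simp: set_Pi_pmf intro!: finite_PiE_dflt)

lemma Pi_supp: "finite J \<Longrightarrow> i \<in> J \<Longrightarrow> \<omega> \<in> set_pmf (Pi_pmf J d Q) \<Longrightarrow> \<omega> i \<in> set_pmf (Q i)"
  by (auto simp: set_Pi_pmf PiE_dflt_def)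

lemma E_pmf_Pi_union:
  assumes "finite A" "finite B" "A \<inter> B = {}" "\<And>i. i \<in> A \<union> B \<Longrightarrow> fin_supp (Q i)"
  shows "E_pmf (Pi_pmf (A \<union> B) d Q) f =
    E_pmf (Pi_pmf A d Q) (\<lambda>g. E_pmf (Pi_pmf B d Q) (\<lambda>h. f (\<lambda>x. if x \<in> A then g x else h x)))"
  using assms
  by (subst Pi_pmf_union) (auto simp: E_pmf_pair case_prod_unfold intro!: E_pmf_cong cong: if_cong)

text \<open>Stands in for measurability with respect to the coordinates in \<open>A\<close>.
  Independence of functions of disjoint blocks then reduces to splitting the product law,
  \<open>E_pmf_Pi_indep\<close>.\<close>

definition depends_on :: "'i set \<Rightarrow> (('i \<Rightarrow> 'a) \<Rightarrow> 'b) \<Rightarrow> bool" where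
  "depends_on A f \<longleftrightarrow> (\<forall>\<omega> \<omega>'. (\<forall>i\<in>A. \<omega> i = \<omega>' i) \<longrightarrow> f \<omega> = f \<omega>')"

lemma depends_onI: "(\<And>\<omega> \<omega>'. (\<And>i. i \<in> A \<Longrightarrow> \<omega> i = \<omega>' i) \<Longrightarrow> f \<omega> = f \<omega>') \<Longrightarrow> depends_on A f"
  unfolding depends_on_def by blast

lemma depends_onD: "depends_on A f \<Longrightarrow> (\<And>i. i \<in> A \<Longrightarrow> \<omega> i = \<omega>' i) \<Longrightarrow> f \<omega> = f \<omega>'"
  unfolding depends_on_def by blast

lemma depends_on_comp: "depends_on A f \<Longrightarrow> depends_on A (\<lambda>\<omega>. h (f \<omega>))"
  by (rule depends_onI, rule arg_cong[of _ _ h], rule depends_onD)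

lemma E_pmf_Pi_restrict:
  assumes "finite J" "A \<subseteq> J" "depends_on A f"
  shows "E_pmf (Pi_pmf J d Q) f = E_pmf (Pi_pmf A d Q) f"
proof -
  have "E_pmf (Pi_pmf A d Q) f = E_pmf (Pi_pmf J d Q) (\<lambda>\<omega>. f (\<lambda>x. if x \<in> A then \<omega> x else d))"
    by (subst Pi_pmf_subset[OF assms(1,2)]) simp
  also have "\<dots> = E_pmf (Pi_pmf J d Q) f"
    by (rule E_pmf_cong, rule depends_onD[OF assms(3)]) simp
  finally show ?thesis by simp
qed

lemma E_pmf_Pi_indep:
  assumes "finite J" "A \<subseteq> J" "B \<subseteq> J" "A \<inter> B = {}" "depends_on A f" "depends_on B g" "\<And>i. i \<in> J \<Longrightarrow> fin_supp (Q i)"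
  shows "E_pmf (Pi_pmf J d Q) (\<lambda>\<omega>. f \<omega> * g \<omega>) = E_pmf (Pi_pmf J d Q) f * E_pmf (Pi_pmf J d Q) g"
proof -
  have fin: "finite A" "finite B" using assms(1-3) by (blast intro: finite_subset)+
  have "E_pmf (Pi_pmf J d Q) (\<lambda>\<omega>. f \<omega> * g \<omega>) = E_pmf (Pi_pmf (A \<union> B) d Q) (\<lambda>\<omega>. f \<omega> * g \<omega>)"
    by (rule E_pmf_Pi_restrict)
      (use assms in \<open>auto intro!: depends_onI arg_cong2[where f="(*)"] intro: depends_onD[OF assms(5)] depends_onD[OF assms(6)]\<close>)
  also have "\<dots> = E_pmf (Pi_pmf A d Q) (\<lambda>a. E_pmf (Pi_pmf B d Q) (\<lambda>b. f a * g b))"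
  proof (subst E_pmf_Pi_union)
    show "E_pmf (Pi_pmf A d Q) (\<lambda>a. E_pmf (Pi_pmf B d Q) (\<lambda>b. f (\<lambda>x. if x \<in> A then a x else b x) *
      g (\<lambda>x. if x \<in> A then a x else b x))) = E_pmf (Pi_pmf A d Q) (\<lambda>a. E_pmf (Pi_pmf B d Q) (\<lambda>b. f a * g b))"
      by (intro E_pmf_cong arg_cong2[where f="(*)"] depends_onD[OF assms(5)] depends_onD[OF assms(6)])
        (use assms in auto)
  qed (use fin assms in auto)
  also have "\<dots> = E_pmf (Pi_pmf A d Q) f * E_pmf (Pi_pmf B d Q) g" by simp
  also have "\<dots> = E_pmf (Pi_pmf J d Q) f * E_pmf (Pi_pmf J d Q) g"
    using E_pmf_Pi_restrict[OF assms(1,2,5)] E_pmf_Pi_restrict[OF assms(1,3,6)] by simp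
  finally show ?thesis .
qed

lemma E_pmf_Pi_1:
  assumes "finite J" "i \<in> J"
  shows "E_pmf (Pi_pmf J d Q) (\<lambda>\<omega>. f (\<omega> i)) = E_pmf (Q i) f"
proof -
  have "E_pmf (map_pmf (\<lambda>\<omega>. \<omega> i) (Pi_pmf J d Q)) f = E_pmf (Q i) f"
    by (subst Pi_pmf_component) (use assms in auto)
  then show ?thesis by simp
qed

lemma E_pmf_Pi_2:
  assumes "finite J" "i \<in> J" "j \<in> J" "i \<noteq> j" "\<And>i. i \<in> J \<Longrightarrow> fin_supp (Q i)"
  shows "E_pmf (Pi_pmf J d Q) (\<lambda>\<omega>. f (\<omega> i) (\<omega> j)) = E_pmf (Q i) (\<lambda>a. E_pmf (Q j) (\<lambda>b. f a b))"
proof -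
  have "E_pmf (Pi_pmf J d Q) (\<lambda>\<omega>. f (\<omega> i) (\<omega> j)) = E_pmf (Pi_pmf ({i} \<union> {j}) d Q) (\<lambda>\<omega>. f (\<omega> i) (\<omega> j))"
    by (rule E_pmf_Pi_restrict) (use assms in \<open>auto intro!: depends_onI\<close>)
  also have "\<dots> = E_pmf (Pi_pmf {i} d Q) (\<lambda>a. E_pmf (Pi_pmf {j} d Q) (\<lambda>b. f (a i) (b j)))"
    using assms by (subst E_pmf_Pi_union) auto
  also have "\<dots> = E_pmf (Q i) (\<lambda>a. E_pmf (Q j) (\<lambda>b. f a b))"
    by (simp add: E_pmf_Pi_1 E_pmf_Pi_1[of "{i}" i, where f="\<lambda>a. E_pmf (Q j) (f a)"])
  finally show ?thesis .
qed

section \<open>Mean and variance of the weighted U-statistic\<close>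

text \<open>The gap is a sum of six squares, one for each pair of the signed terms.\<close>

lemma square_of_four_le:
  fixes a b c e :: real
  shows "(a - b - c + e)\<^sup>2 \<le> (4 * a\<^sup>2 + 4 * b\<^sup>2) + (4 * c\<^sup>2 + 4 * e\<^sup>2)"
proof -
  have "(4 * a\<^sup>2 + 4 * b\<^sup>2) + (4 * c\<^sup>2 + 4 * e\<^sup>2) - (a - b - c + e)\<^sup>2
    = (a + b)\<^sup>2 + (a + c)\<^sup>2 + (a - e)\<^sup>2 + (b - c)\<^sup>2 + (b + e)\<^sup>2 + (c + e)\<^sup>2"
    by (simp add: power2_eq_square algebra_simps)
  also have "\<dots> \<ge> 0" by (intro add_nonneg_nonneg) auto
  finally show ?thesis by simp
qed

section \<open>Counting index tuples by their overlaps\<close>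

definition tuples4 :: "'i set \<Rightarrow> ('i \<times> 'i \<times> 'i \<times> 'i) set" where
  "tuples4 I = {(i, j, k, l). {i, j, k, l} \<subseteq> I \<and> distinct [i, j, k, l]}"

lemma card_tuples4:
  assumes "finite I" "card I \<ge> 4"
  shows "card (tuples4 I) = card I * (card I - 1) * (card I - 2) * (card I - 3)"
proof -
  let ?f = "\<lambda>(i, j, k, l). [i, j, k, l]"
  have "bij_betw ?f (tuples4 I) {xs. length xs = 4 \<and> distinct xs \<and> set xs \<subseteq> I}"
    unfolding bij_betw_def
  proof
    show "inj_on ?f (tuples4 I)" by (auto simp: inj_on_def)
    show "?f ` tuples4 I = {xs. length xs = 4 \<and> distinct xs \<and> set xs \<subseteq> I}"
    proof safe
      fix xs assume "length xs = 4" "distinct xs" "set xs \<subseteq> I"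
      then show "xs \<in> ?f ` tuples4 I"
        by (auto simp: tuples4_def image_iff length_Suc_conv numeral_eq_Suc)
    qed (auto simp: tuples4_def)
  qed
  then have "card (tuples4 I) = card {xs. length xs = 4 \<and> distinct xs \<and> set xs \<subseteq> I}"
    by (rule bij_betw_same_card)
  also have "\<dots> = \<Prod>{card I - 4 + 1..card I}"
    by (rule card_lists_distinct_length_eq) (use assms in auto)
  also have "{card I - 4 + 1..card I} = {card I, card I - 1, card I - 2, card I - 3}"
    using assms by auto
  also have "\<Prod>\<dots> = card I * (card I - 1) * (card I - 2) * (card I - 3)"
  proof -
    have "card I \<noteq> card I - 1" "card I \<noteq> card I - 2" "card I \<noteq> card I - 3" "card I - 1 \<noteq> card I - 2"
      "card I - 1 \<noteq> card I - 3" "card I - 2 \<noteq> card I - 3" using assms by linarith+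
    then show ?thesis by (simp add: mult.assoc)
  qed
  finally show ?thesis .
qed

lemma finite_tuples4 [simp]: "finite I \<Longrightarrow> finite (tuples4 I)"
  by (rule finite_subset[of _ "I \<times> I \<times> I \<times> I"]) (auto simp: tuples4_def)

text \<open>For \<open>s \<ge> 4\<close> the factor \<open>s - k\<close> is at least
  \<open>(1 - k / 4) * s\<close>, and \<open>6 / 64\<close> is the product of \<open>3/4\<close>,
  \<open>2/4\<close> and \<open>1/4\<close>.\<close>

lemma card_tuples4_ge:
  assumes "finite I" "card I \<ge> 4"
  shows "real (card (tuples4 I)) \<ge> 6 / 64 * real (card I) ^ 4"
proof -
  define s where "s = real (card I)"
  have s: "s \<ge> 4" using assms s_def by simp
  have "real (card (tuples4 I)) = s * (s - 1) * (s - 2) * (s - 3)"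
    unfolding s_def using assms by (simp add: card_tuples4 of_nat_diff)
  moreover have "s * (s - 1) * (s - 2) * (s - 3) \<ge> s * (3/4 * s) * (2/4 * s) * (1/4 * s)"
    by (intro mult_mono) (use s in auto)
  ultimately show ?thesis unfolding s_def[symmetric] by (simp add: power4_eq_xxxx algebra_simps)
qed

lemma card_Un_images_le:
  assumes "finite A"
  shows "card (\<Union>f\<in>set fl. f ` A) \<le> length fl * card A"
proof -
  have "card (\<Union>f\<in>set fl. f ` A) \<le> (\<Sum>f\<in>set fl. card (f ` A))" by (rule card_UN_le) simp
  also have "\<dots> \<le> (\<Sum>f\<in>set fl. card A)" by (intro sum_mono card_image_le assms)
  also have "\<dots> \<le> length fl * card A" by (simp add: card_length)
  finally show ?thesis .
qed

text \<open>A shared index leaves three free entries; the factor counts which of the two positions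
  holds which of \<open>i\<close> and \<open>j\<close>. The condition concerns the first two entries
  because the linear part is a function of those.\<close>

lemma card_tuples4_hit:
  fixes I :: "'i set"
  assumes "finite I"
  shows "card {(i', j', k', l') \<in> tuples4 I. {i', j'} \<inter> {i, j} \<noteq> {}} \<le> 4 * card I ^ 3"
proof -
  let ?fl = "[\<lambda>(a, b, c). (i, a, b, c), \<lambda>(a, b, c). (j, a, b, c),
    \<lambda>(a, b, c). (a, i, b, c), \<lambda>(a, b, c). (a, j, b, c)] :: ('i \<times> 'i \<times> 'i \<Rightarrow> 'i \<times> 'i \<times> 'i \<times> 'i) list"
  have "card {(i', j', k', l') \<in> tuples4 I. {i', j'} \<inter> {i, j} \<noteq> {}}
      \<le> card (\<Union>f\<in>set ?fl. f ` (I \<times> I \<times> I))"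
    by (rule card_mono) (use assms in \<open>auto simp: tuples4_def image_iff\<close>)
  also have "\<dots> \<le> length ?fl * card (I \<times> I \<times> I)"
    by (rule card_Un_images_le[of "I \<times> I \<times> I" ?fl]) (use assms in auto)
  finally show ?thesis by (simp add: card_cartesian_product power3_eq_cube)
qed

text \<open>There are \<open>4 * 3\<close> ways to place \<open>u\<close> and \<open>v\<close>, each
  leaving two free entries.\<close>

lemma card_tuples4_hit2:
  fixes I :: "'i set"
  assumes "finite I" "u \<noteq> v"
  shows "card {(i', j', k', l') \<in> tuples4 I. u \<in> {i', j', k', l'} \<and> v \<in> {i', j', k', l'}}
    \<le> 12 * card I ^ 2"
proof -
  let ?fl = "[\<lambda>(a, b). (u, v, a, b), \<lambda>(a, b). (u, a, v, b), \<lambda>(a, b). (u, a, b, v),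
    \<lambda>(a, b). (v, u, a, b), \<lambda>(a, b). (a, u, v, b), \<lambda>(a, b). (a, u, b, v),
    \<lambda>(a, b). (v, a, u, b), \<lambda>(a, b). (a, v, u, b), \<lambda>(a, b). (a, b, u, v),
    \<lambda>(a, b). (v, a, b, u), \<lambda>(a, b). (a, v, b, u), \<lambda>(a, b). (a, b, v, u)]
    :: ('i \<times> 'i \<Rightarrow> 'i \<times> 'i \<times> 'i \<times> 'i) list"
  have "card {(i', j', k', l') \<in> tuples4 I. u \<in> {i', j', k', l'} \<and> v \<in> {i', j', k', l'}}
      \<le> card (\<Union>f\<in>set ?fl. f ` (I \<times> I))"
    by (rule card_mono) (use assms in \<open>auto simp: tuples4_def image_iff\<close>)
  also have "\<dots> \<le> length ?fl * card (I \<times> I)"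
    by (rule card_Un_images_le[of "I \<times> I" ?fl]) (use assms in auto)
  finally show ?thesis by (simp add: card_cartesian_product power2_eq_square)
qed

text \<open>One hit is taken from each pair, so there are four choices of two different indices and
  \<open>48 = 4 * 12\<close>. Two hits cost two free entries, which is the origin of the rate
  \<open>1 / s^2\<close> of the degenerate part.\<close>

lemma card_tuples4_hit_both:
  assumes "finite I" "{i, j} \<inter> {k, l} = {}"
  shows "card {(i', j', k', l') \<in> tuples4 I. {i, j} \<inter> {i', j', k', l'} \<noteq> {} \<and> {k, l} \<inter> {i', j', k', l'} \<noteq> {}}
    \<le> 48 * card I ^ 2"
proof -
  let ?S = "\<lambda>u v. {(i', j', k', l') \<in> tuples4 I. u \<in> {i', j', k', l'} \<and> v \<in> {i', j', k', l'}}"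
  have fin: "finite (?S u v)" for u v
    by (rule finite_subset[of _ "tuples4 I"]) (use assms in auto)
  have "card {(i', j', k', l') \<in> tuples4 I. {i, j} \<inter> {i', j', k', l'} \<noteq> {} \<and> {k, l} \<inter> {i', j', k', l'} \<noteq> {}}
    \<le> card ((?S i k \<union> ?S i l) \<union> (?S j k \<union> ?S j l))"
    by (rule card_mono) (use fin in auto)
  also have "\<dots> \<le> (card (?S i k) + card (?S i l)) + (card (?S j k) + card (?S j l))"
    by (meson add_mono card_Un_le order_trans)
  also have "\<dots> \<le> 48 * card I ^ 2"
    using card_tuples4_hit2[OF assms(1), of i k] card_tuples4_hit2[OF assms(1), of i l]
      card_tuples4_hit2[OF assms(1), of j k] card_tuples4_hit2[OF assms(1), of j l] assms(2) by auto
  finally show ?thesis .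
qed

text \<open>Meant for the second moment of a sum whose terms are mostly uncorrelated:
  \<open>bad\<close> marks the pairs that may correlate.\<close>

lemma double_sum_sparse_le:
  fixes f :: "'a \<Rightarrow> 'a \<Rightarrow> real"
  assumes "finite T" "\<And>a. a \<in> T \<Longrightarrow> card {b \<in> T. bad a b} \<le> m"
    and "\<And>a b. a \<in> T \<Longrightarrow> b \<in> T \<Longrightarrow> f a b \<le> c" "0 \<le> c"
    and "\<And>a b. a \<in> T \<Longrightarrow> b \<in> T \<Longrightarrow> \<not> bad a b \<Longrightarrow> f a b = 0"
  shows "(\<Sum>a\<in>T. \<Sum>b\<in>T. f a b) \<le> real (card T) * (real m * c)"
proof -
  have "(\<Sum>b\<in>T. f a b) \<le> real m * c" if "a \<in> T" for a
  proof -
    have "(\<Sum>b\<in>T. f a b) = (\<Sum>b\<in>{b \<in> T. bad a b}. f a b)"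
      by (rule sum.mono_neutral_right) (use assms that in auto)
    also have "\<dots> \<le> (\<Sum>b\<in>{b \<in> T. bad a b}. c)" by (intro sum_mono) (use assms that in auto)
    also have "\<dots> = real (card {b \<in> T. bad a b}) * c" by simp
    also have "\<dots> \<le> real m * c" by (intro mult_right_mono) (use assms that in auto)
    finally show ?thesis .
  qed
  then have "(\<Sum>a\<in>T. \<Sum>b\<in>T. f a b) \<le> (\<Sum>a\<in>T. real m * c)" by (rule sum_mono)
  then show ?thesis by simp
qed

section \<open>The kernel, its linear part and its degenerate part\<close>

definition prod_marg :: "(nat \<times> nat) pmf \<Rightarrow> (nat \<times> nat) pmf" where
  "prod_marg q = pair_pmf (map_pmf fst q) (map_pmf snd q)"

definition dev :: "(nat \<times> nat) pmf \<Rightarrow> nat \<times> nat \<Rightarrow> real" where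
  "dev q g = pmf q g - pmf (prod_marg q) g"

definition wdist :: "(nat \<times> nat) set \<Rightarrow> (nat \<times> nat \<Rightarrow> real) \<Rightarrow> (nat \<times> nat) pmf \<Rightarrow> real" where
  "wdist G w q = (\<Sum>g\<in>G. w g * (dev q g)\<^sup>2)"

definition wnorm :: "(nat \<times> nat) set \<Rightarrow> (nat \<times> nat \<Rightarrow> real) \<Rightarrow> (nat \<times> nat) pmf \<Rightarrow> real" where
  "wnorm G w p = (\<Sum>g\<in>G. w g * (pmf p g)\<^sup>2)"

text \<open>The product of the two indicators is written as one indicator of the crossed pair
  \<open>(fst (\<omega> i), snd (\<omega> j))\<close>. Both terms are then point masses, at draws
  with laws \<open>q\<close> and \<open>prod_marg q\<close>.\<close>

definition phi_fun :: "(nat \<Rightarrow> nat \<times> nat) \<Rightarrow> nat \<Rightarrow> nat \<Rightarrow> nat \<times> nat \<Rightarrow> real" where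
  "phi_fun \<omega> i j g = of_bool (\<omega> i = g) - of_bool ((fst (\<omega> i), snd (\<omega> j)) = g)"

definition kernel_fun :: "(nat \<times> nat) set \<Rightarrow> (nat \<times> nat \<Rightarrow> real) \<Rightarrow> (nat \<Rightarrow> nat \<times> nat) \<Rightarrow> nat \<times> nat \<times> nat \<times> nat \<Rightarrow> real" where
  "kernel_fun G w \<omega> = (\<lambda>(i, j, k, l). \<Sum>g\<in>G. w g * phi_fun \<omega> i j g * phi_fun \<omega> k l g)"

text \<open>The kernel is left unsymmetrised; averaging over ordered tuples has the same effect, see
  \<open>U_W_eq_u_statistic\<close>.\<close>

definition u_statistic :: "(nat \<times> nat) set \<Rightarrow> (nat \<times> nat \<Rightarrow> real) \<Rightarrow> nat set \<Rightarrow> (nat \<Rightarrow> nat \<times> nat) \<Rightarrow> real" where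
  "u_statistic G w I \<omega> = (\<Sum>\<tau>\<in>tuples4 I. kernel_fun G w \<omega> \<tau>) / real (card (tuples4 I))"

text \<open>The weights \<open>w\<close> are deterministic, since the observations that determine
  them are conditioned on beforehand. Coordinates outside \<open>I\<close> may have other laws, so
  that the statistics of all cells live on one product space.\<close>

locale ustat =
  fixes J I :: "nat set" and d :: "nat \<times> nat" and Q :: "nat \<Rightarrow> (nat \<times> nat) pmf"
    and q :: "(nat \<times> nat) pmf" and A B :: "nat set" and w :: "nat \<times> nat \<Rightarrow> real"
  assumes finJ: "finite J" and IJ: "I \<subseteq> J" and fin_supp_Q: "\<And>i. i \<in> J \<Longrightarrow> finite (set_pmf (Q i))"
    and Qq: "\<And>i. i \<in> I \<Longrightarrow> Q i = q" and finA: "finite A" and finB: "finite B"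
    and qG: "set_pmf q \<subseteq> A \<times> B" and w0: "\<And>g. 0 \<le> w g" and w1: "\<And>g. w g \<le> 1"
begin

abbreviation "G \<equiv> A \<times> B"
abbreviation "M \<equiv> Pi_pmf J d Q"
abbreviation "r \<equiv> prod_marg q"
abbreviation "\<Delta> \<equiv> dev q"
definition "b = wnorm G w q + wnorm G w r"
abbreviation "D \<equiv> wdist G w q"

lemma fin_supp_M: "fin_supp M" using finJ fin_supp_Q by auto
lemma finG: "finite G" using finA finB by auto
lemma fin_supp_q: "fin_supp q" using qG finG finite_subset by blast
lemma rG: "set_pmf r \<subseteq> G" using qG by (auto simp: prod_marg_def)
lemma fin_supp_r: "fin_supp r" using rG finG finite_subset by blast

lemma D_nonneg: "0 \<le> D" unfolding wdist_def by (intro sum_nonneg mult_nonneg_nonneg w0) auto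

lemma wnorm_le_1: assumes "set_pmf p \<subseteq> G" shows "wnorm G w p \<le> 1"
proof -
  have "wnorm G w p \<le> (\<Sum>g\<in>G. pmf p g)" unfolding wnorm_def
  proof (rule sum_mono)
    fix g
    have "w g * (pmf p g)\<^sup>2 \<le> 1 * (pmf p g)\<^sup>2" by (intro mult_right_mono w1) auto
    also have "\<dots> \<le> pmf p g" using pmf_le_1[of p g] by (simp add: power2_eq_square mult_left_le_one_le)
    finally show "w g * (pmf p g)\<^sup>2 \<le> pmf p g" .
  qed
  also have "\<dots> = 1" using sum_pmf_eq_1[OF finG assms] .
  finally show ?thesis .
qed

lemma wnorm_nonneg: "0 \<le> wnorm G w p"
  unfolding wnorm_def by (intro sum_nonneg mult_nonneg_nonneg w0) auto

lemma b_nonneg: "0 \<le> b" and b_le_2: "b \<le> 2"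
  unfolding b_def using wnorm_nonneg wnorm_le_1[OF qG] wnorm_le_1[OF rG] add_nonneg_nonneg by force+

lemma D_le: "D \<le> 2 * b"
proof -
  have "D \<le> (\<Sum>g\<in>G. 2 * (w g * (pmf q g)\<^sup>2) + 2 * (w g * (pmf r g)\<^sup>2))"
    unfolding wdist_def
  proof (rule sum_mono)
    fix g
    have "(dev q g)\<^sup>2 \<le> 2 * (pmf q g)\<^sup>2 + 2 * (pmf r g)\<^sup>2"
      unfolding dev_def using sum_squares_bound[of "pmf q g" "- pmf r g"] by (simp add: power2_diff)
    from mult_left_mono[OF this w0[of g]]
    show "w g * (dev q g)\<^sup>2 \<le> 2 * (w g * (pmf q g)\<^sup>2) + 2 * (w g * (pmf r g)\<^sup>2)"
      by (simp add: algebra_simps)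
  qed
  also have "\<dots> = 2 * b" by (simp add: b_def wnorm_def sum.distrib sum_distrib_left)
  finally show ?thesis .
qed

text \<open>Writing \<open>q\<close> as the product of its marginals plus the deviation leaves only
  the norm of the product. That norm factorises like the weights and can therefore be averaged over
  them.\<close>

lemma b_le: "b \<le> 2 * D + 3 * wnorm G w r"
proof -
  have "wnorm G w q \<le> (\<Sum>g\<in>G. 2 * (w g * (dev q g)\<^sup>2) + 2 * (w g * (pmf r g)\<^sup>2))"
    unfolding wnorm_def
  proof (rule sum_mono)
    fix g
    have "(pmf q g)\<^sup>2 = (dev q g + pmf r g)\<^sup>2" by (simp add: dev_def)
    also have "\<dots> \<le> 2 * (dev q g)\<^sup>2 + 2 * (pmf r g)\<^sup>2"
      using sum_squares_bound[of "dev q g" "pmf r g"] by (simp add: power2_sum)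
    finally have "(pmf q g)\<^sup>2 \<le> 2 * (dev q g)\<^sup>2 + 2 * (pmf r g)\<^sup>2" .
    from mult_left_mono[OF this w0[of g]]
    show "w g * (pmf q g)\<^sup>2 \<le> 2 * (w g * (dev q g)\<^sup>2) + 2 * (w g * (pmf r g)\<^sup>2)"
      by (simp add: algebra_simps)
  qed
  also have "\<dots> = 2 * D + 2 * wnorm G w r"
    by (simp add: wdist_def wnorm_def sum.distrib sum_distrib_left)
  finally show ?thesis unfolding b_def by simp
qed

text \<open>Since \<open>w \<le> 1\<close>, the square of the left-hand side is at most a single
  term of the weighted norm.\<close>

lemma w_pmf_le_sqrt_b:
  assumes "g \<in> G" "p = q \<or> p = r"
  shows "w g * pmf p g \<le> sqrt b"
proof (rule real_le_rsqrt)
  have "(w g * pmf p g)\<^sup>2 = w g * (w g * (pmf p g)\<^sup>2)" by (simp add: power2_eq_square algebra_simps)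
  also have "\<dots> \<le> 1 * (w g * (pmf p g)\<^sup>2)" by (intro mult_right_mono w1 mult_nonneg_nonneg w0) auto
  also have "\<dots> \<le> wnorm G w p" unfolding wnorm_def
    using member_le_sum[of g G "\<lambda>g. w g * (pmf p g)\<^sup>2"] assms(1) finG w0 by auto
  also have "\<dots> \<le> b" unfolding b_def using assms(2) wnorm_nonneg by auto
  finally show "(w g * pmf p g)\<^sup>2 \<le> b" .
qed

lemma E_pmf_obs: assumes "i \<in> I" shows "E_pmf M (\<lambda>\<omega>. f (\<omega> i)) = E_pmf q f"
  using E_pmf_Pi_1[OF finJ, of i d Q f] assms IJ Qq by auto

lemma E_pmf_cross:
  assumes "i \<in> I" "j \<in> I" "i \<noteq> j"
  shows "E_pmf M (\<lambda>\<omega>. f (fst (\<omega> i), snd (\<omega> j))) = E_pmf r f"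
proof -
  have "E_pmf M (\<lambda>\<omega>. f (fst (\<omega> i), snd (\<omega> j))) = E_pmf q (\<lambda>a. E_pmf q (\<lambda>b. f (fst a, snd b)))"
    using E_pmf_Pi_2[OF finJ, of i j Q d "\<lambda>a b. f (fst a, snd b)"] assms IJ Qq fin_supp_Q by (auto simp: subset_iff)
  also have "\<dots> = E_pmf r f"
    unfolding prod_marg_def using fin_supp_q by (simp add: E_pmf_pair)
  finally show ?thesis .
qed

lemma E_pmf_of_bool: "fin_supp p \<Longrightarrow> E_pmf p (\<lambda>x. of_bool (x = a)) = pmf p a"
  using E_pmf_point[of p a 1] by simp

lemma E_pmf_phi_fun:
  assumes "i \<in> I" "j \<in> I" "i \<noteq> j"
  shows "E_pmf M (\<lambda>\<omega>. phi_fun \<omega> i j g) = \<Delta> g"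
  unfolding phi_fun_def dev_def
  using E_pmf_obs[OF assms(1), of "\<lambda>x. of_bool (x = g)"] E_pmf_cross[OF assms, of "\<lambda>x. of_bool (x = g)"]
  by (simp add: E_pmf_diff[OF fin_supp_M] E_pmf_of_bool fin_supp_q fin_supp_r)

text \<open>The inner product of two point masses in the \<open>w\<close>-weighted space of
  functions on the grid.\<close>

definition pick :: "nat \<times> nat \<Rightarrow> nat \<times> nat \<Rightarrow> real" where
  "pick a a' = (\<Sum>g\<in>G. w g * of_bool (a = g) * of_bool (a' = g))"

lemma pick_alt: "pick a a' = of_bool (a = a' \<and> a \<in> G) * w a"
proof (cases "a = a' \<and> a \<in> G")
  case True
  then have "pick a a' = (\<Sum>g\<in>{a}. w g * of_bool (a = g) * of_bool (a' = g))"
    unfolding pick_def by (intro sum.mono_neutral_right finG) auto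
  then show ?thesis using True by auto
next
  case False
  then have "pick a a' = 0" unfolding pick_def by (intro sum.neutral) auto
  then show ?thesis using False by simp
qed

lemma pick_sq: "(pick a a')\<^sup>2 \<le> pick a a'"
  unfolding pick_alt using w0[of a] w1[of a]
  by (auto simp: power2_eq_square mult_left_le_one_le)

text \<open>The last two assumptions say that \<open>f\<close> and \<open>f'\<close> have laws
  \<open>p\<close> and \<open>p'\<close>. As they depend on disjoint blocks, the expectation is at
  most a weighted collision probability of independent draws, hence at most the sum of the two
  squared norms.\<close>

lemma E_pmf_pick_le:
  assumes dis: "K \<inter> K' = {}" and KJ: "K \<subseteq> J" "K' \<subseteq> J" and depends_on: "depends_on K f" "depends_on K' f'"
    and p: "p = q \<or> p = r" "p' = q \<or> p' = r"
    and f: "\<And>h. E_pmf M (\<lambda>\<omega>. h (f \<omega>)) = E_pmf p h" and f': "\<And>h. E_pmf M (\<lambda>\<omega>. h (f' \<omega>)) = E_pmf p' h"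
  shows "E_pmf M (\<lambda>\<omega>. (pick (f \<omega>) (f' \<omega>))\<^sup>2) \<le> b"
proof -
  have "E_pmf M (\<lambda>\<omega>. (pick (f \<omega>) (f' \<omega>))\<^sup>2) \<le> E_pmf M (\<lambda>\<omega>. pick (f \<omega>) (f' \<omega>))"
    by (intro E_pmf_mono fin_supp_M pick_sq)
  also have "\<dots> = (\<Sum>g\<in>G. E_pmf M (\<lambda>\<omega>. (w g * of_bool (f \<omega> = g)) * of_bool (f' \<omega> = g)))"
    unfolding pick_def by (simp add: E_pmf_sum[OF fin_supp_M])
  also have "\<dots> = (\<Sum>g\<in>G. w g * pmf p g * pmf p' g)"
  proof (rule sum.cong[OF refl])
    fix g
    have d1: "depends_on K (\<lambda>\<omega>. w g * of_bool (f \<omega> = g))" and d2: "depends_on K' (\<lambda>\<omega>. of_bool (f' \<omega> = g))"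
      using depends_on unfolding depends_on_def by metis+
    have fp: "fin_supp p" "fin_supp p'" using p fin_supp_q fin_supp_r by auto
    have "E_pmf M (\<lambda>\<omega>. (w g * of_bool (f \<omega> = g)) * of_bool (f' \<omega> = g)) =
      E_pmf M (\<lambda>\<omega>. w g * of_bool (f \<omega> = g)) * E_pmf M (\<lambda>\<omega>. of_bool (f' \<omega> = g))"
      by (rule E_pmf_Pi_indep[OF finJ KJ dis d1 d2 fin_supp_Q])
    also have "E_pmf M (\<lambda>\<omega>. w g * of_bool (f \<omega> = g)) = w g * pmf p g"
      using f[of "\<lambda>x. w g * of_bool (x = g)"] E_pmf_of_bool[OF fp(1)] by simp
    also have "E_pmf M (\<lambda>\<omega>. of_bool (f' \<omega> = g)) = pmf p' g"
      using f'[of "\<lambda>x. of_bool (x = g)"] E_pmf_of_bool[OF fp(2)] by simp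
    finally show "E_pmf M (\<lambda>\<omega>. (w g * of_bool (f \<omega> = g)) * of_bool (f' \<omega> = g)) = w g * pmf p g * pmf p' g" .
  qed
  also have "\<dots> \<le> (\<Sum>g\<in>G. w g * (pmf q g)\<^sup>2 + w g * (pmf r g)\<^sup>2)"
  proof (rule sum_mono)
    fix g
    have "pmf p g * pmf p' g \<le> (pmf q g)\<^sup>2 + (pmf r g)\<^sup>2"
    proof -
      have "2 * (pmf q g * pmf r g) \<le> (pmf q g)\<^sup>2 + (pmf r g)\<^sup>2"
        using sum_squares_bound[of "pmf q g" "pmf r g"] by auto
      moreover have "0 \<le> pmf q g * pmf r g" by simp
      ultimately have "pmf q g * pmf r g \<le> (pmf q g)\<^sup>2 + (pmf r g)\<^sup>2" by linarith
      then show ?thesis using p by (auto simp: power2_eq_square mult.commute)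
    qed
    from mult_left_mono[OF this w0[of g]]
    show "w g * pmf p g * pmf p' g \<le> w g * (pmf q g)\<^sup>2 + w g * (pmf r g)\<^sup>2"
      by (simp add: algebra_simps)
  qed
  also have "\<dots> = b" by (simp add: b_def wnorm_def sum.distrib)
  finally show ?thesis .
qed

lemma E_pmf_kernel_fun_sq:
  assumes "(i, j, k, l) \<in> tuples4 I"
  shows "E_pmf M (\<lambda>\<omega>. (kernel_fun G w \<omega> (i, j, k, l))\<^sup>2) \<le> 16 * b"
proof -
  let ?x = "\<lambda>\<omega> i j. (fst (\<omega> i), snd (\<omega> j)) :: nat \<times> nat"
  have t: "i \<in> I" "j \<in> I" "k \<in> I" "l \<in> I" "i \<noteq> j" "k \<noteq> l" "{i, j} \<inter> {k, l} = {}" "{i, j} \<subseteq> J" "{k, l} \<subseteq> J"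
    using assms IJ by (auto simp: tuples4_def)
  \<comment> \<open>The kernel is bilinear in point masses; each term compares an observed or
    crossed pair from \<open>i, j\<close> with one from \<open>k, l\<close>.\<close>
  have eq: "kernel_fun G w \<omega> (i, j, k, l) = pick (\<omega> i) (\<omega> k) - pick (\<omega> i) (?x \<omega> k l) -
      pick (?x \<omega> i j) (\<omega> k) + pick (?x \<omega> i j) (?x \<omega> k l)" for \<omega>
    unfolding kernel_fun_def pick_def phi_fun_def
    by (simp add: sum_subtractf[symmetric] sum.distrib[symmetric] algebra_simps)
  have "E_pmf M (\<lambda>\<omega>. (kernel_fun G w \<omega> (i, j, k, l))\<^sup>2) \<le>
    E_pmf M (\<lambda>\<omega>. (4 * (pick (\<omega> i) (\<omega> k))\<^sup>2 + 4 * (pick (\<omega> i) (?x \<omega> k l))\<^sup>2) +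
      (4 * (pick (?x \<omega> i j) (\<omega> k))\<^sup>2 + 4 * (pick (?x \<omega> i j) (?x \<omega> k l))\<^sup>2))"
  proof (rule E_pmf_mono[OF fin_supp_M])
    fix \<omega>
    show "(kernel_fun G w \<omega> (i, j, k, l))\<^sup>2 \<le> (4 * (pick (\<omega> i) (\<omega> k))\<^sup>2 + 4 * (pick (\<omega> i) (?x \<omega> k l))\<^sup>2) +
      (4 * (pick (?x \<omega> i j) (\<omega> k))\<^sup>2 + 4 * (pick (?x \<omega> i j) (?x \<omega> k l))\<^sup>2)"
      unfolding eq by (rule square_of_four_le)
  qed
  also have "\<dots> = 4 * E_pmf M (\<lambda>\<omega>. (pick (\<omega> i) (\<omega> k))\<^sup>2) + 4 * E_pmf M (\<lambda>\<omega>. (pick (\<omega> i) (?x \<omega> k l))\<^sup>2) +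
     (4 * E_pmf M (\<lambda>\<omega>. (pick (?x \<omega> i j) (\<omega> k))\<^sup>2) + 4 * E_pmf M (\<lambda>\<omega>. (pick (?x \<omega> i j) (?x \<omega> k l))\<^sup>2))"
    by (simp add: E_pmf_add[OF fin_supp_M])
  also have "\<dots> \<le> 4 * b + 4 * b + (4 * b + 4 * b)"
    by (intro add_mono mult_left_mono
        E_pmf_pick_le[OF t(7-9) _ _ disjI1 disjI1, OF _ _ refl refl E_pmf_obs[OF t(1)] E_pmf_obs[OF t(3)]]
        E_pmf_pick_le[OF t(7-9) _ _ disjI1 disjI2, OF _ _ refl refl E_pmf_obs[OF t(1)] E_pmf_cross[OF t(3,4,6)]]
        E_pmf_pick_le[OF t(7-9) _ _ disjI2 disjI1, OF _ _ refl refl E_pmf_cross[OF t(1,2,5)] E_pmf_obs[OF t(3)]]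
        E_pmf_pick_le[OF t(7-9) _ _ disjI2 disjI2, OF _ _ refl refl E_pmf_cross[OF t(1,2,5)] E_pmf_cross[OF t(3,4,6)]])
      (auto intro!: depends_onI)
  finally show ?thesis by simp
qed

text \<open>The conditional expectation of the kernel given one of its two pairs of observations,
  that is, its projection in the sense of Hoeffding.\<close>

definition linear_part :: "(nat \<Rightarrow> nat \<times> nat) \<Rightarrow> nat \<Rightarrow> nat \<Rightarrow> real" where
  "linear_part \<omega> i j = (\<Sum>g\<in>G. w g * phi_fun \<omega> i j g * \<Delta> g)"

text \<open>A point mass leaves one term of the inner sum. The expectation becomes
  \<open>\<Sum> (w * \<Delta>^2) * (w * p)\<close>, where the second factor is at most
  \<open>sqrt b\<close>.\<close>

lemma E_pmf_single_sq:
  assumes p: "p = q \<or> p = r" and f: "\<And>h. E_pmf M (\<lambda>\<omega>. h (f \<omega>)) = E_pmf p h"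
  shows "E_pmf M (\<lambda>\<omega>. (\<Sum>g\<in>G. w g * of_bool (f \<omega> = g) * \<Delta> g)\<^sup>2) \<le> D * sqrt b"
proof -
  have fp: "fin_supp p" "set_pmf p \<subseteq> G" using p fin_supp_q fin_supp_r qG rG by auto
  have "E_pmf M (\<lambda>\<omega>. (\<Sum>g\<in>G. w g * of_bool (f \<omega> = g) * \<Delta> g)\<^sup>2) =
    E_pmf p (\<lambda>a. (\<Sum>g\<in>G. w g * of_bool (a = g) * \<Delta> g)\<^sup>2)"
    using f[of "\<lambda>a. (\<Sum>g\<in>G. w g * of_bool (a = g) * \<Delta> g)\<^sup>2"] .
  also have "\<dots> = E_pmf p (\<lambda>a. (w a * \<Delta> a)\<^sup>2)"
  proof (rule E_pmf_cong)
    fix a assume "a \<in> set_pmf p"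
    then have "a \<in> G" using fp by auto
    then have "(\<Sum>g\<in>G. w g * of_bool (a = g) * \<Delta> g) = (\<Sum>g\<in>{a}. w g * of_bool (a = g) * \<Delta> g)"
      by (intro sum.mono_neutral_right finG) auto
    then show "(\<Sum>g\<in>G. w g * of_bool (a = g) * \<Delta> g)\<^sup>2 = (w a * \<Delta> a)\<^sup>2" by simp
  qed
  also have "\<dots> = (\<Sum>a\<in>G. pmf p a * (w a * \<Delta> a)\<^sup>2)" by (rule E_pmf_on[OF finG fp(2)])
  also have "\<dots> \<le> (\<Sum>a\<in>G. (w a * (\<Delta> a)\<^sup>2) * sqrt b)"
  proof (rule sum_mono)
    fix a assume "a \<in> G"
    have "pmf p a * (w a * \<Delta> a)\<^sup>2 = (w a * (\<Delta> a)\<^sup>2) * (w a * pmf p a)"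
      by (simp add: power2_eq_square algebra_simps)
    also have "\<dots> \<le> (w a * (\<Delta> a)\<^sup>2) * sqrt b"
      by (intro mult_left_mono w_pmf_le_sqrt_b \<open>a \<in> G\<close> p mult_nonneg_nonneg w0) auto
    finally show "pmf p a * (w a * \<Delta> a)\<^sup>2 \<le> (w a * (\<Delta> a)\<^sup>2) * sqrt b" .
  qed
  also have "\<dots> = D * sqrt b" by (simp add: wdist_def sum_distrib_right)
  finally show ?thesis .
qed

lemma E_pmf_linear_part_sq:
  assumes "i \<in> I" "j \<in> I" "i \<noteq> j"
  shows "E_pmf M (\<lambda>\<omega>. (linear_part \<omega> i j)\<^sup>2) \<le> 4 * (D * sqrt b)"
proof -
  let ?f = "\<lambda>\<omega>. (\<Sum>g\<in>G. w g * of_bool (\<omega> i = g) * \<Delta> g)"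
  let ?h = "\<lambda>\<omega>. (\<Sum>g\<in>G. w g * of_bool ((fst (\<omega> i), snd (\<omega> j)) = g) * \<Delta> g)"
  have eq: "linear_part \<omega> i j = ?f \<omega> - ?h \<omega>" for \<omega>
    unfolding linear_part_def phi_fun_def by (simp add: sum_subtractf[symmetric] algebra_simps)
  have "E_pmf M (\<lambda>\<omega>. (linear_part \<omega> i j)\<^sup>2) \<le> E_pmf M (\<lambda>\<omega>. 2 * (?f \<omega>)\<^sup>2 + 2 * (?h \<omega>)\<^sup>2)"
  proof (rule E_pmf_mono[OF fin_supp_M])
    fix \<omega>
    show "(linear_part \<omega> i j)\<^sup>2 \<le> 2 * (?f \<omega>)\<^sup>2 + 2 * (?h \<omega>)\<^sup>2"
      unfolding eq using sum_squares_bound[of "?f \<omega>" "- ?h \<omega>"] by (simp add: power2_diff)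
  qed
  also have "\<dots> = 2 * E_pmf M (\<lambda>\<omega>. (?f \<omega>)\<^sup>2) + 2 * E_pmf M (\<lambda>\<omega>. (?h \<omega>)\<^sup>2)" by (simp add: E_pmf_add[OF fin_supp_M])
  also have "\<dots> \<le> 2 * (D * sqrt b) + 2 * (D * sqrt b)"
    by (intro add_mono mult_left_mono E_pmf_single_sq[OF _ E_pmf_obs[OF assms(1)]]
        E_pmf_single_sq[OF _ E_pmf_cross[OF assms]]) auto
  finally show ?thesis by (simp add: mult.commute)
qed

lemma E_pmf_linear_part:
  assumes "i \<in> I" "j \<in> I" "i \<noteq> j"
  shows "E_pmf M (\<lambda>\<omega>. linear_part \<omega> i j) = D"
proof -
  have "E_pmf M (\<lambda>\<omega>. linear_part \<omega> i j) = (\<Sum>g\<in>G. w g * E_pmf M (\<lambda>\<omega>. phi_fun \<omega> i j g) * \<Delta> g)"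
    unfolding linear_part_def by (simp add: E_pmf_sum[OF fin_supp_M])
  then show ?thesis using E_pmf_phi_fun[OF assms] by (simp add: wdist_def power2_eq_square algebra_simps)
qed

lemma E_pmf_linear_part_centred_sq:
  assumes "i \<in> I" "j \<in> I" "i \<noteq> j"
  shows "E_pmf M (\<lambda>\<omega>. (linear_part \<omega> i j - D)\<^sup>2) \<le> 4 * (D * sqrt b)"
proof -
  have "E_pmf M (\<lambda>\<omega>. (linear_part \<omega> i j - D)\<^sup>2) = E_pmf M (\<lambda>\<omega>. (linear_part \<omega> i j)\<^sup>2 - 2 * D * linear_part \<omega> i j + D\<^sup>2)"
    by (simp add: power2_eq_square algebra_simps)
  also have "\<dots> = E_pmf M (\<lambda>\<omega>. (linear_part \<omega> i j)\<^sup>2) - D\<^sup>2"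
    by (simp add: E_pmf_add[OF fin_supp_M] E_pmf_diff[OF fin_supp_M] E_pmf_linear_part[OF assms] power2_eq_square)
  finally have "E_pmf M (\<lambda>\<omega>. (linear_part \<omega> i j - D)\<^sup>2) \<le> E_pmf M (\<lambda>\<omega>. (linear_part \<omega> i j)\<^sup>2)" by simp
  then show ?thesis using E_pmf_linear_part_sq[OF assms] by (rule order_trans)
qed

definition degenerate_part :: "(nat \<Rightarrow> nat \<times> nat) \<Rightarrow> nat \<times> nat \<times> nat \<times> nat \<Rightarrow> real" where
  "degenerate_part \<omega> = (\<lambda>(i, j, k, l). \<Sum>g\<in>G. w g * (phi_fun \<omega> i j g - \<Delta> g) * (phi_fun \<omega> k l g - \<Delta> g))"

lemma degenerate_part_alt: "degenerate_part \<omega> (i, j, k, l) = kernel_fun G w \<omega> (i, j, k, l) - linear_part \<omega> i j - linear_part \<omega> k l + D"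
  unfolding degenerate_part_def kernel_fun_def linear_part_def wdist_def
  by (simp add: sum_subtractf[symmetric] sum.distrib[symmetric] power2_eq_square algebra_simps)

lemma E_pmf_degenerate_part_sq:
  assumes t: "(i, j, k, l) \<in> tuples4 I"
  shows "E_pmf M (\<lambda>\<omega>. (degenerate_part \<omega> (i, j, k, l))\<^sup>2) \<le> 256 * b"
proof -
  have m: "i \<in> I" "j \<in> I" "k \<in> I" "l \<in> I" "i \<noteq> j" "k \<noteq> l" using assms by (auto simp: tuples4_def)
  have "E_pmf M (\<lambda>\<omega>. (degenerate_part \<omega> (i, j, k, l))\<^sup>2) \<le> E_pmf M (\<lambda>\<omega>. (4 * (kernel_fun G w \<omega> (i, j, k, l))\<^sup>2 +
    4 * (linear_part \<omega> i j)\<^sup>2) + (4 * (linear_part \<omega> k l)\<^sup>2 + 4 * D\<^sup>2))"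
  proof (rule E_pmf_mono[OF fin_supp_M])
    fix \<omega>
    show "(degenerate_part \<omega> (i, j, k, l))\<^sup>2 \<le> (4 * (kernel_fun G w \<omega> (i, j, k, l))\<^sup>2 +
      4 * (linear_part \<omega> i j)\<^sup>2) + (4 * (linear_part \<omega> k l)\<^sup>2 + 4 * D\<^sup>2)"
      unfolding degenerate_part_alt by (rule square_of_four_le)
  qed
  also have "\<dots> = 4 * E_pmf M (\<lambda>\<omega>. (kernel_fun G w \<omega> (i, j, k, l))\<^sup>2) + 4 * E_pmf M (\<lambda>\<omega>. (linear_part \<omega> i j)\<^sup>2) +
     (4 * E_pmf M (\<lambda>\<omega>. (linear_part \<omega> k l)\<^sup>2) + 4 * D\<^sup>2)"
    by (simp add: E_pmf_add[OF fin_supp_M])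
  also have "\<dots> \<le> 4 * (16 * b) + 4 * (4 * (D * sqrt b)) + (4 * (4 * (D * sqrt b)) + 4 * (4 * (D * sqrt b)))"
  proof (intro add_mono mult_left_mono E_pmf_kernel_fun_sq[OF t] E_pmf_linear_part_sq m)
    \<comment> \<open>Jensen's inequality, since \<open>D\<close> is the mean of the linear
      part.\<close>
    have "D\<^sup>2 \<le> E_pmf M (\<lambda>\<omega>. (linear_part \<omega> i j)\<^sup>2)"
      using E_pmf_sq_le[OF fin_supp_M, of "\<lambda>\<omega>. linear_part \<omega> i j"] E_pmf_linear_part[OF m(1,2,5)] by simp
    also have "\<dots> \<le> 4 * (D * sqrt b)" by (rule E_pmf_linear_part_sq[OF m(1,2,5)])
    finally show "D\<^sup>2 \<le> 4 * (D * sqrt b)" .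
  qed auto
  also have "\<dots> = 64 * b + 48 * (D * sqrt b)" by simp
  \<comment> \<open>Here \<open>D \<le> 2 * b\<close>, and \<open>sqrt b \<le> 2\<close> because
    \<open>b \<le> 2\<close>. The total is \<open>64 + 192 = 256\<close>.\<close>
  also have "\<dots> \<le> 64 * b + 48 * ((2 * b) * 2)"
    using D_le D_nonneg b_nonneg b_le_2
    by (intro add_left_mono mult_left_mono mult_mono real_le_lsqrt) auto
  finally show ?thesis by simp
qed

text \<open>Given one of the two pairs of observations, the degenerate part is centred, so two tuples
  contribute to the second moment only if each pair of one meets the other tuple.\<close>

lemma degenerate_part_orth:
  assumes t: "(i, j, k, l) \<in> tuples4 I" and t': "(i', j', k', l') \<in> tuples4 I"
    and dis: "{k, l} \<inter> {i', j', k', l'} = {}"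
  shows "E_pmf M (\<lambda>\<omega>. degenerate_part \<omega> (i, j, k, l) * degenerate_part \<omega> (i', j', k', l')) = 0"
proof -
  have m: "k \<in> I" "l \<in> I" "k \<noteq> l" using t by (auto simp: tuples4_def)
  have "E_pmf M (\<lambda>\<omega>. degenerate_part \<omega> (i, j, k, l) * degenerate_part \<omega> (i', j', k', l')) =
    (\<Sum>g\<in>G. E_pmf M (\<lambda>\<omega>. (phi_fun \<omega> k l g - \<Delta> g) * (w g * (phi_fun \<omega> i j g - \<Delta> g) * degenerate_part \<omega> (i', j', k', l'))))"
  proof -
    have "degenerate_part \<omega> (i, j, k, l) * degenerate_part \<omega> (i', j', k', l') =
      (\<Sum>g\<in>G. (phi_fun \<omega> k l g - \<Delta> g) * (w g * (phi_fun \<omega> i j g - \<Delta> g) * degenerate_part \<omega> (i', j', k', l')))" for \<omega>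
      unfolding degenerate_part_def[of \<omega>, THEN fun_cong, of "(i, j, k, l)"] case_prod_conv sum_distrib_right
      by (intro sum.cong refl) (simp add: mult_ac)
    then show ?thesis by (simp only: E_pmf_sum[OF fin_supp_M])
  qed
  also have "\<dots> = 0"
  proof (rule sum.neutral, safe)
    fix x y :: nat
    let ?g = "(x, y)"
    have "E_pmf M (\<lambda>\<omega>. (phi_fun \<omega> k l ?g - \<Delta> ?g) * (w ?g * (phi_fun \<omega> i j ?g - \<Delta> ?g) * degenerate_part \<omega> (i', j', k', l'))) =
      E_pmf M (\<lambda>\<omega>. phi_fun \<omega> k l ?g - \<Delta> ?g) * E_pmf M (\<lambda>\<omega>. w ?g * (phi_fun \<omega> i j ?g - \<Delta> ?g) * degenerate_part \<omega> (i', j', k', l'))"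
    proof (rule E_pmf_Pi_indep[OF finJ _ _ _ _ _ fin_supp_Q])
      show "depends_on {k, l} (\<lambda>\<omega>. phi_fun \<omega> k l ?g - \<Delta> ?g)"
        by (rule depends_onI) (simp add: phi_fun_def)
      show "depends_on ({i, j} \<union> {i', j', k', l'}) (\<lambda>\<omega>. w ?g * (phi_fun \<omega> i j ?g - \<Delta> ?g) * degenerate_part \<omega> (i', j', k', l'))"
        by (rule depends_onI) (simp add: phi_fun_def degenerate_part_def)
      show "{k, l} \<subseteq> J" "{i, j} \<union> {i', j', k', l'} \<subseteq> J" "{k, l} \<inter> ({i, j} \<union> {i', j', k', l'}) = {}"
        using t t' dis IJ by (auto simp: tuples4_def)
    qed
    also have "E_pmf M (\<lambda>\<omega>. phi_fun \<omega> k l ?g - \<Delta> ?g) = 0"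
      using E_pmf_phi_fun[OF m] by (simp add: E_pmf_diff[OF fin_supp_M])
    finally show "E_pmf M (\<lambda>\<omega>. (phi_fun \<omega> k l ?g - \<Delta> ?g) * (w ?g * (phi_fun \<omega> i j ?g - \<Delta> ?g) * degenerate_part \<omega> (i', j', k', l'))) = 0"
      by simp
  qed
  finally show ?thesis .
qed

lemma degenerate_part_swap: "degenerate_part \<omega> (i, j, k, l) = degenerate_part \<omega> (k, l, i, j)"
  unfolding degenerate_part_def by (simp add: mult_ac)

lemma E_pmf_mult_le:
  assumes "E_pmf M (\<lambda>\<omega>. (f \<omega>)\<^sup>2) \<le> c" "E_pmf M (\<lambda>\<omega>. (f' \<omega>)\<^sup>2) \<le> c"
  shows "E_pmf M (\<lambda>\<omega>. f \<omega> * f' \<omega>) \<le> c"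
proof -
  have "E_pmf M (\<lambda>\<omega>. f \<omega> * f' \<omega>) \<le> E_pmf M (\<lambda>\<omega>. (f \<omega>)\<^sup>2 / 2 + (f' \<omega>)\<^sup>2 / 2)"
  proof (rule E_pmf_mono[OF fin_supp_M])
    fix \<omega>
    show "f \<omega> * f' \<omega> \<le> (f \<omega>)\<^sup>2 / 2 + (f' \<omega>)\<^sup>2 / 2" using sum_squares_bound[of "f \<omega>" "f' \<omega>"] by simp
  qed
  also have "\<dots> = E_pmf M (\<lambda>\<omega>. (f \<omega>)\<^sup>2) / 2 + E_pmf M (\<lambda>\<omega>. (f' \<omega>)\<^sup>2) / 2" by (simp add: E_pmf_add[OF fin_supp_M])
  finally show ?thesis using assms by simp
qed

lemma E_pmf_sum_sq: "E_pmf M (\<lambda>\<omega>. (\<Sum>a\<in>T. f a \<omega>)\<^sup>2) = (\<Sum>a\<in>T. \<Sum>a'\<in>T. E_pmf M (\<lambda>\<omega>. f a \<omega> * f a' \<omega>))"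
  by (simp add: power2_eq_square sum_product E_pmf_sum[OF fin_supp_M])

text \<open>Among the pairs of tuples, a share of order \<open>1 / s\<close> correlates through the
  linear part and a share of order \<open>1 / s^2\<close> through the degenerate part. The constant
  rounds up \<open>262144 = 2 * 48 * 256 * 64 / 6\<close>.\<close>

lemma ustat_variance:
  assumes "card I \<ge> 4"
  shows "E_pmf M (\<lambda>\<omega>. (u_statistic G w I \<omega> - D)\<^sup>2) \<le>
    300000 * (D * sqrt b / real (card I) + b / (real (card I))\<^sup>2)"
proof -
  define T where "T = tuples4 I"
  define s where "s = real (card I)"
  define N where "N = real (card T)"
  have finI: "finite I" using finJ IJ finite_subset by blast
  have finT: "finite T" unfolding T_def using finI by simp
  have s4: "s \<ge> 4" using assms s_def by simp
  have N: "N \<ge> 6 / 64 * s ^ 4" unfolding N_def T_def s_def by (rule card_tuples4_ge[OF finI assms])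
  have Npos: "N > 0" using N s4 by (smt (verit) divide_pos_pos zero_less_mult_iff zero_less_power)
  let ?l = "\<lambda>\<omega> (i, j, k :: nat, l :: nat). linear_part \<omega> i j - D"
  let ?V1 = "E_pmf M (\<lambda>\<omega>. (\<Sum>\<tau>\<in>T. ?l \<omega> \<tau>)\<^sup>2)"
  let ?V2 = "E_pmf M (\<lambda>\<omega>. (\<Sum>\<tau>\<in>T. degenerate_part \<omega> \<tau>)\<^sup>2)"
  \<comment> \<open>Exchanging the two pairs of a tuple permutes all tuples, so both linear parts of
    the kernel have the same sum.\<close>
  have swap: "(\<Sum>\<tau>\<in>T. case \<tau> of (i, j, k, l) \<Rightarrow> f k l) = (\<Sum>\<tau>\<in>T. case \<tau> of (i, j, k, l) \<Rightarrow> f i j)"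
    for f :: "nat \<Rightarrow> nat \<Rightarrow> real"
    by (rule sum.reindex_bij_witness[of _ "\<lambda>(i, j, k, l). (k, l, i, j)" "\<lambda>(i, j, k, l). (k, l, i, j)"])
      (auto simp: T_def tuples4_def)
  have dec: "u_statistic G w I \<omega> - D = (\<Sum>\<tau>\<in>T. degenerate_part \<omega> \<tau>) / N + 2 * (\<Sum>\<tau>\<in>T. ?l \<omega> \<tau>) / N" for \<omega>
  proof -
    have "N * (u_statistic G w I \<omega> - D) = (\<Sum>\<tau>\<in>T. kernel_fun G w \<omega> \<tau> - D)"
      using Npos unfolding u_statistic_def N_def T_def by (simp add: sum_subtractf right_diff_distrib)
    also have "\<dots> = (\<Sum>\<tau>\<in>T. degenerate_part \<omega> \<tau> + ?l \<omega> \<tau> + (case \<tau> of (i, j, k, l) \<Rightarrow> linear_part \<omega> k l - D))"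
      by (intro sum.cong refl) (auto simp: degenerate_part_alt)
    also have "\<dots> = (\<Sum>\<tau>\<in>T. degenerate_part \<omega> \<tau>) + 2 * (\<Sum>\<tau>\<in>T. ?l \<omega> \<tau>)"
      unfolding sum.distrib swap[of "\<lambda>k l. linear_part \<omega> k l - D"] by (simp only: mult_2 add.assoc)
    finally show ?thesis using Npos by (simp add: field_simps)
  qed
  have "E_pmf M (\<lambda>\<omega>. (u_statistic G w I \<omega> - D)\<^sup>2) \<le>
    E_pmf M (\<lambda>\<omega>. 2 * (\<Sum>\<tau>\<in>T. degenerate_part \<omega> \<tau>)\<^sup>2 / N\<^sup>2 + 8 * (\<Sum>\<tau>\<in>T. ?l \<omega> \<tau>)\<^sup>2 / N\<^sup>2)"
  proof (rule E_pmf_mono[OF fin_supp_M])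
    fix \<omega>
    have "(a + 2 * c)\<^sup>2 \<le> 2 * a\<^sup>2 + 8 * c\<^sup>2" for a c :: real
      using sum_squares_bound[of a "2 * c"] by (simp add: power2_sum power_mult_distrib)
    from this[of "(\<Sum>\<tau>\<in>T. degenerate_part \<omega> \<tau>) / N" "(\<Sum>\<tau>\<in>T. ?l \<omega> \<tau>) / N"]
    show "(u_statistic G w I \<omega> - D)\<^sup>2 \<le> 2 * (\<Sum>\<tau>\<in>T. degenerate_part \<omega> \<tau>)\<^sup>2 / N\<^sup>2 + 8 * (\<Sum>\<tau>\<in>T. ?l \<omega> \<tau>)\<^sup>2 / N\<^sup>2"
      unfolding dec by (simp add: power_divide)
  qed
  also have "\<dots> = 2 * ?V2 / N\<^sup>2 + 8 * ?V1 / N\<^sup>2" by (simp add: E_pmf_add[OF fin_supp_M])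
  also have "\<dots> \<le> 2 * (N * (real (48 * card I ^ 2) * (256 * b))) / N\<^sup>2 +
      8 * (N * (real (4 * card I ^ 3) * (4 * (D * sqrt b)))) / N\<^sup>2"
  proof (intro add_mono divide_right_mono mult_left_mono)
    show "?V2 \<le> N * (real (48 * card I ^ 2) * (256 * b))"
      unfolding E_pmf_sum_sq N_def
    proof (rule double_sum_sparse_le[OF finT])
      let ?bad = "\<lambda>(i, j, k, l) (i', j', k', l'). {i, j} \<inter> {i', j', k', l'} \<noteq> {} \<and>
        {k, l} \<inter> {i', j', k', l'} \<noteq> {}"
      show "card {b \<in> T. ?bad a b} \<le> 48 * card I ^ 2" if "a \<in> T" for a
      proof -
        obtain i j k l where a: "a = (i, j, k, l)" by (metis prod_cases4)
        show ?thesis unfolding a T_def using card_tuples4_hit_both[OF finI, of i j k l] that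
          by (auto simp: a T_def tuples4_def case_prod_unfold)
      qed
      fix a a' assume aT: "a \<in> T" "a' \<in> T"
      obtain i j k l where a: "a = (i, j, k, l)" by (metis prod_cases4)
      obtain i' j' k' l' where a': "a' = (i', j', k', l')" by (metis prod_cases4)
      show "E_pmf M (\<lambda>\<omega>. degenerate_part \<omega> a * degenerate_part \<omega> a') \<le> 256 * b"
        by (rule E_pmf_mult_le) (use aT a a' in \<open>auto simp: T_def intro!: E_pmf_degenerate_part_sq\<close>)
      show "E_pmf M (\<lambda>\<omega>. degenerate_part \<omega> a * degenerate_part \<omega> a') = 0" if "\<not> ?bad a a'"
      proof (cases "{k, l} \<inter> {i', j', k', l'} = {}")
        case True
        then show ?thesis using aT degenerate_part_orth[of i j k l i' j' k' l'] unfolding a a' T_def by blast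
      next
        case False
        then have "{i, j} \<inter> {i', j', k', l'} = {}" using that unfolding a a' by auto
        moreover have "(k, l, i, j) \<in> tuples4 I" using aT unfolding a T_def tuples4_def by auto
        ultimately show ?thesis
          using aT degenerate_part_orth[of k l i j i' j' k' l'] degenerate_part_swap[of _ i j k l] unfolding a a' T_def by simp
      qed
    qed (use b_nonneg in auto)
    show "?V1 \<le> N * (real (4 * card I ^ 3) * (4 * (D * sqrt b)))"
      unfolding E_pmf_sum_sq N_def
    proof (rule double_sum_sparse_le[OF finT])
      let ?bad = "\<lambda>(i, j, k :: nat, l :: nat) (i', j', k' :: nat, l' :: nat). {i', j'} \<inter> {i, j} \<noteq> {}"
      show "card {b \<in> T. ?bad a b} \<le> 4 * card I ^ 3" if "a \<in> T" for a
      proof -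
        obtain i j k l where a: "a = (i, j, k, l)" by (metis prod_cases4)
        show ?thesis unfolding a T_def using card_tuples4_hit[OF finI, of i j]
          by (auto simp: case_prod_unfold)
      qed
      fix a a' assume aT: "a \<in> T" "a' \<in> T"
      obtain i j k l where a: "a = (i, j, k, l)" by (metis prod_cases4)
      obtain i' j' k' l' where a': "a' = (i', j', k', l')" by (metis prod_cases4)
      have m: "i \<in> I" "j \<in> I" "i \<noteq> j" "i' \<in> I" "j' \<in> I" "i' \<noteq> j'"
        using aT unfolding a a' T_def tuples4_def by auto
      show "E_pmf M (\<lambda>\<omega>. ?l \<omega> a * ?l \<omega> a') \<le> 4 * (D * sqrt b)"
        unfolding a a' by (rule E_pmf_mult_le) (use m in \<open>auto intro!: E_pmf_linear_part_centred_sq\<close>)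
      show "E_pmf M (\<lambda>\<omega>. ?l \<omega> a * ?l \<omega> a') = 0" if "\<not> ?bad a a'"
      proof -
        have "E_pmf M (\<lambda>\<omega>. (linear_part \<omega> i j - D) * (linear_part \<omega> i' j' - D)) =
          E_pmf M (\<lambda>\<omega>. linear_part \<omega> i j - D) * E_pmf M (\<lambda>\<omega>. linear_part \<omega> i' j' - D)"
        proof (rule E_pmf_Pi_indep[OF finJ _ _ _ _ _ fin_supp_Q])
          show "depends_on {i, j} (\<lambda>\<omega>. linear_part \<omega> i j - D)" "depends_on {i', j'} (\<lambda>\<omega>. linear_part \<omega> i' j' - D)"
            by (rule depends_onI, simp add: linear_part_def phi_fun_def)+
          show "{i, j} \<subseteq> J" "{i', j'} \<subseteq> J" "{i, j} \<inter> {i', j'} = {}"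
            using m IJ that unfolding a a' by auto
        qed
        also have "E_pmf M (\<lambda>\<omega>. linear_part \<omega> i j - D) = 0" using E_pmf_linear_part[OF m(1-3)] by (simp add: E_pmf_diff[OF fin_supp_M])
        finally show ?thesis unfolding a a' by simp
      qed
    qed (use D_nonneg b_nonneg in auto)
  qed (use Npos in auto)
  also have "\<dots> = (24576 * (s\<^sup>2 * b) + 128 * (s ^ 3 * (D * sqrt b))) / N"
    using Npos unfolding s_def by (simp add: field_simps power2_eq_square)
  also have "\<dots> \<le> (24576 * (s\<^sup>2 * b) + 128 * (s ^ 3 * (D * sqrt b))) / (6 / 64 * s ^ 4)"
    by (intro divide_left_mono N mult_pos_pos add_nonneg_nonneg mult_nonneg_nonneg)
      (use Npos s4 b_nonneg D_nonneg in auto)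
  also have "\<dots> = 262144 * (b / s\<^sup>2) + (4096 / 3) * (D * sqrt b / s)"
    using s4 by (simp add: field_simps power2_eq_square power3_eq_cube power4_eq_xxxx)
  also have "\<dots> \<le> 300000 * (b / s\<^sup>2) + 300000 * (D * sqrt b / s)"
    by (intro add_mono mult_right_mono) (use s4 b_nonneg D_nonneg in auto)
  finally show ?thesis unfolding s_def by (simp add: algebra_simps)
qed

lemma E_pmf_kernel_fun:
  assumes t: "(i, j, k, l) \<in> tuples4 I"
  shows "E_pmf M (\<lambda>\<omega>. kernel_fun G w \<omega> (i, j, k, l)) = D"
proof -
  have m: "i \<in> I" "j \<in> I" "k \<in> I" "l \<in> I" "i \<noteq> j" "k \<noteq> l" using assms by (auto simp: tuples4_def)
  have "E_pmf M (\<lambda>\<omega>. kernel_fun G w \<omega> (i, j, k, l)) = (\<Sum>g\<in>G. E_pmf M (\<lambda>\<omega>. (w g * phi_fun \<omega> i j g) * phi_fun \<omega> k l g))"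
    unfolding kernel_fun_def by (simp add: E_pmf_sum[OF fin_supp_M])
  also have "\<dots> = (\<Sum>g\<in>G. E_pmf M (\<lambda>\<omega>. w g * phi_fun \<omega> i j g) * E_pmf M (\<lambda>\<omega>. phi_fun \<omega> k l g))"
    by (intro sum.cong refl E_pmf_Pi_indep[OF finJ, of "{i, j}" "{k, l}"] fin_supp_Q depends_onI)
      (use t IJ in \<open>auto simp: tuples4_def phi_fun_def\<close>)
  also have "\<dots> = D" using E_pmf_phi_fun m by (simp add: wdist_def power2_eq_square algebra_simps)
  finally show ?thesis .
qed

lemma ustat_unbiased:
  assumes "card I \<ge> 4"
  shows "E_pmf M (u_statistic G w I) = D"
proof -
  have finI: "finite I" using finJ IJ finite_subset by blast
  have "real (card (tuples4 I)) > 0" using card_tuples4_ge[OF finI assms] assms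
    by (smt (verit) divide_pos_pos of_nat_0_less_iff zero_less_mult_iff zero_less_power gr0I not_numeral_le_zero)
  moreover have "E_pmf M (u_statistic G w I) = (\<Sum>\<tau>\<in>tuples4 I. E_pmf M (\<lambda>\<omega>. kernel_fun G w \<omega> \<tau>)) / real (card (tuples4 I))"
    unfolding u_statistic_def by (simp add: E_pmf_sum[OF fin_supp_M])
  moreover have "(\<Sum>\<tau>\<in>tuples4 I. E_pmf M (\<lambda>\<omega>. kernel_fun G w \<omega> \<tau>)) = (\<Sum>\<tau>\<in>tuples4 I. D)"
    by (rule sum.cong) (auto simp: E_pmf_kernel_fun)
  ultimately show ?thesis by simp
qed

end

lemma depends_on_u_statistic: "I \<subseteq> K \<Longrightarrow> depends_on K (u_statistic G w I)"
  unfolding u_statistic_def kernel_fun_def phi_fun_def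
  by (intro depends_onI arg_cong2[where f="(/)"] sum.cong refl) (auto simp: tuples4_def subset_iff)

section \<open>The U-statistic of a sample and its weights\<close>

lemma choose_4: "n \<ge> 4 \<Longrightarrow> 24 * (n choose 4) = n * (n - 1) * (n - 2) * (n - 3)"
proof -
  assume "n \<ge> 4"
  then obtain m where n: "n = Suc (Suc (Suc (Suc m)))"
    using le_Suc_ex[of 4 n] by (auto simp: numeral_eq_Suc)
  have "Suc 3 * (n choose Suc 3) = n * ((n - 1) choose 3)"
    unfolding n using Suc_times_binomial[of 3 "Suc (Suc (Suc m))"] by simp
  moreover have "Suc 2 * ((n - 1) choose Suc 2) = (n - 1) * ((n - 2) choose 2)"
    unfolding n using Suc_times_binomial[of 2 "Suc (Suc m)"] by simp
  moreover have "Suc 1 * ((n - 2) choose Suc 1) = (n - 2) * ((n - 3) choose 1)"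
    unfolding n using Suc_times_binomial[of 1 "Suc m"] by simp
  ultimately have "4 * (n choose 4) = n * ((n - 1) choose 3)" "3 * ((n - 1) choose 3) = (n - 1) * ((n - 2) choose 2)"
    "2 * ((n - 2) choose 2) = (n - 2) * (n - 3)" by (simp_all add: numeral_eq_Suc)
  then have e: "4 * (n choose 4) = n * ((n - 1) choose 3)" "3 * ((n - 1) choose 3) = (n - 1) * ((n - 2) choose 2)"
    "2 * ((n - 2) choose 2) = (n - 2) * (n - 3)" by auto
  have "24 * (n choose 4) = 6 * (4 * (n choose 4))" by simp
  also have "\<dots> = 2 * n * (3 * ((n - 1) choose 3))" unfolding e(1) by simp
  also have "\<dots> = n * (n - 1) * (2 * ((n - 2) choose 2))" unfolding e(2) by simp
  also have "\<dots> = n * (n - 1) * (n - 2) * (n - 3)" unfolding e(3) by simp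
  finally show ?thesis .
qed

definition incr4 :: "nat set \<Rightarrow> (nat \<times> nat \<times> nat \<times> nat) set" where
  "incr4 I = {(i, j, k, l). {i, j, k, l} \<subseteq> I \<and> i < j \<and> j < k \<and> k < l}"

text \<open>Sorting shows that a tuple of distinct indices is the same as an increasing tuple
  together with a permutation of its entries.\<close>

lemma sum_perms_incr4:
  fixes F :: "nat \<times> nat \<times> nat \<times> nat \<Rightarrow> real"
  assumes "finite I"
  shows "(\<Sum>(i, j, k, l)\<in>incr4 I. \<Sum>\<pi> | \<pi> permutes {i, j, k, l}. F (\<pi> i, \<pi> j, \<pi> k, \<pi> l)) =
    (\<Sum>\<tau>\<in>tuples4 I. F \<tau>)"
proof -
  let ?D = "SIGMA t:incr4 I. (case t of (i, j, k, l) \<Rightarrow> {\<pi>. \<pi> permutes {i, j, k, l}})"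
  let ?h = "\<lambda>((i, j, k, l), \<pi>). (\<pi> i, \<pi> j, \<pi> k, \<pi> l)"
  have fin: "finite (incr4 I)"
    by (rule finite_subset[of _ "I \<times> I \<times> I \<times> I"]) (use assms in \<open>auto simp: incr4_def\<close>)
  have "bij_betw ?h ?D (tuples4 I)"
    unfolding bij_betw_def
  proof
    show "inj_on ?h ?D"
    proof (rule inj_onI, safe)
      fix i j k l i' j' k' l' :: nat and \<pi> \<pi>'
      assume t: "(i, j, k, l) \<in> incr4 I" "(i', j', k', l') \<in> incr4 I"
        and p: "\<pi> permutes {i, j, k, l}" "\<pi>' permutes {i', j', k', l'}"
        and e: "\<pi> i = \<pi>' i'" "\<pi> j = \<pi>' j'" "\<pi> k = \<pi>' k'" "\<pi> l = \<pi>' l'"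
      have o: "i < j" "j < k" "k < l" "i' < j'" "j' < k'" "k' < l'" using t by (auto simp: incr4_def)
      have "{i, j, k, l} = \<pi> ` {i, j, k, l}" using permutes_image[OF p(1)] by simp
      also have "\<dots> = \<pi>' ` {i', j', k', l'}" using e by simp
      also have "\<dots> = {i', j', k', l'}" using permutes_image[OF p(2)] .
      finally have S: "{i, j, k, l} = {i', j', k', l'}" .
      \<comment> \<open>An increasing tuple is recovered from the set of its entries.\<close>
      have "sorted_list_of_set (set [i, j, k, l]) = [i, j, k, l]"
        by (rule sorted_list_of_set.idem_if_sorted_distinct) (use o in auto)
      moreover have "sorted_list_of_set (set [i', j', k', l']) = [i', j', k', l']"
        by (rule sorted_list_of_set.idem_if_sorted_distinct) (use o in auto)
      ultimately have L: "[i, j, k, l] = [i', j', k', l']" using S by simp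
      then show "i = i'" "j = j'" "k = k'" "l = l'" by auto
      show "\<pi> = \<pi>'"
      proof
        fix z show "\<pi> z = \<pi>' z"
          using e L permutes_not_in[OF p(1), of z] permutes_not_in[OF p(2), of z]
          by (cases "z \<in> {i, j, k, l}") auto
      qed
    qed
    show "?h ` ?D = tuples4 I"
    proof (rule antisym; rule subsetI)
      fix x assume "x \<in> ?h ` ?D"
      then obtain i j k l \<pi> where x: "x = (\<pi> i, \<pi> j, \<pi> k, \<pi> l)" and t: "(i, j, k, l) \<in> incr4 I"
        and p: "\<pi> permutes {i, j, k, l}" by auto
      have o: "i < j" "j < k" "k < l" "{i, j, k, l} \<subseteq> I" using t by (auto simp: incr4_def)
      have i: "\<pi> a = \<pi> b \<longleftrightarrow> a = b" for a b using permutes_inj[OF p] by (rule inj_eq)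
      have "distinct [\<pi> i, \<pi> j, \<pi> k, \<pi> l]" using o by (simp add: i)
      moreover have "{\<pi> i, \<pi> j, \<pi> k, \<pi> l} \<subseteq> I" using permutes_image[OF p] o(4) by auto
      ultimately show "x \<in> tuples4 I" unfolding x tuples4_def by auto
    next
      fix x assume "x \<in> tuples4 I"
      then obtain a b c e where x: "x = (a, b, c, e)" and di: "distinct [a, b, c, e]" and sI: "{a, b, c, e} \<subseteq> I"
        by (auto simp: tuples4_def)
      define A where "A = {a, b, c, e}"
      define xs where "xs = sorted_list_of_set A"
      have A: "finite A" "card A = 4" unfolding A_def using di by auto
      have "length xs = 4" unfolding xs_def using A by simp
      then obtain i j k l where xs: "xs = [i, j, k, l]" by (auto simp: numeral_eq_Suc length_Suc_conv)
      have st: "set xs = A" unfolding xs_def using A by simp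
      have "sorted xs" "distinct xs" unfolding xs_def by simp_all
      then have o: "i < j" "j < k" "k < l" unfolding xs by auto
      have S: "{i, j, k, l} = {a, b, c, e}" using st unfolding xs A_def by simp
      \<comment> \<open>The permutation that puts the sorted entries back into the given order; it
        must fix everything else in order to permute the set of entries.\<close>
      define \<pi> where "\<pi> = (\<lambda>z. if z = i then a else if z = j then b else if z = k then c else if z = l then e else z)"
      have ne: "j \<noteq> i" "k \<noteq> i" "k \<noteq> j" "l \<noteq> i" "l \<noteq> j" "l \<noteq> k" using o by linarith+
      have vals: "\<pi> i = a" "\<pi> j = b" "\<pi> k = c" "\<pi> l = e" unfolding \<pi>_def by (simp_all add: ne)
      have "bij_betw \<pi> {i, j, k, l} {i, j, k, l}"
        unfolding bij_betw_def
      proof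
        have "\<pi> ` {i, j, k, l} = {a, b, c, e}" by (simp only: image_insert image_empty vals)
        then show "\<pi> ` {i, j, k, l} = {i, j, k, l}" by (rule trans[OF _ S[symmetric]])
        have "distinct (map \<pi> [i, j, k, l])" unfolding list.map vals by (rule di)
        then have "inj_on \<pi> (set [i, j, k, l])" unfolding distinct_map by (rule conjunct2)
        then show "inj_on \<pi> {i, j, k, l}" by (simp only: list.set)
      qed
      then have "\<pi> permutes {i, j, k, l}"
        by (rule bij_imp_permutes) (simp add: \<pi>_def)
      moreover have "(i, j, k, l) \<in> incr4 I" using o S sI unfolding incr4_def by auto
      ultimately have "((i, j, k, l), \<pi>) \<in> ?D" by auto
      then show "x \<in> ?h ` ?D" using vals unfolding x by force
    qed
  qed
  then have "(\<Sum>\<tau>\<in>tuples4 I. F \<tau>) = (\<Sum>p\<in>?D. F (?h p))"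
    by (rule sum.reindex_bij_betw[symmetric])
  also have "\<dots> = (\<Sum>t\<in>incr4 I. \<Sum>\<pi>\<in>(case t of (i, j, k, l) \<Rightarrow> {\<pi>. \<pi> permutes {i, j, k, l}}). F (?h (t, \<pi>)))"
    by (subst sum.Sigma) (use fin in \<open>auto simp: finite_permutations intro!: sum.cong\<close>)
  also have "\<dots> = (\<Sum>(i, j, k, l)\<in>incr4 I. \<Sum>\<pi> | \<pi> permutes {i, j, k, l}. F (\<pi> i, \<pi> j, \<pi> k, \<pi> l))"
    by (intro sum.cong refl) auto
  finally show ?thesis by simp
qed

text \<open>The factor \<open>1 / fact 4\<close> of the kernel and the binomial coefficient combine
  to the number of ordered tuples.\<close>

lemma U_W_eq_u_statistic:
  assumes "length D \<ge> 4"
  shows "U_W l1 l2 D = u_statistic ({1..l1} \<times> {1..l2})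
    (\<lambda>(x, y). 1 / (1 + real (weight_XY l1 l2 D x y))) {2 * ustat_t D + 1..4 + 4 * ustat_t D} (\<lambda>i. D ! (i - 1))"
proof -
  define t where "t = ustat_t D"
  define I where "I = {2 * t + 1..4 + 4 * t}"
  let ?G = "{1..l1} \<times> {1..l2}"
  let ?w = "\<lambda>(x, y). 1 / (1 + real (weight_XY l1 l2 D x y))"
  let ?F = "kernel_fun ?G ?w (\<lambda>i. D ! (i - 1))"
  have cI: "card I = 2 * t + 4" "finite I" unfolding I_def by auto
  have h: "h_kernel l1 l2 D i j k l = 1 / 24 * (\<Sum>\<pi> | \<pi> permutes {i, j, k, l}. ?F (\<pi> i, \<pi> j, \<pi> k, \<pi> l))" for i j k l
  proof -
    have "?F (a, b, c, e) = (\<Sum>x\<in>{1..l1}. \<Sum>y\<in>{1..l2}.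
        phi D a b x y * phi D c e x y / (1 + real (weight_XY l1 l2 D x y)))" for a b c e
      unfolding sum.cartesian_product kernel_fun_def case_prod_conv
    proof (intro sum.cong refl, unfold split_paired_all case_prod_conv)
      fix x y
      have "phi_fun (\<lambda>i. D ! (i - 1)) i j (x, y) = phi D i j x y" for i j
        unfolding phi_fun_def phi_def obs_X_def obs_Y_def by (simp add: prod_eq_iff of_bool_conj)
      then show "1 / (1 + real (weight_XY l1 l2 D x y)) * phi_fun (\<lambda>i. D ! (i - 1)) a b (x, y) *
        phi_fun (\<lambda>i. D ! (i - 1)) c e (x, y) = phi D a b x y * phi D c e x y / (1 + real (weight_XY l1 l2 D x y))"
        by simp
    qed
    then show ?thesis unfolding h_kernel_def by (simp add: fact_numeral)
  qed
  have S: "{(i, j, k, l). 2 * t + 1 \<le> i \<and> i < j \<and> j < k \<and> k < l \<and> l \<le> 4 + 4 * t} = incr4 I"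
    unfolding incr4_def I_def by auto
  have "U_W l1 l2 D = 1 / real ((2 * t + 4) choose 4) *
      (\<Sum>(i, j, k, l)\<in>incr4 I. 1 / 24 * (\<Sum>\<pi> | \<pi> permutes {i, j, k, l}. ?F (\<pi> i, \<pi> j, \<pi> k, \<pi> l)))"
    unfolding U_W_def Let_def t_def[symmetric] S h by simp
  also have "\<dots> = (\<Sum>(i, j, k, l)\<in>incr4 I. \<Sum>\<pi> | \<pi> permutes {i, j, k, l}. ?F (\<pi> i, \<pi> j, \<pi> k, \<pi> l)) /
      real (24 * ((2 * t + 4) choose 4))"
    by (simp add: case_prod_unfold sum_divide_distrib sum_distrib_left mult.commute)
  also have "24 * ((2 * t + 4) choose 4) = card (tuples4 I)"
    using choose_4[of "2 * t + 4"] card_tuples4[of I] cI by simp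
  also have "(\<Sum>(i, j, k, l)\<in>incr4 I. \<Sum>\<pi> | \<pi> permutes {i, j, k, l}. ?F (\<pi> i, \<pi> j, \<pi> k, \<pi> l)) =
      (\<Sum>\<tau>\<in>tuples4 I. ?F \<tau>)"
    by (rule sum_perms_incr4[OF cI(2)])
  finally show ?thesis unfolding u_statistic_def I_def t_def .
qed

text \<open>Passes from positions within the list of a cell to the numbers of the observations in
  the whole sample.\<close>

lemma u_statistic_reindex:
  assumes "inj_on e I"
  shows "u_statistic G w I (\<lambda>i. \<omega> (e i)) = u_statistic G w (e ` I) \<omega>"
proof -
  let ?h = "\<lambda>(i, j, k, l). (e i, e j, e k, e l)"
  have bij: "bij_betw ?h (tuples4 I) (tuples4 (e ` I))"
    unfolding bij_betw_def
  proof
    show "inj_on ?h (tuples4 I)"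
      using assms by (auto simp: inj_on_def tuples4_def)
    show "?h ` tuples4 I = tuples4 (e ` I)"
    proof (rule antisym; rule subsetI)
      fix x assume "x \<in> ?h ` tuples4 I"
      then show "x \<in> tuples4 (e ` I)" using assms by (auto simp: inj_on_def tuples4_def)
    next
      fix x assume "x \<in> tuples4 (e ` I)"
      then obtain i j k l where "x = (e i, e j, e k, e l)" "{i, j, k, l} \<subseteq> I" "distinct [e i, e j, e k, e l]"
        unfolding tuples4_def by auto
      moreover from this have "(i, j, k, l) \<in> tuples4 I" unfolding tuples4_def by auto
      ultimately show "x \<in> ?h ` tuples4 I" by force
    qed
  qed
  have "(\<Sum>\<tau>\<in>tuples4 (e ` I). kernel_fun G w \<omega> \<tau>) = (\<Sum>\<tau>\<in>tuples4 I. kernel_fun G w \<omega> (?h \<tau>))"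
    by (rule sum.reindex_bij_betw[OF bij, symmetric])
  also have "\<dots> = (\<Sum>\<tau>\<in>tuples4 I. kernel_fun G w (\<lambda>i. \<omega> (e i)) \<tau>)"
    by (intro sum.cong refl) (auto simp: kernel_fun_def phi_fun_def)
  finally show ?thesis unfolding u_statistic_def using bij_betw_same_card[OF bij] by simp
qed

text \<open>The reciprocal of \<open>1 + a\<^sub>x\<^sub>y = (1 + a\<^sub>x) (1 + a'\<^sub>y)\<close>.\<close>

definition flat_weight :: "nat set \<Rightarrow> nat set \<Rightarrow> (nat \<Rightarrow> nat \<times> nat) \<Rightarrow> nat \<times> nat \<Rightarrow> real" where
  "flat_weight AX AY \<omega> g = 1 / (1 + real (card {j \<in> AX. fst (\<omega> j) = fst g})) * (1 / (1 + real (card {j \<in> AY. snd (\<omega> j) = snd g})))"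

text \<open>Positions count from 1 and a block is half-open, \<open>a < i \<le> b\<close>, so blocks
  that share an endpoint are disjoint.\<close>

definition nthset :: "nat list \<Rightarrow> nat \<Rightarrow> nat \<Rightarrow> nat set" where
  "nthset js a b = (\<lambda>i. js ! (i - 1)) ` {a + 1..b}"

lemma inj_nth: "distinct js \<Longrightarrow> b \<le> length js \<Longrightarrow> inj_on (\<lambda>i. js ! (i - 1)) {a + 1..b}"
  by (auto simp: inj_on_def nth_eq_iff_index_eq)

lemma card_nthset: "distinct js \<Longrightarrow> b \<le> length js \<Longrightarrow> card (nthset js a b) = b - a"
  unfolding nthset_def by (subst card_image[OF inj_nth]) auto

lemma nthset_subset: "b \<le> length js \<Longrightarrow> nthset js a b \<subseteq> set js"
  unfolding nthset_def by auto

lemma nthset_disjoint: "distinct js \<Longrightarrow> b \<le> c \<Longrightarrow> e \<le> length js \<Longrightarrow> nthset js a b \<inter> nthset js c e = {}"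
  unfolding nthset_def by (auto simp: nth_eq_iff_index_eq)

lemma card_nthset_filter:
  assumes "distinct js" "b \<le> length js"
  shows "card {i \<in> {a + 1..b}. P (js ! (i - 1))} = card {j \<in> nthset js a b. P j}"
proof -
  have "{j \<in> nthset js a b. P j} = (\<lambda>i. js ! (i - 1)) ` {i \<in> {a + 1..b}. P (js ! (i - 1))}"
    unfolding nthset_def by auto
  moreover have "inj_on (\<lambda>i. js ! (i - 1)) {i \<in> {a + 1..b}. P (js ! (i - 1))}"
    by (rule inj_on_subset[OF inj_nth[OF assms]]) auto
  ultimately show ?thesis by (simp add: card_image)
qed

lemma U_W_map:
  fixes js :: "nat list" and l1 l2 :: nat
  assumes "distinct js" "length js \<ge> 4"
  defines "t \<equiv> (length js - 4) div 4"
  defines "t1 \<equiv> min t l1"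
  defines "t2 \<equiv> min t l2"
  shows "U_W l1 l2 (map \<omega> js) = u_statistic ({1..l1} \<times> {1..l2})
    (flat_weight (nthset js 0 t1) (nthset js t1 (t1 + t2)) \<omega>) (nthset js (2 * t) (4 + 4 * t)) \<omega>"
proof -
  let ?D = "map \<omega> js"
  have t: "ustat_t ?D = t" unfolding ustat_t_def t_def by simp
  have tl: "4 + 4 * t \<le> length js" unfolding t_def using assms(2) by linarith
  have le: "t1 \<le> length js" "t1 + t2 \<le> length js" "t1 + t2 \<le> 2 * t" using tl unfolding t1_def t2_def by linarith+
  have nth: "?D ! (i - 1) = \<omega> (js ! (i - 1))" if "1 \<le> i" "i \<le> length js" for i
    by (rule nth_map) (use that in linarith)
  have X: "weight_X l1 ?D x = card {j \<in> nthset js 0 t1. fst (\<omega> j) = x}" for x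
  proof -
    have "weight_X l1 ?D x = card {i \<in> {0 + 1..t1}. fst (\<omega> (js ! (i - 1))) = x}"
      unfolding weight_X_def t t1_def[symmetric] obs_X_def
      by (rule arg_cong[of _ _ card]) (use nth le in auto)
    then show ?thesis using card_nthset_filter[OF assms(1) le(1), of 0 "\<lambda>j. fst (\<omega> j) = x"] by simp
  qed
  have Y: "weight_Y l1 l2 ?D y = card {j \<in> nthset js t1 (t1 + t2). snd (\<omega> j) = y}" for y
  proof -
    have "weight_Y l1 l2 ?D y = card {i \<in> {t1 + 1..t1 + t2}. snd (\<omega> (js ! (i - 1))) = y}"
      unfolding weight_Y_def t Let_def t1_def[symmetric] t2_def[symmetric] obs_Y_def
      by (rule arg_cong[of _ _ card]) (use nth le in auto)
    then show ?thesis using card_nthset_filter[OF assms(1) le(2), of t1 "\<lambda>j. snd (\<omega> j) = y"] by simp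
  qed
  have w: "(\<lambda>(x, y). 1 / (1 + real (weight_XY l1 l2 ?D x y))) =
      flat_weight (nthset js 0 t1) (nthset js t1 (t1 + t2)) \<omega>"
    by (auto simp: fun_eq_iff flat_weight_def weight_XY_def X Y of_nat_diff algebra_simps)
  have "U_W l1 l2 ?D = u_statistic ({1..l1} \<times> {1..l2})
    (flat_weight (nthset js 0 t1) (nthset js t1 (t1 + t2)) \<omega>) {2 * t + 1..4 + 4 * t} (\<lambda>i. ?D ! (i - 1))"
    by (subst U_W_eq_u_statistic) (use assms(2) in \<open>simp_all add: t w\<close>)
  also have "\<dots> = u_statistic ({1..l1} \<times> {1..l2})
    (flat_weight (nthset js 0 t1) (nthset js t1 (t1 + t2)) \<omega>) {2 * t + 1..4 + 4 * t} (\<lambda>i. \<omega> (js ! (i - 1)))"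
    by (rule depends_onD[OF depends_on_u_statistic[OF order_refl]]) (use nth tl in auto)
  also have "\<dots> = u_statistic ({1..l1} \<times> {1..l2})
    (flat_weight (nthset js 0 t1) (nthset js t1 (t1 + t2)) \<omega>) (nthset js (2 * t) (4 + 4 * t)) \<omega>"
    unfolding nthset_def[of js "2 * t"] by (rule u_statistic_reindex[OF inj_nth[OF assms(1) tl]])
  finally show ?thesis .
qed

text \<open>Bound \<open>1 / (1 + j)^2\<close> by \<open>2 / ((j + 1) * (j + 2))\<close>. This
  denominator turns \<open>k choose j\<close> into \<open>(k + 2) choose (j + 2)\<close>, and
  together with \<open>p^2\<close> the sum becomes part of the binomial expansion of exponent
  \<open>k + 2\<close>.\<close>

lemma binomial_inverse_square_moment:
  assumes p: "0 \<le> p" "p \<le> 1"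
  shows "E_pmf (binomial_pmf k p) (\<lambda>j. (1 / (1 + real j))\<^sup>2) * p\<^sup>2 \<le> 2 / (real k + 1)\<^sup>2"
proof -
  have "E_pmf (binomial_pmf k p) (\<lambda>j. (1 / (1 + real j))\<^sup>2) * p\<^sup>2 =
    (\<Sum>j\<le>k. real (k choose j) * p ^ j * (1 - p) ^ (k - j) * (1 / (1 + real j))\<^sup>2 * p\<^sup>2)"
    using p by (subst expectation_binomial_pmf') (auto simp: sum_distrib_right sum_distrib_left mult_ac)
  also have "\<dots> \<le> (\<Sum>j\<le>k. 2 / ((real k + 1) * (real k + 2)) *
      (real ((k + 2) choose (j + 2)) * p ^ (j + 2) * (1 - p) ^ (k + 2 - (j + 2))))"
  proof (rule sum_mono)
    fix j
    have h1: "(1 / (1 + real j))\<^sup>2 \<le> 2 / ((real j + 1) * (real j + 2))"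
      by (simp add: power2_eq_square divide_simps) (simp add: algebra_simps)
    have h2: "real (k choose j) / ((real j + 1) * (real j + 2)) =
      real ((k + 2) choose (j + 2)) / ((real k + 1) * (real k + 2))"
    proof -
      have "Suc (Suc k) * (Suc k choose Suc j) = (Suc (Suc k) choose Suc (Suc j)) * Suc (Suc j)"
        "Suc k * (k choose j) = (Suc k choose Suc j) * Suc j"
        by (rule Suc_times_binomial_eq)+
      then have "Suc (Suc k) * (Suc k * (k choose j)) = ((Suc (Suc k) choose Suc (Suc j)) * Suc (Suc j)) * Suc j"
        by (simp only: mult.assoc[symmetric])
      then have "Suc (Suc k) * Suc k * (k choose j) = (Suc (Suc k) choose Suc (Suc j)) * Suc (Suc j) * Suc j"
        by (simp only: mult.assoc)
      then have "real (Suc (Suc k) * Suc k * (k choose j)) = real ((Suc (Suc k) choose Suc (Suc j)) * Suc (Suc j) * Suc j)"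
        by (rule arg_cong)
      then have "(real k + 2) * (real k + 1) * real (k choose j) =
        real ((k + 2) choose (j + 2)) * (real j + 2) * (real j + 1)"
        unfolding of_nat_mult by (simp add: add_ac)
      then show ?thesis by (simp add: divide_simps mult_ac)
    qed
    have "real (k choose j) * (1 / (1 + real j))\<^sup>2 \<le> real (k choose j) * (2 / ((real j + 1) * (real j + 2)))"
      by (rule mult_left_mono[OF h1]) simp
    also have "\<dots> = 2 * (real (k choose j) / ((real j + 1) * (real j + 2)))" by simp
    finally have "real (k choose j) * (1 / (1 + real j))\<^sup>2 \<le>
      2 * (real ((k + 2) choose (j + 2)) / ((real k + 1) * (real k + 2)))" unfolding h2 .
    then have "real (k choose j) * (1 / (1 + real j))\<^sup>2 * (p ^ j * (1 - p) ^ (k - j) * p\<^sup>2) \<le>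
      2 * (real ((k + 2) choose (j + 2)) / ((real k + 1) * (real k + 2))) * (p ^ j * (1 - p) ^ (k - j) * p\<^sup>2)"
      by (rule mult_right_mono) (use p in auto)
    moreover have "p ^ (j + 2) = p ^ j * p\<^sup>2" "k + 2 - (j + 2) = k - j" by (auto simp: power_add power2_eq_square)
    ultimately show "real (k choose j) * p ^ j * (1 - p) ^ (k - j) * (1 / (1 + real j))\<^sup>2 * p\<^sup>2 \<le>
      2 / ((real k + 1) * (real k + 2)) *
      (real ((k + 2) choose (j + 2)) * p ^ (j + 2) * (1 - p) ^ (k + 2 - (j + 2)))"
      by (simp only: mult_ac times_divide_eq_right times_divide_eq_left)
  qed
  also have "\<dots> = 2 / ((real k + 1) * (real k + 2)) *
      (\<Sum>i\<in>{2..k+2}. real ((k + 2) choose i) * p ^ i * (1 - p) ^ (k + 2 - i))"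
  proof -
    have "(\<Sum>j\<le>k. f (j + 2)) = (\<Sum>i\<in>{2..k+2}. f i)" for f :: "nat \<Rightarrow> real"
      by (rule sum.reindex_bij_witness[of _ "\<lambda>i. i - 2" "\<lambda>j. j + 2"]) auto
    from this[of "\<lambda>i. real ((k + 2) choose i) * p ^ i * (1 - p) ^ (k + 2 - i)"] show ?thesis
      by (simp only: sum_distrib_left[symmetric])
  qed
  also have "\<dots> \<le> 2 / ((real k + 1) * (real k + 2)) * 1"
  proof (rule mult_left_mono)
    have "(\<Sum>i\<in>{2..k+2}. real ((k + 2) choose i) * p ^ i * (1 - p) ^ (k + 2 - i)) \<le>
      (\<Sum>i\<le>k+2. real ((k + 2) choose i) * p ^ i * (1 - p) ^ (k + 2 - i))"
      by (rule sum_mono2) (use p in auto)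
    also have "\<dots> = (p + (1 - p)) ^ (k + 2)" by (rule binomial_ring[symmetric])
    finally show "(\<Sum>i\<in>{2..k+2}. real ((k + 2) choose i) * p ^ i * (1 - p) ^ (k + 2 - i)) \<le> 1" by simp
  qed auto
  also have "\<dots> \<le> 2 / (real k + 1)\<^sup>2"
    by (simp add: power2_eq_square frac_le)
  finally show ?thesis .
qed

text \<open>The count is binomial. With the probability as a factor on the left, the bound also
  covers events of probability zero.\<close>

lemma E_pmf_inverse_count_sq:
  assumes finJ: "finite J" and A: "A \<subseteq> J" "\<And>i. i \<in> A \<Longrightarrow> Q i = q"
  shows "E_pmf (Pi_pmf J d Q) (\<lambda>\<omega>. (1 / (1 + real (card {j \<in> A. P (\<omega> j)})))\<^sup>2) * (measure_pmf.prob q {z. P z})\<^sup>2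
    \<le> 2 / (real (card A) + 1)\<^sup>2"
proof -
  define p where "p = measure_pmf.prob q {z. P z}"
  have p: "0 \<le> p" "p \<le> 1" unfolding p_def by auto
  have finA: "finite A" using finJ A finite_subset by auto
  have bern: "map_pmf P q = bernoulli_pmf p"
  proof (rule pmf_eqI)
    fix b
    have "measure_pmf.prob q {z. \<not> P z} = 1 - p"
      using measure_pmf.prob_compl[of "{z. P z}" q] unfolding p_def by (simp add: Collect_neg_eq Compl_eq_Diff_UNIV)
    then show "pmf (map_pmf P q) b = pmf (bernoulli_pmf p) b"
      using p by (cases b) (auto simp: pmf_map vimage_def p_def)
  qed
  have "E_pmf (Pi_pmf J d Q) (\<lambda>\<omega>. (1 / (1 + real (card {j \<in> A. P (\<omega> j)})))\<^sup>2) =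
    E_pmf (Pi_pmf A d Q) (\<lambda>\<omega>. (1 / (1 + real (card {j \<in> A. P (\<omega> j)})))\<^sup>2)"
    by (rule E_pmf_Pi_restrict[OF finJ A(1)]) (auto intro!: depends_onI arg_cong[of _ _ card] simp: )
  also have "Pi_pmf A d Q = Pi_pmf A d (\<lambda>_. q)" by (rule Pi_pmf_cong) (use A in auto)
  also have "E_pmf (Pi_pmf A d (\<lambda>_. q)) (\<lambda>\<omega>. (1 / (1 + real (card {j \<in> A. P (\<omega> j)})))\<^sup>2) =
    E_pmf (map_pmf (\<lambda>f. card {x \<in> A. f x}) (Pi_pmf A (P d) (\<lambda>_. map_pmf P q))) (\<lambda>j. (1 / (1 + real j))\<^sup>2)"
    by (subst Pi_pmf_map[OF finA refl]) simp
  also have "map_pmf (\<lambda>f. card {x \<in> A. f x}) (Pi_pmf A (P d) (\<lambda>_. map_pmf P q)) = binomial_pmf (card A) p"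
    unfolding bern by (rule binomial_pmf_altdef'[symmetric]) (use finA p in auto)
  finally show ?thesis using binomial_inverse_square_moment[OF p, of "card A"] p_def by simp
qed

section \<open>Moments of the test statistic given the cell labels\<close>

declare One_nat_def [simp del]

text \<open>The argument is real so that the same function can be evaluated at expected cell counts
  and at their halves.\<close>

definition omega_at :: "nat \<Rightarrow> nat \<Rightarrow> real \<Rightarrow> real" where
  "omega_at l1 l2 s = sqrt (min s (real l1) * min s (real l2))"

lemma omega_at_pos: "l1 \<ge> 1 \<Longrightarrow> l2 \<ge> 1 \<Longrightarrow> 0 < s \<Longrightarrow> 0 < omega_at l1 l2 s"
  unfolding omega_at_def by (auto intro!: mult_pos_pos)

lemma omega_at_sq: "l1 \<ge> 1 \<Longrightarrow> l2 \<ge> 1 \<Longrightarrow> 0 < s \<Longrightarrow> (omega_at l1 l2 s)\<^sup>2 = min s (real l1) * min s (real l2)"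
  unfolding omega_at_def by (simp add: zero_le_mult_iff)

lemma omega_at_le: "0 < s \<Longrightarrow> omega_at l1 l2 s \<le> s"
  unfolding omega_at_def by (rule real_le_lsqrt) (auto simp: power2_eq_square intro!: mult_mono)

lemma omega_at_mono: "l1 \<ge> 1 \<Longrightarrow> l2 \<ge> 1 \<Longrightarrow> 0 < s \<Longrightarrow> s \<le> s' \<Longrightarrow> omega_at l1 l2 s \<le> omega_at l1 l2 s'"
  unfolding omega_at_def by (auto intro!: real_sqrt_le_mono mult_mono)

lemma omega_at_half: "l1 \<ge> 1 \<Longrightarrow> l2 \<ge> 1 \<Longrightarrow> 0 < s \<Longrightarrow> omega_at l1 l2 s / 2 \<le> omega_at l1 l2 (s / 2)"
proof -
  assume a: "l1 \<ge> 1" "l2 \<ge> 1" "0 < s"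
  have "omega_at l1 l2 s / 2 = sqrt ((min s (real l1) / 2) * (min s (real l2) / 2))"
    unfolding omega_at_def by (simp add: real_sqrt_divide)
  also have "\<dots> \<le> omega_at l1 l2 (s / 2)"
    unfolding omega_at_def using a by (intro real_sqrt_le_mono mult_mono) auto
  finally show ?thesis .
qed

lemma ratio_omega_le:
  assumes "l1 \<ge> 1" "l2 \<ge> 1" "0 < s"
  shows "s / omega_at l1 l2 s \<le> sqrt (1 + s / real l1) * sqrt (1 + s / real l2)"
proof -
  have r: "s / min s (real l) \<le> 1 + s / real l" if "l \<ge> 1" for l :: nat
    using assms that by (auto simp: min_def divide_simps)
  have "s / omega_at l1 l2 s = sqrt ((s / min s (real l1)) * (s / min s (real l2)))"
    unfolding omega_at_def using assms by (simp add: real_sqrt_divide real_sqrt_mult)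
  also have "\<dots> \<le> sqrt ((1 + s / real l1) * (1 + s / real l2))"
    using assms by (intro real_sqrt_le_mono mult_mono r) auto
  finally show ?thesis by (simp add: real_sqrt_mult)
qed

text \<open>Each ratio \<open>s / min s l\<close> is at most \<open>1 + s / l\<close>, which is
  linear in \<open>s\<close>; after the Cauchy-Schwarz inequality only the number of cells and the
  total count remain. It is applied to actual counts under the null hypothesis and to expected
  counts under the alternative.\<close>

lemma sum_ratio_omega_le:
  fixes s :: "'m \<Rightarrow> real"
  assumes "l1 \<ge> 1" "l2 \<ge> 1" "\<And>m. m \<in> S \<Longrightarrow> 0 < s m" "finite S" "real (card S) \<le> D" "(\<Sum>m\<in>S. s m) \<le> E"
  shows "(\<Sum>m\<in>S. s m / omega_at l1 l2 (s m)) \<le> sqrt ((D + E / real l1) * (D + E / real l2))"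
proof -
  have "(\<Sum>m\<in>S. s m / omega_at l1 l2 (s m)) \<le> (\<Sum>m\<in>S. sqrt (1 + s m / real l1) * sqrt (1 + s m / real l2))"
    using assms by (intro sum_mono ratio_omega_le) auto
  also have "\<dots> \<le> sqrt ((D + E / real l1) * (D + E / real l2))"
  proof (rule real_le_rsqrt)
    have "(\<Sum>m\<in>S. sqrt (1 + s m / real l1) * sqrt (1 + s m / real l2))\<^sup>2 \<le>
      (\<Sum>m\<in>S. (sqrt (1 + s m / real l1))\<^sup>2) * (\<Sum>m\<in>S. (sqrt (1 + s m / real l2))\<^sup>2)"
      by (rule Cauchy_Schwarz_ineq_sum)
    also have "\<dots> = (\<Sum>m\<in>S. 1 + s m / real l1) * (\<Sum>m\<in>S. 1 + s m / real l2)"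
      by (intro arg_cong2[where f="(*)"] sum.cong refl real_sqrt_pow2) (use assms(3) in \<open>auto intro!: add_nonneg_nonneg divide_nonneg_nonneg dest: less_imp_le\<close>)
    also have "\<dots> = (real (card S) + (\<Sum>m\<in>S. s m) / real l1) * (real (card S) + (\<Sum>m\<in>S. s m) / real l2)"
      by (simp add: sum.distrib sum_divide_distrib)
    also have "\<dots> \<le> (D + E / real l1) * (D + E / real l2)"
    proof -
      have "0 \<le> (\<Sum>m\<in>S. s m)" using assms(3) by (intro sum_nonneg) (auto intro: less_imp_le)
      then show ?thesis using assms(5,6)
        by (intro mult_mono add_mono divide_right_mono) (auto intro!: add_nonneg_nonneg divide_nonneg_nonneg)
    qed
    finally show "(\<Sum>m\<in>S. sqrt (1 + s m / real l1) * sqrt (1 + s m / real l2))\<^sup>2 \<le>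
      (D + E / real l1) * (D + E / real l2)" .
  qed
  finally show ?thesis .
qed

lemma pmf_prod_marg: "pmf (prod_marg q) g = pmf (map_pmf fst q) (fst g) * pmf (map_pmf snd q) (snd g)"
  unfolding prod_marg_def by (cases g) (simp add: pmf_pair)

lemma flat_weight_bounds: "0 \<le> flat_weight AX AY \<omega> g" "flat_weight AX AY \<omega> g \<le> 1"
proof -
  show "0 \<le> flat_weight AX AY \<omega> g" unfolding flat_weight_def by simp
  have "1 / (1 + real k) \<le> 1" for k by simp
  then show "flat_weight AX AY \<omega> g \<le> 1" unfolding flat_weight_def by (intro mult_le_one) auto
qed

text \<open>Both constants are far from optimal.\<close>

definition variance_const :: real where "variance_const = 3600000"

definition null_const :: real where "null_const = 10 ^ 12"

text \<open>The cell labels \<open>\<mu>\<close> of the observations \<open>1, \<dots>, N\<close> are fixed. In cell \<open>m\<close>, the observations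
  in \<open>AX m\<close> and \<open>AY m\<close> determine the weights and those in \<open>AU m\<close> enter the U-statistic; \<open>WA\<close> collects
  the former over all cells.\<close>

locale cells =
  fixes N d l1 l2 :: nat and \<mu> :: "nat \<Rightarrow> nat" and q :: "nat \<Rightarrow> (nat \<times> nat) pmf"
  assumes qG: "\<And>m. m \<in> {1..d} \<Longrightarrow> set_pmf (q m) \<subseteq> {1..l1} \<times> {1..l2}"
    and \<mu>: "\<And>i. i \<in> {1..N} \<Longrightarrow> \<mu> i \<in> {1..d}" and l1: "l1 \<ge> 1" and l2: "l2 \<ge> 1"
begin

definition "js m = filter (\<lambda>i. \<mu> i = m) [1..<N + 1]"
definition "\<sigma> m = length (js m)"
definition "t m = (\<sigma> m - 4) div 4"
definition "t1 m = min (t m) l1"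
definition "t2 m = min (t m) l2"
definition "AX m = nthset (js m) 0 (t1 m)"
definition "AY m = nthset (js m) (t1 m) (t1 m + t2 m)"
definition "AU m = nthset (js m) (2 * t m) (4 + 4 * t m)"
definition "M = {m \<in> {1..d}. \<sigma> m \<ge> 4}"
definition "\<omega> m = omega_at l1 l2 (real (\<sigma> m))"
definition "cf m = real (\<sigma> m) * \<omega> m"
abbreviation "G \<equiv> {1..l1} \<times> {1..l2}"
abbreviation "W m f \<equiv> flat_weight (AX m) (AY m) f"
abbreviation "J \<equiv> {1..N}"
abbreviation "Q i \<equiv> q (\<mu> i)"
definition "WA = (\<Union>m\<in>M. AX m \<union> AY m)"
abbreviation "Dm m f \<equiv> wdist G (W m f) (q m)"
abbreviation "Bm m f \<equiv> wnorm G (W m f) (prod_marg (q m))"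
text \<open>This and \<open>cell_norm\<close> carry the factors of the test statistic, so that the
  variance contributed by a cell is bounded in terms of these two quantities alone.\<close>

definition "cell_mean f m = cf m * Dm m f"
definition "cell_norm f m = (\<omega> m)\<^sup>2 * Bm m f"
definition "cond_mean f = (\<Sum>m\<in>M. cell_mean f m)"
definition "T f = (\<Sum>m\<in>M. cf m * u_statistic G (W m f) (AU m) f)"
abbreviation "PJ \<equiv> Pi_pmf J (0, 0) Q"

lemma js_props: "distinct (js m)" "set (js m) = {i \<in> J. \<mu> i = m}"
  unfolding js_def by auto

lemma finM: "finite M" unfolding M_def by simp

lemma Md: "m \<in> M \<Longrightarrow> m \<in> {1..d}" unfolding M_def by simp

lemma len: assumes "m \<in> M" shows "4 + 4 * t m \<le> \<sigma> m" "\<sigma> m \<ge> 4" "\<sigma> m \<le> 4 * t m + 7"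
  using assms unfolding M_def t_def by simp_all presburger+

lemma lens: assumes "m \<in> M" shows "4 + 4 * t m \<le> length (js m)" "t1 m \<le> length (js m)" "t1 m + t2 m \<le> length (js m)"
    "t1 m + t2 m \<le> 2 * t m"
  using len[OF assms] unfolding \<sigma>_def t1_def t2_def by linarith+

lemma subs: assumes "m \<in> M" shows "AX m \<subseteq> set (js m)" "AY m \<subseteq> set (js m)" "AU m \<subseteq> set (js m)"
  unfolding AX_def AY_def AU_def using lens[OF assms] by (intro nthset_subset; simp)+

lemma cards: assumes "m \<in> M" shows "card (AX m) = t1 m" "card (AY m) = t2 m" "card (AU m) = 2 * t m + 4"
  unfolding AX_def AY_def AU_def using lens[OF assms] js_props by (simp_all add: card_nthset)

lemma disj: assumes "m \<in> M" shows "AX m \<inter> AY m = {}" "AX m \<inter> AU m = {}" "AY m \<inter> AU m = {}"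
  unfolding AX_def AY_def AU_def using lens[OF assms] js_props
  by (intro nthset_disjoint; simp)+

lemma in_cell: assumes "m \<in> M" "i \<in> AX m \<union> AY m \<union> AU m" shows "i \<in> J" "\<mu> i = m"
  using subs[OF assms(1)] assms(2) js_props(2)[of m] by auto

text \<open>An observation has only one label, so the U-statistic of a cell uses no observation that
  determines the weights of another cell.\<close>

lemma AU_sub: assumes "m \<in> M" shows "AU m \<subseteq> J - WA"
proof -
  have "i \<notin> AX m' \<union> AY m'" if "i \<in> AU m" "m' \<in> M" for i m'
  proof
    assume "i \<in> AX m' \<union> AY m'"
    then have "m' = m" using in_cell(2)[OF that(2), of i] in_cell(2)[OF assms, of i] that by auto
    then show False using disj[OF assms] \<open>i \<in> AX m' \<union> AY m'\<close> that by auto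
  qed
  then show ?thesis unfolding WA_def using in_cell(1)[OF assms] by auto
qed

lemma WA_sub: "WA \<subseteq> J" unfolding WA_def using in_cell(1) by auto

lemma fin_supp_Q: "i \<in> J \<Longrightarrow> finite (set_pmf (Q i))"
  by (rule finite_subset[OF qG[OF \<mu>]]) auto

lemma ustat_rest: assumes "m \<in> M" shows "ustat (J - WA) (AU m) Q (q m) {1..l1} {1..l2} (W m g)"
proof
  show "AU m \<subseteq> J - WA" by (rule AU_sub[OF assms])
  show "finite (set_pmf (Q i))" if "i \<in> J - WA" for i using fin_supp_Q that by auto
  show "Q i = q m" if "i \<in> AU m" for i using in_cell(2)[OF assms] that by auto
  show "set_pmf (q m) \<subseteq> {1..l1} \<times> {1..l2}" using qG[OF Md[OF assms]] .
qed (auto simp: flat_weight_bounds)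

text \<open>At most three observations are discarded, which gives
  \<open>\<sigma> \<le> 4 * t + 7\<close>, and \<open>2 * t + 4\<close> of them enter the
  U-statistic.\<close>

lemma s_bounds: assumes "m \<in> M" shows "real (\<sigma> m) / 2 \<le> real (2 * t m + 4)" "4 \<le> real (\<sigma> m)"
proof -
  have "real (\<sigma> m) \<le> real (4 * t m + 7)" using len(3)[OF assms] of_nat_le_iff by blast
  then show "real (\<sigma> m) / 2 \<le> real (2 * t m + 4)" by simp
  show "4 \<le> real (\<sigma> m)" using len(2)[OF assms] by simp
qed

text \<open>From \<open>\<sigma> \<le> 4 * t + 7 \<le> 7 * (t + 1)\<close> comes one factor 7 per
  coordinate, hence 49. The factors \<open>t1 + 1\<close> and \<open>t2 + 1\<close> are those that
  the inverse moments of the weights cancel.\<close>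

lemma omega_bounds: assumes "m \<in> M" shows "0 < \<omega> m" "\<omega> m \<le> real (\<sigma> m)" "(\<omega> m)\<^sup>2 \<le> 49 * ((real (t1 m) + 1) * (real (t2 m) + 1))"
proof -
  have s: "0 < real (\<sigma> m)" using s_bounds(2)[OF assms] by linarith
  show "0 < \<omega> m" "\<omega> m \<le> real (\<sigma> m)" unfolding \<omega>_def using omega_at_pos omega_at_le l1 l2 s by auto
  have "min (real (\<sigma> m)) (real l) \<le> 7 * (real (min (t m) l) + 1)" for l
  proof -
    have "min (\<sigma> m) l \<le> 7 * (min (t m) l + 1)" using len(3)[OF assms] by (auto simp: min_def)
    then have "real (min (\<sigma> m) l) \<le> real (7 * (min (t m) l + 1))" using of_nat_le_iff by blast
    then show ?thesis by (simp add: of_nat_min)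
  qed
  from mult_mono[OF this[of l1] this[of l2]]
  show "(\<omega> m)\<^sup>2 \<le> 49 * ((real (t1 m) + 1) * (real (t2 m) + 1))"
    unfolding \<omega>_def t1_def t2_def omega_at_sq[OF l1 l2 s] by (simp add: algebra_simps)
qed

lemma cf_pos: "m \<in> M \<Longrightarrow> 0 < cf m"
  unfolding cf_def using omega_bounds s_bounds by (intro mult_pos_pos) fastforce+

lemma wdist_nonneg: "(\<And>g. 0 \<le> w g) \<Longrightarrow> 0 \<le> wdist A w p"
  unfolding wdist_def by (intro sum_nonneg mult_nonneg_nonneg) auto

lemma cell_mean_nonneg: "m \<in> M \<Longrightarrow> 0 \<le> cell_mean f m"
  unfolding cell_mean_def using cf_pos by (intro mult_nonneg_nonneg wdist_nonneg flat_weight_bounds) (auto intro: less_imp_le)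

lemma cell_norm_nonneg: "0 \<le> cell_norm f m"
  unfolding cell_norm_def wnorm_def by (intro mult_nonneg_nonneg sum_nonneg flat_weight_bounds) auto

text \<open>\<open>ustat_variance\<close> with \<open>b\<close> replaced through \<open>b_le\<close>
  and the sample size replaced by \<open>\<sigma> / 2\<close>.\<close>

lemma cell_variance:
  assumes m: "m \<in> M"
  shows "(cf m)\<^sup>2 * E_pmf (Pi_pmf (J - WA) (0, 0) Q) (\<lambda>h. (u_statistic G (W m g) (AU m) h - Dm m g)\<^sup>2) \<le>
    variance_const * (cell_mean g m * sqrt (cell_mean g m) + cell_mean g m * sqrt (cell_norm g m) + cell_mean g m + cell_norm g m)"
proof -
  interpret u: ustat "J - WA" "AU m" "(0, 0)" Q "q m" "{1..l1}" "{1..l2}" "W m g" by (rule ustat_rest[OF m])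
  define s where "s = real (2 * t m + 4)"
  define S where "S = real (\<sigma> m)"
  define Ow where "Ow = \<omega> m"
  define D where "D = Dm m g"
  define B where "B = Bm m g"
  note c = cards(3)[OF m]
  have s: "S / 2 \<le> s" "4 \<le> S" using s_bounds[OF m] unfolding s_def S_def by auto
  have Ow: "0 < Ow" "Ow \<le> S" using omega_bounds[OF m] unfolding Ow_def S_def by auto
  have D0: "0 \<le> D" unfolding D_def by (rule u.D_nonneg)
  have B0: "0 \<le> B" unfolding B_def by (rule u.wnorm_nonneg)
  have b: "u.b \<le> 2 * D + 3 * B" unfolding D_def B_def by (rule u.b_le)
  have sb: "sqrt u.b \<le> 2 * sqrt D + 2 * sqrt B"
  proof (rule real_le_lsqrt)
    show "u.b \<le> (2 * sqrt D + 2 * sqrt B)\<^sup>2"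
      using b D0 B0 by (simp add: power2_sum power_mult_distrib) (smt (verit) mult_nonneg_nonneg real_sqrt_ge_zero)
  qed (use D0 B0 in auto)
  have "E_pmf (Pi_pmf (J - WA) (0, 0) Q) (\<lambda>h. (u_statistic G (W m g) (AU m) h - D)\<^sup>2) \<le>
      300000 * (D * sqrt u.b / s + u.b / s\<^sup>2)"
    using u.ustat_variance unfolding c s_def D_def by simp
  also have "\<dots> \<le> 300000 * (D * (2 * sqrt D + 2 * sqrt B) / (S / 2) + (2 * D + 3 * B) / (S / 2)\<^sup>2)"
    by (intro mult_left_mono add_mono frac_le mult_left_mono sb b power_mono s)
      (use s D0 B0 in \<open>auto intro!: mult_nonneg_nonneg\<close>)
  also have "\<dots> = 300000 * (4 * (D * sqrt D) / S + 4 * (D * sqrt B) / S + 8 * D / S\<^sup>2 + 12 * B / S\<^sup>2)"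
    using s by (simp add: field_simps power2_eq_square)
  finally have "(S * Ow)\<^sup>2 * E_pmf (Pi_pmf (J - WA) (0, 0) Q) (\<lambda>h. (u_statistic G (W m g) (AU m) h - D)\<^sup>2) \<le>
      (S * Ow)\<^sup>2 * (300000 * (4 * (D * sqrt D) / S + 4 * (D * sqrt B) / S + 8 * D / S\<^sup>2 + 12 * B / S\<^sup>2))"
    by (rule mult_left_mono) simp
  also have "\<dots> = 300000 * (4 * ((S * Ow * D) * (Ow * sqrt D)) + 4 * ((S * Ow * D) * (Ow * sqrt B)) +
      8 * (Ow * Ow * D) + 12 * (Ow\<^sup>2 * B))"
    using s by (simp add: field_simps power2_eq_square)
  \<comment> \<open>The spare factor \<open>Ow\<close> moves under the square roots, and
    \<open>Ow \<le> S\<close> turns \<open>Ow * Ow * D\<close> into the cell mean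
    \<open>S * Ow * D\<close>.\<close>
  also have "\<dots> \<le> 300000 * (4 * ((S * Ow * D) * sqrt (S * Ow * D)) + 4 * ((S * Ow * D) * sqrt (Ow\<^sup>2 * B)) +
      8 * (S * Ow * D) + 12 * (Ow\<^sup>2 * B))"
  proof (intro mult_left_mono add_mono order_refl)
    have "Ow * sqrt D = sqrt (Ow * Ow * D)" using Ow by (simp add: real_sqrt_mult)
    also have "\<dots> \<le> sqrt (S * Ow * D)" using Ow D0 by (intro real_sqrt_le_mono mult_right_mono) auto
    finally show "Ow * sqrt D \<le> sqrt (S * Ow * D)" .
    show "Ow * sqrt B \<le> sqrt (Ow\<^sup>2 * B)" using Ow by (simp add: real_sqrt_mult)
    show "Ow * Ow * D \<le> S * Ow * D" using Ow D0 by (intro mult_right_mono) auto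
  qed (use s Ow D0 in auto)
  \<comment> \<open>The largest coefficient is 12, and \<open>12 * 300000\<close> is
    \<open>variance_const\<close>.\<close>
  also have "\<dots> \<le> variance_const * ((S * Ow * D) * sqrt (S * Ow * D) + (S * Ow * D) * sqrt (Ow\<^sup>2 * B) + (S * Ow * D) + Ow\<^sup>2 * B)"
  proof -
    have "0 \<le> (S * Ow * D) * sqrt (S * Ow * D)" "0 \<le> (S * Ow * D) * sqrt (Ow\<^sup>2 * B)" "0 \<le> S * Ow * D" "0 \<le> Ow\<^sup>2 * B"
      using s Ow D0 B0 by (auto intro!: mult_nonneg_nonneg)
    then show ?thesis unfolding variance_const_def by (simp only: distrib_left)
  qed
  finally show ?thesis unfolding cell_mean_def cell_norm_def cf_def S_def Ow_def D_def B_def .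
qed

abbreviation "mrg g h \<equiv> (\<lambda>x. if x \<in> WA then g x else h x)"

lemma T_mrg: "T (mrg g h) = (\<Sum>m\<in>M. cf m * u_statistic G (W m g) (AU m) h)"
  unfolding T_def
proof (intro sum.cong refl arg_cong2[where f="(*)"])
  fix m assume m: "m \<in> M"
  have "AX m \<subseteq> WA" "AY m \<subseteq> WA" unfolding WA_def using m by auto
  then have W: "W m (mrg g h) = W m g" unfolding flat_weight_def
    by (intro ext arg_cong2[where f="(*)"] arg_cong2[where f="(/)"] arg_cong2[where f="(+)"] arg_cong[of _ _ real]
        arg_cong[of _ _ card] refl) auto
  have "u_statistic G (W m g) (AU m) (mrg g h) = u_statistic G (W m g) (AU m) h"
    by (rule depends_onD[OF depends_on_u_statistic[OF order_refl]]) (use AU_sub[OF m] in auto)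
  then show "u_statistic G (W m (mrg g h)) (AU m) (mrg g h) = u_statistic G (W m g) (AU m) h" unfolding W .
qed

lemma E_pmf_two_stage: "E_pmf PJ F = E_pmf (Pi_pmf WA (0, 0) Q) (\<lambda>g. E_pmf (Pi_pmf (J - WA) (0, 0) Q) (\<lambda>h. F (mrg g h)))"
proof -
  have "WA \<union> (J - WA) = J" using WA_sub by auto
  then show ?thesis using E_pmf_Pi_union[of WA "J - WA" Q "(0, 0)" F] fin_supp_Q WA_sub finite_subset[OF WA_sub] by auto
qed

lemma depends_on_W: assumes m: "m \<in> M" shows "depends_on WA (\<lambda>f. W m f)"
proof (rule depends_onI)
  fix f f' :: "nat \<Rightarrow> nat \<times> nat" assume e: "\<And>i. i \<in> WA \<Longrightarrow> f i = f' i"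
  have "AX m \<subseteq> WA" "AY m \<subseteq> WA" unfolding WA_def using m by auto
  then show "W m f = W m f'" unfolding flat_weight_def
    by (intro ext arg_cong2[where f="(*)"] arg_cong2[where f="(/)"] arg_cong2[where f="(+)"] arg_cong[of _ _ real]
        arg_cong[of _ _ card] refl) (use e in auto)
qed

text \<open>Returns from the outer expectation over the weights to the full sample, where the
  moments of the weights are available.\<close>

lemma E_pmf_weights:
  assumes "\<And>f f'. (\<And>m. m \<in> M \<Longrightarrow> W m f = W m f') \<Longrightarrow> F f = F f'"
  shows "E_pmf (Pi_pmf WA (0, 0) Q) F = E_pmf PJ F"
proof -
  have "depends_on WA F"
    by (rule depends_onI, rule assms, rule depends_onD[OF depends_on_W]) auto
  then show ?thesis using E_pmf_Pi_restrict[OF _ WA_sub, of F] by simp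
qed

lemma T_cond_mean: "E_pmf (Pi_pmf (J - WA) (0, 0) Q) (\<lambda>h. T (mrg g h)) = cond_mean g"
proof -
  have fin_supp: "fin_supp (Pi_pmf (J - WA) (0, 0) Q)" using fin_supp_Q by auto
  have "E_pmf (Pi_pmf (J - WA) (0, 0) Q) (\<lambda>h. T (mrg g h)) =
    (\<Sum>m\<in>M. cf m * E_pmf (Pi_pmf (J - WA) (0, 0) Q) (u_statistic G (W m g) (AU m)))"
    unfolding T_mrg by (simp add: E_pmf_sum[OF fin_supp])
  also have "\<dots> = cond_mean g"
    unfolding cond_mean_def cell_mean_def using ustat.ustat_unbiased[OF ustat_rest] cards(3) by (intro sum.cong refl) simp
  finally show ?thesis .
qed

text \<open>Given the weights, different cells use disjoint sets of observations and their centred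
  terms are independent, so only the diagonal survives.\<close>

lemma T_cond_variance:
  "E_pmf (Pi_pmf (J - WA) (0, 0) Q) (\<lambda>h. (T (mrg g h) - cond_mean g)\<^sup>2) \<le>
    (\<Sum>m\<in>M. variance_const * (cell_mean g m * sqrt (cell_mean g m) + cell_mean g m * sqrt (cell_norm g m) + cell_mean g m + cell_norm g m))"
proof -
  let ?P = "Pi_pmf (J - WA) (0, 0) Q"
  have fin_supp: "fin_supp ?P" using fin_supp_Q by auto
  define R where "R = (\<lambda>m h. cf m * (u_statistic G (W m g) (AU m) h - Dm m g))"
  have "T (mrg g h) - cond_mean g = (\<Sum>m\<in>M. R m h)" for h
    unfolding T_mrg cond_mean_def cell_mean_def R_def by (simp add: sum_subtractf[symmetric] right_diff_distrib)
  then have "E_pmf ?P (\<lambda>h. (T (mrg g h) - cond_mean g)\<^sup>2) = E_pmf ?P (\<lambda>h. (\<Sum>m\<in>M. R m h)\<^sup>2)" by simp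
  also have "\<dots> = (\<Sum>m\<in>M. \<Sum>m'\<in>M. E_pmf ?P (\<lambda>h. R m h * R m' h))"
    by (simp add: power2_eq_square sum_product E_pmf_sum[OF fin_supp])
  also have "\<dots> = (\<Sum>m\<in>M. E_pmf ?P (\<lambda>h. (R m h)\<^sup>2))"
  proof (rule sum.cong[OF refl])
    fix m assume m: "m \<in> M"
    have "E_pmf ?P (\<lambda>h. R m h * R m' h) = 0" if m': "m' \<in> M" "m' \<noteq> m" for m'
    proof -
      have "E_pmf ?P (\<lambda>h. R m h * R m' h) = E_pmf ?P (R m) * E_pmf ?P (R m')"
      proof (rule E_pmf_Pi_indep[OF _ AU_sub[OF m] AU_sub[OF m'(1)]])
        show "AU m \<inter> AU m' = {}" using in_cell(2)[OF m] in_cell(2)[OF m'(1)] m'(2) by fastforce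
        show "depends_on (AU m) (R m)" "depends_on (AU m') (R m')"
          unfolding R_def
          by (intro depends_onI arg_cong2[where f="(*)"] arg_cong2[where f="(-)"] refl depends_onD[OF depends_on_u_statistic[OF order_refl]], simp)+
      qed (use fin_supp_Q in auto)
      moreover have "E_pmf ?P (R m) = 0"
        unfolding R_def using ustat.ustat_unbiased[OF ustat_rest[OF m]] cards(3)[OF m]
        by (simp add: E_pmf_diff[OF fin_supp])
      ultimately show ?thesis by simp
    qed
    then have "(\<Sum>m'\<in>M. E_pmf ?P (\<lambda>h. R m h * R m' h)) = (\<Sum>m'\<in>{m}. E_pmf ?P (\<lambda>h. R m h * R m' h))"
      by (intro sum.mono_neutral_right finM) (use m in auto)
    then show "(\<Sum>m'\<in>M. E_pmf ?P (\<lambda>h. R m h * R m' h)) = E_pmf ?P (\<lambda>h. (R m h)\<^sup>2)"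
      by (simp add: power2_eq_square)
  qed
  also have "\<dots> = (\<Sum>m\<in>M. (cf m)\<^sup>2 * E_pmf ?P (\<lambda>h. (u_statistic G (W m g) (AU m) h - Dm m g)\<^sup>2))"
    unfolding R_def by (simp add: power_mult_distrib)
  also have "\<dots> \<le> (\<Sum>m\<in>M. variance_const * (cell_mean g m * sqrt (cell_mean g m) + cell_mean g m * sqrt (cell_norm g m) + cell_mean g m + cell_norm g m))"
    by (intro sum_mono cell_variance)
  finally show ?thesis .
qed

lemma fin_supp_PJ: "fin_supp PJ" using fin_supp_Q by auto

abbreviation "uX m f x \<equiv> 1 / (1 + real (card {j \<in> AX m. fst (f j) = x}))"
abbreviation "vY m f y \<equiv> 1 / (1 + real (card {j \<in> AY m. snd (f j) = y}))"
abbreviation "qX m x \<equiv> pmf (map_pmf fst (q m)) x"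
abbreviation "qY m y \<equiv> pmf (map_pmf snd (q m)) y"

lemma uX_moment: assumes m: "m \<in> M" shows "E_pmf PJ (\<lambda>f. (uX m f x)\<^sup>2) * (qX m x)\<^sup>2 \<le> 2 / (real (t1 m) + 1)\<^sup>2"
proof -
  have "E_pmf PJ (\<lambda>f. (1 / (1 + real (card {j \<in> AX m. (\<lambda>z. fst z = x) (f j)})))\<^sup>2) *
      (measure_pmf.prob (q m) {z. fst z = x})\<^sup>2 \<le> 2 / (real (card (AX m)) + 1)\<^sup>2"
    by (rule E_pmf_inverse_count_sq) (use in_cell[OF m] in auto)
  then show ?thesis using cards[OF m] by (simp add: pmf_map vimage_def)
qed

lemma vY_moment: assumes m: "m \<in> M" shows "E_pmf PJ (\<lambda>f. (vY m f y)\<^sup>2) * (qY m y)\<^sup>2 \<le> 2 / (real (t2 m) + 1)\<^sup>2"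
proof -
  have "E_pmf PJ (\<lambda>f. (1 / (1 + real (card {j \<in> AY m. (\<lambda>z. snd z = y) (f j)})))\<^sup>2) *
      (measure_pmf.prob (q m) {z. snd z = y})\<^sup>2 \<le> 2 / (real (card (AY m)) + 1)\<^sup>2"
    by (rule E_pmf_inverse_count_sq) (use in_cell[OF m] in auto)
  then show ?thesis using cards[OF m] by (simp add: pmf_map vimage_def)
qed

lemma first_moment_le:
  assumes "E_pmf PJ (\<lambda>f. (u f)\<^sup>2) * p\<^sup>2 \<le> 2 / (k + 1)\<^sup>2" "0 \<le> p" "\<And>f. 0 \<le> u f" "0 \<le> k"
  shows "E_pmf PJ u * p \<le> sqrt 2 / (k + 1)"
proof (rule power2_le_imp_le)
  have "(E_pmf PJ u * p)\<^sup>2 \<le> E_pmf PJ (\<lambda>f. (u f)\<^sup>2) * p\<^sup>2"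
    unfolding power_mult_distrib by (intro mult_right_mono E_pmf_sq_le fin_supp_PJ) auto
  then show "(E_pmf PJ u * p)\<^sup>2 \<le> (sqrt 2 / (k + 1))\<^sup>2" using assms(1) by (simp add: power_divide)
qed (use assms in auto)

text \<open>The X and Y weights are independent. Each first moment absorbs one factor of its
  marginal at the cost of \<open>sqrt 2 / (t + 1)\<close>, with \<open>t1\<close> or
  \<open>t2\<close> for \<open>t\<close>; the remaining marginals sum to 1. With
  \<open>omega_bounds\<close> this gives \<open>98 = 49 * 2\<close>.\<close>

lemma E_pmf_cell_norm: assumes m: "m \<in> M" shows "E_pmf PJ (\<lambda>f. cell_norm f m) \<le> 98"
proof -
  have dX: "depends_on (AX m) (\<lambda>f :: nat \<Rightarrow> nat \<times> nat. uX m f x)" for x :: nat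
  proof (rule depends_onI)
    fix f f' :: "nat \<Rightarrow> nat \<times> nat" assume "\<And>i. i \<in> AX m \<Longrightarrow> f i = f' i"
    then have "{j \<in> AX m. fst (f j) = x} = {j \<in> AX m. fst (f' j) = x}" by auto
    then show "uX m f x = uX m f' x" by simp
  qed
  have dY: "depends_on (AY m) (\<lambda>f :: nat \<Rightarrow> nat \<times> nat. vY m f y)" for y :: nat
  proof (rule depends_onI)
    fix f f' :: "nat \<Rightarrow> nat \<times> nat" assume "\<And>i. i \<in> AY m \<Longrightarrow> f i = f' i"
    then have "{j \<in> AY m. snd (f j) = y} = {j \<in> AY m. snd (f' j) = y}" by auto
    then show "vY m f y = vY m f' y" by simp
  qed
  have "E_pmf PJ (Bm m) = (\<Sum>(x, y)\<in>G. E_pmf PJ (\<lambda>f. uX m f x * vY m f y) * (qX m x * qY m y)\<^sup>2)"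
    unfolding wnorm_def flat_weight_def E_pmf_sum[OF fin_supp_PJ] pmf_prod_marg
    by (intro sum.cong refl) (simp only: case_prod_unfold Bochner_Integration.integral_mult_left_zero)
  also have "\<dots> = (\<Sum>(x, y)\<in>G. (E_pmf PJ (\<lambda>f. uX m f x) * qX m x) * (E_pmf PJ (\<lambda>f. vY m f y) * qY m y) * (qX m x * qY m y))"
  proof (rule sum.cong[OF refl], safe)
    fix x y
    have "E_pmf PJ (\<lambda>f. uX m f x * vY m f y) = E_pmf PJ (\<lambda>f. uX m f x) * E_pmf PJ (\<lambda>f. vY m f y)"
      by (rule E_pmf_Pi_indep[OF _ _ _ disj(1)[OF m] dX dY]) (use in_cell[OF m] fin_supp_Q in auto)
    then show "E_pmf PJ (\<lambda>f. uX m f x * vY m f y) * (qX m x * qY m y)\<^sup>2 =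
      (E_pmf PJ (\<lambda>f. uX m f x) * qX m x) * (E_pmf PJ (\<lambda>f. vY m f y) * qY m y) * (qX m x * qY m y)"
      by (simp add: power2_eq_square mult_ac)
  qed
  also have "\<dots> \<le> (\<Sum>(x, y)\<in>G. (sqrt 2 / (real (t1 m) + 1)) * (sqrt 2 / (real (t2 m) + 1)) * (qX m x * qY m y))"
    unfolding case_prod_unfold
    by (intro sum_mono mult_right_mono mult_mono first_moment_le uX_moment[OF m] vY_moment[OF m] mult_nonneg_nonneg E_pmf_nonneg) auto
  also have "\<dots> = 2 / ((real (t1 m) + 1) * (real (t2 m) + 1)) * (\<Sum>(x, y)\<in>G. qX m x * qY m y)"
    by (simp add: sum_distrib_left case_prod_unfold)
  also have "(\<Sum>(x, y)\<in>G. qX m x * qY m y) = (\<Sum>x\<in>{1..l1}. qX m x) * (\<Sum>y\<in>{1..l2}. qY m y)"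
    by (simp add: sum.cartesian_product[symmetric] sum_product)
  also have "\<dots> = 1"
  proof -
    have "(\<Sum>x\<in>{1..l1}. qX m x) = 1" "(\<Sum>y\<in>{1..l2}. qY m y) = 1"
      by (rule sum_pmf_eq_1; use qG[OF Md[OF m]] in fastforce)+
    then show ?thesis by simp
  qed
  finally have B: "E_pmf PJ (Bm m) \<le> 2 / ((real (t1 m) + 1) * (real (t2 m) + 1))" by simp
  have "E_pmf PJ (\<lambda>f. cell_norm f m) = (\<omega> m)\<^sup>2 * E_pmf PJ (Bm m)" unfolding cell_norm_def by simp
  also have "\<dots> \<le> (49 * ((real (t1 m) + 1) * (real (t2 m) + 1))) * (2 / ((real (t1 m) + 1) * (real (t2 m) + 1)))"
    by (intro mult_mono omega_bounds(3)[OF m] B E_pmf_nonneg) (auto simp: wnorm_def intro!: sum_nonneg mult_nonneg_nonneg flat_weight_bounds)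
  also have "\<dots> = 98"
  proof -
    have "(49 * k) * (2 / k) = 98" if "k \<noteq> 0" for k :: real using that by simp
    moreover have "(real (t1 m) + 1) * (real (t2 m) + 1) > 0" by (intro mult_pos_pos) auto
    ultimately show ?thesis by fastforce
  qed
  finally show ?thesis .
qed

lemma sum_\<sigma>: "(\<Sum>m\<in>M. \<sigma> m) \<le> N"
proof -
  have "(\<Sum>m\<in>M. \<sigma> m) = (\<Sum>m\<in>M. card {i \<in> J. \<mu> i = m})"
    unfolding \<sigma>_def using distinct_card[OF js_props(1)] js_props(2) by simp
  also have "\<dots> = card (\<Union>m\<in>M. {i \<in> J. \<mu> i = m})"
    by (rule card_UN_disjoint[symmetric]) (use finM in auto)
  also have "\<dots> \<le> card J" by (rule card_mono) auto
  finally show ?thesis by simp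
qed

lemma card_M: "card M \<le> d"
proof -
  have "card M \<le> card {1..d}" unfolding M_def by (rule card_mono) auto
  then show ?thesis by simp
qed

lemma sum_ratio: "(\<Sum>m\<in>M. real (\<sigma> m) / \<omega> m) \<le> sqrt ((real d + real N / real l1) * (real d + real N / real l2))"
  unfolding \<omega>_def
proof (rule sum_ratio_omega_le[OF l1 l2])
  show "(\<Sum>m\<in>M. real (\<sigma> m)) \<le> real N" using sum_\<sigma> by (metis of_nat_le_iff of_nat_sum)
  show "0 < real (\<sigma> m)" if "m \<in> M" for m using s_bounds(2)[OF that] by linarith
qed (use finM card_M in auto)

end

text \<open>The Cauchy-Schwarz inequality with weights \<open>V / p\<close>. Where \<open>p\<close>
  vanishes the quotient is 0 by convention, and \<open>V\<close> must vanish there for the left-hand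
  side to lose nothing.\<close>

lemma sum_sq_weighted_le:
  fixes V p u :: "'x \<Rightarrow> real"
  assumes "\<And>x. x \<in> S \<Longrightarrow> 0 \<le> V x" "\<And>x. x \<in> S \<Longrightarrow> 0 \<le> p x" "\<And>x. x \<in> S \<Longrightarrow> p x = 0 \<Longrightarrow> V x = 0"
  shows "(\<Sum>x\<in>S. V x * u x)\<^sup>2 \<le> (\<Sum>x\<in>S. V x / p x) * (\<Sum>x\<in>S. V x / p x * ((u x)\<^sup>2 * (p x)\<^sup>2))"
proof -
  have "(\<Sum>x\<in>S. V x * u x) = (\<Sum>x\<in>S. sqrt (V x / p x) * (sqrt (V x / p x) * (u x * p x)))"
  proof (rule sum.cong[OF refl])
    fix x assume x: "x \<in> S"
    have "sqrt (V x / p x) * (sqrt (V x / p x) * (u x * p x)) = (V x / p x) * (u x * p x)"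
      using assms(1,2)[OF x] by (simp add: mult.assoc[symmetric])
    also have "\<dots> = V x * u x" using assms(3)[OF x] by (cases "p x = 0") auto
    finally show "V x * u x = sqrt (V x / p x) * (sqrt (V x / p x) * (u x * p x))" by (rule sym)
  qed
  also have "\<dots>\<^sup>2 \<le> (\<Sum>x\<in>S. (sqrt (V x / p x))\<^sup>2) * (\<Sum>x\<in>S. (sqrt (V x / p x) * (u x * p x))\<^sup>2)"
    by (rule Cauchy_Schwarz_ineq_sum)
  also have "\<dots> = (\<Sum>x\<in>S. V x / p x) * (\<Sum>x\<in>S. V x / p x * ((u x)\<^sup>2 * (p x)\<^sup>2))"
    by (intro arg_cong2[where f="(*)"] sum.cong refl) (use assms(1,2) in \<open>simp_all add: power_mult_distrib\<close>)
  finally show ?thesis .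
qed

text \<open>The chi-squared sum enters twice: once as a factor of the Cauchy-Schwarz inequality and
  once as the total mass that averages the second moments of \<open>u\<close>.\<close>

lemma expectation_sum_sq_le:
  fixes V p :: "'x \<Rightarrow> real" and u :: "'f \<Rightarrow> 'x \<Rightarrow> real"
  assumes fin_supp: "finite (set_pmf P)" and V: "\<And>x. x \<in> S \<Longrightarrow> 0 \<le> V x" "\<And>x. x \<in> S \<Longrightarrow> 0 \<le> p x"
    "\<And>x. x \<in> S \<Longrightarrow> p x = 0 \<Longrightarrow> V x = 0" and \<kappa>: "(\<Sum>x\<in>S. V x / p x) \<le> \<kappa>"
    and u: "\<And>x. x \<in> S \<Longrightarrow> E_pmf P (\<lambda>f. (u f x)\<^sup>2) * (p x)\<^sup>2 \<le> c" and c: "0 \<le> c"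
  shows "E_pmf P (\<lambda>f. (\<Sum>x\<in>S. V x * u f x)\<^sup>2) \<le> c * \<kappa>\<^sup>2"
proof -
  let ?s = "\<Sum>x\<in>S. V x / p x"
  have s0: "0 \<le> ?s" using V by (intro sum_nonneg divide_nonneg_nonneg) auto
  have "E_pmf P (\<lambda>f. (\<Sum>x\<in>S. V x * u f x)\<^sup>2) \<le> E_pmf P (\<lambda>f. ?s * (\<Sum>x\<in>S. V x / p x * ((u f x)\<^sup>2 * (p x)\<^sup>2)))"
    by (intro E_pmf_mono fin_supp sum_sq_weighted_le V)
  also have "\<dots> = ?s * (\<Sum>x\<in>S. V x / p x * (E_pmf P (\<lambda>f. (u f x)\<^sup>2) * (p x)\<^sup>2))"
    by (simp add: E_pmf_sum[OF fin_supp])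
  also have "\<dots> \<le> ?s * (\<Sum>x\<in>S. V x / p x * c)"
    using V by (intro mult_left_mono s0 sum_mono u divide_nonneg_nonneg) auto
  also have "\<dots> = c * ?s\<^sup>2" unfolding sum_distrib_right[symmetric] by (simp add: power2_eq_square)
  also have "\<dots> \<le> c * \<kappa>\<^sup>2" using s0 \<kappa> c by (intro mult_left_mono power_mono)
  finally show ?thesis .
qed

context cells
begin

lemma fin_supp_rest: "fin_supp (Pi_pmf (J - WA) (0, 0) Q)"
  using fin_supp_Q by (intro fin_supp_Pi) auto

lemma fin_supp_WA: "fin_supp (Pi_pmf WA (0, 0) Q)"
  using WA_sub finite_subset[OF WA_sub] by (intro fin_supp_Pi fin_supp_Q) auto

text \<open>The product bound on the squared deviation makes the mean at most \<open>cf m\<close>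
  times a function of the X weights times a function of the Y weights. These are independent, and
  each second moment is at most \<open>2 * \<kappa>^2 / (t + 1)^2\<close>, with \<open>t1\<close> or
  \<open>t2\<close> for \<open>t\<close>. Hence the constant \<open>98 = 2 * 49\<close>.\<close>

lemma cell_mean_moment:
  assumes m: "m \<in> M" and V: "\<And>x y. (x, y) \<in> G \<Longrightarrow> (dev (q m) (x, y))\<^sup>2 \<le> V x * V' y"
    and V0: "\<And>x. 0 \<le> V x" "\<And>y. 0 \<le> V' y" and Vz: "\<And>x. qX m x = 0 \<Longrightarrow> V x = 0" "\<And>y. qY m y = 0 \<Longrightarrow> V' y = 0"
    and \<kappa>: "(\<Sum>x\<in>{1..l1}. V x / qX m x) \<le> \<kappa>" "(\<Sum>y\<in>{1..l2}. V' y / qY m y) \<le> \<kappa>"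
  shows "E_pmf PJ (\<lambda>f. (cell_mean f m)\<^sup>2) \<le> (98 * \<kappa>\<^sup>2 * (real (\<sigma> m) / \<omega> m))\<^sup>2"
proof -
  define P where "P = (\<lambda>f :: nat \<Rightarrow> nat \<times> nat. \<Sum>x\<in>{1..l1}. V x * uX m f x)"
  define R where "R = (\<lambda>f :: nat \<Rightarrow> nat \<times> nat. \<Sum>y\<in>{1..l2}. V' y * vY m f y)"
  have P0: "0 \<le> P f" and R0: "0 \<le> R f" for f unfolding P_def R_def using V0 by (auto intro!: sum_nonneg)
  have amle: "cell_mean f m \<le> cf m * (P f * R f)" for f
  proof -
    have "Dm m f \<le> (\<Sum>(x, y)\<in>G. (V x * uX m f x) * (V' y * vY m f y))"
      unfolding wdist_def case_prod_unfold
    proof (rule sum_mono)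
      fix g assume "g \<in> G"
      then have "(dev (q m) g)\<^sup>2 \<le> V (fst g) * V' (snd g)" using V by (cases g) auto
      then have "W m f g * (dev (q m) g)\<^sup>2 \<le> W m f g * (V (fst g) * V' (snd g))"
        by (rule mult_left_mono) (rule flat_weight_bounds)
      then show "W m f g * (dev (q m) g)\<^sup>2 \<le> (V (fst g) * uX m f (fst g)) * (V' (snd g) * vY m f (snd g))"
        unfolding flat_weight_def by (simp add: mult_ac)
    qed
    also have "\<dots> = P f * R f"
      unfolding P_def R_def sum_product sum.cartesian_product ..
    finally show ?thesis unfolding cell_mean_def using cf_pos[OF m] by (intro mult_left_mono) auto
  qed
  have "E_pmf PJ (\<lambda>f. (cell_mean f m)\<^sup>2) \<le> E_pmf PJ (\<lambda>f. (cf m)\<^sup>2 * ((P f)\<^sup>2 * (R f)\<^sup>2))"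
  proof (rule E_pmf_mono[OF fin_supp_PJ])
    fix f
    show "(cell_mean f m)\<^sup>2 \<le> (cf m)\<^sup>2 * ((P f)\<^sup>2 * (R f)\<^sup>2)"
      using power_mono[OF amle[of f] cell_mean_nonneg[OF m], of 2] by (simp add: power_mult_distrib)
  qed
  also have "\<dots> = (cf m)\<^sup>2 * (E_pmf PJ (\<lambda>f. (P f)\<^sup>2) * E_pmf PJ (\<lambda>f. (R f)\<^sup>2))"
  proof -
    have "E_pmf PJ (\<lambda>f. (P f)\<^sup>2 * (R f)\<^sup>2) = E_pmf PJ (\<lambda>f. (P f)\<^sup>2) * E_pmf PJ (\<lambda>f. (R f)\<^sup>2)"
    proof (rule E_pmf_Pi_indep[OF _ _ _ disj(1)[OF m]])
      show "depends_on (AX m) (\<lambda>f. (P f)\<^sup>2)"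
      proof (rule depends_onI)
        fix f f' :: "nat \<Rightarrow> nat \<times> nat" assume "\<And>i. i \<in> AX m \<Longrightarrow> f i = f' i"
        then have "{j \<in> AX m. fst (f j) = x} = {j \<in> AX m. fst (f' j) = x}" for x by auto
        then show "(P f)\<^sup>2 = (P f')\<^sup>2" unfolding P_def by simp
      qed
      show "depends_on (AY m) (\<lambda>f. (R f)\<^sup>2)"
      proof (rule depends_onI)
        fix f f' :: "nat \<Rightarrow> nat \<times> nat" assume "\<And>i. i \<in> AY m \<Longrightarrow> f i = f' i"
        then have "{j \<in> AY m. snd (f j) = x} = {j \<in> AY m. snd (f' j) = x}" for x by auto
        then show "(R f)\<^sup>2 = (R f')\<^sup>2" unfolding R_def by simp
      qed
    qed (use in_cell[OF m] fin_supp_Q in auto)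
    then show ?thesis by simp
  qed
  also have "\<dots> \<le> (cf m)\<^sup>2 * ((2 / (real (t1 m) + 1)\<^sup>2 * \<kappa>\<^sup>2) * (2 / (real (t2 m) + 1)\<^sup>2 * \<kappa>\<^sup>2))"
    unfolding P_def R_def
    by (intro mult_left_mono mult_mono expectation_sum_sq_le[OF fin_supp_PJ _ _ _ \<kappa>(1)] expectation_sum_sq_le[OF fin_supp_PJ _ _ _ \<kappa>(2)]
        uX_moment[OF m] vY_moment[OF m] E_pmf_nonneg V0 Vz pmf_nonneg) auto
  also have "\<dots> = (2 * \<kappa>\<^sup>2 * (real (\<sigma> m) / \<omega> m) * ((\<omega> m)\<^sup>2 / ((real (t1 m) + 1) * (real (t2 m) + 1))))\<^sup>2"
    unfolding cf_def using omega_bounds(1)[OF m] by (simp add: field_simps power2_eq_square)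
  also have "\<dots> \<le> (2 * \<kappa>\<^sup>2 * (real (\<sigma> m) / \<omega> m) * 49)\<^sup>2"
  proof (intro power_mono mult_left_mono)
    have "(real (t1 m) + 1) * (real (t2 m) + 1) > 0" by (intro mult_pos_pos) auto
    then show "(\<omega> m)\<^sup>2 / ((real (t1 m) + 1) * (real (t2 m) + 1)) \<le> 49"
      using omega_bounds(3)[OF m] by (simp add: pos_divide_le_eq)
  qed (use omega_bounds(1)[OF m] in auto)
  finally show ?thesis by (simp add: mult_ac)
qed

lemma sqrt_le_one_plus: "0 \<le> a \<Longrightarrow> sqrt a \<le> 1 + a" for a :: real
  by (rule real_le_lsqrt) (auto simp: power2_eq_square algebra_simps)

lemma var_term_le:
  fixes a b :: real assumes "0 \<le> a" "0 \<le> b"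
  shows "a * sqrt a + a * sqrt b + a + b \<le> 4 * (a\<^sup>2 + b + 1)"
proof -
  have "a * sqrt a \<le> a * (1 + a)" by (intro mult_left_mono sqrt_le_one_plus assms)
  moreover have "2 * (a * sqrt b) \<le> a\<^sup>2 + b" using sum_squares_bound[of a "sqrt b"] assms by simp
  moreover have "2 * a \<le> 1 + a\<^sup>2" using sum_squares_bound[of a 1] by simp
  moreover have "0 \<le> a\<^sup>2" by simp
  ultimately show ?thesis using assms by (simp add: power2_eq_square algebra_simps)
qed

lemma cond_mean_cong: "(\<And>m. m \<in> M \<Longrightarrow> W m f = W m f') \<Longrightarrow> cond_mean f = cond_mean f'"
  unfolding cond_mean_def cell_mean_def by (intro sum.cong refl) simp

text \<open>Given the weights, the second moment is the squared mean plus the variance.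
  \<open>var_term_le\<close> removes the square roots from the latter, so that only moments
  computable over the weights remain.\<close>

lemma second_moment_T:
  "E_pmf PJ (\<lambda>f. (T f)\<^sup>2) \<le> E_pmf PJ (\<lambda>f. (cond_mean f)\<^sup>2 + 4 * variance_const * (\<Sum>m\<in>M. (cell_mean f m)\<^sup>2 + cell_norm f m + 1))"
proof -
  let ?P = "Pi_pmf (J - WA) (0, 0) Q"
  have fin_supp: "fin_supp ?P" "fin_supp (Pi_pmf WA (0, 0) Q)" by (rule fin_supp_rest fin_supp_WA)+
  have "E_pmf PJ (\<lambda>f. (T f)\<^sup>2) = E_pmf (Pi_pmf WA (0, 0) Q) (\<lambda>g. E_pmf ?P (\<lambda>h. (T (mrg g h))\<^sup>2))"
    by (rule E_pmf_two_stage)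
  also have "\<dots> \<le> E_pmf (Pi_pmf WA (0, 0) Q) (\<lambda>f. (cond_mean f)\<^sup>2 + 4 * variance_const * (\<Sum>m\<in>M. (cell_mean f m)\<^sup>2 + cell_norm f m + 1))"
  proof (rule E_pmf_mono[OF fin_supp(2)])
    fix g
    have "E_pmf ?P (\<lambda>h. (T (mrg g h) - cond_mean g)\<^sup>2) \<le>
        (\<Sum>m\<in>M. variance_const * (cell_mean g m * sqrt (cell_mean g m) + cell_mean g m * sqrt (cell_norm g m) + cell_mean g m + cell_norm g m))"
      by (rule T_cond_variance)
    also have "\<dots> \<le> (\<Sum>m\<in>M. variance_const * (4 * ((cell_mean g m)\<^sup>2 + cell_norm g m + 1)))"
      by (intro sum_mono mult_left_mono var_term_le cell_mean_nonneg cell_norm_nonneg) (auto simp: variance_const_def)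
    also have "\<dots> = 4 * variance_const * (\<Sum>m\<in>M. (cell_mean g m)\<^sup>2 + cell_norm g m + 1)" by (simp add: sum_distrib_left mult_ac)
    finally have V: "E_pmf ?P (\<lambda>h. (T (mrg g h) - cond_mean g)\<^sup>2) \<le> 4 * variance_const * (\<Sum>m\<in>M. (cell_mean g m)\<^sup>2 + cell_norm g m + 1)" .
    have "E_pmf ?P (\<lambda>h. (T (mrg g h))\<^sup>2) = E_pmf ?P (\<lambda>h. (T (mrg g h) - cond_mean g)\<^sup>2 + 2 * cond_mean g * T (mrg g h) - (cond_mean g)\<^sup>2)"
      by (simp add: power2_eq_square algebra_simps)
    also have "\<dots> = E_pmf ?P (\<lambda>h. (T (mrg g h) - cond_mean g)\<^sup>2) + (cond_mean g)\<^sup>2"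
      using T_cond_mean[of g] by (simp add: E_pmf_add[OF fin_supp(1)] E_pmf_diff[OF fin_supp(1)] power2_eq_square)
    finally show "E_pmf ?P (\<lambda>h. (T (mrg g h))\<^sup>2) \<le> (cond_mean g)\<^sup>2 + 4 * variance_const * (\<Sum>m\<in>M. (cell_mean g m)\<^sup>2 + cell_norm g m + 1)"
      using V by simp
  qed
  also have "\<dots> = E_pmf PJ (\<lambda>f. (cond_mean f)\<^sup>2 + 4 * variance_const * (\<Sum>m\<in>M. (cell_mean f m)\<^sup>2 + cell_norm f m + 1))"
  proof (rule E_pmf_weights)
    fix f f' assume e: "\<And>m. m \<in> M \<Longrightarrow> W m f = W m f'"
    have "cond_mean f = cond_mean f'" by (rule cond_mean_cong) (rule e)
    moreover have "(\<Sum>m\<in>M. (cell_mean f m)\<^sup>2 + cell_norm f m + 1) = (\<Sum>m\<in>M. (cell_mean f' m)\<^sup>2 + cell_norm f' m + 1)"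
      by (rule sum.cong) (simp_all only: cell_mean_def cell_norm_def e)
    ultimately show "(cond_mean f)\<^sup>2 + 4 * variance_const * (\<Sum>m\<in>M. (cell_mean f m)\<^sup>2 + cell_norm f m + 1) =
      (cond_mean f')\<^sup>2 + 4 * variance_const * (\<Sum>m\<in>M. (cell_mean f' m)\<^sup>2 + cell_norm f' m + 1)" by simp
  qed
  finally show ?thesis .
qed

text \<open>The first term comes from the cell means, whose root mean squares are at most
  \<open>\<beta> m\<close>; the second is the noise of at most \<open>d\<close> cells. For
  \<open>\<kappa>\<close> of order \<open>1 / d\<close> both are of order \<open>d\<close>, see
  \<open>type_I_bound\<close>.\<close>

lemma null_second_moment:
  assumes V: "\<And>m x y. m \<in> M \<Longrightarrow> (x, y) \<in> G \<Longrightarrow> (dev (q m) (x, y))\<^sup>2 \<le> V m x * V' m y"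
    and V0: "\<And>m x. 0 \<le> V m x" "\<And>m y. 0 \<le> V' m y"
    and Vz: "\<And>m x. m \<in> M \<Longrightarrow> qX m x = 0 \<Longrightarrow> V m x = 0" "\<And>m y. m \<in> M \<Longrightarrow> qY m y = 0 \<Longrightarrow> V' m y = 0"
    and \<kappa>: "\<And>m. m \<in> M \<Longrightarrow> (\<Sum>x\<in>{1..l1}. V m x / qX m x) \<le> \<kappa>"
      "\<And>m. m \<in> M \<Longrightarrow> (\<Sum>y\<in>{1..l2}. V' m y / qY m y) \<le> \<kappa>" "0 < \<kappa>"
  shows "E_pmf PJ (\<lambda>f. (T f)\<^sup>2) \<le>
    null_const * (\<kappa> ^ 4 * ((real d + real N / real l1) * (real d + real N / real l2)) + real d)"
proof -
  define \<beta> where "\<beta> = (\<lambda>m. 98 * \<kappa>\<^sup>2 * (real (\<sigma> m) / \<omega> m))"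
  define X where "X = (real d + real N / real l1) * (real d + real N / real l2)"
  have X0: "0 \<le> X" unfolding X_def by simp
  have \<beta>0: "0 < \<beta> m" if "m \<in> M" for m
    unfolding \<beta>_def using omega_bounds(1)[OF that] s_bounds(2)[OF that] \<kappa>(3) by (auto intro!: mult_pos_pos divide_pos_pos)
  have s\<beta>0: "0 \<le> (\<Sum>m\<in>M. \<beta> m)" by (rule sum_nonneg) (rule less_imp_le[OF \<beta>0])
  have a: "E_pmf PJ (\<lambda>f. (cell_mean f m)\<^sup>2) \<le> (\<beta> m)\<^sup>2" if "m \<in> M" for m
    unfolding \<beta>_def by (rule cell_mean_moment[OF that V[OF that] V0 Vz[OF that] \<kappa>(1,2)[OF that]])
  have S: "(\<Sum>m\<in>M. \<beta> m)\<^sup>2 \<le> 9604 * \<kappa> ^ 4 * X"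
  proof -
    have "(\<Sum>m\<in>M. \<beta> m) = 98 * \<kappa>\<^sup>2 * (\<Sum>m\<in>M. real (\<sigma> m) / \<omega> m)" unfolding \<beta>_def by (simp add: sum_distrib_left)
    also have "\<dots> \<le> 98 * \<kappa>\<^sup>2 * sqrt X" unfolding X_def by (intro mult_left_mono sum_ratio) auto
    finally have "(\<Sum>m\<in>M. \<beta> m)\<^sup>2 \<le> (98 * \<kappa>\<^sup>2 * sqrt X)\<^sup>2"
      by (rule power_mono) (rule s\<beta>0)
    also have "\<dots> = 9604 * \<kappa> ^ 4 * X" using X0 by (simp add: power_mult_distrib power2_eq_square power4_eq_xxxx)
    finally show ?thesis .
  qed
  have sq: "(\<Sum>m\<in>M. (\<beta> m)\<^sup>2) \<le> (\<Sum>m\<in>M. \<beta> m)\<^sup>2"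
  proof -
    have "(\<Sum>m\<in>M. (\<beta> m)\<^sup>2) \<le> (\<Sum>m\<in>M. \<beta> m * (\<Sum>m\<in>M. \<beta> m))"
      unfolding power2_eq_square using \<beta>0 finM
      by (intro sum_mono mult_left_mono member_le_sum) (auto intro: less_imp_le)
    then show ?thesis by (simp add: sum_distrib_right[symmetric] power2_eq_square)
  qed
  have cond_mean: "E_pmf PJ (\<lambda>f. (cond_mean f)\<^sup>2) \<le> (\<Sum>m\<in>M. \<beta> m)\<^sup>2"
  proof -
    \<comment> \<open>Minkowski's inequality for the cell means, through the Cauchy-Schwarz
      inequality with weights \<open>\<beta> m\<close>.\<close>
    have "E_pmf PJ (\<lambda>f. (cond_mean f)\<^sup>2) \<le> E_pmf PJ (\<lambda>f. (\<Sum>m\<in>M. \<beta> m) * (\<Sum>m\<in>M. (cell_mean f m)\<^sup>2 / \<beta> m))"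
    proof (rule E_pmf_mono[OF fin_supp_PJ])
      fix f
      have e0: "cond_mean f = (\<Sum>m\<in>M. sqrt (\<beta> m) * (cell_mean f m / sqrt (\<beta> m)))"
        unfolding cond_mean_def using \<beta>0 by (intro sum.cong refl) force
      have "(cond_mean f)\<^sup>2 \<le> (\<Sum>m\<in>M. (sqrt (\<beta> m))\<^sup>2) * (\<Sum>m\<in>M. (cell_mean f m / sqrt (\<beta> m))\<^sup>2)"
        unfolding e0 by (rule Cauchy_Schwarz_ineq_sum)
      also have "\<dots> = (\<Sum>m\<in>M. \<beta> m) * (\<Sum>m\<in>M. (cell_mean f m)\<^sup>2 / \<beta> m)"
        by (intro arg_cong2[where f="(*)"] sum.cong refl) (use \<beta>0 in \<open>auto simp: power_divide less_imp_le\<close>)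
      finally show "(cond_mean f)\<^sup>2 \<le> (\<Sum>m\<in>M. \<beta> m) * (\<Sum>m\<in>M. (cell_mean f m)\<^sup>2 / \<beta> m)" .
    qed
    also have "\<dots> = (\<Sum>m\<in>M. \<beta> m) * (\<Sum>m\<in>M. E_pmf PJ (\<lambda>f. (cell_mean f m)\<^sup>2) / \<beta> m)"
      by (simp add: E_pmf_sum[OF fin_supp_PJ])
    also have "\<dots> \<le> (\<Sum>m\<in>M. \<beta> m) * (\<Sum>m\<in>M. (\<beta> m)\<^sup>2 / \<beta> m)"
      by (intro mult_left_mono sum_mono divide_right_mono a s\<beta>0 less_imp_le[OF \<beta>0])
    also have "(\<Sum>m\<in>M. (\<beta> m)\<^sup>2 / \<beta> m) = (\<Sum>m\<in>M. \<beta> m)"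
      by (rule sum.cong) (use \<beta>0 in \<open>auto simp: power2_eq_square\<close>)
    finally show ?thesis by (simp add: power2_eq_square)
  qed
  have "E_pmf PJ (\<lambda>f. (T f)\<^sup>2) \<le> E_pmf PJ (\<lambda>f. (cond_mean f)\<^sup>2 + 4 * variance_const * (\<Sum>m\<in>M. (cell_mean f m)\<^sup>2 + cell_norm f m + 1))"
    by (rule second_moment_T)
  also have "\<dots> = E_pmf PJ (\<lambda>f. (cond_mean f)\<^sup>2) + 4 * variance_const * (\<Sum>m\<in>M. E_pmf PJ (\<lambda>f. (cell_mean f m)\<^sup>2) + E_pmf PJ (\<lambda>f. cell_norm f m) + 1)"
    by (simp add: E_pmf_add[OF fin_supp_PJ] E_pmf_sum[OF fin_supp_PJ])
  also have "\<dots> \<le> (\<Sum>m\<in>M. \<beta> m)\<^sup>2 + 4 * variance_const * (\<Sum>m\<in>M. (\<beta> m)\<^sup>2 + 98 + 1)"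
    by (intro add_mono cond_mean mult_left_mono sum_mono a E_pmf_cell_norm order_refl) (auto simp: variance_const_def)
  also have "\<dots> = (\<Sum>m\<in>M. \<beta> m)\<^sup>2 + 4 * variance_const * ((\<Sum>m\<in>M. (\<beta> m)\<^sup>2) + 99 * real (card M))"
    by (simp add: sum.distrib)
  also have "\<dots> \<le> 9604 * \<kappa> ^ 4 * X + 4 * variance_const * (9604 * \<kappa> ^ 4 * X + 99 * real d)"
    by (intro add_mono mult_left_mono order_trans[OF sq] S) (use card_M in \<open>auto simp: variance_const_def\<close>)
  \<comment> \<open>The larger coefficient is \<open>9604 * (1 + 4 * variance_const)\<close>, which
    is below \<open>1.4 * 10^11\<close>.\<close>
  also have "\<dots> \<le> null_const * (\<kappa> ^ 4 * X + real d)"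
  proof -
    have "0 \<le> \<kappa> ^ 4 * X" using X0 by simp
    then show ?thesis unfolding variance_const_def null_const_def by (simp add: algebra_simps)
  qed
  finally show ?thesis unfolding X_def .
qed

text \<open>The Cauchy-Schwarz inequality is used against the reciprocal weights, whose total over
  the grid is bounded surely: the X counts sum to at most \<open>t1 \<le> l1\<close>, so
  \<open>\<Sum> (1 + a x) \<le> 2 * l1\<close>, and likewise for Y. Truncating the weight samples at
  \<open>l1\<close> and \<open>l2\<close> pays off here.\<close>

lemma cell_mean_lower:
  assumes m: "m \<in> M"
  shows "cf m * (\<Sum>g\<in>G. \<bar>dev (q m) g\<bar>)\<^sup>2 / (4 * real l1 * real l2) \<le> cell_mean f m"
proof -
  define a where "a = (\<lambda>x. 1 + real (card {j \<in> AX m. fst (f j) = x}))"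
  define a' where "a' = (\<lambda>y. 1 + real (card {j \<in> AY m. snd (f j) = y}))"
  have apos: "0 < a x" "0 < a' x" for x unfolding a_def a'_def by auto
  have W: "W m f g = 1 / (a (fst g) * a' (snd g))" for g unfolding flat_weight_def a_def a'_def by simp
  have label_count: "(\<Sum>x\<in>{1..l}. real (card {j \<in> A. p j = x})) \<le> real (card A)" if "finite A"
    for l and A :: "nat set" and p :: "nat \<Rightarrow> nat"
  proof -
    have "(\<Sum>x\<in>{1..l}. card {j \<in> A. p j = x}) = card (\<Union>x\<in>{1..l}. {j \<in> A. p j = x})"
      by (rule card_UN_disjoint[symmetric]) (use that in auto)
    also have "\<dots> \<le> card A" by (rule card_mono) (use that in auto)
    finally show ?thesis unfolding of_nat_sum[symmetric] of_nat_le_iff .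
  qed
  have fA: "finite (AX m)" "finite (AY m)"
    using finite_subset[OF subs(1)[OF m]] finite_subset[OF subs(2)[OF m]] by auto
  have s1: "(\<Sum>x\<in>{1..l1}. a x) \<le> 2 * real l1"
    using label_count[OF fA(1), of "\<lambda>j. fst (f j)" l1] cards(1)[OF m] unfolding a_def t1_def by (simp add: sum.distrib)
  have s2: "(\<Sum>y\<in>{1..l2}. a' y) \<le> 2 * real l2"
    using label_count[OF fA(2), of "\<lambda>j. snd (f j)" l2] cards(2)[OF m] unfolding a'_def t2_def by (simp add: sum.distrib)
  have e0: "(\<Sum>g\<in>G. \<bar>dev (q m) g\<bar>) = (\<Sum>g\<in>G. sqrt (W m f g) * \<bar>dev (q m) g\<bar> * sqrt (a (fst g) * a' (snd g)))"
  proof (rule sum.cong[OF refl])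
    fix g
    have "sqrt (W m f g) * sqrt (a (fst g) * a' (snd g)) = 1"
      unfolding W using apos[of "fst g"] apos[of "snd g"] by (simp add: real_sqrt_divide real_sqrt_mult)
    then have "\<bar>dev (q m) g\<bar> * (sqrt (W m f g) * sqrt (a (fst g) * a' (snd g))) = \<bar>dev (q m) g\<bar>" by simp
    then show "\<bar>dev (q m) g\<bar> = sqrt (W m f g) * \<bar>dev (q m) g\<bar> * sqrt (a (fst g) * a' (snd g))"
      by (simp only: mult_ac)
  qed
  have e1: "(\<Sum>g\<in>G. (sqrt (W m f g) * \<bar>dev (q m) g\<bar>)\<^sup>2) = Dm m f"
    unfolding wdist_def by (simp add: power_mult_distrib flat_weight_bounds)
  have "(\<Sum>g\<in>G. (sqrt (a (fst g) * a' (snd g)))\<^sup>2) = (\<Sum>g\<in>G. a (fst g) * a' (snd g))"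
    using apos by (intro sum.cong refl real_sqrt_pow2) (simp add: less_imp_le)
  also have "\<dots> = (\<Sum>x\<in>{1..l1}. a x) * (\<Sum>y\<in>{1..l2}. a' y)"
    unfolding sum_product sum.cartesian_product by (simp add: case_prod_unfold)
  also have "\<dots> \<le> (2 * real l1) * (2 * real l2)"
    by (intro mult_mono s1 s2 sum_nonneg less_imp_le[OF apos(2)]) simp
  finally have e2: "(\<Sum>g\<in>G. (sqrt (a (fst g) * a' (snd g)))\<^sup>2) \<le> (2 * real l1) * (2 * real l2)" .
  have "(\<Sum>g\<in>G. \<bar>dev (q m) g\<bar>)\<^sup>2 \<le>
      (\<Sum>g\<in>G. (sqrt (W m f g) * \<bar>dev (q m) g\<bar>)\<^sup>2) * (\<Sum>g\<in>G. (sqrt (a (fst g) * a' (snd g)))\<^sup>2)"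
    unfolding e0 by (rule Cauchy_Schwarz_ineq_sum)
  also have "\<dots> \<le> Dm m f * ((2 * real l1) * (2 * real l2))"
    unfolding e1 by (intro mult_left_mono e2 wdist_nonneg flat_weight_bounds)
  finally have "(\<Sum>g\<in>G. \<bar>dev (q m) g\<bar>)\<^sup>2 / (4 * real l1 * real l2) \<le> Dm m f"
    using l1 l2 by (subst pos_divide_le_eq) (auto simp: mult_ac)
  from mult_left_mono[OF this, of "cf m"] cf_pos[OF m] show ?thesis unfolding cell_mean_def by simp
qed

text \<open>\<open>D\<close> plays the role of the conditional mean and \<open>dflt\<close> that of
  the number of cells. The assumption gives \<open>sqrt D \<ge> 10^13\<close>, so the bracket is at
  most \<open>2 * D^2 / 10^13\<close>, which outweighs \<open>variance_const\<close>.\<close>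

lemma numeric_power_bound:
  fixes D dflt :: real
  assumes "D \<ge> 10 ^ 26 * sqrt dflt" "1 \<le> dflt"
  shows "4 / D\<^sup>2 * (variance_const * (D * sqrt D + D * sqrt (4900 * dflt) + D + 4900 * dflt)) \<le> 1 / 50"
proof -
  define r where "r = sqrt dflt"
  have r: "1 \<le> r" "dflt = r\<^sup>2" unfolding r_def using assms by auto
  have D: "10 ^ 26 * r \<le> D" using assms r_def by simp
  have D1: "10 ^ 26 \<le> D" using mult_left_mono[OF r(1), of "10 ^ 26"] D by simp
  have D0: "0 < D" using D1 by simp
  have sD: "10 ^ 13 \<le> sqrt D" using D1 by (intro real_le_rsqrt) (simp add: power2_eq_square)
  have "10 ^ 13 * sqrt D \<le> sqrt D * sqrt D" by (rule mult_right_mono[OF sD]) (use D0 in simp)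
  then have t1: "sqrt D \<le> D / 10 ^ 13" using D0 by simp
  have t2: "sqrt (4900 * dflt) \<le> 70 * (D / 10 ^ 26)"
  proof -
    have "sqrt (4900 * dflt) = 70 * r"
      unfolding r(2) using r(1) by (intro real_sqrt_unique) (auto simp: power_mult_distrib)
    then show ?thesis using D by simp
  qed
  have t3: "1 \<le> D / 10 ^ 26" using D1 by simp
  have t4: "4900 * dflt \<le> 4900 * (D * (D / 10 ^ 26))"
  proof -
    have "r \<le> D / 10 ^ 26" using D by simp
    moreover have "r \<le> D" using mult_right_mono[of 1 "10 ^ 26" r] D r(1) by simp
    ultimately have "r * r \<le> D * (D / 10 ^ 26)" using r(1) D0 by (intro mult_mono) auto
    then show ?thesis unfolding r(2) by (simp add: power2_eq_square)
  qed
  have "D * sqrt D + D * sqrt (4900 * dflt) + D + 4900 * dflt \<le>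
    D * (D / 10 ^ 13) + D * (70 * (D / 10 ^ 26)) + D * (D / 10 ^ 26) + 4900 * (D * (D / 10 ^ 26))"
    using mult_left_mono[OF t1, of D] mult_left_mono[OF t2, of D] mult_left_mono[OF t3, of D] t4 D0 by linarith
  also have "\<dots> \<le> D\<^sup>2 * (2 / 10 ^ 13)" by (simp add: power2_eq_square)
  finally have "4 / D\<^sup>2 * (variance_const * (D * sqrt D + D * sqrt (4900 * dflt) + D + 4900 * dflt)) \<le>
    4 / D\<^sup>2 * (variance_const * (D\<^sup>2 * (2 / 10 ^ 13)))"
    by (intro mult_left_mono) (auto simp: variance_const_def)
  also have "\<dots> = 4 * variance_const * (2 / 10 ^ 13)" using D0 by simp
  also have "\<dots> \<le> 1 / 50" by (simp add: variance_const_def)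
  finally show ?thesis .
qed

text \<open>The error is \<open>1/50 + 1/50\<close>. By Markov's inequality the cell norms, of mean
  at most 98 each, sum to more than \<open>4900 * d\<close> with probability at most
  \<open>1/50\<close>. Otherwise Chebyshev's inequality given the weights applies, as
  \<open>\<tau>\<close> is at most half the conditional mean.\<close>

lemma alternative_power:
  assumes d: "1 \<le> d"
    and H: "(\<Sum>m\<in>M. cf m * (\<Sum>g\<in>G. \<bar>dev (q m) g\<bar>)\<^sup>2 / (4 * real l1 * real l2)) \<ge> max (10 ^ 26 * sqrt (real d)) (2 * \<tau>)"
  shows "E_pmf PJ (\<lambda>f. of_bool (T f < \<tau>)) \<le> 1 / 25"
proof -
  let ?P = "Pi_pmf (J - WA) (0, 0) Q"
  have fin_supp: "fin_supp ?P" "fin_supp (Pi_pmf WA (0, 0) Q)" by (rule fin_supp_rest fin_supp_WA)+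
  define Bt where "Bt = (\<lambda>f. \<Sum>m\<in>M. cell_norm f m)"
  define D0 where "D0 = real d * 4900"
  have Bt0: "0 \<le> Bt f" for f unfolding Bt_def by (intro sum_nonneg cell_norm_nonneg)
  have D0: "0 < D0" unfolding D0_def using d by simp
  have "E_pmf PJ (\<lambda>f. of_bool (T f < \<tau>)) = E_pmf (Pi_pmf WA (0, 0) Q) (\<lambda>g. E_pmf ?P (\<lambda>h. of_bool (T (mrg g h) < \<tau>)))"
    by (rule E_pmf_two_stage)
  \<comment> \<open>Markov's inequality is built into the bound: \<open>Bt g / D0\<close> exceeds 1
    as soon as the norms exceed their level \<open>D0\<close>.\<close>
  also have "\<dots> \<le> E_pmf (Pi_pmf WA (0, 0) Q) (\<lambda>g. Bt g / D0 + 1 / 50)"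
  proof (rule E_pmf_mono[OF fin_supp(2)])
    fix g
    show "E_pmf ?P (\<lambda>h. of_bool (T (mrg g h) < \<tau>)) \<le> Bt g / D0 + 1 / 50"
    proof (cases "Bt g \<le> D0")
      case False
      have "E_pmf ?P (\<lambda>h. of_bool (T (mrg g h) < \<tau>)) \<le> 1" by (rule E_pmf_le_const[OF fin_supp(1)]) auto
      also have "1 \<le> Bt g / D0" using False D0 by simp
      finally show ?thesis by simp
    next
      case True
      have cond_mean: "cond_mean g \<ge> max (10 ^ 26 * sqrt (real d)) (2 * \<tau>)"
        unfolding cond_mean_def by (rule order_trans[OF H]) (intro sum_mono cell_mean_lower)
      then have D1: "cond_mean g \<ge> 10 ^ 26 * sqrt (real d)" "cond_mean g \<ge> 2 * \<tau>" by auto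
      have "sqrt (real d) \<ge> 1" using d by simp
      then have Dpos: "cond_mean g > 0" using D1(1) by (smt (verit) mult_pos_pos zero_less_power)
      have ale: "cell_mean g m \<le> cond_mean g" if "m \<in> M" for m
        unfolding cond_mean_def by (rule member_le_sum) (use that finM cell_mean_nonneg in auto)
      have ble: "cell_norm g m \<le> D0" if "m \<in> M" for m
        using True member_le_sum[of m M "cell_norm g"] that finM cell_norm_nonneg unfolding Bt_def by fastforce
      have "E_pmf ?P (\<lambda>h. of_bool (T (mrg g h) < \<tau>)) \<le> E_pmf ?P (\<lambda>h. 4 / (cond_mean g)\<^sup>2 * (T (mrg g h) - cond_mean g)\<^sup>2)"
      proof (rule E_pmf_mono[OF fin_supp(1)])
        fix h
        show "of_bool (T (mrg g h) < \<tau>) \<le> 4 / (cond_mean g)\<^sup>2 * (T (mrg g h) - cond_mean g)\<^sup>2"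
        proof (cases "T (mrg g h) < \<tau>")
          case True
          then have "cond_mean g / 2 \<le> cond_mean g - T (mrg g h)" using D1(2) by linarith
          then have "(cond_mean g / 2)\<^sup>2 \<le> (cond_mean g - T (mrg g h))\<^sup>2" using Dpos by (intro power_mono) auto
          then show ?thesis using True Dpos by (simp add: power_divide power2_commute[of "cond_mean g"] field_simps)
        qed auto
      qed
      also have "\<dots> = 4 / (cond_mean g)\<^sup>2 * E_pmf ?P (\<lambda>h. (T (mrg g h) - cond_mean g)\<^sup>2)" by simp
      also have "\<dots> \<le> 4 / (cond_mean g)\<^sup>2 * (\<Sum>m\<in>M. variance_const * (cell_mean g m * sqrt (cell_mean g m) + cell_mean g m * sqrt (cell_norm g m) + cell_mean g m + cell_norm g m))"
        by (intro mult_left_mono T_cond_variance) auto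
      also have "\<dots> \<le> 4 / (cond_mean g)\<^sup>2 * (\<Sum>m\<in>M. variance_const * (cell_mean g m * sqrt (cond_mean g) + cell_mean g m * sqrt D0 + cell_mean g m + cell_norm g m))"
        by (intro mult_left_mono sum_mono add_mono real_sqrt_le_mono ale ble cell_mean_nonneg order_refl) (auto simp: variance_const_def)
      also have "(\<Sum>m\<in>M. variance_const * (cell_mean g m * sqrt (cond_mean g) + cell_mean g m * sqrt D0 + cell_mean g m + cell_norm g m)) =
          variance_const * (cond_mean g * sqrt (cond_mean g) + cond_mean g * sqrt D0 + cond_mean g + Bt g)"
        by (simp add: cond_mean_def Bt_def sum_distrib_left sum_distrib_right sum.distrib distrib_left)
      also have "4 / (cond_mean g)\<^sup>2 * \<dots> \<le> 4 / (cond_mean g)\<^sup>2 * (variance_const * (cond_mean g * sqrt (cond_mean g) + cond_mean g * sqrt D0 + cond_mean g + D0))"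
        by (intro mult_left_mono add_mono order_refl True) (auto simp: variance_const_def)
      also have "\<dots> \<le> 1 / 50"
        using numeric_power_bound[OF D1(1)] d unfolding D0_def by (simp add: mult.commute)
      finally show ?thesis using divide_nonneg_pos[OF Bt0[of g] D0] by linarith
    qed
  qed
  also have "\<dots> = E_pmf PJ (\<lambda>g. Bt g / D0 + 1 / 50)"
  proof (rule E_pmf_weights)
    fix f f' assume e: "\<And>m. m \<in> M \<Longrightarrow> W m f = W m f'"
    have "Bt f = Bt f'" unfolding Bt_def by (rule sum.cong) (simp_all only: cell_norm_def e)
    then show "Bt f / D0 + 1 / 50 = Bt f' / D0 + 1 / 50" by simp
  qed
  also have "\<dots> = (\<Sum>m\<in>M. E_pmf PJ (\<lambda>g. cell_norm g m)) / D0 + 1 / 50"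
    unfolding Bt_def by (simp add: E_pmf_add[OF fin_supp_PJ] E_pmf_sum[OF fin_supp_PJ])
  also have "\<dots> \<le> (\<Sum>m\<in>M. 98) / D0 + 1 / 50"
    by (intro add_mono divide_right_mono sum_mono E_pmf_cell_norm order_refl) (use D0 in auto)
  also have "\<dots> \<le> (98 * real d) / D0 + 1 / 50"
    using card_M D0 by (intro add_mono divide_right_mono) auto
  also have "\<dots> = 1 / 25" unfolding D0_def using d by simp
  finally show ?thesis .
qed

end

section \<open>Random cell labels\<close>

text \<open>The test statistic as a function of the cell label, X and Y of each observation. These
  are discrete, so the sample can be modelled by a product of pmfs.\<close>

definition T_labelled :: "nat \<Rightarrow> nat \<Rightarrow> nat \<Rightarrow> nat \<Rightarrow> (nat \<Rightarrow> nat \<times> nat \<times> nat) \<Rightarrow> real" where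
  "T_labelled l1 l2 d N F = (\<Sum>m\<in>{1..d}.
     let D = map (\<lambda>i. snd (F i)) (filter (\<lambda>i. fst (F i) = m) [1..<N + 1]);
         \<sigma> = length D;
         \<omega> = sqrt (real (min \<sigma> l1) * real (min \<sigma> l2))
     in of_bool (\<sigma> \<ge> 4) * real \<sigma> * \<omega> * U_W l1 l2 D)"

lemma depends_on_T_labelled: "depends_on {1..N} (T_labelled l1 l2 d N)"
proof (rule depends_onI)
  fix F F' :: "nat \<Rightarrow> nat \<times> nat \<times> nat" assume e: "\<And>i. i \<in> {1..N} \<Longrightarrow> F i = F' i"
  have f: "filter (\<lambda>i. fst (F i) = m) [1..<N + 1] = filter (\<lambda>i. fst (F' i) = m) [1..<N + 1]" for m
    by (rule filter_cong) (use e in auto)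
  have "map (\<lambda>i. snd (F i)) (filter (\<lambda>i. fst (F i) = m) [1..<N + 1]) =
    map (\<lambda>i. snd (F' i)) (filter (\<lambda>i. fst (F' i) = m) [1..<N + 1])" for m
    unfolding f by (rule map_cong) (use e in auto)
  then show "T_labelled l1 l2 d N F = T_labelled l1 l2 d N F'" unfolding T_labelled_def by presburger
qed

lemma (in cells) T_labelled_eq: "T_labelled l1 l2 d N (\<lambda>i. (\<mu> i, f i)) = T f"
proof -
  have "T_labelled l1 l2 d N (\<lambda>i. (\<mu> i, f i)) = (\<Sum>m\<in>{1..d}. of_bool (\<sigma> m \<ge> 4) * cf m * U_W l1 l2 (map f (js m)))"
    unfolding T_labelled_def cf_def \<omega>_def omega_at_def
    by (intro sum.cong refl) (simp add: Let_def \<sigma>_def js_def of_nat_min)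
  also have "\<dots> = (\<Sum>m\<in>M. of_bool (\<sigma> m \<ge> 4) * cf m * U_W l1 l2 (map f (js m)))"
    by (rule sum.mono_neutral_right) (auto simp: M_def)
  also have "\<dots> = T f"
    unfolding T_def
  proof (rule sum.cong[OF refl])
    fix m assume m: "m \<in> M"
    have "length (js m) \<ge> 4" using len(2)[OF m] unfolding \<sigma>_def .
    then have "U_W l1 l2 (map f (js m)) = u_statistic G (W m f) (AU m) f"
      unfolding AX_def AY_def AU_def t1_def t2_def t_def \<sigma>_def by (rule U_W_map[OF js_props(1)])
    then show "of_bool (\<sigma> m \<ge> 4) * cf m * U_W l1 l2 (map f (js m)) = cf m * u_statistic G (W m f) (AU m) f"
      using len(2)[OF m] by simp
  qed
  finally show ?thesis .
qed

locale mixture =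
  fixes d l1 l2 :: nat and \<rho> :: "nat pmf" and q :: "nat \<Rightarrow> (nat \<times> nat) pmf"
  assumes qG: "\<And>m. m \<in> {1..d} \<Longrightarrow> set_pmf (q m) \<subseteq> {1..l1} \<times> {1..l2}"
    and \<rho>: "set_pmf \<rho> \<subseteq> {1..d}" and l1: "l1 \<ge> 1" and l2: "l2 \<ge> 1"
begin

definition "law = bind_pmf \<rho> (\<lambda>m. map_pmf (Pair m) (q m))"

abbreviation "labels N \<equiv> Pi_pmf {1..N :: nat} 0 (\<lambda>_. \<rho>)"

lemma fin_supp\<rho>: "fin_supp \<rho>" using \<rho> finite_subset by blast

lemma fin_supp_labels: "fin_supp (labels N)" using fin_supp\<rho> by auto

lemma labels_cells: "\<mu> \<in> set_pmf (labels N) \<Longrightarrow> cells N d l1 l2 \<mu> q"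
proof
  fix i assume "\<mu> \<in> set_pmf (labels N)" "i \<in> {1..N}"
  then show "\<mu> i \<in> {1..d}" using Pi_supp[of "{1..N}" i \<mu> 0 "\<lambda>_. \<rho>"] \<rho> by auto
qed (use qG l1 l2 in auto)

text \<open>All labels are drawn first; given them the observations are independent with laws
  \<open>q (\<mu> i)\<close>, which is the setting of \<open>cells\<close>.\<close>

lemma E_pmf_law:
  assumes "depends_on {1..N} \<Phi>"
  shows "E_pmf (Pi_pmf {1..N} dflt (\<lambda>_. law)) \<Phi> =
    E_pmf (labels N) (\<lambda>\<mu>. E_pmf (Pi_pmf {1..N} (0, 0) (\<lambda>i. q (\<mu> i))) (\<lambda>f. \<Phi> (\<lambda>i. (\<mu> i, f i))))"
proof -
  have "Pi_pmf {1..N} dflt (\<lambda>_. law) = bind_pmf (labels N) (\<lambda>\<mu>. Pi_pmf {1..N} dflt (\<lambda>i. map_pmf (Pair (\<mu> i)) (q (\<mu> i))))"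
    unfolding law_def by (rule Pi_pmf_bind) simp
  also have "(\<lambda>\<mu>. Pi_pmf {1..N} dflt (\<lambda>i. map_pmf (Pair (\<mu> i)) (q (\<mu> i)))) =
    (\<lambda>\<mu>. bind_pmf (Pi_pmf {1..N} (0, 0) (\<lambda>i. q (\<mu> i))) (\<lambda>f. return_pmf (\<lambda>i. if i \<in> {1..N} then (\<mu> i, f i) else dflt)))"
  proof
    fix \<mu>
    have "Pi_pmf {1..N} dflt (\<lambda>i. bind_pmf (q (\<mu> i)) (\<lambda>x. return_pmf (\<mu> i, x))) =
      bind_pmf (Pi_pmf {1..N} (0, 0) (\<lambda>i. q (\<mu> i))) (\<lambda>f. Pi_pmf {1..N} dflt (\<lambda>i. return_pmf (\<mu> i, f i)))"
      by (rule Pi_pmf_bind) simp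
    then show "Pi_pmf {1..N} dflt (\<lambda>i. map_pmf (Pair (\<mu> i)) (q (\<mu> i))) =
      bind_pmf (Pi_pmf {1..N} (0, 0) (\<lambda>i. q (\<mu> i))) (\<lambda>f. return_pmf (\<lambda>i. if i \<in> {1..N} then (\<mu> i, f i) else dflt))"
      by (simp add: map_pmf_def)
  qed
  finally have eq: "Pi_pmf {1..N} dflt (\<lambda>_. law) = bind_pmf (labels N) (\<lambda>\<mu>. bind_pmf (Pi_pmf {1..N} (0, 0) (\<lambda>i. q (\<mu> i)))
    (\<lambda>f. return_pmf (\<lambda>i. if i \<in> {1..N} then (\<mu> i, f i) else dflt)))" .
  have fsi: "fin_supp (Pi_pmf {1..N} (0, 0) (\<lambda>i. q (\<mu> i)))" if "\<mu> \<in> set_pmf (labels N)" for \<mu>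
    using cells.fin_supp_PJ[OF labels_cells[OF that]] .
  have "E_pmf (Pi_pmf {1..N} dflt (\<lambda>_. law)) \<Phi> =
    E_pmf (labels N) (\<lambda>\<mu>. E_pmf (bind_pmf (Pi_pmf {1..N} (0, 0) (\<lambda>i. q (\<mu> i)))
    (\<lambda>f. return_pmf (\<lambda>i. if i \<in> {1..N} then (\<mu> i, f i) else dflt))) \<Phi>)"
    unfolding eq by (rule E_pmf_bind[OF fin_supp_labels]) (use fsi in auto)
  also have "\<dots> = E_pmf (labels N) (\<lambda>\<mu>. E_pmf (Pi_pmf {1..N} (0, 0) (\<lambda>i. q (\<mu> i))) (\<lambda>f. \<Phi> (\<lambda>i. (\<mu> i, f i))))"
  proof (rule E_pmf_cong)
    fix \<mu> assume \<mu>: "\<mu> \<in> set_pmf (labels N)"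
    have "\<Phi> (\<lambda>i. if i \<in> {1..N} then (\<mu> i, f i) else dflt) = \<Phi> (\<lambda>i. (\<mu> i, f i))" for f
      by (rule depends_onD[OF assms]) auto
    then show "E_pmf (bind_pmf (Pi_pmf {1..N} (0, 0) (\<lambda>i. q (\<mu> i)))
      (\<lambda>f. return_pmf (\<lambda>i. if i \<in> {1..N} then (\<mu> i, f i) else dflt))) \<Phi> =
      E_pmf (Pi_pmf {1..N} (0, 0) (\<lambda>i. q (\<mu> i))) (\<lambda>f. \<Phi> (\<lambda>i. (\<mu> i, f i)))"
      by (subst E_pmf_bind[OF fsi[OF \<mu>]]) auto
  qed
  finally show ?thesis .
qed

text \<open>Cells that receive observations have positive probability, so the structural bounds of
  the null hypothesis are asked of such cells alone.\<close>

lemma label_hit: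
  assumes "\<mu> \<in> set_pmf (labels N)" "m \<in> cells.M N d \<mu>"
  shows "m \<in> set_pmf \<rho>"
proof -
  interpret cells N d l1 l2 \<mu> q by (rule labels_cells[OF assms(1)])
  have "js m \<noteq> []" using len(2)[OF assms(2)] unfolding \<sigma>_def by auto
  then obtain i where "i \<in> set (js m)" by (cases "js m") auto
  then have "i \<in> {1..N}" "\<mu> i = m" using js_props(2) by auto
  then show ?thesis using Pi_supp[of "{1..N}" i \<mu> 0 "\<lambda>_. \<rho>"] assms(1) by auto
qed

lemma null_error:
  assumes V: "\<And>m x y. m \<in> set_pmf \<rho> \<Longrightarrow> (x, y) \<in> {1..l1} \<times> {1..l2} \<Longrightarrow> (dev (q m) (x, y))\<^sup>2 \<le> V m x * V' m y"
    and V0: "\<And>m x. 0 \<le> V m x" "\<And>m y. 0 \<le> V' m y"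
    and Vz: "\<And>m x. m \<in> set_pmf \<rho> \<Longrightarrow> pmf (map_pmf fst (q m)) x = 0 \<Longrightarrow> V m x = 0"
      "\<And>m y. m \<in> set_pmf \<rho> \<Longrightarrow> pmf (map_pmf snd (q m)) y = 0 \<Longrightarrow> V' m y = 0"
    and \<kappa>: "\<And>m. m \<in> set_pmf \<rho> \<Longrightarrow> (\<Sum>x\<in>{1..l1}. V m x / pmf (map_pmf fst (q m)) x) \<le> \<kappa>"
      "\<And>m. m \<in> set_pmf \<rho> \<Longrightarrow> (\<Sum>y\<in>{1..l2}. V' m y / pmf (map_pmf snd (q m)) y) \<le> \<kappa>" "0 < \<kappa>"
    and \<tau>: "0 < \<tau>"
  shows "E_pmf (Pi_pmf {1..N} dflt (\<lambda>_. law)) (\<lambda>F. of_bool (\<tau> \<le> T_labelled l1 l2 d N F)) \<le>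
    null_const * (\<kappa> ^ 4 * ((real d + real N / real l1) * (real d + real N / real l2)) + real d) / \<tau>\<^sup>2"
proof -
  let ?b = "null_const * (\<kappa> ^ 4 * ((real d + real N / real l1) * (real d + real N / real l2)) + real d)"
  have depends_on: "depends_on {1..N} (\<lambda>F. of_bool (\<tau> \<le> T_labelled l1 l2 d N F) :: real)"
    by (rule depends_on_comp[OF depends_on_T_labelled])
  have "E_pmf (Pi_pmf {1..N} dflt (\<lambda>_. law)) (\<lambda>F. of_bool (\<tau> \<le> T_labelled l1 l2 d N F)) =
    E_pmf (labels N) (\<lambda>\<mu>. E_pmf (Pi_pmf {1..N} (0, 0) (\<lambda>i. q (\<mu> i))) (\<lambda>f. of_bool (\<tau> \<le> T_labelled l1 l2 d N (\<lambda>i. (\<mu> i, f i)))))"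
    by (rule E_pmf_law[OF depends_on])
  also have "\<dots> \<le> ?b / \<tau>\<^sup>2"
  proof (rule E_pmf_le_const[OF fin_supp_labels])
    fix \<mu> assume mu: "\<mu> \<in> set_pmf (labels N)"
    interpret cells N d l1 l2 \<mu> q by (rule labels_cells[OF mu])
    have "E_pmf PJ (\<lambda>f. of_bool (\<tau> \<le> T f)) \<le> E_pmf PJ (\<lambda>f. (T f)\<^sup>2 / \<tau>\<^sup>2)"
    proof (rule E_pmf_mono[OF fin_supp_PJ])
      fix f
      show "of_bool (\<tau> \<le> T f) \<le> (T f)\<^sup>2 / \<tau>\<^sup>2"
        using power_mono[of \<tau> "T f" 2] \<tau> by auto
    qed
    also have "\<dots> = E_pmf PJ (\<lambda>f. (T f)\<^sup>2) / \<tau>\<^sup>2" by simp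
    also have "\<dots> \<le> ?b / \<tau>\<^sup>2"
      by (intro divide_right_mono null_second_moment[where V=V and V'=V'])
        (use V V0 Vz \<kappa> label_hit[OF mu] in auto)
    finally show "E_pmf PJ (\<lambda>f. of_bool (\<tau> \<le> T_labelled l1 l2 d N (\<lambda>i. (\<mu> i, f i)))) \<le> ?b / \<tau>\<^sup>2"
      unfolding T_labelled_eq .
  qed
  finally show ?thesis .
qed

definition "label_count N m \<mu> = (\<Sum>i\<in>{1..N}. of_bool (\<mu> i = m) :: real)"

lemma E_pmf_label_count_dev: "E_pmf (labels N) (\<lambda>\<mu>. (label_count N m \<mu> - real N * pmf \<rho> m)\<^sup>2) \<le> real N * pmf \<rho> m"
proof -
  let ?p = "pmf \<rho> m"
  let ?X = "\<lambda>i \<mu>. of_bool (\<mu> i = m) - ?p"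
  have E1: "E_pmf (labels N) (?X i) = 0" if "i \<in> {1..N}" for i
    using E_pmf_Pi_1[of "{1..N}" i 0 "\<lambda>_. \<rho>" "\<lambda>a. of_bool (a = m) - ?p"] that E_pmf_point[OF fin_supp\<rho>, of m 1]
    by (simp add: E_pmf_diff[OF fin_supp\<rho>])
  have E2: "E_pmf (labels N) (\<lambda>\<mu>. ?X i \<mu> * ?X i \<mu>) \<le> ?p" if "i \<in> {1..N}" for i
  proof -
    have "E_pmf (labels N) (\<lambda>\<mu>. ?X i \<mu> * ?X i \<mu>) = E_pmf \<rho> (\<lambda>a. (of_bool (a = m) - ?p) * (of_bool (a = m) - ?p))"
      using E_pmf_Pi_1[of "{1..N}" i 0 "\<lambda>_. \<rho>" "\<lambda>a. (of_bool (a = m) - ?p) * (of_bool (a = m) - ?p)"] that by simp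
    also have "\<dots> = E_pmf \<rho> (\<lambda>a. of_bool (a = m) * (1 - 2 * ?p) + ?p * ?p)"
      by (rule E_pmf_cong) (auto simp: algebra_simps)
    also have "\<dots> = ?p * (1 - 2 * ?p) + ?p * ?p"
      by (subst E_pmf_add[OF fin_supp\<rho>]) (simp only: E_pmf_point[OF fin_supp\<rho>] E_pmf_const)
    also have "\<dots> \<le> ?p" by (simp add: algebra_simps)
    finally show ?thesis .
  qed
  have "label_count N m \<mu> - real N * ?p = (\<Sum>i\<in>{1..N}. ?X i \<mu>)" for \<mu>
    unfolding label_count_def by (simp add: sum_subtractf)
  then have "E_pmf (labels N) (\<lambda>\<mu>. (label_count N m \<mu> - real N * ?p)\<^sup>2) =
    (\<Sum>i\<in>{1..N}. \<Sum>j\<in>{1..N}. E_pmf (labels N) (\<lambda>\<mu>. ?X i \<mu> * ?X j \<mu>))"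
    by (simp only: power2_eq_square sum_product E_pmf_sum[OF fin_supp_labels])
  also have "\<dots> \<le> (\<Sum>i\<in>{1..N}. ?p)"
  proof (rule sum_mono)
    fix i assume i: "i \<in> {1..N}"
    have "E_pmf (labels N) (\<lambda>\<mu>. ?X i \<mu> * ?X j \<mu>) = 0" if "j \<in> {1..N}" "j \<noteq> i" for j
    proof -
      have "E_pmf (labels N) (\<lambda>\<mu>. ?X i \<mu> * ?X j \<mu>) = E_pmf (labels N) (?X i) * E_pmf (labels N) (?X j)"
        by (rule E_pmf_Pi_indep[of _ "{i}" "{j}"]) (use that i fin_supp\<rho> in \<open>auto intro!: depends_onI\<close>)
      then show ?thesis using E1[OF i] by simp
    qed
    then have "(\<Sum>j\<in>{1..N}. E_pmf (labels N) (\<lambda>\<mu>. ?X i \<mu> * ?X j \<mu>)) = (\<Sum>j\<in>{i}. E_pmf (labels N) (\<lambda>\<mu>. ?X i \<mu> * ?X j \<mu>))"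
      by (intro sum.mono_neutral_right) (use i in auto)
    then show "(\<Sum>j\<in>{1..N}. E_pmf (labels N) (\<lambda>\<mu>. ?X i \<mu> * ?X j \<mu>)) \<le> ?p" using E2[OF i] by simp
  qed
  finally show ?thesis by simp
qed

lemma prob_label_count_small:
  assumes "0 < real N * pmf \<rho> m"
  shows "E_pmf (labels N) (\<lambda>\<mu>. of_bool (label_count N m \<mu> < real N * pmf \<rho> m / 2)) \<le> 4 / (real N * pmf \<rho> m)"
proof -
  let ?l = "real N * pmf \<rho> m"
  have "E_pmf (labels N) (\<lambda>\<mu>. of_bool (label_count N m \<mu> < ?l / 2)) \<le> E_pmf (labels N) (\<lambda>\<mu>. 4 / ?l\<^sup>2 * (label_count N m \<mu> - ?l)\<^sup>2)"
  proof (rule E_pmf_mono[OF fin_supp_labels])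
    fix \<mu>
    show "of_bool (label_count N m \<mu> < ?l / 2) \<le> 4 / ?l\<^sup>2 * (label_count N m \<mu> - ?l)\<^sup>2"
    proof (cases "label_count N m \<mu> < ?l / 2")
      case True
      then have "(?l / 2)\<^sup>2 \<le> (?l - label_count N m \<mu>)\<^sup>2" using assms by (intro power_mono) auto
      then have "?l\<^sup>2 \<le> 4 * (label_count N m \<mu> - ?l)\<^sup>2" by (simp only: power_divide power2_commute[of ?l]) simp
      moreover have "1 \<le> 4 / l\<^sup>2 * X" if "0 < l" "l\<^sup>2 \<le> 4 * X" for l X :: real
        using that by (simp add: pos_le_divide_eq)
      ultimately have "1 \<le> 4 / ?l\<^sup>2 * (label_count N m \<mu> - ?l)\<^sup>2" using assms by blast
      then show ?thesis using True by simp
    qed auto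
  qed
  also have "\<dots> = 4 / ?l\<^sup>2 * E_pmf (labels N) (\<lambda>\<mu>. (label_count N m \<mu> - ?l)\<^sup>2)" by simp
  also have "\<dots> \<le> 4 / ?l\<^sup>2 * ?l" by (intro mult_left_mono E_pmf_label_count_dev) simp
  also have "\<dots> = 4 / ?l" using assms by (simp add: power2_eq_square)
  finally show ?thesis .
qed

text \<open>A heavy cell receives less than half of its expected count with probability at most
  \<open>4 / 800 = 1 / 200\<close> and is then counted as losing its share \<open>c m\<close> of the
  signal. By Markov's inequality more than half of the signal is lost with probability at most
  \<open>1/100\<close>; otherwise \<open>alternative_power\<close> applies, and
  \<open>1/25 + 1/100 = 1/20\<close>.\<close>

lemma alternative_error:
  assumes d: "1 \<le> d" and H: "H \<subseteq> {1..d}" and heavy: "\<And>m. m \<in> H \<Longrightarrow> 800 \<le> real N * pmf \<rho> m"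
    and big: "(\<Sum>m\<in>H. real N * pmf \<rho> m * omega_at l1 l2 (real N * pmf \<rho> m) * (\<Sum>g\<in>{1..l1} \<times> {1..l2}. \<bar>dev (q m) g\<bar>)\<^sup>2
        / (16 * real l1 * real l2)) \<ge> 2 * max (10 ^ 26 * sqrt (real d)) (2 * \<tau>)"
  shows "E_pmf (Pi_pmf {1..N} dflt (\<lambda>_. law)) (\<lambda>F. of_bool (T_labelled l1 l2 d N F < \<tau>)) \<le> 1 / 20"
proof -
  define Th where "Th = max (10 ^ 26 * sqrt (real d)) (2 * \<tau>)"
  define e where "e = (\<lambda>m. (\<Sum>g\<in>{1..l1} \<times> {1..l2}. \<bar>dev (q m) g\<bar>)\<^sup>2)"
  define lam where "lam = (\<lambda>m. real N * pmf \<rho> m)"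
  define c where "c = (\<lambda>m. lam m * omega_at l1 l2 (lam m) * e m / (16 * real l1 * real l2))"
  define bad where "bad = (\<lambda>m \<mu>. of_bool (label_count N m \<mu> < lam m / 2) :: real)"
  have fH: "finite H" using H finite_subset by auto
  \<comment> \<open>Half of the total signal: the loss that can be tolerated, and at least the level
    \<open>Th\<close> that must survive.\<close>
  define Ct where "Ct = (\<Sum>m\<in>H. c m) / 2"
  have ThC: "Th \<le> Ct" using big unfolding c_def lam_def e_def Th_def Ct_def by simp
  have "0 < 10 ^ 26 * sqrt (real d)" using d by simp
  then have Ct: "Ct > 0" using ThC unfolding Th_def by linarith
  have e0: "0 \<le> e m" for m unfolding e_def by simp
  have lam8: "800 \<le> lam m" if "m \<in> H" for m using heavy[OF that] lam_def by simp
  have c0: "0 \<le> c m" if "m \<in> H" for m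
    unfolding c_def using lam8[OF that] omega_at_pos[OF l1 l2, of "lam m"] e0[of m]
    by (intro divide_nonneg_nonneg mult_nonneg_nonneg) auto
  have depends_on: "depends_on {1..N} (\<lambda>F. of_bool (T_labelled l1 l2 d N F < \<tau>) :: real)"
    by (rule depends_on_comp[OF depends_on_T_labelled])
  have "E_pmf (Pi_pmf {1..N} dflt (\<lambda>_. law)) (\<lambda>F. of_bool (T_labelled l1 l2 d N F < \<tau>)) =
    E_pmf (labels N) (\<lambda>\<mu>. E_pmf (Pi_pmf {1..N} (0, 0) (\<lambda>i. q (\<mu> i))) (\<lambda>f. of_bool (T_labelled l1 l2 d N (\<lambda>i. (\<mu> i, f i)) < \<tau>)))"
    by (rule E_pmf_law[OF depends_on])
  also have "\<dots> \<le> E_pmf (labels N) (\<lambda>\<mu>. 1 / 25 + (\<Sum>m\<in>H. bad m \<mu> * c m) / Ct)"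
  proof (rule E_pmf_mono[OF fin_supp_labels])
    fix \<mu> assume mu: "\<mu> \<in> set_pmf (labels N)"
    interpret cells N d l1 l2 \<mu> q by (rule labels_cells[OF mu])
    have b0: "0 \<le> (\<Sum>m\<in>H. bad m \<mu> * c m)"
      unfolding bad_def by (intro sum_nonneg mult_nonneg_nonneg c0) auto
    have "E_pmf PJ (\<lambda>f. of_bool (T f < \<tau>)) \<le> 1 / 25 + (\<Sum>m\<in>H. bad m \<mu> * c m) / Ct"
    proof (cases "(\<Sum>m\<in>H. bad m \<mu> * c m) \<le> Ct")
      case False
      have "E_pmf PJ (\<lambda>f. of_bool (T f < \<tau>)) \<le> 1" by (rule E_pmf_le_const[OF fin_supp_PJ]) auto
      also have "1 \<le> (\<Sum>m\<in>H. bad m \<mu> * c m) / Ct" using False Ct by simp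
      finally show ?thesis by simp
    next
      case True
      have "Th \<le> (\<Sum>m\<in>H. c m) - (\<Sum>m\<in>H. bad m \<mu> * c m)" using ThC True unfolding Ct_def by linarith
      also have "\<dots> = (\<Sum>m\<in>H. (1 - bad m \<mu>) * c m)"
        by (simp add: sum_subtractf[symmetric] left_diff_distrib)
      also have "\<dots> \<le> (\<Sum>m\<in>H \<inter> M. cf m * e m / (4 * real l1 * real l2))"
      proof (rule order_trans[OF _ sum_mono])
        have "m \<in> M" if "m \<in> H" "bad m \<mu> = 0" for m
        proof -
          have "400 \<le> label_count N m \<mu>" using that lam8[OF that(1)] unfolding bad_def by (auto split: if_splits)
          then have "4 \<le> real (\<sigma> m)" unfolding \<sigma>_def label_count_def distinct_card[OF js_props(1), symmetric] js_props(2)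
            by (simp add: Int_def of_bool_def sum.If_cases)
          then show ?thesis using that H unfolding M_def by auto
        qed
        then have out: "bad m \<mu> = 1" if "m \<in> H" "m \<notin> M" for m using that unfolding bad_def by fastforce
        have "(\<Sum>m\<in>H. (1 - bad m \<mu>) * c m) = (\<Sum>m\<in>H \<inter> M. (1 - bad m \<mu>) * c m)"
        proof (rule sum.mono_neutral_right[OF fH])
          show "\<forall>m\<in>H - H \<inter> M. (1 - bad m \<mu>) * c m = 0"
          proof
            fix m assume "m \<in> H - H \<inter> M"
            then have "bad m \<mu> = 1" by (intro out) auto
            then show "(1 - bad m \<mu>) * c m = 0" by simp
          qed
        qed auto
        then show "(\<Sum>m\<in>H. (1 - bad m \<mu>) * c m) \<le> (\<Sum>m\<in>H \<inter> M. (1 - bad m \<mu>) * c m)" by simp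
        fix m assume m: "m \<in> H \<inter> M"
        show "(1 - bad m \<mu>) * c m \<le> cf m * e m / (4 * real l1 * real l2)"
        proof (cases "bad m \<mu> = 0")
          case True
          have cs: "label_count N m \<mu> = real (\<sigma> m)" unfolding \<sigma>_def label_count_def distinct_card[OF js_props(1), symmetric] js_props(2)
            by (simp add: Int_def of_bool_def sum.If_cases)
          have s: "lam m / 2 \<le> real (\<sigma> m)" using True unfolding bad_def cs by (auto split: if_splits)
          have lp: "0 < lam m" using lam8 m by force
          \<comment> \<open>Half of the expected count keeps at least half of each of the two
            factors of \<open>cf m\<close>. This factor 4 accounts for the 16 in \<open>c\<close>,
            against the 4 in \<open>cell_mean_lower\<close>.\<close>
          have "omega_at l1 l2 (lam m) / 2 \<le> omega_at l1 l2 (lam m / 2)" by (rule omega_at_half[OF l1 l2 lp])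
          also have "\<dots> \<le> \<omega> m" unfolding \<omega>_def by (rule omega_at_mono[OF l1 l2 _ s]) (use lp in simp)
          finally have "lam m / 2 * (omega_at l1 l2 (lam m) / 2) \<le> cf m"
            unfolding cf_def using s lp omega_at_pos[OF l1 l2 lp] by (intro mult_mono) auto
          then have "lam m / 2 * (omega_at l1 l2 (lam m) / 2) * (e m / (4 * real l1 * real l2)) \<le> cf m * (e m / (4 * real l1 * real l2))"
            by (rule mult_right_mono) (use e0 in simp)
          then show ?thesis unfolding c_def True by (simp add: field_simps)
        next
          case False
          then have "bad m \<mu> = 1" unfolding bad_def by auto
          then show ?thesis using m by (auto intro!: divide_nonneg_nonneg mult_nonneg_nonneg cf_pos[THEN less_imp_le] e0)
        qed
      qed
      also have "\<dots> \<le> (\<Sum>m\<in>M. cf m * e m / (4 * real l1 * real l2))"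
        by (rule sum_mono2[OF finM])
          (auto intro!: divide_nonneg_nonneg mult_nonneg_nonneg cf_pos[THEN less_imp_le] e0)
      finally have "E_pmf PJ (\<lambda>f. of_bool (T f < \<tau>)) \<le> 1 / 25"
        unfolding Th_def e_def by (rule alternative_power[OF d])
      then show ?thesis using divide_nonneg_pos[OF b0 Ct] by linarith
    qed
    then show "E_pmf PJ (\<lambda>f. of_bool (T_labelled l1 l2 d N (\<lambda>i. (\<mu> i, f i)) < \<tau>)) \<le> 1 / 25 + (\<Sum>m\<in>H. bad m \<mu> * c m) / Ct"
      unfolding T_labelled_eq .
  qed
  also have "\<dots> = 1 / 25 + (\<Sum>m\<in>H. E_pmf (labels N) (bad m) * c m) / Ct"
    by (simp add: E_pmf_add[OF fin_supp_labels] E_pmf_sum[OF fin_supp_labels])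
  also have "\<dots> \<le> 1 / 25 + (\<Sum>m\<in>H. 1 / 200 * c m) / Ct"
  proof (intro add_left_mono divide_right_mono sum_mono mult_right_mono c0)
    fix m assume m: "m \<in> H"
    have "E_pmf (labels N) (bad m) \<le> 4 / lam m"
      unfolding bad_def lam_def by (rule prob_label_count_small) (use heavy[OF m] in linarith)
    also have "\<dots> \<le> 4 / 800" using lam8[OF m] by (intro divide_left_mono) auto
    finally show "E_pmf (labels N) (bad m) \<le> 1 / 200" by simp
  qed (use Ct in auto)
  also have "(\<Sum>m\<in>H. 1 / 200 * c m) / Ct = 1 / 100"
    using Ct unfolding sum_distrib_left[symmetric] Ct_def by simp
  finally show ?thesis by simp
qed

end

declare One_nat_def [simp]

section \<open>Total variation and chi-squared distances\<close>

lemma RN_deriv_count_space_pmf: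
  fixes a :: "'a::countable pmf"
  shows "RN_deriv (count_space UNIV) (measure_pmf a) x = ennreal (pmf a x)"
proof -
  interpret sigma_finite_measure "count_space (UNIV :: 'a set)" by (rule sigma_finite_measure_count_space)
  have "AE x in count_space UNIV. ennreal (pmf a x) = RN_deriv (count_space UNIV) (measure_pmf a) x"
    by (rule RN_deriv_unique) (auto simp: measure_pmf_eq_density)
  then show ?thesis by (simp add: AE_count_space)
qed

lemma l1_dist_pmf_ge:
  fixes a b :: "'a::countable pmf"
  assumes "finite F"
  shows "(\<Sum>x\<in>F. \<bar>pmf a x - pmf b x\<bar>) \<le> l1_dist (count_space UNIV) (measure_pmf a) (measure_pmf b)"
proof -
  have "l1_dist (count_space UNIV) (measure_pmf a) (measure_pmf b) = (\<integral>x. \<bar>pmf a x - pmf b x\<bar> \<partial>count_space UNIV)"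
    unfolding l1_dist_def RN_deriv_count_space_pmf by simp
  moreover have "(\<Sum>x\<in>F. \<bar>pmf a x - pmf b x\<bar>) = (\<integral>x. indicator F x * \<bar>pmf a x - pmf b x\<bar> \<partial>count_space UNIV)"
  proof -
    have fin: "finite {x \<in> UNIV. indicator F x * \<bar>pmf a x - pmf b x\<bar> \<noteq> (0::real)}"
      by (rule finite_subset[OF _ assms]) (auto simp: indicator_def)
    have "(\<integral>x. indicator F x * \<bar>pmf a x - pmf b x\<bar> \<partial>count_space UNIV) =
      (\<Sum>x | x \<in> UNIV \<and> indicator F x * \<bar>pmf a x - pmf b x\<bar> \<noteq> (0::real). indicator F x * \<bar>pmf a x - pmf b x\<bar>)"
      by (rule lebesgue_integral_count_space_finite_support[OF fin])
    also have "\<dots> = (\<Sum>x\<in>F. indicator F x * \<bar>pmf a x - pmf b x\<bar>)"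
      by (rule sum.mono_neutral_left[OF assms]) (auto simp: indicator_def)
    also have "\<dots> = (\<Sum>x\<in>F. \<bar>pmf a x - pmf b x\<bar>)" by (rule sum.cong) auto
    finally show ?thesis by simp
  qed
  moreover have "(\<integral>x. indicator F x * \<bar>pmf a x - pmf b x\<bar> \<partial>count_space UNIV) \<le> (\<integral>x. \<bar>pmf a x - pmf b x\<bar> \<partial>count_space UNIV)"
  proof (rule integral_mono)
    show i: "integrable (count_space UNIV) (\<lambda>x. \<bar>pmf a x - pmf b x\<bar>)"
      by (intro integrable_abs Bochner_Integration.integrable_diff integrable_pmf)
    show "integrable (count_space UNIV) (\<lambda>x. indicator F x * \<bar>pmf a x - pmf b x\<bar>)"
      by (rule Bochner_Integration.integrable_bound[OF i]) (auto simp: indicator_def)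
  qed (auto simp: indicator_def)
  ultimately show ?thesis by simp
qed

text \<open>A finite divergence excludes the infinite branch of the definition. This yields absolute
  continuity, after which the derivative is the ratio of the mass functions.\<close>

lemma chi2_div_pmf:
  fixes a b :: "'a::countable pmf"
  assumes le: "chi2_div (measure_pmf a) (measure_pmf b) \<le> ennreal \<kappa>" and \<kappa>: "0 \<le> \<kappa>"
  shows "pmf b x = 0 \<Longrightarrow> pmf a x = 0"
    and "finite F \<Longrightarrow> (\<Sum>x\<in>F. (pmf a x - pmf b x)\<^sup>2 / pmf b x) \<le> \<kappa>"
proof -
  have ac: "absolutely_continuous (measure_pmf b) (measure_pmf a)"
    using le unfolding chi2_div_def by (auto split: if_splits simp: top_unique)
  show zero: "pmf a x = 0" if "pmf b x = 0" for x
  proof -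
    have "{x} \<in> null_sets (measure_pmf b)" using that by (simp add: null_sets_def emeasure_pmf_single)
    then have "{x} \<in> null_sets (measure_pmf a)" using ac unfolding absolutely_continuous_def by auto
    then show ?thesis by (simp add: null_sets_def emeasure_pmf_single)
  qed
  define f where "f = (\<lambda>x. pmf a x / pmf b x)"
  have dens: "density (measure_pmf b) (\<lambda>x. ennreal (f x)) = measure_pmf a"
  proof (rule measure_eqI_countable[of _ UNIV])
    fix x
    have "emeasure (density (measure_pmf b) (\<lambda>x. ennreal (f x))) {x} = ennreal (f x) * ennreal (pmf b x)"
      by (subst emeasure_density) (auto simp: emeasure_pmf_single)
    also have "\<dots> = ennreal (f x * pmf b x)" by (rule ennreal_mult[symmetric]) (auto simp: f_def)
    also have "f x * pmf b x = pmf a x" unfolding f_def using zero[of x] by auto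
    finally show "emeasure (density (measure_pmf b) (\<lambda>x. ennreal (f x))) {x} = emeasure (measure_pmf a) {x}"
      by (simp add: emeasure_pmf_single)
  qed auto
  have "AE x in measure_pmf b. ennreal (f x) = RN_deriv (measure_pmf b) (measure_pmf a) x"
    by (rule measure_pmf.RN_deriv_unique[OF _ dens]) simp
  then have RN: "RN_deriv (measure_pmf b) (measure_pmf a) x = ennreal (f x)" if "x \<in> set_pmf b" for x
    using that by (auto simp: AE_measure_pmf_iff)
  show "(\<Sum>x\<in>F. (pmf a x - pmf b x)\<^sup>2 / pmf b x) \<le> \<kappa>" if F: "finite F" for F
  proof -
    have "ennreal (\<Sum>x\<in>F. (pmf a x - pmf b x)\<^sup>2 / pmf b x) = (\<Sum>x\<in>F. ennreal ((pmf a x - pmf b x)\<^sup>2 / pmf b x))"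
      by (rule sum_ennreal[symmetric]) auto
    also have "\<dots> = (\<Sum>x\<in>F. ennreal (pmf b x) * ennreal ((f x - 1)\<^sup>2))"
    proof (rule sum.cong[OF refl])
      fix x
      have "(pmf a x - pmf b x)\<^sup>2 / pmf b x = pmf b x * (f x - 1)\<^sup>2"
        by (cases "pmf b x = 0") (auto simp: f_def field_simps power2_eq_square)
      then show "ennreal ((pmf a x - pmf b x)\<^sup>2 / pmf b x) = ennreal (pmf b x) * ennreal ((f x - 1)\<^sup>2)"
        by (simp add: ennreal_mult)
    qed
    also have "\<dots> = (\<integral>\<^sup>+x. indicator F x * (ennreal (pmf b x) * ennreal ((f x - 1)\<^sup>2)) \<partial>count_space UNIV)"
      by (subst nn_integral_count_space'[OF F]) (auto intro!: sum.cong)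
    also have "\<dots> \<le> (\<integral>\<^sup>+x. ennreal (pmf b x) * ennreal ((f x - 1)\<^sup>2) \<partial>count_space UNIV)"
      by (rule nn_integral_mono) (auto simp: indicator_def)
    also have "\<dots> = (\<integral>\<^sup>+x. ennreal ((f x - 1)\<^sup>2) \<partial>measure_pmf b)"
      by (rule nn_integral_measure_pmf[symmetric])
    also have "\<dots> = (\<integral>\<^sup>+x. ennreal ((enn2real (RN_deriv (measure_pmf b) (measure_pmf a) x) - 1)\<^sup>2) \<partial>measure_pmf b)"
      by (rule nn_integral_cong_AE) (auto simp: AE_measure_pmf_iff RN f_def)
    also have "\<dots> = chi2_div (measure_pmf a) (measure_pmf b)" unfolding chi2_div_def using ac by simp
    also have "\<dots> \<le> ennreal \<kappa>" by (rule le)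
    finally show ?thesis using \<kappa> by simp
  qed
qed

section \<open>Covariances and variances of bounded functions\<close>

lemma (in prob_space) integrable_01:
  fixes f :: "'a \<Rightarrow> real"
  assumes "f \<in> borel_measurable M" "\<And>x. 0 \<le> f x" "\<And>x. f x \<le> 1"
  shows "integrable M f"
  by (rule integrable_const_bound[of _ 1]) (use assms in auto)

lemma (in prob_space) cauchy_schwarz_bounded:
  fixes F H :: "'a \<Rightarrow> real"
  assumes [measurable]: "F \<in> borel_measurable M" "H \<in> borel_measurable M"
    and b: "\<And>x. \<bar>F x\<bar> \<le> 1" "\<And>x. \<bar>H x\<bar> \<le> 1"
  shows "(expectation (\<lambda>x. F x * H x))\<^sup>2 \<le> expectation (\<lambda>x. (F x)\<^sup>2) * expectation (\<lambda>x. (H x)\<^sup>2)"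
proof -
  have iF: "integrable M (\<lambda>x. (F x)\<^sup>2)" and iH: "integrable M (\<lambda>x. (H x)\<^sup>2)" and iFH: "integrable M (\<lambda>x. F x * H x)"
  proof -
    have bb: "\<bar>u * v\<bar> \<le> 1" if "\<bar>u\<bar> \<le> 1" "\<bar>v\<bar> \<le> 1" for u v :: real
      unfolding abs_mult using that by (intro mult_le_one) auto
    have ib: "integrable M (\<lambda>x. u x * v x)"
      if "u \<in> borel_measurable M" "v \<in> borel_measurable M" "\<And>x. \<bar>u x\<bar> \<le> 1" "\<And>x. \<bar>v x\<bar> \<le> 1" for u v :: "'a \<Rightarrow> real"
      by (rule integrable_const_bound[of _ 1]) (use that bb in auto)
    show "integrable M (\<lambda>x. (F x)\<^sup>2)" "integrable M (\<lambda>x. (H x)\<^sup>2)" "integrable M (\<lambda>x. F x * H x)"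
      unfolding power2_eq_square by (rule ib; use assms in auto)+
  qed
  define A where "A = expectation (\<lambda>x. (F x)\<^sup>2)"
  define B where "B = expectation (\<lambda>x. (H x)\<^sup>2)"
  define C where "C = expectation (\<lambda>x. F x * H x)"
  have A0: "0 \<le> A" unfolding A_def by simp
  have B0: "0 \<le> B" unfolding B_def by simp
  have q: "0 \<le> A - 2 * t * C + t\<^sup>2 * B" for t
  proof -
    have "0 \<le> expectation (\<lambda>x. (F x - t * H x)\<^sup>2)" by simp
    also have "(\<lambda>x. (F x - t * H x)\<^sup>2) = (\<lambda>x. (F x)\<^sup>2 - 2 * t * (F x * H x) + t\<^sup>2 * (H x)\<^sup>2)"
      by (auto simp: power2_eq_square algebra_simps)
    also have "expectation \<dots> = A - 2 * t * C + t\<^sup>2 * B"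
      unfolding A_def B_def C_def using iF iH iFH by simp
    finally show ?thesis .
  qed
  have "C\<^sup>2 \<le> A * B"
  proof (cases "B = 0")
    case True
    have "C = 0"
    proof (rule ccontr)
      assume "C \<noteq> 0"
      \<comment> \<open>At this point the quadratic, here linear, takes the value
        \<open>-1\<close>.\<close>
      then show False using q[of "(A + 1) / (2 * C)"] True A0 by simp
    qed
    then show ?thesis using A0 B0 by simp
  next
    case False
    then have "B > 0" using B0 by simp
    moreover from False have "A - 2 * (C / B) * C + (C / B)\<^sup>2 * B = A - C\<^sup>2 / B"
      by (simp add: field_simps power2_eq_square)
    \<comment> \<open>The minimiser of the quadratic is \<open>C / B\<close>.\<close>
    ultimately have "C\<^sup>2 / B \<le> A" using q[of "C / B"] by linarith
    then show ?thesis using \<open>B > 0\<close> by (simp add: pos_divide_le_eq)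
  qed
  then show ?thesis unfolding A_def B_def C_def .
qed

lemma (in prob_space) covariance_sq_le:
  fixes f g :: "'a \<Rightarrow> real"
  assumes f: "f \<in> borel_measurable M" "\<And>x. 0 \<le> f x" "\<And>x. f x \<le> 1"
    and g: "g \<in> borel_measurable M" "\<And>x. 0 \<le> g x" "\<And>x. g x \<le> 1"
  shows "(expectation (\<lambda>x. f x * g x) - expectation f * expectation g)\<^sup>2 \<le>
    expectation (\<lambda>x. (f x - expectation f)\<^sup>2) * expectation (\<lambda>x. (g x - expectation g)\<^sup>2)"
proof -
  have i: "integrable M f" "integrable M g" using f g by (auto intro: integrable_01)
  have ifg: "integrable M (\<lambda>x. f x * g x)"
    using f g by (intro integrable_01) (auto intro: mult_le_one)
  have bd: "0 \<le> expectation f" "expectation f \<le> 1" "0 \<le> expectation g" "expectation g \<le> 1"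
    using f g integral_le_const[OF i(1), of 1] integral_le_const[OF i(2), of 1] by auto
  have "expectation (\<lambda>x. (f x - expectation f) * (g x - expectation g)) =
    expectation (\<lambda>x. f x * g x - expectation g * f x - expectation f * g x + expectation f * expectation g)"
    by (simp add: algebra_simps)
  also have "\<dots> = expectation (\<lambda>x. f x * g x) - expectation f * expectation g"
    using i ifg by (simp add: prob_space)
  finally have e: "expectation (\<lambda>x. f x * g x) - expectation f * expectation g =
    expectation (\<lambda>x. (f x - expectation f) * (g x - expectation g))" by simp
  show ?thesis unfolding e
  proof (rule cauchy_schwarz_bounded)
    show "\<bar>f x - expectation f\<bar> \<le> 1" "\<bar>g x - expectation g\<bar> \<le> 1" for x
      using f(2,3)[of x] g(2,3)[of x] bd by auto
  qed (use f g in auto)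
qed

text \<open>Used at mean zero, where it forces the variance to vanish.\<close>

lemma (in prob_space) variance_le_mean:
  fixes f :: "'a \<Rightarrow> real"
  assumes f: "f \<in> borel_measurable M" "\<And>x. 0 \<le> f x" "\<And>x. f x \<le> 1"
  shows "expectation (\<lambda>x. (f x - expectation f)\<^sup>2) \<le> expectation f"
proof -
  have i: "integrable M f" using f by (auto intro: integrable_01)
  have i2: "integrable M (\<lambda>x. (f x)\<^sup>2)" using f by (intro integrable_01) (auto intro: power_le_one)
  have "expectation (\<lambda>x. (f x - expectation f)\<^sup>2) = expectation (\<lambda>x. (f x)\<^sup>2) - (expectation f)\<^sup>2"
    using i i2 by (rule variance_eq)
  also have "\<dots> \<le> expectation (\<lambda>x. (f x)\<^sup>2)" by simp
  also have "\<dots> \<le> expectation f"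
    by (rule integral_mono[OF i2 i]) (use f in \<open>auto simp: power2_eq_square mult_left_le_one_le\<close>)
  finally show ?thesis .
qed

text \<open>The function \<open>(u, v) \<mapsto> u\<^sup>2 / v\<close> is convex; the proof uses its tangent lines
  \<open>u\<^sup>2 / v \<ge> 2 c u - c\<^sup>2 v\<close>.\<close>

lemma (in prob_space) chi2_mixture:
  fixes f :: "'x \<Rightarrow> 'a \<Rightarrow> real"
  assumes f: "\<And>x. f x \<in> borel_measurable M" "\<And>x z. 0 \<le> f x z" "\<And>x z. f x z \<le> 1"
    and C: "AE z in M. z \<in> C" and fin: "finite F"
    and zero: "\<And>x z z'. x \<in> F \<Longrightarrow> z \<in> C \<Longrightarrow> z' \<in> C \<Longrightarrow> f x z' = 0 \<Longrightarrow> f x z = 0"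
    and chi: "\<And>z z'. z \<in> C \<Longrightarrow> z' \<in> C \<Longrightarrow> (\<Sum>x\<in>F. (f x z - f x z')\<^sup>2 / f x z') \<le> \<kappa>"
  shows "(\<Sum>x\<in>F. expectation (\<lambda>z. (f x z - expectation (f x))\<^sup>2) / expectation (f x)) \<le> \<kappa>"
proof -
  define m where "m = (\<lambda>x. expectation (f x))"
  have i: "integrable M (f x)" for x using f by (auto intro: integrable_01)
  have m0: "0 \<le> m x" "m x \<le> 1" for x unfolding m_def using f integral_le_const[OF i[of x], of 1] by auto
  have i2: "integrable M (\<lambda>z. (f x z - m x)\<^sup>2)" for x
  proof (rule integrable_const_bound[of _ 1])
    show "AE z in M. norm ((f x z - m x)\<^sup>2) \<le> 1"
    proof (rule AE_I2)
      fix z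
      have "\<bar>f x z - m x\<bar> \<le> 1" using f(2,3)[of x z] m0[of x] by (auto simp: abs_le_iff)
      then show "norm ((f x z - m x)\<^sup>2) \<le> 1" using power_le_one[of "\<bar>f x z - m x\<bar>" 2] by simp
    qed
  qed (use f in auto)
  have point: "(\<Sum>x\<in>F. (f x z - m x)\<^sup>2 / m x) \<le> \<kappa>" if z: "z \<in> C" for z
  proof -
    \<comment> \<open>The slope of the tangent that touches at \<open>u = f x z - m x\<close>,
      \<open>v = m x\<close>. There it gives the exact value; and since it is affine in
      \<open>f x z'\<close>, it can be averaged over \<open>z'\<close> before the inequality is
      applied.\<close>
    define c where "c = (\<lambda>x. (f x z - m x) / m x)"
    have "(\<Sum>x\<in>F. (f x z - m x)\<^sup>2 / m x) = (\<Sum>x\<in>F. 2 * c x * (f x z - m x) - (c x)\<^sup>2 * m x)"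
    proof (rule sum.cong[OF refl])
      fix x show "(f x z - m x)\<^sup>2 / m x = 2 * c x * (f x z - m x) - (c x)\<^sup>2 * m x"
        unfolding c_def by (cases "m x = 0") (auto simp: field_simps power2_eq_square)
    qed
    also have "\<dots> = expectation (\<lambda>z'. \<Sum>x\<in>F. 2 * c x * (f x z - f x z') - (c x)\<^sup>2 * f x z')"
      unfolding m_def using i by (simp add: prob_space)
    also have "\<dots> \<le> \<kappa>"
    proof (rule integral_le_const)
      show "integrable M (\<lambda>z'. \<Sum>x\<in>F. 2 * c x * (f x z - f x z') - (c x)\<^sup>2 * f x z')"
        using i by auto
      show "AE z' in M. (\<Sum>x\<in>F. 2 * c x * (f x z - f x z') - (c x)\<^sup>2 * f x z') \<le> \<kappa>"
        using C
      proof eventually_elim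
        case (elim z')
        have "(\<Sum>x\<in>F. 2 * c x * (f x z - f x z') - (c x)\<^sup>2 * f x z') \<le> (\<Sum>x\<in>F. (f x z - f x z')\<^sup>2 / f x z')"
        proof (rule sum_mono)
          fix x assume x: "x \<in> F"
          show "2 * c x * (f x z - f x z') - (c x)\<^sup>2 * f x z' \<le> (f x z - f x z')\<^sup>2 / f x z'"
          proof (cases "f x z' = 0")
            case True
            then show ?thesis using zero[OF x z elim] by simp
          next
            case False
            then have p: "f x z' > 0" using f(2)[of x z'] by simp
            have "0 \<le> ((f x z - f x z') - c x * f x z')\<^sup>2 / f x z'" using p by simp
            also have "\<dots> = (f x z - f x z')\<^sup>2 / f x z' - (2 * c x * (f x z - f x z') - (c x)\<^sup>2 * f x z')"
              using p by (simp add: field_simps power2_eq_square)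
            finally show ?thesis by simp
          qed
        qed
        also have "\<dots> \<le> \<kappa>" by (rule chi[OF z elim])
        finally show ?case .
      qed
    qed
    finally show ?thesis .
  qed
  have "(\<Sum>x\<in>F. expectation (\<lambda>z. (f x z - m x)\<^sup>2) / m x) = expectation (\<lambda>z. \<Sum>x\<in>F. (f x z - m x)\<^sup>2 / m x)"
    using i2 by simp
  also have "\<dots> \<le> \<kappa>"
    by (rule integral_le_const) (use i2 C point in \<open>auto elim: eventually_mono\<close>)
  finally show ?thesis unfolding m_def .
qed

section \<open>The averaged conditional laws\<close>

lemma space_ref [simp]: "space ref_measure = UNIV"
  unfolding ref_measure_def by (simp add: space_pair_measure)

lemma meas_X [measurable]: "X_of \<in> measurable ref_measure (count_space UNIV)"
  unfolding X_of_def ref_measure_def by measurable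

lemma meas_Y [measurable]: "Y_of \<in> measurable ref_measure (count_space UNIV)"
  unfolding Y_of_def ref_measure_def by measurable

lemma meas_Z [measurable]: "Z_of \<in> borel_measurable ref_measure"
  unfolding Z_of_def ref_measure_def by measurable

lemma meas_XY [measurable]: "XY_of \<in> measurable ref_measure (count_space UNIV)"
proof -
  have "XY_of -` {a} = {s \<in> space ref_measure. X_of s = fst a \<and> Y_of s = snd a}" for a
    by (auto simp: XY_of_def)
  moreover have "{s \<in> space ref_measure. X_of s = a \<and> Y_of s = b} \<in> sets ref_measure" for a b by measurable
  ultimately show ?thesis unfolding measurable_count_space_eq2_countable by simp
qed

section \<open>The partition of the unit interval\<close>

lemma cell_bounds: "z \<in> cell d m \<Longrightarrow> m \<in> {1..d} \<Longrightarrow> real (m - 1) \<le> z * real d \<and> z * real d \<le> real m"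
  unfolding cell_def by (auto simp: divide_simps split: if_splits)

lemma cell_subset: "m \<in> {1..d} \<Longrightarrow> cell d m \<subseteq> {0..1}"
proof
  fix z assume m: "m \<in> {1..d}" and z: "z \<in> cell d m"
  have "0 * real d \<le> z * real d" using cell_bounds[OF z m] m by auto
  moreover have "z * real d \<le> 1 * real d"
    using cell_bounds[OF z m] m by (metis atLeastAtMost_iff mult_1 of_nat_mono order_trans)
  moreover have "0 < real d" using m by simp
  ultimately have "0 \<le> z" "z \<le> 1" using mult_right_le_imp_le by blast+
  then show "z \<in> {0..1}" by simp
qed

lemma cell_diam:
  assumes "m \<in> {1..d}" "z \<in> cell d m" "z' \<in> cell d m" shows "\<bar>z - z'\<bar> \<le> 1 / real d"
proof -
  have "\<bar>z * real d - z' * real d\<bar> \<le> 1"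
    using cell_bounds[OF assms(2,1)] cell_bounds[OF assms(3,1)] assms(1) by (auto simp: of_nat_diff abs_le_iff)
  moreover have "\<bar>z * real d - z' * real d\<bar> = \<bar>z - z'\<bar> * real d" by (simp add: abs_mult left_diff_distrib[symmetric])
  moreover have "0 < real d" using assms(1) by simp
  ultimately show ?thesis by (simp add: pos_le_divide_eq)
qed

lemma cell_disjoint:
  assumes m: "m \<in> {1..d}" "m' \<in> {1..d}" and z: "z \<in> cell d m" "z \<in> cell d m'" shows "m = m'"
proof -
  have d: "0 < real d" using m by simp
  have *: "a = b" if "a \<in> {1..d}" "b \<in> {1..d}" "a < b" "z \<in> cell d a" "z \<in> cell d b" for a b
  proof -
    have "a \<noteq> d" using that by auto
    then have "z < real a / real d" using that(4) unfolding cell_def by auto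
    then have "z * real d < real a" using d by (simp add: pos_less_divide_eq)
    moreover have "real (b - 1) \<le> z * real d" using cell_bounds[OF that(5,2)] by simp
    moreover have "real a \<le> real (b - 1)" using that(3) by simp
    ultimately show ?thesis by linarith
  qed
  show ?thesis using *[of m m'] *[of m' m] m z by (cases m m' rule: linorder_cases) auto
qed

lemma cell_cover:
  assumes "1 \<le> d" "z \<in> {0..1}" shows "\<exists>m\<in>{1..d}. z \<in> cell d m"
proof (cases "z = 1")
  case True
  then show ?thesis using assms by (intro bexI[of _ d]) (auto simp: cell_def)
next
  case False
  have d: "0 < real d" using assms by simp
  define k where "k = nat \<lfloor>z * real d\<rfloor>"
  have z0: "0 \<le> z * real d" using assms by simp
  have zd: "z * real d < real d" using False assms by auto
  have k: "real k \<le> z * real d" "z * real d < real k + 1"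
    unfolding k_def using z0 by (simp_all add: of_nat_nat)
  have "k + 1 \<in> {1..d}" using k(1) zd by simp
  moreover have "z \<in> cell d (k + 1)"
    unfolding cell_def using k d by (auto simp: pos_divide_le_eq pos_less_divide_eq)
  ultimately show ?thesis by blast
qed

text \<open>The value outside \<open>[0, 1]\<close> is \<open>0\<close>, which labels no cell.\<close>

definition clabel :: "nat \<Rightarrow> real \<Rightarrow> nat" where
  "clabel d z = (\<Sum>m\<in>{1..d}. if z \<in> cell d m then m else 0)"

lemma clabel_eq: assumes "m \<in> {1..d}" shows "clabel d z = m \<longleftrightarrow> z \<in> cell d m"
proof
  show "clabel d z = m" if "z \<in> cell d m"
  proof -
    have "clabel d z = (\<Sum>k\<in>{m}. if z \<in> cell d k then k else 0)"
      unfolding clabel_def by (rule sum.mono_neutral_right) (use assms that cell_disjoint in auto)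
    then show ?thesis using that by simp
  qed
  show "z \<in> cell d m" if "clabel d z = m"
  proof (cases "\<exists>k\<in>{1..d}. z \<in> cell d k")
    case True
    then obtain k where k: "k \<in> {1..d}" "z \<in> cell d k" by auto
    have "clabel d z = (\<Sum>k\<in>{k}. if z \<in> cell d k then k else 0)"
      unfolding clabel_def by (rule sum.mono_neutral_right) (use k cell_disjoint in auto)
    then show ?thesis using that k by simp
  next
    case False
    then have "clabel d z = 0" unfolding clabel_def by (intro sum.neutral) auto
    then show ?thesis using that assms by simp
  qed
qed

lemma sets_cell [measurable]: "cell d m \<in> sets borel"
  unfolding cell_def by auto

lemma meas_clabel [measurable]: "clabel d \<in> measurable borel (count_space UNIV)"
  unfolding clabel_def by measurable

lemma distr_pmf_exists:
  fixes X :: "'a \<Rightarrow> 'b::countable"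
  assumes "prob_space M" and [measurable]: "X \<in> measurable M (count_space UNIV)"
  obtains r where "\<And>b. pmf r b = measure M {s \<in> space M. X s = b}"
proof -
  interpret prob_space M by fact
  interpret D: prob_space "distr M (count_space UNIV) X" by (rule prob_space_distr) simp
  define f where "f = (\<lambda>b. measure M {s \<in> space M. X s = b})"
  have e: "emeasure (distr M (count_space UNIV) X) {b} = ennreal (f b)" for b
    by (subst emeasure_distr) (auto simp: f_def emeasure_eq_measure vimage_def Int_def conj_commute intro!: arg_cong[of _ _ prob])
  have "(\<integral>\<^sup>+b. ennreal (f b) \<partial>count_space UNIV) = (\<integral>\<^sup>+b. emeasure (distr M (count_space UNIV) X) {b} \<partial>count_space UNIV)"
    unfolding e ..
  also have "\<dots> = emeasure (distr M (count_space UNIV) X) UNIV"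
    by (rule emeasure_countable_singleton[symmetric]) auto
  also have "\<dots> = 1" using D.emeasure_space_1 by simp
  finally have "pmf (embed_pmf f) b = f b" for b
    by (intro pmf_embed_pmf) (auto simp: f_def)
  then show ?thesis using that unfolding f_def by blast
qed

lemma (in prob_space) integral_uniform_measure:
  fixes f :: "'a \<Rightarrow> real"
  assumes A: "A \<in> sets M" "0 < prob A" and f: "f \<in> borel_measurable M"
  shows "integral\<^sup>L (uniform_measure M A) f = (\<integral>x\<in>A. f x \<partial>M) / prob A"
proof -
  have "uniform_measure M A = density M (\<lambda>x. ennreal (indicator A x / prob A))"
    unfolding uniform_measure_def
    by (rule arg_cong[of _ _ "density M"])
      (auto simp: fun_eq_iff indicator_def emeasure_eq_measure divide_ennreal[symmetric] A(2))
  also have "integral\<^sup>L \<dots> f = (\<integral>x. (indicator A x / prob A) *\<^sub>R f x \<partial>M)"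
    by (rule integral_density) (use A f in auto)
  also have "\<dots> = (\<integral>x. indicator A x *\<^sub>R f x / prob A \<partial>M)" by simp
  also have "\<dots> = (\<integral>x\<in>A. f x \<partial>M) / prob A" unfolding set_lebesgue_integral_def by simp
  finally show ?thesis .
qed

lemma pmf_map_on:
  assumes "set_pmf a \<subseteq> G" "finite G"
  shows "pmf (map_pmf h a) v = (\<Sum>g\<in>{g \<in> G. h g = v}. pmf a g)"
proof -
  have fsm: "finite (set_pmf (map_pmf h a))" using assms finite_subset by auto
  have "pmf (map_pmf h a) v = E_pmf (map_pmf h a) (\<lambda>z. of_bool (z = v) * 1)"
    using E_pmf_point[OF fsm, of v 1] by simp
  also have "\<dots> = (\<Sum>g\<in>G. pmf a g * of_bool (h g = v))"
    using E_pmf_on[of G a "\<lambda>g. of_bool (h g = v)"] assms by simp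
  also have "\<dots> = (\<Sum>g\<in>{g \<in> G. h g = v}. pmf a g)"
    unfolding sum.inter_filter[OF assms(2)] by (rule sum.cong) auto
  finally show ?thesis .
qed

section \<open>Conditional laws and their averages over the cells\<close>

locale eclass =
  fixes p :: "triple measure" and l1 l2 d :: nat
  assumes E: "p \<in> E_class l1 l2" and d: "1 \<le> d" and l1: "1 \<le> l1" and l2: "1 \<le> l2"
begin

abbreviation "G \<equiv> {1..l1} \<times> {1..l2}"
abbreviation "PZ \<equiv> Z_law p"

lemma prob_p: "prob_space p" and sets_p [measurable_cong]: "sets p = sets ref_measure"
  and AE_Z01: "AE z in PZ. z \<in> {0..1}"
  using E unfolding E_class_def by auto

sublocale p: prob_space p by (rule prob_p)

lemma space_p [simp]: "space p = UNIV"
  using sets_eq_imp_space_eq[OF sets_p] by simp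

lemma meas_p [measurable]: "X_of \<in> measurable p (count_space UNIV)" "Y_of \<in> measurable p (count_space UNIV)"
    "XY_of \<in> measurable p (count_space UNIV)" "Z_of \<in> borel_measurable p"
  unfolding measurable_cong_sets[OF sets_p refl] by (rule meas_X meas_Y meas_XY meas_Z)+

sublocale z: prob_space PZ
  unfolding Z_law_def by (rule p.prob_space_distr) simp

lemma sets_PZ [measurable_cong, simp]: "sets PZ = sets borel" unfolding Z_law_def by simp
lemma space_PZ [simp]: "space PZ = UNIV" unfolding Z_law_def by simp

lemma version_meas: "cond_version p f \<kappa> \<Longrightarrow> (\<lambda>z. pmf (\<kappa> z) w) \<in> borel_measurable PZ"
  unfolding cond_version_def by (simp add: measurable_cong_sets[OF sets_PZ refl])

lemma version_eq: "cond_version p f \<kappa> \<Longrightarrow> B \<in> sets borel \<Longrightarrow>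
    measure p {s. f s = w \<and> Z_of s \<in> B} = (\<integral>z\<in>B. pmf (\<kappa> z) w \<partial>PZ)"
  unfolding cond_version_def by simp

lemma version_int: "cond_version p f \<kappa> \<Longrightarrow> integrable PZ (\<lambda>z. pmf (\<kappa> z) w)"
  by (intro z.integrable_01 version_meas) (auto simp: pmf_le_1)

lemma set_int_sum:
  assumes "\<And>i. i \<in> I \<Longrightarrow> integrable PZ (f i)" "B \<in> sets borel"
  shows "(\<integral>z\<in>B. (\<Sum>i\<in>I. f i z) \<partial>PZ) = (\<Sum>i\<in>I. (\<integral>z\<in>B. f i z \<partial>PZ) :: real)"
  unfolding set_lebesgue_integral_def scaleR_sum_right
  by (rule Bochner_Integration.integral_sum, rule integrable_mult_indicator) (use assms in auto)

lemma AE_XY: "AE s in p. XY_of s \<in> G"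
proof -
  obtain \<kappa> where \<kappa>: "cond_version p XY_of \<kappa>" "AE z in PZ. set_pmf (\<kappa> z) \<subseteq> G"
    using E unfolding E_class_def by auto
  have "measure p {s. XY_of s \<in> G} = measure p (\<Union>g\<in>G. {s. XY_of s = g \<and> Z_of s \<in> UNIV})"
    by (rule arg_cong[of _ _ "measure p"]) auto
  also have "\<dots> = (\<Sum>g\<in>G. measure p {s. XY_of s = g \<and> Z_of s \<in> UNIV})"
  proof (rule p.finite_measure_finite_Union)
    show "(\<lambda>g. {s. XY_of s = g \<and> Z_of s \<in> UNIV}) ` G \<subseteq> sets p"
    proof safe
      fix a b :: nat
      have "{s \<in> space p. XY_of s = (a, b)} \<in> sets p" by measurable
      then show "{s. XY_of s = (a, b) \<and> Z_of s \<in> UNIV} \<in> sets p" by simp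
    qed
  qed (auto simp: disjoint_family_on_def)
  also have "\<dots> = (\<Sum>g\<in>G. \<integral>z\<in>UNIV. pmf (\<kappa> z) g \<partial>PZ)" by (intro sum.cong refl version_eq[OF \<kappa>(1)]) auto
  also have "\<dots> = (\<integral>z\<in>UNIV. (\<Sum>g\<in>G. pmf (\<kappa> z) g) \<partial>PZ)"
    by (rule set_int_sum[symmetric]) (use version_int[OF \<kappa>(1)] in auto)
  also have "\<dots> = (\<integral>z. (\<Sum>g\<in>G. pmf (\<kappa> z) g) \<partial>PZ)" unfolding set_lebesgue_integral_def by simp
  also have "\<dots> = (\<integral>z. 1 \<partial>PZ)"
  proof (rule integral_cong_AE)
    show "AE z in PZ. (\<Sum>g\<in>G. pmf (\<kappa> z) g) = 1"
      using \<kappa>(2) by eventually_elim (rule sum_pmf_eq_1, auto)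
  qed (use version_meas[OF \<kappa>(1)] in auto)
  also have "\<dots> = 1" using z.prob_space by simp
  finally have "p.prob {s. XY_of s \<in> G} = 1" .
  moreover have "XY_of -` G \<inter> space p \<in> sets p" by (rule measurable_sets[OF meas_p(3)]) simp
  then have "{s. XY_of s \<in> G} \<in> sets p" by (simp add: vimage_def)
  ultimately show ?thesis using p.AE_in_set_eq_1[of "{s. XY_of s \<in> G}"] by simp
qed

text \<open>The class provides the support condition for one version. Any two versions agree almost
  everywhere, and simultaneously at all points since these are countably many.\<close>

lemma version_supp:
  assumes "cond_version p XY_of \<kappa>"
  shows "AE z in PZ. set_pmf (\<kappa> z) \<subseteq> G"
proof -
  obtain \<kappa>' where \<kappa>': "cond_version p XY_of \<kappa>'" "AE z in PZ. set_pmf (\<kappa>' z) \<subseteq> G"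
    using E unfolding E_class_def by auto
  have "AE z in PZ. pmf (\<kappa> z) g = pmf (\<kappa>' z) g" for g
    by (rule density_unique_real) (use version_int[OF assms] version_int[OF \<kappa>'(1)] version_eq[OF assms, of _ g] version_eq[OF \<kappa>'(1), of _ g] in auto)
  then have "AE z in PZ. \<forall>g. pmf (\<kappa> z) g = pmf (\<kappa>' z) g" by (simp add: AE_all_countable)
  with \<kappa>'(2) show ?thesis
  proof eventually_elim
    case (elim z)
    have "\<kappa> z = \<kappa>' z" by (rule pmf_eqI) (rule elim(2)[rule_format])
    then show ?case using elim by simp
  qed
qed

text \<open>In \<open>P_chi2\<close> the versions of the conditional laws of X and of Y are chosen
  separately from the joint one that witnesses independence. This ties them together almost
  everywhere.\<close>

lemma marginal_version:
  assumes \<kappa>: "cond_version p XY_of \<kappa>" and \<kappa>f: "cond_version p f \<kappa>f"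
    and [measurable]: "f \<in> measurable p (count_space UNIV)" and fh: "\<And>s. f s = h (XY_of s)"
  shows "AE z in PZ. pmf (map_pmf h (\<kappa> z)) v = pmf (\<kappa>f z) v"
proof -
  let ?H = "{g \<in> G. h g = v}"
  have "AE z in PZ. (\<Sum>g\<in>?H. pmf (\<kappa> z) g) = pmf (\<kappa>f z) v"
  proof (rule density_unique_real)
    fix B assume "B \<in> sets PZ"
    then have B [measurable]: "B \<in> sets borel" by simp
    have sA: "{s. XY_of s = g \<and> Z_of s \<in> B} \<in> sets p" for g
    proof -
      have "{s \<in> space p. XY_of s = g \<and> Z_of s \<in> B} \<in> sets p" by measurable
      then show ?thesis by simp
    qed
    have sf: "{s. f s = v \<and> Z_of s \<in> B} \<in> sets p"
    proof -
      have "{s \<in> space p. f s = v \<and> Z_of s \<in> B} \<in> sets p" by measurable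
      then show ?thesis by simp
    qed
    have "(\<integral>z\<in>B. (\<Sum>g\<in>?H. pmf (\<kappa> z) g) \<partial>PZ) = (\<Sum>g\<in>?H. (\<integral>z\<in>B. pmf (\<kappa> z) g \<partial>PZ))"
      by (rule set_int_sum) (use version_int[OF \<kappa>] B in auto)
    also have "\<dots> = (\<Sum>g\<in>?H. measure p {s. XY_of s = g \<and> Z_of s \<in> B})"
      by (simp only: version_eq[OF \<kappa> B])
    also have "\<dots> = measure p (\<Union>g\<in>?H. {s. XY_of s = g \<and> Z_of s \<in> B})"
      by (rule p.finite_measure_finite_Union[symmetric]) (use sA in \<open>auto simp: disjoint_family_on_def\<close>)
    also have "\<dots> = measure p {s. f s = v \<and> Z_of s \<in> B}"
    proof (rule p.finite_measure_eq_AE)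
      show "AE s in p. s \<in> (\<Union>g\<in>?H. {s. XY_of s = g \<and> Z_of s \<in> B}) \<longleftrightarrow> s \<in> {s. f s = v \<and> Z_of s \<in> B}"
        using AE_XY by eventually_elim (auto simp: fh)
      have "finite ?H" by simp
      then show "(\<Union>g\<in>?H. {s. XY_of s = g \<and> Z_of s \<in> B}) \<in> sets p" using sA by blast
    qed (rule sf)
    also have "\<dots> = (\<integral>z\<in>B. pmf (\<kappa>f z) v \<partial>PZ)" by (rule version_eq[OF \<kappa>f B])
    finally show "(\<integral>z\<in>B. (\<Sum>g\<in>?H. pmf (\<kappa> z) g) \<partial>PZ) = (\<integral>z\<in>B. pmf (\<kappa>f z) v \<partial>PZ)" .
  qed (use version_int[OF \<kappa>] version_int[OF \<kappa>f] in auto)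
  with version_supp[OF \<kappa>] show ?thesis
    by eventually_elim (use pmf_map_on[of _ G h v] in simp)
qed

text \<open>The law of the cell label as a pmf; prescribing all point masses determines the
  choice.\<close>

definition "\<rho> = (SOME r. \<forall>m. pmf r m = measure p {s. clabel d (Z_of s) = m})"

lemma pmf_\<rho>: "pmf \<rho> m = measure p {s. clabel d (Z_of s) = m}"
proof -
  have "(\<lambda>s. clabel d (Z_of s)) \<in> measurable p (count_space UNIV)" by measurable
  from distr_pmf_exists[OF prob_p this]
  obtain r :: "nat pmf" where "\<And>m. pmf r m = measure p {s \<in> space p. clabel d (Z_of s) = m}"
    by blast
  then have "\<forall>m. pmf r m = measure p {s. clabel d (Z_of s) = m}" by simp
  then show ?thesis unfolding \<rho>_def by (rule someI[of "\<lambda>r. \<forall>m. pmf r m = measure p {s. clabel d (Z_of s) = m}", THEN spec])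
qed

lemma pmf_\<rho>_cell: assumes "m \<in> {1..d}" shows "pmf \<rho> m = measure PZ (cell d m)"
proof -
  have "measure PZ (cell d m) = measure p (Z_of -` cell d m \<inter> space p)"
    unfolding Z_law_def by (rule measure_distr) auto
  also have "Z_of -` cell d m \<inter> space p = {s. clabel d (Z_of s) = m}" using clabel_eq[OF assms] by auto
  finally show ?thesis unfolding pmf_\<rho> ..
qed

lemma AE_label: "AE z in PZ. clabel d z \<in> {1..d}"
  using AE_Z01
proof eventually_elim
  case (elim z)
  then obtain m where "m \<in> {1..d}" "z \<in> cell d m" using cell_cover[OF d] by blast
  then show ?case using clabel_eq[of m d z] by simp
qed

lemma set_\<rho>: "set_pmf \<rho> \<subseteq> {1..d}"
proof
  fix m assume m: "m \<in> set_pmf \<rho>"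
  have "AE s in p. clabel d (Z_of s) \<in> {1..d}"
    using AE_label unfolding Z_law_def by (subst (asm) AE_distr_iff) auto
  show "m \<in> {1..d}"
  proof (rule ccontr)
    assume "m \<notin> {1..d}"
    have "AE s in p. clabel d (Z_of s) \<noteq> m"
      using \<open>AE s in p. clabel d (Z_of s) \<in> {1..d}\<close>
      by eventually_elim (use \<open>m \<notin> {1..d}\<close> in auto)
    moreover have "{s \<in> space p. clabel d (Z_of s) = m} \<in> sets p" by measurable
    ultimately have "measure p {s. clabel d (Z_of s) = m} = 0"
      using p.prob_eq_0[of "{s. clabel d (Z_of s) = m}"] by simp
    then show False using m unfolding set_pmf_iff pmf_\<rho> by simp
  qed
qed

lemma ex_q: "\<exists>q. set_pmf q \<subseteq> G \<and> (\<forall>g. pmf \<rho> m * pmf q g = measure p {s. clabel d (Z_of s) = m \<and> XY_of s = g})"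
proof (cases "pmf \<rho> m = 0")
  case True
  have "measure p {s. clabel d (Z_of s) = m \<and> XY_of s = g} = 0" for g
  proof -
    have "{s \<in> space p. clabel d (Z_of s) = m} \<in> sets p" by measurable
    then have "measure p {s. clabel d (Z_of s) = m \<and> XY_of s = g} \<le> measure p {s. clabel d (Z_of s) = m}"
      by (intro p.finite_measure_mono) auto
    then show ?thesis using True unfolding pmf_\<rho> by (simp add: measure_le_0_iff)
  qed
  then show ?thesis using True l1 l2 by (intro exI[of _ "return_pmf (1, 1)"]) auto
next
  case False
  define A where "A = {s. clabel d (Z_of s) = m}"
  have "{s \<in> space p. clabel d (Z_of s) = m} \<in> sets p" by measurable
  then have A [measurable]: "A \<in> sets p" unfolding A_def by simp
  have pA: "p.prob A \<noteq> 0" using False unfolding pmf_\<rho> A_def by simp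
  have eA: "emeasure p A \<noteq> 0" "emeasure p A \<noteq> \<infinity>" using pA by (auto simp: p.emeasure_eq_measure)
  interpret u: prob_space "uniform_measure p A" by (rule prob_space_uniform_measure[OF eA])
  have "XY_of \<in> measurable (uniform_measure p A) (count_space UNIV)"
    using meas_p(3) by (simp cong: measurable_cong_sets)
  from distr_pmf_exists[OF u.prob_space_axioms this]
  obtain q :: "(nat \<times> nat) pmf" where "\<And>g. pmf q g = measure (uniform_measure p A) {s \<in> space (uniform_measure p A). XY_of s = g}"
    by blast
  then have q0: "pmf q g = measure (uniform_measure p A) {s. XY_of s = g}" for g by simp
  have S: "{s. XY_of s = g} \<in> sets p" for g
  proof -
    have "{s \<in> space p. XY_of s = g} \<in> sets p" by measurable
    then show ?thesis by simp
  qed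
  have q: "pmf q g = measure p (A \<inter> {s. XY_of s = g}) / measure p A" for g
    unfolding q0 using measure_uniform_measure[OF eA S] .
  have "set_pmf q \<subseteq> G"
  proof
    fix g assume g: "g \<in> set_pmf q"
    show "g \<in> G"
    proof (rule ccontr)
      assume "g \<notin> G"
      have "AE s in p. XY_of s \<noteq> g" using AE_XY by eventually_elim (use \<open>g \<notin> G\<close> in auto)
      then have "measure p {s. XY_of s = g} = 0" using p.prob_eq_0[OF S[of g]] by simp
      then have "measure p (A \<inter> {s. XY_of s = g}) = 0"
        using p.finite_measure_mono[of "A \<inter> {s. XY_of s = g}" "{s. XY_of s = g}"] S[of g] by (simp add: measure_le_0_iff)
      then show False using g q[of g] by (simp add: set_pmf_iff)
    qed
  qed
  moreover have "pmf \<rho> m * pmf q g = measure p {s. clabel d (Z_of s) = m \<and> XY_of s = g}" for g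
    unfolding q pmf_\<rho> A_def[symmetric] using pA by (simp add: A_def Collect_conj_eq)
  ultimately show ?thesis by blast
qed

text \<open>On a null cell this is an arbitrary law on the grid.\<close>

definition "q m = (SOME q. set_pmf q \<subseteq> G \<and> (\<forall>g. pmf \<rho> m * pmf q g = measure p {s. clabel d (Z_of s) = m \<and> XY_of s = g}))"

lemma q_spec: "set_pmf (q m) \<subseteq> G \<and>
    (\<forall>g. pmf \<rho> m * pmf (q m) g = measure p {s. clabel d (Z_of s) = m \<and> XY_of s = g})"
  unfolding q_def by (rule someI_ex[OF ex_q])

lemmas set_q = q_spec[THEN conjunct1] and pmf_q = q_spec[THEN conjunct2, rule_format]

abbreviation "\<nu> m \<equiv> uniform_measure PZ (cell d m)"

lemma heavy_cell: assumes "m \<in> set_pmf \<rho>" shows "m \<in> {1..d}" "0 < measure PZ (cell d m)" "prob_space (\<nu> m)"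
    "AE z in \<nu> m. z \<in> cell d m" "sets (\<nu> m) = sets borel"
proof -
  show m: "m \<in> {1..d}" using assms set_\<rho> by auto
  show w: "0 < measure PZ (cell d m)" using pmf_positive[OF assms] unfolding pmf_\<rho>_cell[OF m] .
  have e: "emeasure PZ (cell d m) \<noteq> 0" "emeasure PZ (cell d m) \<noteq> \<infinity>" using w by (auto simp: z.emeasure_eq_measure)
  show "prob_space (\<nu> m)" by (rule prob_space_uniform_measure[OF e])
  show "AE z in \<nu> m. z \<in> cell d m" by (rule AE_uniform_measureI) auto
qed simp

lemma AE_\<nu>: assumes "m \<in> set_pmf \<rho>" "AE z in PZ. P z" shows "AE z in \<nu> m. P z"
  by (rule AE_uniform_measureI) (use assms in \<open>auto elim: eventually_mono\<close>)

text \<open>The tower property: \<open>\<nu> m\<close> is the law of Z conditioned on the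
  cell.\<close>

lemma q_mixture:
  assumes m: "m \<in> set_pmf \<rho>" and \<kappa>: "cond_version p XY_of \<kappa>"
  shows "pmf (q m) g = integral\<^sup>L (\<nu> m) (\<lambda>z. pmf (\<kappa> z) g)"
proof -
  note h = heavy_cell[OF m]
  have "integral\<^sup>L (\<nu> m) (\<lambda>z. pmf (\<kappa> z) g) = (\<integral>z\<in>cell d m. pmf (\<kappa> z) g \<partial>PZ) / measure PZ (cell d m)"
    by (rule z.integral_uniform_measure) (use h version_meas[OF \<kappa>] in auto)
  also have "(\<integral>z\<in>cell d m. pmf (\<kappa> z) g \<partial>PZ) = measure p {s. XY_of s = g \<and> Z_of s \<in> cell d m}"
    by (rule version_eq[OF \<kappa>, symmetric]) simp
  also have "\<dots> = pmf \<rho> m * pmf (q m) g"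
    unfolding pmf_q using clabel_eq[OF h(1)] by (intro arg_cong[of _ _ "measure p"]) auto
  also have "\<dots> / measure PZ (cell d m) = pmf (q m) g"
    unfolding pmf_\<rho>_cell[OF h(1)] using h(2) by simp
  finally show ?thesis by simp
qed

lemma version_\<nu>_meas: "cond_version p f \<kappa> \<Longrightarrow> (\<lambda>z. pmf (\<kappa> z) w) \<in> borel_measurable (\<nu> m)"
  using version_meas by (simp cong: measurable_cong_sets)

lemma marginal_mixture:
  assumes m: "m \<in> set_pmf \<rho>" and \<kappa>: "cond_version p XY_of \<kappa>" and \<kappa>f: "cond_version p f \<kappa>f"
    and f: "f \<in> measurable p (count_space UNIV)" "\<And>s. f s = h (XY_of s)"
  shows "pmf (map_pmf h (q m)) v = integral\<^sup>L (\<nu> m) (\<lambda>z. pmf (\<kappa>f z) v)"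
proof -
  interpret n: prob_space "\<nu> m" by (rule heavy_cell(3)[OF m])
  let ?H = "{g \<in> G. h g = v}"
  have "pmf (map_pmf h (q m)) v = (\<Sum>g\<in>?H. pmf (q m) g)" by (rule pmf_map_on[OF set_q]) simp
  also have "\<dots> = integral\<^sup>L (\<nu> m) (\<lambda>z. \<Sum>g\<in>?H. pmf (\<kappa> z) g)"
    unfolding q_mixture[OF m \<kappa>]
    by (rule Bochner_Integration.integral_sum[symmetric], rule n.integrable_01[OF version_\<nu>_meas[OF \<kappa>]]) (auto simp: pmf_le_1)
  also have "\<dots> = integral\<^sup>L (\<nu> m) (\<lambda>z. pmf (\<kappa>f z) v)"
  proof (rule integral_cong_AE)
    show "AE z in \<nu> m. (\<Sum>g\<in>?H. pmf (\<kappa> z) g) = pmf (\<kappa>f z) v"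
      using AE_\<nu>[OF m version_supp[OF \<kappa>]] AE_\<nu>[OF m marginal_version[OF \<kappa> \<kappa>f f, of v]]
      by eventually_elim (use pmf_map_on[of _ G h v] in simp)
  qed (use version_\<nu>_meas[OF \<kappa>] version_\<nu>_meas[OF \<kappa>f] in auto)
  finally show ?thesis .
qed

lemma marginal_variance:
  fixes \<kappa>f :: "real \<Rightarrow> nat pmf"
  assumes m: "m \<in> set_pmf \<rho>" and \<kappa>f: "cond_version p f \<kappa>f" and L: "0 \<le> L" and F: "finite F"
    and chi: "\<And>z z'. z \<in> {0..1} \<Longrightarrow> z' \<in> {0..1} \<Longrightarrow>
      chi2_div (measure_pmf (\<kappa>f z)) (measure_pmf (\<kappa>f z')) \<le> ennreal (L * \<bar>z - z'\<bar>)"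
  defines "e \<equiv> \<lambda>v. integral\<^sup>L (\<nu> m) (\<lambda>z. pmf (\<kappa>f z) v)"
  shows "(\<Sum>v\<in>F. integral\<^sup>L (\<nu> m) (\<lambda>z. (pmf (\<kappa>f z) v - e v)\<^sup>2) / e v) \<le> L / real d"
    and "e v = 0 \<Longrightarrow> integral\<^sup>L (\<nu> m) (\<lambda>z. (pmf (\<kappa>f z) v - e v)\<^sup>2) = 0"
proof -
  interpret n: prob_space "\<nu> m" by (rule heavy_cell(3)[OF m])
  note h = heavy_cell[OF m]
  have c: "chi2_div (measure_pmf (\<kappa>f z)) (measure_pmf (\<kappa>f z')) \<le> ennreal (L * \<bar>z - z'\<bar>)" "0 \<le> L * \<bar>z - z'\<bar>"
    "L * \<bar>z - z'\<bar> \<le> L / real d"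
    if z: "z \<in> cell d m" "z' \<in> cell d m" for z z'
  proof -
    show "chi2_div (measure_pmf (\<kappa>f z)) (measure_pmf (\<kappa>f z')) \<le> ennreal (L * \<bar>z - z'\<bar>)"
      using cell_subset[OF h(1)] z by (intro chi) auto
    show "0 \<le> L * \<bar>z - z'\<bar>" using L by simp
    show "L * \<bar>z - z'\<bar> \<le> L / real d" using mult_left_mono[OF cell_diam[OF h(1) z] L] by simp
  qed
  show "(\<Sum>v\<in>F. integral\<^sup>L (\<nu> m) (\<lambda>z. (pmf (\<kappa>f z) v - e v)\<^sup>2) / e v) \<le> L / real d"
    unfolding e_def
  proof (rule n.chi2_mixture[OF version_\<nu>_meas[OF \<kappa>f] pmf_nonneg pmf_le_1 h(4) F])
    fix z z' assume z: "z \<in> cell d m" "z' \<in> cell d m"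
    show "pmf (\<kappa>f z) v = 0" if "pmf (\<kappa>f z') v = 0" for v
      by (rule chi2_div_pmf(1)[OF c(1,2)[OF z] that])
    show "(\<Sum>v\<in>F. (pmf (\<kappa>f z) v - pmf (\<kappa>f z') v)\<^sup>2 / pmf (\<kappa>f z') v) \<le> L / real d"
      by (rule order_trans[OF chi2_div_pmf(2)[OF c(1,2)[OF z] F] c(3)[OF z]])
  qed
  show "integral\<^sup>L (\<nu> m) (\<lambda>z. (pmf (\<kappa>f z) v - e v)\<^sup>2) = 0" if "e v = 0"
    using n.variance_le_mean[OF version_\<nu>_meas[OF \<kappa>f, of v]] that unfolding e_def
    by (intro antisym) (auto simp: pmf_le_1)
qed

lemma null_structure:
  assumes p: "p \<in> P_chi2 l1 l2 L" and L: "0 \<le> L"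
  obtains V V' :: "nat \<Rightarrow> nat \<Rightarrow> real" where
    "\<And>m x y. m \<in> set_pmf \<rho> \<Longrightarrow> (x, y) \<in> G \<Longrightarrow> (dev (q m) (x, y))\<^sup>2 \<le> V m x * V' m y"
    "\<And>m x. 0 \<le> V m x" "\<And>m y. 0 \<le> V' m y"
    "\<And>m x. m \<in> set_pmf \<rho> \<Longrightarrow> pmf (map_pmf fst (q m)) x = 0 \<Longrightarrow> V m x = 0"
    "\<And>m y. m \<in> set_pmf \<rho> \<Longrightarrow> pmf (map_pmf snd (q m)) y = 0 \<Longrightarrow> V' m y = 0"
    "\<And>m. m \<in> set_pmf \<rho> \<Longrightarrow> (\<Sum>x\<in>{1..l1}. V m x / pmf (map_pmf fst (q m)) x) \<le> L / real d"
    "\<And>m. m \<in> set_pmf \<rho> \<Longrightarrow> (\<Sum>y\<in>{1..l2}. V' m y / pmf (map_pmf snd (q m)) y) \<le> L / real d"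
proof -
  obtain \<kappa> where \<kappa>: "cond_version p XY_of \<kappa>"
    and prod: "AE z in PZ. \<kappa> z = pair_pmf (map_pmf fst (\<kappa> z)) (map_pmf snd (\<kappa> z))"
    using p unfolding P_chi2_def P_class_def by auto
  obtain \<kappa>X where \<kappa>X: "cond_version p X_of \<kappa>X" and chiX: "\<And>z z'. z \<in> {0..1} \<Longrightarrow> z' \<in> {0..1} \<Longrightarrow>
      chi2_div (measure_pmf (\<kappa>X z)) (measure_pmf (\<kappa>X z')) \<le> ennreal (L * \<bar>z - z'\<bar>)"
    using p unfolding P_chi2_def by auto
  obtain \<kappa>Y where \<kappa>Y: "cond_version p Y_of \<kappa>Y" and chiY: "\<And>z z'. z \<in> {0..1} \<Longrightarrow> z' \<in> {0..1} \<Longrightarrow>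
      chi2_div (measure_pmf (\<kappa>Y z)) (measure_pmf (\<kappa>Y z')) \<le> ennreal (L * \<bar>z - z'\<bar>)"
    using p unfolding P_chi2_def by auto
  have X: "X_of s = fst (XY_of s)" and Y: "Y_of s = snd (XY_of s)" for s unfolding XY_of_def by auto
  define f where "f = (\<lambda>x z. pmf (\<kappa>X z) x)"
  define g where "g = (\<lambda>y z. pmf (\<kappa>Y z) y)"
  \<comment> \<open>Variances over the cell. The deviation is a covariance over the cell, so the
    Cauchy-Schwarz inequality provides the product form that \<open>cell_mean_moment\<close>
    separates into X and Y.\<close>
  define V where "V = (\<lambda>m x. integral\<^sup>L (\<nu> m) (\<lambda>z. (f x z - integral\<^sup>L (\<nu> m) (f x))\<^sup>2))"
  define V' where "V' = (\<lambda>m y. integral\<^sup>L (\<nu> m) (\<lambda>z. (g y z - integral\<^sup>L (\<nu> m) (g y))\<^sup>2))"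
  have fm: "f x \<in> borel_measurable (\<nu> m)" "0 \<le> f x z" "f x z \<le> 1" for m x z
    using version_\<nu>_meas[OF \<kappa>X, of x] unfolding f_def by (auto simp: pmf_le_1)
  have gm: "g y \<in> borel_measurable (\<nu> m)" "0 \<le> g y z" "g y z \<le> 1" for m y z
    using version_\<nu>_meas[OF \<kappa>Y, of y] unfolding g_def by (auto simp: pmf_le_1)
  have AEp: "AE z in PZ. pmf (\<kappa> z) (x, y) = f x z * g y z" for x y
    using prod marginal_version[OF \<kappa> \<kappa>X meas_p(1) X, of x] marginal_version[OF \<kappa> \<kappa>Y meas_p(2) Y, of y]
  proof eventually_elim
    case (elim z)
    have "pmf (\<kappa> z) (x, y) = pmf (pair_pmf (map_pmf fst (\<kappa> z)) (map_pmf snd (\<kappa> z))) (x, y)" using elim(1) by simp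
    then show ?case unfolding pmf_pair elim(2,3) f_def g_def .
  qed
  have qf: "pmf (map_pmf fst (q m)) x = integral\<^sup>L (\<nu> m) (f x)" if "m \<in> set_pmf \<rho>" for m x
    unfolding f_def by (rule marginal_mixture[OF that \<kappa> \<kappa>X meas_p(1) X])
  have qg: "pmf (map_pmf snd (q m)) y = integral\<^sup>L (\<nu> m) (g y)" if "m \<in> set_pmf \<rho>" for m y
    unfolding g_def by (rule marginal_mixture[OF that \<kappa> \<kappa>Y meas_p(2) Y])
  show ?thesis
  proof (rule that[of V V'])
    fix m x y assume m: "m \<in> set_pmf \<rho>"
    interpret n: prob_space "\<nu> m" by (rule heavy_cell(3)[OF m])
    have "pmf (q m) (x, y) = integral\<^sup>L (\<nu> m) (\<lambda>z. f x z * g y z)"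
      unfolding q_mixture[OF m \<kappa>]
      by (rule integral_cong_AE) (use version_\<nu>_meas[OF \<kappa>] fm gm AE_\<nu>[OF m AEp] in auto)
    then have "dev (q m) (x, y) = integral\<^sup>L (\<nu> m) (\<lambda>z. f x z * g y z) - integral\<^sup>L (\<nu> m) (f x) * integral\<^sup>L (\<nu> m) (g y)"
      unfolding dev_def prod_marg_def by (simp add: pmf_pair qf[OF m] qg[OF m])
    then show "(dev (q m) (x, y))\<^sup>2 \<le> V m x * V' m y"
      unfolding V_def V'_def using n.covariance_sq_le[of "f x" "g y"] fm gm by simp
  next
    show "0 \<le> V m x" "0 \<le> V' m x" for m x unfolding V_def V'_def by auto
  next
    fix m x assume m: "m \<in> set_pmf \<rho>"
    show "V m x = 0" if "pmf (map_pmf fst (q m)) x = 0"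
      using marginal_variance(2)[OF m \<kappa>X L finite_atLeastAtMost[of 1 l1] chiX, of x] that
      unfolding qf[OF m] V_def f_def by blast
    show "V' m x = 0" if "pmf (map_pmf snd (q m)) x = 0"
      using marginal_variance(2)[OF m \<kappa>Y L finite_atLeastAtMost[of 1 l2] chiY, of x] that
      unfolding qg[OF m] V'_def g_def by blast
    show "(\<Sum>x\<in>{1..l1}. V m x / pmf (map_pmf fst (q m)) x) \<le> L / real d"
      using marginal_variance(1)[OF m \<kappa>X L finite_atLeastAtMost[of 1 l1] chiX]
      unfolding qf[OF m] V_def f_def by blast
    show "(\<Sum>y\<in>{1..l2}. V' m y / pmf (map_pmf snd (q m)) y) \<le> L / real d"
      using marginal_variance(1)[OF m \<kappa>Y L finite_atLeastAtMost[of 1 l2] chiY]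
      unfolding qg[OF m] V'_def g_def by blast
  qed
qed

end

section \<open>Comparison with a cellwise product law\<close>

lemma nn_integral_ref:
  assumes f: "f \<in> borel_measurable ref_measure"
  shows "integral\<^sup>N ref_measure f = (\<integral>\<^sup>+x. \<integral>\<^sup>+y. \<integral>\<^sup>+z. f (x, y, z) \<partial>lborel \<partial>count_space UNIV \<partial>count_space UNIV)"
proof -
  interpret c: sigma_finite_measure "count_space (UNIV :: nat set)" by (rule sigma_finite_measure_count_space)
  interpret cl: pair_sigma_finite "count_space (UNIV :: nat set)" "lborel :: real measure" ..
  have f': "f \<in> borel_measurable (count_space UNIV \<Otimes>\<^sub>M (count_space UNIV \<Otimes>\<^sub>M lborel))"
    using f unfolding ref_measure_def .
  have o: "integral\<^sup>N ref_measure f =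
    (\<integral>\<^sup>+x. \<integral>\<^sup>+w. f (x, w) \<partial>(count_space UNIV \<Otimes>\<^sub>M lborel) \<partial>count_space UNIV)"
    unfolding ref_measure_def by (rule sigma_finite_measure.nn_integral_fst[OF cl.sigma_finite_measure_axioms f', symmetric])
  have i: "(\<integral>\<^sup>+w. f (x, w) \<partial>(count_space UNIV \<Otimes>\<^sub>M lborel)) = (\<integral>\<^sup>+y. \<integral>\<^sup>+z. f (x, y, z) \<partial>lborel \<partial>count_space UNIV)" for x
    using lborel.nn_integral_fst[of "\<lambda>w. f (x, w)" "count_space UNIV"] f' by simp
  show ?thesis unfolding o i ..
qed

lemma sigma_finite_ref: "sigma_finite_measure ref_measure"
proof -
  interpret c: sigma_finite_measure "count_space (UNIV :: nat set)" by (rule sigma_finite_measure_count_space)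
  interpret cl: pair_sigma_finite "count_space (UNIV :: nat set)" "lborel :: real measure" ..
  interpret s: sigma_finite_measure "count_space (UNIV :: nat set) \<Otimes>\<^sub>M (lborel :: real measure)"
    by (rule cl.sigma_finite_measure_axioms)
  interpret r: pair_sigma_finite "count_space (UNIV :: nat set)" "count_space (UNIV :: nat set) \<Otimes>\<^sub>M (lborel :: real measure)" ..
  show ?thesis unfolding ref_measure_def by (rule r.sigma_finite_measure_axioms)
qed

context eclass
begin

section \<open>Laws given by a kernel and the density of Z\<close>

definition "Z_density = RN_deriv lborel PZ"

lemma Z_density_meas [measurable]: "Z_density \<in> borel_measurable borel"
  unfolding Z_density_def using borel_measurable_RN_deriv[of lborel PZ] by simp

lemma PZ_density: "PZ = density lborel Z_density"
  unfolding Z_density_def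
  by (rule sigma_finite_measure.density_RN_deriv[OF sigma_finite_lborel, symmetric]) (use E in \<open>auto simp: E_class_def\<close>)

lemma nn_integral_PZ: "f \<in> borel_measurable borel \<Longrightarrow> integral\<^sup>N PZ f = (\<integral>\<^sup>+z. Z_density z * f z \<partial>lborel)"
  by (subst PZ_density) (rule nn_integral_density, auto)

text \<open>Real-valued coefficients are allowed so that both conditional laws and absolute
  differences of two of them can be inserted. The sum over the grid makes the function vanish off
  the grid.\<close>

definition kernel_density :: "(real \<Rightarrow> nat \<times> nat \<Rightarrow> real) \<Rightarrow> triple \<Rightarrow> real" where
  "kernel_density c s = (\<Sum>g\<in>G. of_bool (XY_of s = g) * c (Z_of s) g)"

lemma kernel_density_eq: "g \<in> G \<Longrightarrow> kernel_density c (fst g, snd g, z) = c z g"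
proof -
  assume g: "g \<in> G"
  have "kernel_density c (fst g, snd g, z) = (\<Sum>h\<in>{g}. of_bool (g = h) * c z h)"
    unfolding kernel_density_def XY_of_def X_of_def Y_of_def Z_of_def fst_conv snd_conv prod.collapse
    by (rule sum.mono_neutral_right) (use g in auto)
  then show ?thesis by simp
qed

lemma kernel_density_out: "XY_of s \<notin> G \<Longrightarrow> kernel_density c s = 0"
  unfolding kernel_density_def by (rule sum.neutral) auto

lemma kernel_density_meas:
  assumes "\<And>g. (\<lambda>z. c z g) \<in> borel_measurable borel"
  shows "kernel_density c \<in> borel_measurable ref_measure"
  unfolding kernel_density_def
proof (rule borel_measurable_sum)
  fix g
  have [measurable]: "(\<lambda>z. c z g) \<in> borel_measurable borel" by (rule assms)
  have "{s \<in> space ref_measure. XY_of s = g} \<in> sets ref_measure" by measurable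
  then have [measurable]: "Measurable.pred ref_measure (\<lambda>s. XY_of s = g)" by (simp add: pred_def)
  show "(\<lambda>s. of_bool (XY_of s = g) * c (Z_of s) g) \<in> borel_measurable ref_measure"
    unfolding of_bool_def by measurable
qed

lemma section_meas: "S \<in> sets ref_measure \<Longrightarrow> {z. (x, y, z) \<in> S} \<in> sets borel"
proof -
  assume S: "S \<in> sets ref_measure"
  have "(\<lambda>z. (x, y, z)) \<in> measurable borel ref_measure"
    unfolding ref_measure_def by measurable
  from measurable_sets[OF this S] show ?thesis by (simp add: vimage_def)
qed

text \<open>Tonelli's theorem on the product structure of \<open>ref_measure\<close>; the discrete
  integrals are finite sums because the density vanishes off the grid.\<close>

lemma nn_integral_slices:
  assumes c: "\<And>g. (\<lambda>z. c z g) \<in> borel_measurable borel" and c0: "\<And>z g. 0 \<le> c z g" and S: "S \<in> sets ref_measure"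
  shows "(\<integral>\<^sup>+s. ennreal (kernel_density c s) * Z_density (Z_of s) * indicator S s \<partial>ref_measure) =
    (\<Sum>g\<in>G. \<integral>\<^sup>+z. ennreal (c z g) * indicator {z. (fst g, snd g, z) \<in> S} z \<partial>PZ)"
proof -
  let ?f = "\<lambda>s. ennreal (kernel_density c s) * Z_density (Z_of s) * indicator S s"
  have [measurable]: "kernel_density c \<in> borel_measurable ref_measure" by (rule kernel_density_meas[OF c])
  have f: "?f \<in> borel_measurable ref_measure" using S by measurable
  have out: "?f (x, y, z) = 0" if "(x, y) \<notin> G" for x y z
    using that by (subst kernel_density_out) (auto simp: XY_of_def X_of_def Y_of_def)
  have "integral\<^sup>N ref_measure ?f = (\<integral>\<^sup>+x. \<integral>\<^sup>+y. \<integral>\<^sup>+z. ?f (x, y, z) \<partial>lborel \<partial>count_space UNIV \<partial>count_space UNIV)"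
    by (rule nn_integral_ref[OF f])
  also have "\<dots> = (\<Sum>x\<in>{1..l1}. \<integral>\<^sup>+y. \<integral>\<^sup>+z. ?f (x, y, z) \<partial>lborel \<partial>count_space UNIV)"
  proof (rule nn_integral_count_space')
    fix x assume "x \<notin> {1..l1}"
    then have z: "?f (x, y, z) = 0" for y z by (intro out) auto
    show "(\<integral>\<^sup>+y. \<integral>\<^sup>+z. ?f (x, y, z) \<partial>lborel \<partial>count_space UNIV) = 0" unfolding z by simp
  qed auto
  also have "\<dots> = (\<Sum>x\<in>{1..l1}. \<Sum>y\<in>{1..l2}. \<integral>\<^sup>+z. ?f (x, y, z) \<partial>lborel)"
  proof (rule sum.cong[OF refl], rule nn_integral_count_space')
    fix x y assume "y \<notin> {1..l2}"
    then have z: "?f (x, y, z) = 0" for z by (intro out) auto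
    show "(\<integral>\<^sup>+z. ?f (x, y, z) \<partial>lborel) = 0" unfolding z by simp
  qed auto
  also have "\<dots> = (\<Sum>g\<in>G. \<integral>\<^sup>+z. ?f (fst g, snd g, z) \<partial>lborel)"
    by (simp add: sum.cartesian_product case_prod_unfold)
  also have "\<dots> = (\<Sum>g\<in>G. \<integral>\<^sup>+z. ennreal (c z g) * indicator {z. (fst g, snd g, z) \<in> S} z \<partial>PZ)"
  proof (rule sum.cong[OF refl])
    fix g assume g: "g \<in> G"
    have [measurable]: "(\<lambda>z. c z g) \<in> borel_measurable borel" "{z. (fst g, snd g, z) \<in> S} \<in> sets borel"
      using c section_meas[OF S] by auto
    have "(\<integral>\<^sup>+z. ?f (fst g, snd g, z) \<partial>lborel) =
      (\<integral>\<^sup>+z. Z_density z * (ennreal (c z g) * indicator {z. (fst g, snd g, z) \<in> S} z) \<partial>lborel)"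
      by (rule nn_integral_cong) (simp add: kernel_density_eq[OF g] Z_of_def indicator_def mult_ac)
    also have "\<dots> = (\<integral>\<^sup>+z. ennreal (c z g) * indicator {z. (fst g, snd g, z) \<in> S} z \<partial>PZ)"
      by (rule nn_integral_PZ[symmetric]) measurable
    finally show "(\<integral>\<^sup>+z. ?f (fst g, snd g, z) \<partial>lborel) =
      (\<integral>\<^sup>+z. ennreal (c z g) * indicator {z. (fst g, snd g, z) \<in> S} z \<partial>PZ)" .
  qed
  finally show ?thesis .
qed

text \<open>The given law and its comparison law both have this form with the same factor
  \<open>Z_density\<close>, which reduces their distance to an integral over Z of distances on the
  grid.\<close>

definition kernel_law :: "(real \<Rightarrow> (nat \<times> nat) pmf) \<Rightarrow> triple measure" where
  "kernel_law \<kappa> = density ref_measure (\<lambda>s. ennreal (kernel_density (\<lambda>z. pmf (\<kappa> z)) s) * Z_density (Z_of s))"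

lemma sets_kernel_law [simp, measurable_cong]: "sets (kernel_law \<kappa>) = sets ref_measure"
  unfolding kernel_law_def by simp

lemma dens_meas:
  assumes "\<And>g. (\<lambda>z. pmf (\<kappa> z) g) \<in> borel_measurable borel"
  shows "(\<lambda>s. ennreal (kernel_density (\<lambda>z. pmf (\<kappa> z)) s) * Z_density (Z_of s)) \<in> borel_measurable ref_measure"
proof -
  have [measurable]: "kernel_density (\<lambda>z. pmf (\<kappa> z)) \<in> borel_measurable ref_measure" by (rule kernel_density_meas[OF assms])
  show ?thesis by measurable
qed

lemma emeasure_kernel_law:
  assumes \<kappa>: "\<And>g. (\<lambda>z. pmf (\<kappa> z) g) \<in> borel_measurable borel" and S: "S \<in> sets ref_measure"
  shows "emeasure (kernel_law \<kappa>) S = (\<Sum>g\<in>G. \<integral>\<^sup>+z. ennreal (pmf (\<kappa> z) g) * indicator {z. (fst g, snd g, z) \<in> S} z \<partial>PZ)"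
  unfolding kernel_law_def
  by (subst emeasure_density[OF dens_meas[OF \<kappa>] S]) (rule nn_integral_slices[OF \<kappa> _ S], simp)

lemma set_integral_pmf:
  assumes \<kappa>: "(\<lambda>z. pmf (\<kappa> z) g) \<in> borel_measurable borel" and B: "B \<in> sets borel"
  shows "(\<integral>\<^sup>+z. ennreal (pmf (\<kappa> z) g) * indicator B z \<partial>PZ) = ennreal (\<integral>z\<in>B. pmf (\<kappa> z) g \<partial>PZ)"
proof -
  have [measurable]: "(\<lambda>z. pmf (\<kappa> z) g) \<in> borel_measurable borel" by fact
  have "integrable PZ (\<lambda>z. indicator B z *\<^sub>R pmf (\<kappa> z) g)"
    by (rule z.integrable_01) (use B in \<open>auto simp: indicator_def pmf_le_1\<close>)
  then have "(\<integral>\<^sup>+z. ennreal (indicator B z *\<^sub>R pmf (\<kappa> z) g) \<partial>PZ) = ennreal (\<integral>z\<in>B. pmf (\<kappa> z) g \<partial>PZ)"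
    unfolding set_lebesgue_integral_def by (rule nn_integral_eq_integral) auto
  moreover have "(\<integral>\<^sup>+z. ennreal (pmf (\<kappa> z) g) * indicator B z \<partial>PZ) =
      (\<integral>\<^sup>+z. ennreal (indicator B z *\<^sub>R pmf (\<kappa> z) g) \<partial>PZ)"
    by (rule nn_integral_cong) (simp split: split_indicator)
  ultimately show ?thesis by simp
qed

lemma version_borel: "cond_version p f \<kappa> \<Longrightarrow> (\<lambda>z. pmf (\<kappa> z) w) \<in> borel_measurable borel"
  unfolding cond_version_def by simp

text \<open>Up to a null set, \<open>S\<close> is the disjoint union over the grid points of events
  that fix the pair and restrict Z to a section of \<open>S\<close>. The defining identity of a
  version evaluates each of them.\<close>

lemma p_eq_kernel_law:
  assumes \<kappa>: "cond_version p XY_of \<kappa>"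
  shows "p = kernel_law \<kappa>"
proof (rule measure_eqI)
  fix S assume S': "S \<in> sets p"
  then have S: "S \<in> sets ref_measure" using sets_p by simp
  have sg: "{s. XY_of s = g \<and> Z_of s \<in> {z. (fst g, snd g, z) \<in> S}} \<in> sets p" for g
  proof -
    have "{s \<in> space p. XY_of s = g} \<in> sets p" by measurable
    then have "{s. XY_of s = g} \<inter> S \<in> sets p" using S' by auto
    also have "{s. XY_of s = g} \<inter> S = {s. XY_of s = g \<and> Z_of s \<in> {z. (fst g, snd g, z) \<in> S}}"
      by (auto simp: XY_of_def X_of_def Y_of_def Z_of_def)
    finally show ?thesis .
  qed
  have "emeasure p S = emeasure p (\<Union>g\<in>G. {s. XY_of s = g \<and> Z_of s \<in> {z. (fst g, snd g, z) \<in> S}})"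
  proof (rule emeasure_eq_AE)
    show "AE s in p. s \<in> S \<longleftrightarrow> s \<in> (\<Union>g\<in>G. {s. XY_of s = g \<and> Z_of s \<in> {z. (fst g, snd g, z) \<in> S}})"
      using AE_XY
    proof eventually_elim
      case (elim s)
      obtain x y z where s: "s = (x, y, z)" by (metis prod_cases3)
      show ?case using elim unfolding s by (auto simp: XY_of_def X_of_def Y_of_def Z_of_def)
    qed
  qed (use S' sg in auto)
  also have "\<dots> = (\<Sum>g\<in>G. emeasure p {s. XY_of s = g \<and> Z_of s \<in> {z. (fst g, snd g, z) \<in> S}})"
    by (rule sum_emeasure[symmetric]) (use sg in \<open>auto simp: disjoint_family_on_def\<close>)
  also have "\<dots> = (\<Sum>g\<in>G. \<integral>\<^sup>+z. ennreal (pmf (\<kappa> z) g) * indicator {z. (fst g, snd g, z) \<in> S} z \<partial>PZ)"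
  proof (rule sum.cong[OF refl])
    fix g
    have B: "{z. (fst g, snd g, z) \<in> S} \<in> sets borel" by (rule section_meas[OF S])
    show "emeasure p {s. XY_of s = g \<and> Z_of s \<in> {z. (fst g, snd g, z) \<in> S}} =
      (\<integral>\<^sup>+z. ennreal (pmf (\<kappa> z) g) * indicator {z. (fst g, snd g, z) \<in> S} z \<partial>PZ)"
      unfolding set_integral_pmf[OF version_borel[OF \<kappa>] B] version_eq[OF \<kappa> B, symmetric] p.emeasure_eq_measure ..
  qed
  also have "\<dots> = emeasure (kernel_law \<kappa>) S" by (rule emeasure_kernel_law[OF version_borel[OF \<kappa>] S, symmetric])
  finally show "emeasure p S = emeasure (kernel_law \<kappa>) S" .
qed (simp add: sets_p)

text \<open>Both derivatives are kernel densities times \<open>Z_density\<close>, almost everywhere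
  by uniqueness. The difference of the kernel densities is bounded pointwise, and the slices are
  then integrated.\<close>

lemma l1_dist_kernel_law_le:
  assumes \<kappa>: "\<And>g. (\<lambda>z. pmf (\<kappa> z) g) \<in> borel_measurable borel" and \<kappa>': "\<And>g. (\<lambda>z. pmf (\<kappa>' z) g) \<in> borel_measurable borel"
  shows "l1_dist ref_measure (kernel_law \<kappa>) (kernel_law \<kappa>') \<le> (\<integral>z. (\<Sum>g\<in>G. \<bar>pmf (\<kappa> z) g - pmf (\<kappa>' z) g\<bar>) \<partial>PZ)"
proof -
  interpret R: sigma_finite_measure ref_measure by (rule sigma_finite_ref)
  let ?a = "kernel_density (\<lambda>z. pmf (\<kappa> z))" and ?b = "kernel_density (\<lambda>z. pmf (\<kappa>' z))"
  let ?c = "\<lambda>z g. \<bar>pmf (\<kappa> z) g - pmf (\<kappa>' z) g\<bar>"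
  have [measurable]: "(\<lambda>z. pmf (\<kappa> z) g) \<in> borel_measurable borel" "(\<lambda>z. pmf (\<kappa>' z) g) \<in> borel_measurable borel" for g
    by (rule \<kappa> \<kappa>')+
  have RN: "AE s in ref_measure. ennreal (?a s) * Z_density (Z_of s) = RN_deriv ref_measure (kernel_law \<kappa>) s"
    "AE s in ref_measure. ennreal (?b s) * Z_density (Z_of s) = RN_deriv ref_measure (kernel_law \<kappa>') s"
    unfolding kernel_law_def by (rule R.RN_deriv_unique[OF dens_meas[OF \<kappa>] refl] R.RN_deriv_unique[OF dens_meas[OF \<kappa>'] refl])+
  have kd0: "0 \<le> ?a s" "0 \<le> ?b s" for s unfolding kernel_density_def by (auto intro!: sum_nonneg)
  have "l1_dist ref_measure (kernel_law \<kappa>) (kernel_law \<kappa>') = enn2real (\<integral>\<^sup>+s. ennreal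
    \<bar>enn2real (RN_deriv ref_measure (kernel_law \<kappa>) s) - enn2real (RN_deriv ref_measure (kernel_law \<kappa>') s)\<bar> \<partial>ref_measure)"
    unfolding l1_dist_def by (rule integral_eq_nn_integral) auto
  also have "\<dots> \<le> enn2real (ennreal (\<integral>z. (\<Sum>g\<in>G. ?c z g) \<partial>PZ))"
  proof (rule enn2real_mono)
    have "(\<integral>\<^sup>+s. ennreal \<bar>enn2real (RN_deriv ref_measure (kernel_law \<kappa>) s) - enn2real (RN_deriv ref_measure (kernel_law \<kappa>') s)\<bar> \<partial>ref_measure)
      \<le> (\<integral>\<^sup>+s. ennreal (kernel_density ?c s) * Z_density (Z_of s) * indicator UNIV s \<partial>ref_measure)"
    proof (rule nn_integral_mono_AE)
      show "AE s in ref_measure. ennreal \<bar>enn2real (RN_deriv ref_measure (kernel_law \<kappa>) s) - enn2real (RN_deriv ref_measure (kernel_law \<kappa>') s)\<bar>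
        \<le> ennreal (kernel_density ?c s) * Z_density (Z_of s) * indicator UNIV s"
        using RN
      proof eventually_elim
        case (elim s)
        define e where "e = enn2real (Z_density (Z_of s))"
        have e0: "0 \<le> e" unfolding e_def by simp
        \<comment> \<open>Only an inequality holds, as \<open>enn2real\<close> sends an infinite
          density to 0.\<close>
        have ed: "ennreal e \<le> Z_density (Z_of s)" unfolding e_def by (cases "Z_density (Z_of s)") auto
        have "\<bar>enn2real (RN_deriv ref_measure (kernel_law \<kappa>) s) - enn2real (RN_deriv ref_measure (kernel_law \<kappa>') s)\<bar> = \<bar>?a s * e - ?b s * e\<bar>"
          unfolding elim[symmetric] e_def using kd0[of s] by (simp add: enn2real_mult)
        also have "\<dots> = \<bar>?a s - ?b s\<bar> * e" using e0 by (simp add: left_diff_distrib[symmetric] abs_mult)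
        also have "\<bar>?a s - ?b s\<bar> \<le> kernel_density ?c s"
          unfolding kernel_density_def sum_subtractf[symmetric] by (rule order_trans[OF sum_abs], rule sum_mono) (auto simp: of_bool_def)
        finally have "\<bar>enn2real (RN_deriv ref_measure (kernel_law \<kappa>) s) - enn2real (RN_deriv ref_measure (kernel_law \<kappa>') s)\<bar> \<le> kernel_density ?c s * e"
          using e0 by (simp add: mult_right_mono)
        then have "ennreal \<bar>enn2real (RN_deriv ref_measure (kernel_law \<kappa>) s) - enn2real (RN_deriv ref_measure (kernel_law \<kappa>') s)\<bar> \<le> ennreal (kernel_density ?c s * e)"
          by (rule ennreal_leI)
        also have "\<dots> = ennreal (kernel_density ?c s) * ennreal e"
          by (rule ennreal_mult) (use e0 in \<open>auto simp: kernel_density_def intro!: sum_nonneg\<close>)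
        also have "\<dots> \<le> ennreal (kernel_density ?c s) * Z_density (Z_of s)" by (rule mult_left_mono[OF ed]) simp
        finally show ?case by simp
      qed
    qed
    also have "\<dots> = (\<Sum>g\<in>G. \<integral>\<^sup>+z. ennreal (?c z g) * indicator {z. (fst g, snd g, z) \<in> UNIV} z \<partial>PZ)"
      by (rule nn_integral_slices) (use sets.top[of ref_measure] in auto)
    also have "\<dots> = (\<integral>\<^sup>+z. (\<Sum>g\<in>G. ennreal (?c z g)) \<partial>PZ)"
      by (subst nn_integral_sum) auto
    also have "\<dots> = (\<integral>\<^sup>+z. ennreal (\<Sum>g\<in>G. ?c z g) \<partial>PZ)" by (simp add: sum_ennreal)
    also have "\<dots> = ennreal (\<integral>z. (\<Sum>g\<in>G. ?c z g) \<partial>PZ)"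
    proof (rule nn_integral_eq_integral)
      have "integrable PZ (\<lambda>z. ?c z g)" for g
        by (intro integrable_abs Bochner_Integration.integrable_diff z.integrable_01) (auto simp: pmf_le_1)
      then show "integrable PZ (\<lambda>z. \<Sum>g\<in>G. ?c z g)" by auto
    qed (auto intro!: AE_I2 sum_nonneg)
    finally show "(\<integral>\<^sup>+s. ennreal \<bar>enn2real (RN_deriv ref_measure (kernel_law \<kappa>) s) - enn2real (RN_deriv ref_measure (kernel_law \<kappa>') s)\<bar> \<partial>ref_measure)
      \<le> ennreal (\<integral>z. (\<Sum>g\<in>G. ?c z g) \<partial>PZ)" .
  qed simp
  also have "\<dots> = (\<integral>z. (\<Sum>g\<in>G. ?c z g) \<partial>PZ)" by (auto intro!: integral_nonneg_AE AE_I2 sum_nonneg)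
  finally show ?thesis .
qed

text \<open>The kernel of the comparison law. Outside the unit interval the label is 0, and
  \<open>q 0\<close> is still a law on the grid, so \<open>\<kappa>prod_supp\<close> holds at every
  point.\<close>

definition "\<kappa>prod z = prod_marg (q (clabel d z))"

lemma \<kappa>prod_meas: "(\<lambda>z. pmf (\<kappa>prod z) g) \<in> borel_measurable borel"
proof -
  have "(\<lambda>m. pmf (prod_marg (q m)) g) \<in> borel_measurable (count_space UNIV)" by simp
  from measurable_compose[OF meas_clabel[of d] this] show ?thesis unfolding \<kappa>prod_def .
qed

lemma \<kappa>prod_supp: "set_pmf (\<kappa>prod z) \<subseteq> G"
  unfolding \<kappa>prod_def prod_marg_def using set_q[of "clabel d z"] by auto

lemma emeasure_kernel_law_prod_Z:
  assumes B: "B \<in> sets borel"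
  shows "emeasure (kernel_law \<kappa>prod) {s. Z_of s \<in> B} = emeasure PZ B"
proof -
  have "{s \<in> space ref_measure. Z_of s \<in> B} \<in> sets ref_measure" using B by measurable
  then have S: "{s. Z_of s \<in> B} \<in> sets ref_measure" by simp
  note [measurable] = \<kappa>prod_meas
  have "emeasure (kernel_law \<kappa>prod) {s. Z_of s \<in> B} = (\<Sum>g\<in>G. \<integral>\<^sup>+z. ennreal (pmf (\<kappa>prod z) g) * indicator B z \<partial>PZ)"
    by (subst emeasure_kernel_law[OF \<kappa>prod_meas S]) (simp add: Z_of_def)
  also have "\<dots> = (\<integral>\<^sup>+z. (\<Sum>g\<in>G. ennreal (pmf (\<kappa>prod z) g) * indicator B z) \<partial>PZ)"
    using B by (subst nn_integral_sum) auto
  also have "\<dots> = (\<integral>\<^sup>+z. indicator B z \<partial>PZ)"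
  proof (rule nn_integral_cong)
    fix z
    have "(\<Sum>g\<in>G. ennreal (pmf (\<kappa>prod z) g) * indicator B z) = ennreal (\<Sum>g\<in>G. pmf (\<kappa>prod z) g) * indicator B z"
      by (simp add: sum_distrib_right[symmetric] sum_ennreal)
    also have "(\<Sum>g\<in>G. pmf (\<kappa>prod z) g) = 1" by (rule sum_pmf_eq_1[OF _ \<kappa>prod_supp]) simp
    finally show "(\<Sum>g\<in>G. ennreal (pmf (\<kappa>prod z) g) * indicator B z) = indicator B z" by simp
  qed
  also have "\<dots> = emeasure PZ B" using B by simp
  finally show ?thesis .
qed

lemma space_kernel_law [simp]: "space (kernel_law \<kappa>) = UNIV"
  unfolding kernel_law_def by simp

lemma Z_law_kernel_law: "Z_law (kernel_law \<kappa>prod) = PZ"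
proof (rule measure_eqI)
  show "sets (Z_law (kernel_law \<kappa>prod)) = sets PZ" unfolding Z_law_def by simp
  fix B assume "B \<in> sets (Z_law (kernel_law \<kappa>prod))"
  then have B: "B \<in> sets borel" unfolding Z_law_def by simp
  have "Z_of \<in> borel_measurable (kernel_law \<kappa>prod)" unfolding measurable_cong_sets[OF sets_kernel_law refl] by (rule meas_Z)
  then have "emeasure (Z_law (kernel_law \<kappa>prod)) B = emeasure (kernel_law \<kappa>prod) (Z_of -` B \<inter> space (kernel_law \<kappa>prod))"
    unfolding Z_law_def by (rule emeasure_distr) (rule B)
  also have "Z_of -` B \<inter> space (kernel_law \<kappa>prod) = {s. Z_of s \<in> B}" by auto
  finally show "emeasure (Z_law (kernel_law \<kappa>prod)) B = emeasure PZ B" using emeasure_kernel_law_prod_Z[OF B] by simp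
qed

lemma version_kernel_law: "cond_version (kernel_law \<kappa>prod) XY_of \<kappa>prod"
  unfolding cond_version_def Z_law_kernel_law
proof (intro conjI allI ballI \<kappa>prod_meas)
  fix w and B :: "real set" assume B: "B \<in> sets borel"
  have "{s \<in> space ref_measure. XY_of s = w \<and> Z_of s \<in> B} \<in> sets ref_measure" using B by measurable
  then have S: "{s. XY_of s = w \<and> Z_of s \<in> B} \<in> sets ref_measure" by simp
  let ?i = "\<lambda>g. \<integral>\<^sup>+z. ennreal (pmf (\<kappa>prod z) g) * indicator {z. (fst g, snd g, z) \<in> {s. XY_of s = w \<and> Z_of s \<in> B}} z \<partial>PZ"
  have z: "?i g = 0" if "g \<noteq> w" for g
  proof -
    have "{z. (fst g, snd g, z) \<in> {s. XY_of s = w \<and> Z_of s \<in> B}} = {}"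
      using that by (auto simp: XY_of_def X_of_def Y_of_def prod_eq_iff)
    then show ?thesis by simp
  qed
  have w: "?i w = ennreal (\<integral>z\<in>B. pmf (\<kappa>prod z) w \<partial>PZ)"
  proof -
    have "{z. (fst w, snd w, z) \<in> {s. XY_of s = w \<and> Z_of s \<in> B}} = B"
      by (auto simp: XY_of_def X_of_def Y_of_def Z_of_def)
    then show ?thesis using set_integral_pmf[OF \<kappa>prod_meas B] by simp
  qed
  have e: "emeasure (kernel_law \<kappa>prod) {s. XY_of s = w \<and> Z_of s \<in> B} = ennreal (\<integral>z\<in>B. pmf (\<kappa>prod z) w \<partial>PZ)"
  proof (cases "w \<in> G")
    case True
    have "(\<Sum>g\<in>G. ?i g) = (\<Sum>g\<in>{w}. ?i g)" by (rule sum.mono_neutral_right) (use True z in auto)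
    then show ?thesis using emeasure_kernel_law[OF \<kappa>prod_meas S] w by simp
  next
    case False
    have "pmf (\<kappa>prod z) w = 0" for z using \<kappa>prod_supp[of z] False unfolding pmf_eq_0_set_pmf by auto
    then have "ennreal (\<integral>z\<in>B. pmf (\<kappa>prod z) w \<partial>PZ) = 0" by (simp add: set_lebesgue_integral_def)
    moreover have "(\<Sum>g\<in>G. ?i g) = 0" by (rule sum.neutral, rule ballI, rule z) (use False in blast)
    ultimately show ?thesis using emeasure_kernel_law[OF \<kappa>prod_meas S] by simp
  qed
  have "0 \<le> (\<integral>z\<in>B. pmf (\<kappa>prod z) w \<partial>PZ)" unfolding set_lebesgue_integral_def by simp
  then show "measure (kernel_law \<kappa>prod) {s \<in> space (kernel_law \<kappa>prod). XY_of s = w \<and> Z_of s \<in> B} = (\<integral>z\<in>B. pmf (\<kappa>prod z) w \<partial>PZ)"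
    using e by (simp add: measure_def)
qed

lemma kernel_law_in_P_class: "kernel_law \<kappa>prod \<in> P_class l1 l2"
proof -
  have "prob_space (kernel_law \<kappa>prod)"
  proof
    show "emeasure (kernel_law \<kappa>prod) (space (kernel_law \<kappa>prod)) = 1"
      using emeasure_kernel_law_prod_Z[of UNIV] z.emeasure_space_1 by simp
  qed
  moreover have "absolutely_continuous lborel PZ" using E unfolding E_class_def by auto
  ultimately have "kernel_law \<kappa>prod \<in> E_class l1 l2"
    unfolding E_class_def mem_Collect_eq Z_law_kernel_law
    using version_kernel_law \<kappa>prod_supp AE_Z01 sets_kernel_law by (intro conjI exI[of _ \<kappa>prod]) auto
  moreover have "\<kappa>prod z = pair_pmf (map_pmf fst (\<kappa>prod z)) (map_pmf snd (\<kappa>prod z))" for z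
    unfolding \<kappa>prod_def prod_marg_def by (simp add: map_fst_pair_pmf map_snd_pair_pmf)
  ultimately show ?thesis unfolding P_class_def using version_kernel_law by auto
qed

text \<open>Almost every point lies in a cell of positive probability, on which the conditioned law
  \<open>\<nu> m\<close> is a probability measure.\<close>

lemma AE_label_\<rho>: "AE z in PZ. clabel d z \<in> set_pmf \<rho>"
proof -
  have "AE z in PZ. \<forall>m\<in>{1..d} - set_pmf \<rho>. clabel d z \<noteq> m"
  proof (rule AE_finite_allI)
    fix m assume m: "m \<in> {1..d} - set_pmf \<rho>"
    then have "measure PZ (cell d m) = 0" using pmf_\<rho>_cell[of m] by (simp add: set_pmf_iff)
    then have "AE z in PZ. z \<notin> cell d m" using z.prob_eq_0[of "cell d m"] by simp
    then show "AE z in PZ. clabel d z \<noteq> m" by eventually_elim (use clabel_eq[of m d] m in auto)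
  qed simp
  with AE_label show ?thesis by eventually_elim auto
qed

text \<open>The triangle inequality at each point \<open>z\<close>. Passing from the conditional law
  to the cell average costs at most \<open>L / d\<close>, by averaging the total variation bound
  over the cell; passing from the average to the product of its marginals costs the deviation of the
  cell.\<close>

lemma alternative_structure:
  assumes p: "p \<in> Q_TV_far l1 l2 L \<epsilon>" and L: "0 \<le> L"
  shows "\<epsilon> \<le> L / real d + (\<Sum>m\<in>{1..d}. pmf \<rho> m * (\<Sum>g\<in>G. \<bar>dev (q m) g\<bar>))"
proof -
  obtain \<kappa> where \<kappa>: "cond_version p XY_of \<kappa>" and TV: "\<And>z z'. z \<in> {0..1} \<Longrightarrow> z' \<in> {0..1} \<Longrightarrow>
      l1_dist (count_space UNIV) (measure_pmf (\<kappa> z)) (measure_pmf (\<kappa> z')) \<le> L * \<bar>z - z'\<bar>"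
    using p unfolding Q_TV_far_def Q_TV_def by auto
  define e where "e = (\<lambda>m. \<Sum>g\<in>G. \<bar>dev (q m) g\<bar>)"
  have \<kappa>b [measurable]: "(\<lambda>z. pmf (\<kappa> z) g) \<in> borel_measurable borel" for g by (rule version_borel[OF \<kappa>])
  have int: "integrable PZ (\<lambda>z. pmf (\<kappa> z) g)" "integrable PZ (\<lambda>z. pmf (\<kappa>prod z) g)" for g
    using \<kappa>prod_meas[of g] by (auto intro!: z.integrable_01 simp: pmf_le_1)
  have "\<epsilon> \<le> (INF q\<in>P_class l1 l2. l1_dist ref_measure p q)" using p unfolding Q_TV_far_def by auto
  also have "\<dots> \<le> l1_dist ref_measure p (kernel_law \<kappa>prod)"
    by (rule cINF_lower[OF _ kernel_law_in_P_class]) (auto intro!: bdd_belowI[of _ 0] simp: l1_dist_def)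
  also have "\<dots> = l1_dist ref_measure (kernel_law \<kappa>) (kernel_law \<kappa>prod)" using p_eq_kernel_law[OF \<kappa>] by simp
  also have "\<dots> \<le> (\<integral>z. (\<Sum>g\<in>G. \<bar>pmf (\<kappa> z) g - pmf (\<kappa>prod z) g\<bar>) \<partial>PZ)"
    by (rule l1_dist_kernel_law_le[OF \<kappa>b \<kappa>prod_meas])
  also have "\<dots> \<le> (\<integral>z. L / real d + (\<Sum>m\<in>{1..d}. e m * indicator (cell d m) z) \<partial>PZ)"
  proof (rule integral_mono_AE)
    show "integrable PZ (\<lambda>z. \<Sum>g\<in>G. \<bar>pmf (\<kappa> z) g - pmf (\<kappa>prod z) g\<bar>)" using int by auto
    show "integrable PZ (\<lambda>z. L / real d + (\<Sum>m\<in>{1..d}. e m * indicator (cell d m) z))"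
      by (intro Bochner_Integration.integrable_add Bochner_Integration.integrable_sum integrable_mult_right
          integrable_real_indicator) (auto simp: z.emeasure_eq_measure)
    show "AE z in PZ. (\<Sum>g\<in>G. \<bar>pmf (\<kappa> z) g - pmf (\<kappa>prod z) g\<bar>) \<le> L / real d + (\<Sum>m\<in>{1..d}. e m * indicator (cell d m) z)"
      using AE_label_\<rho>
    proof eventually_elim
      case (elim z)
      define m where "m = clabel d z"
      have m: "m \<in> set_pmf \<rho>" using elim m_def by simp
      note h = heavy_cell[OF m]
      interpret n: prob_space "\<nu> m" by (rule h(3))
      have zm: "z \<in> cell d m" by (rule clabel_eq[OF h(1), THEN iffD1]) (simp add: m_def)
      have intn: "integrable (\<nu> m) (\<lambda>z'. pmf (\<kappa> z') g)" for g
        by (rule n.integrable_01) (auto simp: pmf_le_1 cong: measurable_cong_sets)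
      have i1: "integrable (\<nu> m) (\<lambda>z'. \<bar>pmf (\<kappa> z) g - pmf (\<kappa> z') g\<bar>)" for g
        using intn[of g] by auto
      have a: "\<bar>pmf (\<kappa> z) g - pmf (q m) g\<bar> \<le> integral\<^sup>L (\<nu> m) (\<lambda>z'. \<bar>pmf (\<kappa> z) g - pmf (\<kappa> z') g\<bar>)" for g
      proof -
        have "pmf (\<kappa> z) g - pmf (q m) g = integral\<^sup>L (\<nu> m) (\<lambda>z'. pmf (\<kappa> z) g - pmf (\<kappa> z') g)"
          unfolding q_mixture[OF m \<kappa>] using intn[of g] n.prob_space by simp
        then show ?thesis using integral_abs_bound[of "\<nu> m" "\<lambda>z'. pmf (\<kappa> z) g - pmf (\<kappa> z') g"] by simp
      qed
      have "(\<Sum>g\<in>G. \<bar>pmf (\<kappa> z) g - pmf (q m) g\<bar>) \<le> (\<Sum>g\<in>G. integral\<^sup>L (\<nu> m) (\<lambda>z'. \<bar>pmf (\<kappa> z) g - pmf (\<kappa> z') g\<bar>))"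
        by (rule sum_mono) (rule a)
      also have "\<dots> = integral\<^sup>L (\<nu> m) (\<lambda>z'. \<Sum>g\<in>G. \<bar>pmf (\<kappa> z) g - pmf (\<kappa> z') g\<bar>)"
        by (rule Bochner_Integration.integral_sum[symmetric]) (rule i1)
      also have "\<dots> \<le> L / real d"
      proof (rule n.integral_le_const)
        show "integrable (\<nu> m) (\<lambda>z'. \<Sum>g\<in>G. \<bar>pmf (\<kappa> z) g - pmf (\<kappa> z') g\<bar>)" using i1 by auto
        show "AE z' in \<nu> m. (\<Sum>g\<in>G. \<bar>pmf (\<kappa> z) g - pmf (\<kappa> z') g\<bar>) \<le> L / real d"
          using h(4)
        proof eventually_elim
          case (elim z')
          have "(\<Sum>g\<in>G. \<bar>pmf (\<kappa> z) g - pmf (\<kappa> z') g\<bar>) \<le> l1_dist (count_space UNIV) (measure_pmf (\<kappa> z)) (measure_pmf (\<kappa> z'))"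
            by (rule l1_dist_pmf_ge) simp
          also have "\<dots> \<le> L * \<bar>z - z'\<bar>" using cell_subset[OF h(1)] zm elim by (intro TV) auto
          also have "\<dots> \<le> L * (1 / real d)" by (intro mult_left_mono cell_diam[OF h(1) zm elim] L)
          finally show ?case by simp
        qed
      qed
      finally have A: "(\<Sum>g\<in>G. \<bar>pmf (\<kappa> z) g - pmf (q m) g\<bar>) \<le> L / real d" .
      have "(\<Sum>g\<in>G. \<bar>pmf (\<kappa> z) g - pmf (\<kappa>prod z) g\<bar>) \<le> (\<Sum>g\<in>G. \<bar>pmf (\<kappa> z) g - pmf (q m) g\<bar> + \<bar>dev (q m) g\<bar>)"
        unfolding \<kappa>prod_def m_def[symmetric] dev_def by (rule sum_mono) linarith
      also have "\<dots> \<le> L / real d + e m" unfolding sum.distrib e_def using A by simp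
      also have "e m = (\<Sum>k\<in>{m}. e k * indicator (cell d k) z)" using zm by simp
      also have "\<dots> = (\<Sum>k\<in>{1..d}. e k * indicator (cell d k) z)"
        by (rule sum.mono_neutral_left) (use h(1) zm cell_disjoint in \<open>auto simp: indicator_def\<close>)
      finally show ?case .
    qed
  qed
  also have "\<dots> = L / real d + (\<Sum>m\<in>{1..d}. e m * measure PZ (cell d m))"
  proof -
    have I: "integrable PZ (\<lambda>z. e m * indicator (cell d m) z)" for m
      by (intro integrable_mult_right integrable_real_indicator) (auto simp: z.emeasure_eq_measure)
    have "(\<integral>z. L / real d + (\<Sum>m\<in>{1..d}. e m * indicator (cell d m) z) \<partial>PZ) =
      (\<integral>z. L / real d \<partial>PZ) + (\<integral>z. (\<Sum>m\<in>{1..d}. e m * indicator (cell d m) z) \<partial>PZ)"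
      by (rule Bochner_Integration.integral_add[OF _ Bochner_Integration.integrable_sum[OF I]]) simp
    also have "(\<integral>z. (\<Sum>m\<in>{1..d}. e m * indicator (cell d m) z) \<partial>PZ) =
      (\<Sum>m\<in>{1..d}. \<integral>z. e m * indicator (cell d m) z \<partial>PZ)"
      by (rule Bochner_Integration.integral_sum) (rule I)
    also have "\<dots> = (\<Sum>m\<in>{1..d}. e m * measure PZ (cell d m))"
      by (intro sum.cong refl) simp
    finally show ?thesis using z.prob_space by simp
  qed
  also have "\<dots> = L / real d + (\<Sum>m\<in>{1..d}. pmf \<rho> m * e m)"
    using pmf_\<rho>_cell by (simp add: mult.commute)
  finally show ?thesis unfolding e_def .
qed

end

section \<open>From the Poisson sample size to a fixed one\<close>

text \<open>The probability generating function, used at 2 and \<open>1 / 2\<close> for Chernoff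
  bounds.\<close>

lemma nn_integral_poisson_power:
  assumes "0 < lam" "0 \<le> z"
  shows "(\<integral>\<^sup>+k. ennreal (z ^ k) \<partial>measure_pmf (poisson_pmf lam)) = ennreal (exp (lam * (z - 1)))"
proof -
  have s: "(\<lambda>k. exp (- lam) * ((lam * z) ^ k /\<^sub>R fact k)) sums (exp (- lam) * exp (lam * z))"
    by (intro sums_mult exp_converges)
  have t: "pmf (poisson_pmf lam) k * z ^ k = exp (- lam) * ((lam * z) ^ k /\<^sub>R fact k)" for k
    using assms by (simp add: power_mult_distrib divide_inverse)
  have "(\<integral>\<^sup>+k. ennreal (z ^ k) \<partial>measure_pmf (poisson_pmf lam)) =
    (\<Sum>k. ennreal (pmf (poisson_pmf lam) k * z ^ k))"
    unfolding nn_integral_measure_pmf nn_integral_count_space_nat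
    by (simp only: ennreal_mult[OF pmf_nonneg zero_le_power[OF assms(2)]])
  also have "\<dots> = ennreal (\<Sum>k. pmf (poisson_pmf lam) k * z ^ k)"
    by (rule suminf_ennreal2) (use assms sums_summable[OF s] in \<open>simp_all only: t, auto simp: t[symmetric]\<close>)
  also have "(\<Sum>k. pmf (poisson_pmf lam) k * z ^ k) = exp (- lam) * exp (lam * z)"
    unfolding t by (rule sums_unique[OF s, symmetric])
  also have "\<dots> = exp (lam * (z - 1))" by (simp add: exp_add[symmetric] algebra_simps)
  finally show ?thesis .
qed

text \<open>Chernoff's bound with base 2 gives \<open>exp (n / 2 - n * ln 2)\<close>, and
  \<open>ln 2 \<ge> 2 / 3\<close> makes the exponent at most \<open>- n / 6\<close>.\<close>

lemma poisson_upper_tail: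
  assumes n: "1 \<le> (n::nat)"
  shows "emeasure (measure_pmf (poisson_pmf (real n / 2))) {k. n < k} \<le> ennreal (exp (- real n / 8))"
proof -
  let ?P = "measure_pmf (poisson_pmf (real n / 2))"
  have "emeasure ?P {k. n < k} = (\<integral>\<^sup>+k. indicator {k. n < k} k \<partial>?P)" by simp
  also have "\<dots> \<le> (\<integral>\<^sup>+k. ennreal (1 / 2 ^ n) * ennreal (2 ^ k) \<partial>?P)"
  proof (rule nn_integral_mono)
    fix k :: nat
    show "indicator {k. n < k} k \<le> ennreal (1 / 2 ^ n) * ennreal (2 ^ k)"
    proof (cases "n < k")
      case True
      then have "(2::real) ^ n \<le> 2 ^ k" by (intro power_increasing) auto
      then have "1 \<le> 1 / 2 ^ n * (2 ^ k :: real)" by (simp add: field_simps)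
      then have "ennreal 1 \<le> ennreal (1 / 2 ^ n * 2 ^ k)" by (rule ennreal_leI)
      then show ?thesis using True by (simp add: ennreal_mult[symmetric])
    qed auto
  qed
  also have "\<dots> = ennreal (1 / 2 ^ n) * ennreal (exp (real n / 2 * (2 - 1)))"
    using n by (subst nn_integral_cmult) (auto simp: nn_integral_poisson_power)
  also have "\<dots> = ennreal (exp (real n / 2 - real n * ln 2))"
  proof -
    have "(2::real) ^ n = exp (real n * ln 2)" by (simp add: exp_of_nat_mult)
    then show ?thesis by (simp add: ennreal_mult[symmetric] exp_diff)
  qed
  also have "\<dots> \<le> ennreal (exp (- real n / 8))"
  proof (rule ennreal_leI)
    have "real n * (2 / 3) \<le> real n * ln 2" by (intro mult_left_mono ln2_ge_two_thirds) auto
    then show "exp (real n / 2 - real n * ln 2) \<le> exp (- real n / 8)" by simp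
  qed
  finally show ?thesis .
qed

text \<open>Chernoff's bound with base \<open>1 / 2\<close> gives
  \<open>exp (n / 4 * (ln 2 - 1))\<close>; \<open>ln 2 \<le> 25 / 36\<close> and
  \<open>n \<ge> 160\<close> make the exponent less than \<open>- 12\<close>.\<close>

lemma poisson_lower_tail:
  assumes n: "160 \<le> (n::nat)"
  shows "emeasure (measure_pmf (poisson_pmf (real n / 2))) {k. real k < real n / 4} \<le> ennreal (1 / 20)"
proof -
  let ?P = "measure_pmf (poisson_pmf (real n / 2))"
  have "emeasure ?P {k. real k < real n / 4} = (\<integral>\<^sup>+k. indicator {k. real k < real n / 4} k \<partial>?P)" by simp
  also have "\<dots> \<le> (\<integral>\<^sup>+k. ennreal (2 powr (real n / 4)) * ennreal ((1 / 2) ^ k) \<partial>?P)"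
  proof (rule nn_integral_mono)
    fix k :: nat
    show "indicator {k. real k < real n / 4} k \<le> ennreal (2 powr (real n / 4)) * ennreal ((1 / 2) ^ k)"
    proof (cases "real k < real n / 4")
      case True
      then have "2 powr (real k) \<le> (2::real) powr (real n / 4)" by (intro powr_mono) auto
      then have "1 \<le> 2 powr (real n / 4) * (1 / 2) ^ k" by (simp add: powr_realpow power_one_over field_simps)
      then have "ennreal 1 \<le> ennreal (2 powr (real n / 4) * (1 / 2) ^ k)" by (rule ennreal_leI)
      then show ?thesis using True by (simp add: ennreal_mult[symmetric])
    qed auto
  qed
  also have "\<dots> = ennreal (2 powr (real n / 4)) * ennreal (exp (real n / 2 * (1 / 2 - 1)))"
    using n by (subst nn_integral_cmult) (auto simp: nn_integral_poisson_power)
  also have "\<dots> = ennreal (exp (real n / 4 * ln 2 - real n / 4))"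
    by (simp add: ennreal_mult[symmetric] powr_def exp_add[symmetric] mult.commute)
  also have "\<dots> \<le> ennreal (1 / 20)"
  proof (rule ennreal_leI)
    have "real n / 4 * ln 2 \<le> real n / 4 * (25 / 36)" by (intro mult_left_mono ln2_le_25_over_36) auto
    moreover have "160 \<le> real n" using n by simp
    ultimately have "real n / 4 * ln 2 - real n / 4 \<le> - 12" by linarith
    then have "exp (real n / 4 * ln 2 - real n / 4) \<le> exp (- 12)" by simp
    also have "\<dots> \<le> 1 / 20"
    proof -
      have "(7::real) \<le> exp 6" using exp_ge_add_one_self[of 6] by simp
      then have "(7::real) * 7 \<le> exp 6 * exp 6" by (intro mult_mono) auto
      also have "exp 6 * exp 6 = exp (12::real)" by (simp add: exp_add[symmetric])
      finally have "20 \<le> exp (12::real)" by simp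
      then show ?thesis by (simp add: exp_minus field_simps)
    qed
    finally show "exp (real n / 4 * ln 2 - real n / 4) \<le> 1 / 20" .
  qed
  finally show ?thesis .
qed

context eclass
begin

section \<open>The law of the labelled sample\<close>

sublocale mix: mixture d l1 l2 \<rho> q
  by unfold_locales (use set_q set_\<rho> l1 l2 in auto)

abbreviation "law \<equiv> mix.law"

definition "lab s = (clabel d (Z_of s), XY_of s)"

lemma pmf_law: "pmf law (m, g) = measure p {s. lab s = (m, g)}"
proof -
  have "pmf law (m, g) = E_pmf \<rho> (\<lambda>m'. pmf (map_pmf (Pair m') (q m')) (m, g))"
    unfolding mix.law_def by (rule pmf_bind)
  also have "\<dots> = E_pmf \<rho> (\<lambda>m'. of_bool (m' = m) * pmf (q m) g)"
  proof (rule E_pmf_cong)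
    fix m'
    show "pmf (map_pmf (Pair m') (q m')) (m, g) = of_bool (m' = m) * pmf (q m) g"
    proof (cases "m' = m")
      case True
      have "inj (Pair m)" by (auto simp: inj_on_def)
      then show ?thesis using True pmf_map_inj'[of "Pair m" "q m" g] by simp
    next
      case False
      then have "(m, g) \<notin> set_pmf (map_pmf (Pair m') (q m'))" by auto
      then show ?thesis using False by (simp only: pmf_eq_0_set_pmf[symmetric]) simp
    qed
  qed
  also have "\<dots> = pmf \<rho> m * pmf (q m) g" by (rule E_pmf_point[OF mix.fin_supp\<rho>])
  also have "\<dots> = measure p {s. lab s = (m, g)}" unfolding pmf_q lab_def by simp
  finally show ?thesis .
qed

lemma lab_sets: "{s. lab s = b} \<in> sets p"
proof -
  have "{s \<in> space p. clabel d (Z_of s) = fst b \<and> XY_of s = snd b} \<in> sets p" by measurable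
  also have "{s \<in> space p. clabel d (Z_of s) = fst b \<and> XY_of s = snd b} = {s. lab s = b}"
    unfolding lab_def by auto
  finally show ?thesis .
qed

lemma emeasure_lab: "emeasure p {s. lab s = b} = ennreal (pmf law b)"
  using pmf_law[of "fst b" "snd b"] by (simp add: p.emeasure_eq_measure)

lemma T_stat_eq: "T_stat l1 l2 d S N = T_labelled l1 l2 d N (\<lambda>i. lab (S i))"
proof -
  have "cell_data d S N m = map (\<lambda>i. snd (lab (S i))) (filter (\<lambda>i. fst (lab (S i)) = m) [1..<N + 1])"
    if "m \<in> {1..d}" for m
    unfolding cell_data_def lab_def by (simp add: clabel_eq[OF that])
  then show ?thesis unfolding T_stat_def T_labelled_def by (intro sum.cong refl) (simp only: Let_def)
qed

definition "dflt = (0 :: nat, 0 :: nat, 0 :: nat)"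
text \<open>Lists rather than functions, because their type is countable and laws on it are
  determined by point masses.\<close>

definition "label_list n S = map (\<lambda>i. lab (S i)) [1..<n + 1]"
definition "label_list_pmf n = map_pmf (\<lambda>F. map F [1..<n + 1]) (Pi_pmf {1..n} dflt (\<lambda>_. law))"
abbreviation "PM n \<equiv> (\<Pi>\<^sub>M i\<in>{1..n::nat}. p)"

lemma list_eq_iff: "map F [1..<n + 1] = w \<longleftrightarrow> length w = n \<and> (\<forall>i\<in>{1..n}. F i = w ! (i - 1))"
proof
  assume a: "map F [1..<n + 1] = w"
  show "length w = n \<and> (\<forall>i\<in>{1..n}. F i = w ! (i - 1))"
  proof (intro conjI ballI)
    fix i assume "i \<in> {1..n}"
    then have "map F [1..<n + 1] ! (i - 1) = F i" by (subst nth_map) (auto simp del: upt_Suc)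
    then show "F i = w ! (i - 1)" using a by simp
  qed (use a in auto)
next
  assume a: "length w = n \<and> (\<forall>i\<in>{1..n}. F i = w ! (i - 1))"
  show "map F [1..<n + 1] = w"
    by (rule nth_equalityI) (use a in \<open>auto simp del: upt_Suc\<close>)
qed

lemma emeasure_label_list:
  "label_list n -` {w} \<inter> space (PM n) \<in> sets (PM n)" "emeasure (PM n) (label_list n -` {w} \<inter> space (PM n)) = ennreal (pmf (label_list_pmf n) w)"
proof -
  interpret pp: product_sigma_finite "\<lambda>_ :: nat. p" ..
  let ?A = "\<lambda>i. {s. lab s = w ! (i - 1)}"
  have "label_list n -` {w} \<inter> space (PM n) \<in> sets (PM n) \<and>
    emeasure (PM n) (label_list n -` {w} \<inter> space (PM n)) = ennreal (pmf (label_list_pmf n) w)"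
  proof (cases "length w = n")
    case True
    have S: "label_list n -` {w} \<inter> space (PM n) = Pi\<^sub>E {1..n} ?A"
      unfolding label_list_def space_PiM using True list_eq_iff[of "\<lambda>i. lab (_ i)" n w]
      by (auto simp: list_eq_iff PiE_iff extensional_def simp del: upt_Suc)
    have "emeasure (PM n) (Pi\<^sub>E {1..n} ?A) = (\<Prod>i\<in>{1..n}. emeasure p (?A i))"
      by (rule pp.emeasure_PiM) (auto intro: lab_sets)
    also have "\<dots> = ennreal (\<Prod>i\<in>{1..n}. pmf law (w ! (i - 1)))"
      unfolding emeasure_lab by (rule prod_ennreal) simp
    also have "(\<Prod>i\<in>{1..n}. pmf law (w ! (i - 1))) = measure_pmf.prob (Pi_pmf {1..n} dflt (\<lambda>_. law)) (Pi {1..n} (\<lambda>i. {w ! (i - 1)}))"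
      by (subst measure_Pi_pmf_Pi) (auto simp: measure_pmf_single)
    also have "Pi {1..n} (\<lambda>i. {w ! (i - 1)}) = (\<lambda>F. map F [1..<n + 1]) -` {w}"
    proof (rule set_eqI)
      fix F :: "nat \<Rightarrow> nat \<times> nat \<times> nat"
      show "F \<in> Pi {1..n} (\<lambda>i. {w ! (i - 1)}) \<longleftrightarrow> F \<in> (\<lambda>F. map F [1..<n + 1]) -` {w}"
        unfolding Pi_iff vimage_def mem_Collect_eq singleton_iff list_eq_iff using True by blast
    qed
    finally have "emeasure (PM n) (Pi\<^sub>E {1..n} ?A) = ennreal (pmf (label_list_pmf n) w)" unfolding label_list_pmf_def pmf_map .
    moreover have "Pi\<^sub>E {1..n} ?A \<in> sets (PM n)" by (rule sets_PiM_I_finite) (auto intro: lab_sets)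
    ultimately show ?thesis unfolding S by simp
  next
    case False
    then have "label_list n -` {w} \<inter> space (PM n) = {}" unfolding label_list_def by auto
    moreover have "w \<notin> set_pmf (label_list_pmf n)" using False unfolding label_list_pmf_def by auto
    then have "pmf (label_list_pmf n) w = 0" by (simp add: pmf_eq_0_set_pmf)
    ultimately show ?thesis by simp
  qed
  then show "label_list n -` {w} \<inter> space (PM n) \<in> sets (PM n)" "emeasure (PM n) (label_list n -` {w} \<inter> space (PM n)) = ennreal (pmf (label_list_pmf n) w)"
    by auto
qed

lemma fin_supp_law: "fin_supp law"
  unfolding mix.law_def using mix.fin_supp\<rho> finite_subset[OF set_q] by (auto simp: set_bind_pmf)

lemma fin_supp_label_list_pmf: "fin_supp (label_list_pmf n)"
  unfolding label_list_pmf_def using fin_supp_law by auto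

text \<open>The sample and N are independent, so the image of their joint law on the countable type
  of size and list is a product of pmfs. The size comes first there, which makes N the outer
  variable.\<close>

lemma expect_eq:
  assumes n: "1 \<le> n" and f: "\<And>S N. f S N = \<Phi> (label_list n S) N" and \<Phi>: "\<And>w N. 0 \<le> \<Phi> w N" "\<And>w N. \<Phi> w N \<le> 1"
  shows "ennreal (expect n p f) = (\<integral>\<^sup>+N. ennreal (E_pmf (label_list_pmf n) (\<lambda>w. \<Phi> w N)) \<partial>measure_pmf (poisson_pmf (real n / 2)))"
proof -
  let ?P = "poisson_pmf (real n / 2)"
  let ?M = "PM n \<Otimes>\<^sub>M measure_pmf ?P"
  let ?R = "\<lambda>(S, N). (N, label_list n S)"
  have vim: "?R -` {(N, w)} \<inter> space ?M = (label_list n -` {w} \<inter> space (PM n)) \<times> {N}" for N w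
    by (auto simp: space_pair_measure)
  have R: "?R \<in> measurable ?M (count_space UNIV)"
    unfolding measurable_count_space_eq2_countable
  proof (intro conjI ballI)
    fix a :: "nat \<times> (nat \<times> nat \<times> nat) list"
    show "?R -` {a} \<inter> space ?M \<in> sets ?M"
      using vim[of "fst a" "snd a"] emeasure_label_list(1)[of n "snd a"] by (auto intro!: pair_measureI)
  qed auto
  have D: "distr ?M (count_space UNIV) ?R = measure_pmf (pair_pmf ?P (label_list_pmf n))"
  proof (rule measure_eqI_countable[of _ UNIV])
    fix a :: "nat \<times> (nat \<times> nat \<times> nat) list"
    obtain N w where a: "a = (N, w)" by (cases a)
    have "emeasure (distr ?M (count_space UNIV) ?R) {a} = emeasure ?M ((label_list n -` {w} \<inter> space (PM n)) \<times> {N})"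
      unfolding a vim[symmetric] by (rule emeasure_distr[OF R]) simp
    also have "\<dots> = emeasure (PM n) (label_list n -` {w} \<inter> space (PM n)) * emeasure (measure_pmf ?P) {N}"
      by (rule measure_pmf.emeasure_pair_measure_Times[OF emeasure_label_list(1)]) simp
    also have "\<dots> = ennreal (pmf (label_list_pmf n) w) * ennreal (pmf ?P N)"
      unfolding emeasure_label_list(2) emeasure_pmf_single ..
    also have "\<dots> = emeasure (measure_pmf (pair_pmf ?P (label_list_pmf n))) {a}"
      unfolding a emeasure_pmf_single pmf_pair by (simp only: ennreal_mult[OF pmf_nonneg pmf_nonneg] mult.commute)
    finally show "emeasure (distr ?M (count_space UNIV) ?R) {a} = emeasure (measure_pmf (pair_pmf ?P (label_list_pmf n))) {a}" .
  qed auto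
  let ?\<Phi> = "\<lambda>(N, w). \<Phi> w N"
  have "expect n p f = integral\<^sup>L ?M (\<lambda>x. ?\<Phi> (?R x))"
    unfolding expect_def f by (simp add: case_prod_unfold)
  also have "\<dots> = integral\<^sup>L (distr ?M (count_space UNIV) ?R) ?\<Phi>"
    by (rule integral_distr[OF R, symmetric]) simp
  also have "\<dots> = integral\<^sup>L (measure_pmf (pair_pmf ?P (label_list_pmf n))) ?\<Phi>" unfolding D ..
  finally have "ennreal (expect n p f) = ennreal (integral\<^sup>L (measure_pmf (pair_pmf ?P (label_list_pmf n))) ?\<Phi>)" by simp
  also have "\<dots> = (\<integral>\<^sup>+x. ennreal (?\<Phi> x) \<partial>measure_pmf (pair_pmf ?P (label_list_pmf n)))"
    by (rule nn_integral_eq_integral[symmetric])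
      (use \<Phi> in \<open>auto intro!: measure_pmf.integrable_const_bound[of _ 1] AE_pmfI\<close>)
  also have "\<dots> = (\<integral>\<^sup>+N. \<integral>\<^sup>+w. ennreal (\<Phi> w N) \<partial>measure_pmf (label_list_pmf n) \<partial>measure_pmf ?P)"
    by (subst nn_integral_pair_pmf') simp
  also have "\<dots> = (\<integral>\<^sup>+N. ennreal (E_pmf (label_list_pmf n) (\<lambda>w. \<Phi> w N)) \<partial>measure_pmf ?P)"
    by (intro nn_integral_cong nn_integral_eq_integral integrable_measure_pmf_finite fin_supp_label_list_pmf) (use \<Phi> in auto)
  finally show ?thesis .
qed

lemma E_pmf_label_list_pmf:
  assumes N: "N \<le> n"
  shows "E_pmf (label_list_pmf n) (\<lambda>w. h (T_labelled l1 l2 d N (\<lambda>i. w ! (i - 1)))) = E_pmf (Pi_pmf {1..N} dflt (\<lambda>_. law)) (\<lambda>F. h (T_labelled l1 l2 d N F))"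
proof -
  have "E_pmf (label_list_pmf n) (\<lambda>w. h (T_labelled l1 l2 d N (\<lambda>i. w ! (i - 1)))) =
    E_pmf (Pi_pmf {1..n} dflt (\<lambda>_. law)) (\<lambda>F. h (T_labelled l1 l2 d N (\<lambda>i. map F [1..<n + 1] ! (i - 1))))"
    unfolding label_list_pmf_def by simp
  also have "\<dots> = E_pmf (Pi_pmf {1..n} dflt (\<lambda>_. law)) (\<lambda>F. h (T_labelled l1 l2 d N F))"
  proof (rule E_pmf_cong)
    fix F
    have "T_labelled l1 l2 d N (\<lambda>i. map F [1..<n + 1] ! (i - 1)) = T_labelled l1 l2 d N F"
    proof (rule depends_onD[OF depends_on_T_labelled])
      fix i assume "i \<in> {1..N}"
      then show "map F [1..<n + 1] ! (i - 1) = F i" using N by (subst nth_map) (auto simp del: upt_Suc)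
    qed
    then show "h (T_labelled l1 l2 d N (\<lambda>i. map F [1..<n + 1] ! (i - 1))) = h (T_labelled l1 l2 d N F)" by simp
  qed
  also have "\<dots> = E_pmf (Pi_pmf {1..N} dflt (\<lambda>_. law)) (\<lambda>F. h (T_labelled l1 l2 d N F))"
    by (rule E_pmf_Pi_restrict[OF _ _ depends_on_comp[OF depends_on_T_labelled]]) (use N in auto)
  finally show ?thesis .
qed

lemma T_stat_label_list: "N \<le> n \<Longrightarrow> T_stat l1 l2 d S N = T_labelled l1 l2 d N (\<lambda>i. label_list n S ! (i - 1))"
  unfolding T_stat_eq
proof (rule depends_onD[OF depends_on_T_labelled])
  fix i assume "N \<le> n" "i \<in> {1..N}"
  then show "lab (S i) = label_list n S ! (i - 1)" unfolding label_list_def by (subst nth_map) (auto simp del: upt_Suc)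
qed

lemma type_I_reduction:
  assumes n: "1 \<le> n" and b: "\<And>N. N \<le> n \<Longrightarrow> E_pmf (Pi_pmf {1..N} dflt (\<lambda>_. law)) (\<lambda>F. of_bool (\<tau> \<le> T_labelled l1 l2 d N F)) \<le> \<beta>"
    and \<beta>: "0 \<le> \<beta>"
  shows "ennreal (expect n p (\<lambda>S N. psi n l1 l2 d \<tau> S N)) \<le> ennreal \<beta>"
proof -
  define \<Phi> where "\<Phi> = (\<lambda>w N. if N \<le> n then of_bool (\<tau> \<le> T_labelled l1 l2 d N (\<lambda>i. w ! (i - 1))) else 0 :: real)"
  have "ennreal (expect n p (\<lambda>S N. psi n l1 l2 d \<tau> S N)) =
    (\<integral>\<^sup>+N. ennreal (E_pmf (label_list_pmf n) (\<lambda>w. \<Phi> w N)) \<partial>measure_pmf (poisson_pmf (real n / 2)))"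
    by (rule expect_eq[OF n]) (auto simp: psi_def \<Phi>_def T_stat_label_list)
  also have "\<dots> \<le> (\<integral>\<^sup>+N. ennreal \<beta> \<partial>measure_pmf (poisson_pmf (real n / 2)))"
  proof (intro nn_integral_mono ennreal_leI)
    fix N
    show "E_pmf (label_list_pmf n) (\<lambda>w. \<Phi> w N) \<le> \<beta>"
    proof (cases "N \<le> n")
      case True
      then show ?thesis using b[OF True] E_pmf_label_list_pmf[OF True, of "\<lambda>T. of_bool (\<tau> \<le> T)"] unfolding \<Phi>_def by simp
    qed (simp add: \<Phi>_def \<beta>)
  qed
  finally show ?thesis by simp
qed

text \<open>The two halves of \<open>1 / 10\<close> are the error at a fixed size and the
  probability of fewer than \<open>n / 4\<close> observations. The exponential is the probability of
  \<open>N > n\<close>, when the test accepts.\<close>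

lemma type_II_reduction:
  assumes n: "160 \<le> n" and b: "\<And>N. real n / 4 \<le> real N \<Longrightarrow> N \<le> n \<Longrightarrow>
      E_pmf (Pi_pmf {1..N} dflt (\<lambda>_. law)) (\<lambda>F. of_bool (T_labelled l1 l2 d N F < \<tau>)) \<le> 1 / 20"
  shows "ennreal (expect n p (\<lambda>S N. 1 - psi n l1 l2 d \<tau> S N)) \<le> ennreal (1 / 10 + exp (- real n / 8))"
proof -
  let ?P = "measure_pmf (poisson_pmf (real n / 2))"
  define \<Phi> where "\<Phi> = (\<lambda>w N. if N \<le> n then of_bool (T_labelled l1 l2 d N (\<lambda>i. w ! (i - 1)) < \<tau>) else 1 :: real)"
  have n1: "1 \<le> n" using n by simp
  have "ennreal (expect n p (\<lambda>S N. 1 - psi n l1 l2 d \<tau> S N)) = (\<integral>\<^sup>+N. ennreal (E_pmf (label_list_pmf n) (\<lambda>w. \<Phi> w N)) \<partial>?P)"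
    by (rule expect_eq[OF n1]) (auto simp: psi_def \<Phi>_def T_stat_label_list)
  also have "\<dots> \<le> (\<integral>\<^sup>+N. ennreal (1 / 20) + indicator {k. real k < real n / 4} N + indicator {k. n < k} N \<partial>?P)"
  proof (intro nn_integral_mono)
    fix N
    have one: "E_pmf (label_list_pmf n) (\<lambda>w. \<Phi> w N) \<le> 1" by (rule E_pmf_le_const[OF fin_supp_label_list_pmf]) (auto simp: \<Phi>_def)
    show "ennreal (E_pmf (label_list_pmf n) (\<lambda>w. \<Phi> w N)) \<le> ennreal (1 / 20) + indicator {k. real k < real n / 4} N + indicator {k. n < k} N"
    proof (cases "real n / 4 \<le> real N \<and> N \<le> n")
      case True
      then have "E_pmf (label_list_pmf n) (\<lambda>w. \<Phi> w N) \<le> 1 / 20"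
        using b[of N] E_pmf_label_list_pmf[of N n "\<lambda>T. of_bool (T < \<tau>)"] unfolding \<Phi>_def by simp
      then have "ennreal (E_pmf (label_list_pmf n) (\<lambda>w. \<Phi> w N)) \<le> ennreal (1 / 20)" by (rule ennreal_leI)
      then show ?thesis by (simp add: add_increasing2 add.assoc)
    next
      case False
      have "ennreal (E_pmf (label_list_pmf n) (\<lambda>w. \<Phi> w N)) \<le> 1" using ennreal_leI[OF one] by simp
      also have "1 \<le> indicator {k. real k < real n / 4} N + (indicator {k. n < k} N :: ennreal)"
        using False by (auto simp: indicator_def)
      also have "\<dots> \<le> ennreal (1 / 20) + (indicator {k. real k < real n / 4} N + indicator {k. n < k} N)"
        by (rule add_increasing) auto
      finally show ?thesis by (simp add: add.assoc)
    qed
  qed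
  also have "\<dots> = ennreal (1 / 20) + emeasure ?P {k. real k < real n / 4} + emeasure ?P {k. n < k}"
    by (simp add: nn_integral_add)
  also have "\<dots> \<le> ennreal (1 / 20) + ennreal (1 / 20) + ennreal (exp (- real n / 8))"
    by (intro add_mono order_refl poisson_lower_tail[OF n] poisson_upper_tail[OF n1])
  also have "\<dots> = ennreal (1 / 10 + exp (- real n / 8))"
    by (simp add: ennreal_plus[symmetric] del: ennreal_plus)
  finally show ?thesis .
qed

end

section \<open>Choice of the constants\<close>

text \<open>\<open>x\<close> is the number of cells before rounding. It is also the scale of the
  separation, since the assumption on \<open>\<epsilon>\<close> reads
  \<open>\<epsilon> \<ge> c / x\<close>.\<close>

lemma num_cells_bounds:
  fixes n l1 l2 :: nat
  assumes "1 \<le> n" "1 \<le> l1" "1 \<le> l2"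
  defines "x \<equiv> real n powr (2 / 5) / real (l1 * l2) powr (1 / 5)"
  defines "d \<equiv> num_cells n l1 l2"
  shows "0 < x" "x \<le> real d" "real d \<le> x + 1" "1 \<le> d" "x ^ 5 * (real l1 * real l2) = (real n)\<^sup>2"
proof -
  have ll: "0 < real (l1 * l2)" using assms by simp
  have n: "0 < real n" using assms by simp
  have "0 < real n powr (2 / 5)" "0 < real (l1 * l2) powr (1 / 5)"
    unfolding powr_gt_zero using assms(1-3) by auto
  then show x: "0 < x" unfolding x_def by (rule divide_pos_pos)
  have d: "d = nat \<lceil>x\<rceil>" unfolding d_def num_cells_def x_def ..
  show "x \<le> real d" unfolding d by (rule real_nat_ceiling_ge)
  have "0 < \<lceil>x\<rceil>" using x by simp
  then have rd: "real d = of_int \<lceil>x\<rceil>" unfolding d by simp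
  show "real d \<le> x + 1" unfolding rd by linarith
  show "1 \<le> d" using \<open>0 < \<lceil>x\<rceil>\<close> unfolding d by linarith
  have p: "(a powr b) ^ 5 = a powr (5 * b)" if "0 < a" for a b :: real
    using that by (simp add: powr_realpow[symmetric] powr_powr mult.commute)
  have "x ^ 5 = (real n)\<^sup>2 / real (l1 * l2)"
    unfolding x_def power_divide p[OF ll] p[OF n] using n ll by (simp add: powr_numeral)
  then show "x ^ 5 * (real l1 * real l2) = (real n)\<^sup>2" using assms(2,3) by auto
qed

text \<open>The constant in \<open>d \<le> cell_factor K * x\<close>: from
  \<open>d \<le> x + 1\<close> it suffices that \<open>x\<close> is at least
  \<open>min 1 (1 / K^2)\<close>, see \<open>d_le_x\<close>.\<close>

definition cell_factor :: "real \<Rightarrow> real" where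
  "cell_factor K = 1 + 1 / min 1 (1 / K\<^sup>2)"

lemma cell_factor_ge_1: "0 < K \<Longrightarrow> 1 \<le> cell_factor K"
  unfolding cell_factor_def by simp

locale regime =
  fixes K x :: real and n l1 l2 d :: nat
  assumes K: "0 < K" and n: "1 \<le> n" and l12: "l2 \<le> l1" and l2: "1 \<le> l2"
    and x0: "0 < x" and xd: "x \<le> real d" and dx: "real d \<le> x + 1" and d: "1 \<le> d"
    and x5: "x ^ 5 * (real l1 * real l2) = (real n)\<^sup>2" and dl: "real d * real l1 \<le> K * real n"
begin

lemma l1: "1 \<le> l1" using l12 l2 by simp

lemma lpos: "0 < real l1" "0 < real l2" using l1 l2 by auto

lemma d_le: "real d \<le> K * (real n / real l1)" "real d \<le> K * (real n / real l2)"
proof -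
  show 1: "real d \<le> K * (real n / real l1)" using dl lpos by (simp add: pos_le_divide_eq)
  have "K * (real n / real l1) \<le> K * (real n / real l2)"
    using K l12 lpos by (intro mult_left_mono divide_left_mono) auto
  then show "real d \<le> K * (real n / real l2)" using 1 by simp
qed

text \<open>\<open>d * l1 \<le> K * n\<close> and \<open>l2 \<le> l1\<close> make each factor at
  most \<open>(K + 1) * n / l\<close>, with \<open>l1\<close> or \<open>l2\<close> for
  \<open>l\<close>. By \<open>n_sq\<close> the result equals \<open>(K + 1)^2 * x^5\<close>.\<close>

lemma quadratic_le:
  assumes "0 \<le> E" "E \<le> real n"
  shows "(real d + E / real l1) * (real d + E / real l2) \<le> (K + 1)\<^sup>2 * ((real n)\<^sup>2 / (real l1 * real l2))"
proof -
  have "real d + E / real l \<le> (K + 1) * (real n / real l)" if "real d \<le> K * (real n / real l)" "0 < real l" for l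
  proof -
    have "E / real l \<le> real n / real l" using that(2) by (intro divide_right_mono assms(2)) simp
    then show ?thesis unfolding distrib_right mult_1 using that(1) by linarith
  qed
  from mult_mono[OF this[OF d_le(1) lpos(1)] this[OF d_le(2) lpos(2)]]
  have "(real d + E / real l1) * (real d + E / real l2) \<le> ((K + 1) * (real n / real l1)) * ((K + 1) * (real n / real l2))"
    using assms K lpos by simp
  then show ?thesis by (simp add: power2_eq_square mult_ac)
qed

lemma n_sq: "(real n)\<^sup>2 / (real l1 * real l2) = x ^ 5"
  using lpos unfolding x5[symmetric] by simp

abbreviation "c1 \<equiv> cell_factor K"

lemma c1: "1 \<le> c1" using K by (rule cell_factor_ge_1)

text \<open>If \<open>x\<close> were below the minimum, then
  \<open>1 \<le> d^2 \<le> K^2 * x^5 \<le> K^2 * x < 1\<close>.\<close>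

lemma d_le_x: "real d \<le> c1 * x"
proof -
  let ?m = "min 1 (1 / K\<^sup>2)"
  have m0: "0 < ?m" using K by simp
  have "?m \<le> x"
  proof (rule ccontr)
    assume "\<not> ?m \<le> x"
    then have x1: "x < 1" "x < 1 / K\<^sup>2" by auto
    have "1 \<le> (real d)\<^sup>2" using d by simp
    also have "\<dots> \<le> (K * (real n / real l1)) * (K * (real n / real l2))"
      unfolding power2_eq_square using d_le by (intro mult_mono) auto
    also have "\<dots> = K\<^sup>2 * x ^ 5" unfolding n_sq[symmetric] by (simp add: power2_eq_square)
    also have "\<dots> \<le> K\<^sup>2 * x" using x0 x1(1) power_decreasing[of 1 5 x] by (intro mult_left_mono) auto
    also have "\<dots> < 1" using x1(2) K by (simp add: pos_less_divide_eq mult.commute)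
    finally show False by simp
  qed
  then have "1 \<le> x / ?m" using m0 by (simp add: pos_le_divide_eq)
  then show ?thesis unfolding cell_factor_def using dx by (simp add: algebra_simps)
qed

end

lemma sum_abs_dev_le:
  assumes "set_pmf q \<subseteq> A \<times> B" "finite A" "finite B"
  shows "(\<Sum>g\<in>A \<times> B. \<bar>dev q g\<bar>) \<le> 2"
proof -
  have "(\<Sum>g\<in>A \<times> B. \<bar>dev q g\<bar>) \<le> (\<Sum>g\<in>A \<times> B. pmf q g + pmf (prod_marg q) g)"
  proof (rule sum_mono)
    fix g
    show "\<bar>dev q g\<bar> \<le> pmf q g + pmf (prod_marg q) g"
      unfolding dev_def using pmf_nonneg[of q g] pmf_nonneg[of "prod_marg q" g] by linarith
  qed
  also have "\<dots> = 1 + 1"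
    unfolding sum.distrib
    by (intro arg_cong2[where f="(+)"] sum_pmf_eq_1) (use assms in \<open>auto simp: prod_marg_def\<close>)
  finally show ?thesis by simp
qed

text \<open>With \<open>\<kappa> = L / d\<close> the factor \<open>\<kappa>^4\<close> meets
  \<open>(K + 1)^2 * d^5\<close>, so the second moment of the statistic is at most a constant times
  \<open>d = \<tau>^2 / \<zeta>\<close>. The lower bound on \<open>\<zeta>\<close> is ten times that
  constant.\<close>

lemma type_I_bound:
  fixes L K \<zeta> :: real
  assumes L: "0 < L" and K: "0 < K" and \<zeta>: "10 * (null_const * (L ^ 4 * (K + 1)\<^sup>2 + 1)) \<le> \<zeta>"
    and R: "regime K x n l1 l2 d" and p: "p \<in> P_chi2 l1 l2 L"
  shows "ennreal (expect n p (\<lambda>S N. psi n l1 l2 d (sqrt (\<zeta> * real d)) S N)) \<le> ennreal (1 / 10)"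
proof -
  interpret regime K x n l1 l2 d by fact
  have "p \<in> E_class l1 l2" using p unfolding P_chi2_def P_class_def by auto
  then interpret eclass p l1 l2 d using d l1 l2 by unfold_locales
  define Cb where "Cb = null_const * (L ^ 4 * (K + 1)\<^sup>2 + 1)"
  have Cb: "0 < Cb" unfolding Cb_def null_const_def by (intro mult_pos_pos add_nonneg_pos) auto
  have \<zeta>0: "0 < \<zeta>" using \<zeta> Cb unfolding Cb_def[symmetric] by linarith
  have d0: "0 < real d" using d by simp
  have \<tau>: "0 < sqrt (\<zeta> * real d)" using \<zeta>0 d0 by simp
  have kp: "0 < L / real d" using L d0 by simp
  from null_structure[OF p less_imp_le[OF L]] obtain V V' :: "nat \<Rightarrow> nat \<Rightarrow> real" where V:
    "\<And>m x y. m \<in> set_pmf \<rho> \<Longrightarrow> (x, y) \<in> G \<Longrightarrow> (dev (q m) (x, y))\<^sup>2 \<le> V m x * V' m y"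
    "\<And>m x. 0 \<le> V m x" "\<And>m y. 0 \<le> V' m y"
    "\<And>m x. m \<in> set_pmf \<rho> \<Longrightarrow> pmf (map_pmf fst (q m)) x = 0 \<Longrightarrow> V m x = 0"
    "\<And>m y. m \<in> set_pmf \<rho> \<Longrightarrow> pmf (map_pmf snd (q m)) y = 0 \<Longrightarrow> V' m y = 0"
    "\<And>m. m \<in> set_pmf \<rho> \<Longrightarrow> (\<Sum>x\<in>{1..l1}. V m x / pmf (map_pmf fst (q m)) x) \<le> L / real d"
    "\<And>m. m \<in> set_pmf \<rho> \<Longrightarrow> (\<Sum>y\<in>{1..l2}. V' m y / pmf (map_pmf snd (q m)) y) \<le> L / real d" by blast
  show ?thesis
  proof (rule type_I_reduction[OF n])
    fix N assume N: "N \<le> n"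
    let ?X = "(real d + real N / real l1) * (real d + real N / real l2)"
    have "E_pmf (Pi_pmf {1..N} dflt (\<lambda>_. law)) (\<lambda>F. of_bool (sqrt (\<zeta> * real d) \<le> T_labelled l1 l2 d N F)) \<le>
      null_const * ((L / real d) ^ 4 * ?X + real d) / (sqrt (\<zeta> * real d))\<^sup>2"
      by (rule mix.null_error[OF V kp \<tau>])
    also have "\<dots> \<le> Cb * real d / (sqrt (\<zeta> * real d))\<^sup>2"
    proof (rule divide_right_mono)
      have "?X \<le> (K + 1)\<^sup>2 * x ^ 5" using quadratic_le[of "real N"] N unfolding n_sq by simp
      also have "\<dots> \<le> (K + 1)\<^sup>2 * real d ^ 5" using x0 xd by (intro mult_left_mono power_mono) auto
      finally have "(L / real d) ^ 4 * ?X \<le> (L / real d) ^ 4 * ((K + 1)\<^sup>2 * real d ^ 5)"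
        by (rule mult_left_mono) simp
      also have "\<dots> = L ^ 4 * (K + 1)\<^sup>2 * real d"
      proof -
        have "(L / real d) ^ 4 * real d ^ 5 = L ^ 4 * real d"
          using d0 by (simp add: power_divide eval_nat_numeral)
        then show ?thesis by (metis mult.assoc mult.commute)
      qed
      finally have "null_const * ((L / real d) ^ 4 * ?X + real d) \<le> null_const * (L ^ 4 * (K + 1)\<^sup>2 * real d + real d)"
        by (intro mult_left_mono) (auto simp: null_const_def)
      then show "null_const * ((L / real d) ^ 4 * ?X + real d) \<le> Cb * real d" unfolding Cb_def by (simp add: algebra_simps)
    qed simp
    also have "\<dots> = Cb / \<zeta>" using \<zeta>0 d0 by simp
    also have "\<dots> \<le> 1 / 10" using \<zeta> \<zeta>0 unfolding Cb_def[symmetric] by (simp add: pos_divide_le_eq)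
    finally show "E_pmf (Pi_pmf {1..N} dflt (\<lambda>_. law)) (\<lambda>F. of_bool (sqrt (\<zeta> * real d) \<le> T_labelled l1 l2 d N F)) \<le> 1 / 10" .
  qed simp
qed

text \<open>Each summand in the bound on \<open>c\<close> serves one step. \<open>4 * L\<close>
  makes the smoothness error \<open>L / d\<close> at most \<open>\<epsilon> / 4\<close>.
  \<open>480\<close> yields \<open>x \<ge> 160\<close>, hence \<open>n \<ge> 160\<close>.
  \<open>25600 * cell_factor K\<close> makes the light cells cost at most
  \<open>\<epsilon> / 4\<close>. The last one lifts the signal to the level required by
  \<open>alternative_error\<close>.\<close>

lemma type_II_bound:
  fixes L K \<zeta> \<epsilon> :: real
  assumes L: "0 < L" and K: "0 < K" and \<zeta>: "0 \<le> \<zeta>" and R: "regime K x n l1 l2 d" and p: "p \<in> Q_TV_far l1 l2 L \<epsilon>"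
    and c: "4 * L + 480 + 25600 * cell_factor K + 1024 * (K + 1) * cell_factor K * (2 * 10 ^ 26 + 4 * sqrt \<zeta>) \<le> c"
    and \<epsilon>: "c / x \<le> \<epsilon>"
  shows "ennreal (expect n p (\<lambda>S N. 1 - psi n l1 l2 d (sqrt (\<zeta> * real d)) S N)) \<le> ennreal (1 / 10 + exp (- real n / 8))"
proof -
  interpret regime K x n l1 l2 d by fact
  have "p \<in> E_class l1 l2" using p unfolding Q_TV_far_def Q_TV_def Q_class_def by auto
  then interpret eclass p l1 l2 d using d l1 l2 by unfold_locales
  define e where "e = (\<lambda>m. \<Sum>g\<in>G. \<bar>dev (q m) g\<bar>)"
  have e0: "0 \<le> e m" and e2: "e m \<le> 2" for m
    unfolding e_def using sum_abs_dev_le[OF set_q] by (auto intro: sum_nonneg)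
  have d0: "0 < real d" using d by simp
  \<comment> \<open>From \<open>2 * max (10^26) (2 * sqrt \<zeta>)\<close>, with the maximum
    replaced by the sum.\<close>
  define Cz where "Cz = 2 * 10 ^ 26 + 4 * sqrt \<zeta>"
  have Cz: "0 \<le> Cz" unfolding Cz_def using \<zeta> by simp
  have t: "0 \<le> 1024 * (K + 1) * c1 * Cz" using K c1 Cz by simp
  have c': "4 * L \<le> c" "480 \<le> c" "25600 * c1 \<le> c" "1024 * (K + 1) * c1 * Cz \<le> c" "1 \<le> c"
    using c L c1 t unfolding Cz_def[symmetric] by linarith+
  have cx: "c \<le> \<epsilon> * x" using \<epsilon> x0 by (simp add: pos_divide_le_eq)
  have \<epsilon>0: "0 < \<epsilon>" using cx c'(5) x0 by (smt (verit) mult_nonpos_nonneg)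
  have far: "\<epsilon> \<le> L / real d + (\<Sum>m\<in>{1..d}. pmf \<rho> m * e m)"
    unfolding e_def by (rule alternative_structure[OF p less_imp_le[OF L]])
  have "L / real d \<le> L / x" using L x0 xd by (intro divide_left_mono) auto
  also have "\<dots> \<le> \<epsilon> / 4" using c'(1) cx x0 by (simp add: pos_divide_le_eq)
  finally have far': "3 / 4 * \<epsilon> \<le> (\<Sum>m\<in>{1..d}. pmf \<rho> m * e m)" using far by linarith
  have s1: "(\<Sum>m\<in>{1..d}. pmf \<rho> m) = 1" by (rule sum_pmf_eq_1[OF _ set_\<rho>]) simp
  \<comment> \<open>An upper bound on the separation: \<open>3 / 4 * \<epsilon> \<le> 2\<close>
    gives \<open>\<epsilon> \<le> 3\<close>, and then \<open>c \<le> \<epsilon> * x\<close> forces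
    \<open>x\<close> to be large.\<close>
  have "(\<Sum>m\<in>{1..d}. pmf \<rho> m * e m) \<le> (\<Sum>m\<in>{1..d}. pmf \<rho> m * 2)"
    by (intro sum_mono mult_left_mono e2) auto
  also have "\<dots> = 2" using s1 by (simp add: sum_distrib_right[symmetric])
  finally have "\<epsilon> \<le> 3" using far' by linarith
  then have "480 \<le> 3 * x" using cx c'(2) mult_right_mono[of \<epsilon> 3 x] x0 by linarith
  then have x160: "160 \<le> x" by simp
  have x2n: "x\<^sup>2 \<le> real n"
  proof (rule power2_le_imp_le)
    have "(x\<^sup>2)\<^sup>2 = x ^ 4" by (simp add: power_mult[symmetric])
    also have "\<dots> \<le> x ^ 5" using x160 by (intro power_increasing) auto
    also have "\<dots> \<le> x ^ 5 * (real l1 * real l2)"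
    proof -
      have "1 * 1 \<le> real l1 * real l2" using l1 l2 by (intro mult_mono) auto
      then show ?thesis using mult_left_mono[of 1 "real l1 * real l2" "x ^ 5"] x0 by simp
    qed
    also have "\<dots> = (real n)\<^sup>2" by (rule x5)
    finally show "(x\<^sup>2)\<^sup>2 \<le> (real n)\<^sup>2" .
  qed simp
  have "160 \<le> real n"
  proof -
    have "x * 1 \<le> x * x" using x160 by (intro mult_left_mono) auto
    then show ?thesis using x2n x160 unfolding power2_eq_square by linarith
  qed
  then have n160: "160 \<le> n" by simp
  show ?thesis
  proof (rule type_II_reduction[OF n160])
    fix N assume N: "real n / 4 \<le> real N" "N \<le> n"
    have N0: "0 < real N" using N(1) n160 by linarith
    define H where "H = {m \<in> {1..d}. 800 \<le> real N * pmf \<rho> m}"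
    define lam where "lam = (\<lambda>m. real N * pmf \<rho> m)"
    have lamH: "0 < lam m" if "m \<in> H" for m using that unfolding H_def lam_def by auto
    have H: "H \<subseteq> {1..d}" "finite H" unfolding H_def by auto
    \<comment> \<open>A light cell has probability at most \<open>800 / N \<le> 3200 / n\<close> and
      deviation at most 2, and there are at most \<open>cell_factor K * x\<close> cells. The
      inequality \<open>x^2 \<le> n\<close> then brings in
      \<open>\<epsilon> * x \<ge> c\<close>.\<close>
    have light: "(\<Sum>m\<in>{1..d} - H. pmf \<rho> m * e m) \<le> \<epsilon> / 4"
    proof -
      have "(\<Sum>m\<in>{1..d} - H. pmf \<rho> m * e m) \<le> (\<Sum>m\<in>{1..d} - H. 800 / real N * 2)"
      proof (intro sum_mono mult_mono e2 e0)
        fix m assume "m \<in> {1..d} - H"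
        then have "real N * pmf \<rho> m \<le> 800" unfolding H_def by auto
        then show "pmf \<rho> m \<le> 800 / real N" using N0 by (simp add: pos_le_divide_eq mult.commute)
      qed (use N0 in auto)
      also have "\<dots> \<le> real d * (1600 / real N)"
      proof -
        have "card ({1..d} - H) \<le> card {1..d}" by (rule card_mono) auto
        then have "real (card ({1..d} - H)) \<le> real d" by simp
        then show ?thesis using N0 by (simp add: mult_right_mono divide_right_mono)
      qed
      also have "\<dots> \<le> (c1 * x) * (6400 / real n)"
      proof (rule mult_mono[OF d_le_x])
        have "1600 / real N \<le> 1600 / (real n / 4)"
          using N n by (intro divide_left_mono) (auto intro!: mult_pos_pos)
        then show "1600 / real N \<le> 6400 / real n" by simp
      qed (use c1 x0 N0 in auto)
      also have "\<dots> \<le> \<epsilon> / 4"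
      proof -
        have "25600 * c1 * x \<le> (\<epsilon> * x) * x" using c'(3) cx x0 by (intro mult_right_mono) auto
        also have "\<dots> = \<epsilon> * x\<^sup>2" by (simp add: power2_eq_square)
        also have "\<dots> \<le> \<epsilon> * real n" using x2n \<epsilon>0 by (intro mult_left_mono) auto
        finally have "25600 * c1 * x \<le> \<epsilon> * real n" .
        then show ?thesis using n by (simp add: field_simps)
      qed
      finally show ?thesis .
    qed
    have "(\<Sum>m\<in>{1..d}. pmf \<rho> m * e m) = (\<Sum>m\<in>{1..d} - H. pmf \<rho> m * e m) + (\<Sum>m\<in>H. pmf \<rho> m * e m)"
      by (rule sum.subset_diff) (use H in auto)
    then have heavy: "\<epsilon> / 2 \<le> (\<Sum>m\<in>H. pmf \<rho> m * e m)" using far' light by linarith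
    define S1 where "S1 = (\<Sum>m\<in>H. lam m * omega_at l1 l2 (lam m) * (e m)\<^sup>2)"
    define s where "s = sqrt (real l1 * real l2)"
    have s0: "0 < s" unfolding s_def using lpos by simp
    have s2: "s\<^sup>2 = real l1 * real l2" unfolding s_def using lpos by simp
    \<comment> \<open>Solves \<open>x^5 * s^2 = n^2\<close> for \<open>n\<close>, so that the signal
      below can be written in \<open>x\<close>, \<open>s\<close> and
      \<open>\<epsilon>\<close>.\<close>
    have nxs: "real n = x\<^sup>2 * sqrt x * s"
    proof (rule power2_eq_imp_eq)
      have "(x\<^sup>2 * sqrt x * s)\<^sup>2 = x ^ 5 * s\<^sup>2" using x0 by (simp add: power_mult_distrib eval_nat_numeral)
      then show "(real n)\<^sup>2 = (x\<^sup>2 * sqrt x * s)\<^sup>2" unfolding s2 x5 by simp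
    qed (use x0 s0 in auto)
    have ratio: "(\<Sum>m\<in>H. lam m / omega_at l1 l2 (lam m)) \<le> (K + 1) * (real n / s)"
    proof -
      have "(\<Sum>m\<in>H. lam m) \<le> (\<Sum>m\<in>{1..d}. lam m)"
        by (rule sum_mono2) (use H in \<open>auto simp: lam_def\<close>)
      also have "\<dots> = real N" unfolding lam_def sum_distrib_left[symmetric] s1 by simp
      also have "\<dots> \<le> real n" using N by simp
      finally have sl: "(\<Sum>m\<in>H. lam m) \<le> real n" .
      have "card H \<le> card {1..d}" by (rule card_mono) (use H in auto)
      then have cH: "real (card H) \<le> real d" by simp
      have "(\<Sum>m\<in>H. lam m / omega_at l1 l2 (lam m)) \<le> sqrt ((real d + real n / real l1) * (real d + real n / real l2))"
        by (rule sum_ratio_omega_le[OF l1 l2 lamH H(2) cH sl])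
      also have "\<dots> \<le> sqrt ((K + 1)\<^sup>2 * ((real n)\<^sup>2 / (real l1 * real l2)))"
        by (rule real_sqrt_le_mono[OF quadratic_le]) auto
      also have "\<dots> = (K + 1) * (real n / s)"
        unfolding s_def using K by (simp add: real_sqrt_mult real_sqrt_divide)
      finally show ?thesis .
    qed
    \<comment> \<open>Splits \<open>lam * e\<close> into \<open>sqrt (lam * \<omega>) * e\<close>
      and \<open>sqrt (lam / \<omega>)\<close>, where \<open>\<omega>\<close> is
      \<open>omega_at\<close> at the expected count; the squares of the second factor are summed in
      \<open>ratio\<close>.\<close>
    have cs: "(\<Sum>m\<in>H. lam m * e m)\<^sup>2 \<le> S1 * ((K + 1) * (real n / s))"
    proof -
      have omp: "0 < omega_at l1 l2 (lam m)" if "m \<in> H" for m by (rule omega_at_pos[OF l1 l2 lamH[OF that]])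
      have eq: "(\<Sum>m\<in>H. lam m * e m) = (\<Sum>m\<in>H. sqrt (lam m * omega_at l1 l2 (lam m)) * e m * sqrt (lam m / omega_at l1 l2 (lam m)))"
      proof (rule sum.cong[OF refl])
        fix m assume m: "m \<in> H"
        have "sqrt (lam m * omega_at l1 l2 (lam m)) * sqrt (lam m / omega_at l1 l2 (lam m)) = sqrt (lam m * lam m)"
          unfolding real_sqrt_mult[symmetric] using omp[OF m] by simp
        also have "\<dots> = lam m" using lamH[OF m] by simp
        finally have "e m * (sqrt (lam m * omega_at l1 l2 (lam m)) * sqrt (lam m / omega_at l1 l2 (lam m))) = e m * lam m" by simp
        then show "lam m * e m = sqrt (lam m * omega_at l1 l2 (lam m)) * e m * sqrt (lam m / omega_at l1 l2 (lam m))"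
          by (simp only: mult_ac)
      qed
      have "(\<Sum>m\<in>H. lam m * e m)\<^sup>2 \<le> (\<Sum>m\<in>H. (sqrt (lam m * omega_at l1 l2 (lam m)) * e m)\<^sup>2) * (\<Sum>m\<in>H. (sqrt (lam m / omega_at l1 l2 (lam m)))\<^sup>2)"
        unfolding eq by (rule Cauchy_Schwarz_ineq_sum)
      also have "(\<Sum>m\<in>H. (sqrt (lam m * omega_at l1 l2 (lam m)) * e m)\<^sup>2) = S1"
        unfolding S1_def
      proof (rule sum.cong[OF refl])
        fix m assume "m \<in> H"
        then show "(sqrt (lam m * omega_at l1 l2 (lam m)) * e m)\<^sup>2 = lam m * omega_at l1 l2 (lam m) * (e m)\<^sup>2"
          using lamH[of m] omp[of m] by (simp add: power_mult_distrib less_imp_le)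
      qed
      also have "(\<Sum>m\<in>H. (sqrt (lam m / omega_at l1 l2 (lam m)))\<^sup>2) = (\<Sum>m\<in>H. lam m / omega_at l1 l2 (lam m))"
      proof (rule sum.cong[OF refl])
        fix m assume "m \<in> H"
        then show "(sqrt (lam m / omega_at l1 l2 (lam m)))\<^sup>2 = lam m / omega_at l1 l2 (lam m)"
          using lamH[of m] omp[of m] by (simp add: less_imp_le)
      qed
      also have "S1 * \<dots> \<le> S1 * ((K + 1) * (real n / s))"
      proof (rule mult_left_mono[OF ratio])
        show "0 \<le> S1" unfolding S1_def
        proof (rule sum_nonneg)
          fix m assume "m \<in> H"
          then show "0 \<le> lam m * omega_at l1 l2 (lam m) * (e m)\<^sup>2" using lamH[of m] omp[of m] by simp
        qed
      qed
      finally show ?thesis .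
    qed
    have "real n * \<epsilon> / 8 \<le> (\<Sum>m\<in>H. lam m * e m)"
    proof -
      have "real n / 4 * (\<epsilon> / 2) \<le> real N * (\<Sum>m\<in>H. pmf \<rho> m * e m)"
        using N heavy \<epsilon>0 by (intro mult_mono) auto
      also have "\<dots> = (\<Sum>m\<in>H. lam m * e m)" unfolding lam_def sum_distrib_left by (simp add: mult.assoc)
      finally show ?thesis by simp
    qed
    then have "(real n * \<epsilon> / 8)\<^sup>2 \<le> (\<Sum>m\<in>H. lam m * e m)\<^sup>2" using \<epsilon>0 by (intro power_mono) auto
    also note cs
    finally have S1: "(real n * \<epsilon> / 8)\<^sup>2 \<le> S1 * ((K + 1) * (real n / s))" .
    have key: "Cz * sqrt (real d) \<le> S1 / (16 * real l1 * real l2)"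
    proof -
      have n0: "0 < real n" using n by simp
      have "real n * \<epsilon>\<^sup>2 * s / (64 * (K + 1)) \<le> S1"
      proof -
        have "(real n * \<epsilon> / 8)\<^sup>2 * (s / ((K + 1) * real n)) \<le> S1 * ((K + 1) * (real n / s)) * (s / ((K + 1) * real n))"
          using n0 s0 K by (intro mult_right_mono[OF S1]) auto
        moreover have "S1 * ((K + 1) * (real n / s)) * (s / ((K + 1) * real n)) = S1" using n0 s0 K by simp
        moreover have "(real n * \<epsilon> / 8)\<^sup>2 * (s / ((K + 1) * real n)) = real n * \<epsilon>\<^sup>2 * s / (64 * (K + 1))"
        proof -
          have "(a * \<epsilon> / 8)\<^sup>2 * (s / (k * a)) = a * \<epsilon>\<^sup>2 * s / (64 * k)" if "a \<noteq> 0" "k \<noteq> 0" for a k :: real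
            using that by (simp add: power2_eq_square)
          from this[of "real n" "K + 1"] show ?thesis using n0 K by simp
        qed
        ultimately show ?thesis by simp
      qed
      then have "real n * \<epsilon>\<^sup>2 * s / (64 * (K + 1)) / (16 * s\<^sup>2) \<le> S1 / (16 * s\<^sup>2)"
        by (rule divide_right_mono) simp
      moreover have "real n * \<epsilon>\<^sup>2 * s / (64 * (K + 1)) / (16 * s\<^sup>2) = (\<epsilon> * x)\<^sup>2 * sqrt x / (1024 * (K + 1))"
      proof -
        have "x\<^sup>2 * y * s * \<epsilon>\<^sup>2 * s / (64 * k) / (16 * s\<^sup>2) = (\<epsilon> * x)\<^sup>2 * y / (1024 * k)" if "k \<noteq> 0" for k y :: real
          using that s0 by (simp add: power2_eq_square)
        from this[of "K + 1" "sqrt x"] show ?thesis unfolding nxs using K by simp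
      qed
      \<comment> \<open>Here \<open>1024 = 64 * 16\<close>. The signal is of order at least
        \<open>(\<epsilon> * x)^2 * sqrt x\<close>, while the required level is of order
        \<open>sqrt d\<close>, that is, at most of order \<open>sqrt x\<close>.\<close>
      ultimately have 1: "(\<epsilon> * x)\<^sup>2 * sqrt x / (1024 * (K + 1)) \<le> S1 / (16 * real l1 * real l2)"
        unfolding s2 by (simp add: mult.assoc)
      have "1024 * (K + 1) * c1 * Cz \<le> c * 1" using c'(4) by simp
      also have "c * 1 \<le> c * c" using c'(5) by (intro mult_left_mono) auto
      also have "\<dots> \<le> (\<epsilon> * x)\<^sup>2" unfolding power2_eq_square using cx c'(5) by (intro mult_mono) auto
      finally have 2: "1024 * (K + 1) * c1 * Cz \<le> (\<epsilon> * x)\<^sup>2" .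
      have "sqrt (real d) \<le> sqrt (c1 * x)" using d_le_x by simp
      also have "\<dots> = sqrt c1 * sqrt x" by (rule real_sqrt_mult)
      also have "\<dots> \<le> c1 * sqrt x"
      proof (rule mult_right_mono)
        show "sqrt c1 \<le> c1"
        proof (rule real_le_lsqrt)
          show "c1 \<le> c1\<^sup>2" using mult_right_mono[of 1 c1 c1] c1 by (simp add: power2_eq_square)
        qed (use c1 in auto)
      qed (use x0 in auto)
      finally have "Cz * sqrt (real d) \<le> Cz * (c1 * sqrt x)" using Cz by (rule mult_left_mono)
      also have "\<dots> = (1024 * (K + 1) * c1 * Cz) * sqrt x / (1024 * (K + 1))"
      proof -
        have "Cz * (c1 * y) = (1024 * k * c1 * Cz) * y / (1024 * k)" if "k \<noteq> 0" for k y :: real using that by simp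
        from this[of "K + 1" "sqrt x"] show ?thesis using K by simp
      qed
      also have "\<dots> \<le> (\<epsilon> * x)\<^sup>2 * sqrt x / (1024 * (K + 1))"
        using 2 K x0 by (intro divide_right_mono mult_right_mono) auto
      finally show ?thesis using 1 by linarith
    qed
    show "E_pmf (Pi_pmf {1..N} dflt (\<lambda>_. law)) (\<lambda>F. of_bool (T_labelled l1 l2 d N F < sqrt (\<zeta> * real d))) \<le> 1 / 20"
    proof (rule mix.alternative_error[OF d H(1)])
      show "800 \<le> real N * pmf \<rho> m" if "m \<in> H" for m using that unfolding H_def by auto
      have "2 * max (10 ^ 26 * sqrt (real d)) (2 * sqrt (\<zeta> * real d)) \<le> Cz * sqrt (real d)"
        unfolding Cz_def real_sqrt_mult using \<zeta> by (auto simp: max_def algebra_simps)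
      also note key
      also have "S1 / (16 * real l1 * real l2) = (\<Sum>m\<in>H. real N * pmf \<rho> m * omega_at l1 l2 (real N * pmf \<rho> m) *
          (\<Sum>g\<in>{1..l1} \<times> {1..l2}. \<bar>dev (q m) g\<bar>)\<^sup>2 / (16 * real l1 * real l2))"
        unfolding S1_def e_def lam_def sum_divide_distrib ..
      finally show "2 * max (10 ^ 26 * sqrt (real d)) (2 * sqrt (\<zeta> * real d)) \<le> (\<Sum>m\<in>H. real N * pmf \<rho> m * omega_at l1 l2 (real N * pmf \<rho> m) *
          (\<Sum>g\<in>{1..l1} \<times> {1..l2}. \<bar>dev (q m) g\<bar>)\<^sup>2 / (16 * real l1 * real l2))" .
    qed
  qed
qed

text \<open>The suprema are taken in the extended nonnegative reals, where the supremum of the empty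
  family is 0.\<close>

theorem theorem5p5:
  fixes L K :: real
  assumes "L > 0" and "K > 0"
  shows "\<exists>\<zeta>0>0. \<forall>\<zeta>\<ge>\<zeta>0. \<exists>c>0. \<forall>(n::nat) (l1::nat) (l2::nat) (d::nat) (\<tau>::real) (\<epsilon>::real).
      n \<ge> 1 \<longrightarrow> l1 \<ge> l2 \<longrightarrow> l2 \<ge> 1 \<longrightarrow>
      d = num_cells n l1 l2 \<longrightarrow> \<tau> = sqrt (\<zeta> * real d) \<longrightarrow>
      real d * real l1 \<le> K * real n \<longrightarrow>
      \<epsilon> \<ge> c * real (l1 * l2) powr (1 / 5) / real n powr (2 / 5) \<longrightarrow>
        (SUP p\<in>P_chi2 l1 l2 L. ennreal (expect n p (\<lambda>S N. psi n l1 l2 d \<tau> S N)))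
          \<le> ennreal (1 / 10) \<and>
        (SUP p\<in>Q_TV_far l1 l2 L \<epsilon>. ennreal (expect n p (\<lambda>S N. 1 - psi n l1 l2 d \<tau> S N)))
          \<le> ennreal (1 / 10 + exp (- real n / 8))"
proof -
  define z0 where "z0 = 10 * (null_const * (L ^ 4 * (K + 1)\<^sup>2 + 1))"
  have z0: "0 < z0" unfolding z0_def null_const_def by (intro mult_pos_pos add_nonneg_pos) auto
  define C where "C = (\<lambda>\<zeta>. 4 * L + 480 + 25600 * cell_factor K + 1024 * (K + 1) * cell_factor K * (2 * 10 ^ 26 + 4 * sqrt \<zeta>))"
  have c1: "0 \<le> cell_factor K" using cell_factor_ge_1[OF assms(2)] by linarith
  have main: "(SUP p\<in>P_chi2 l1 l2 L. ennreal (expect n p (\<lambda>S N. psi n l1 l2 d (sqrt (\<zeta> * real d)) S N))) \<le> ennreal (1 / 10) \<and>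
      (SUP p\<in>Q_TV_far l1 l2 L \<epsilon>. ennreal (expect n p (\<lambda>S N. 1 - psi n l1 l2 d (sqrt (\<zeta> * real d)) S N)))
        \<le> ennreal (1 / 10 + exp (- real n / 8))"
    if \<zeta>: "z0 \<le> \<zeta>" and h: "1 \<le> n" "l2 \<le> l1" "1 \<le> l2" "d = num_cells n l1 l2" "real d * real l1 \<le> K * real n"
      and \<epsilon>: "C \<zeta> * real (l1 * l2) powr (1 / 5) / real n powr (2 / 5) \<le> \<epsilon>"
    for \<zeta> \<epsilon> :: real and n l1 l2 d :: nat
  proof -
    define x where "x = real n powr (2 / 5) / real (l1 * l2) powr (1 / 5)"
    have l1: "1 \<le> l1" using h by simp
    note b = num_cells_bounds[OF h(1) l1 h(3), folded x_def h(4)]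
    have R: "regime K x n l1 l2 d" by unfold_locales (use assms h b in auto)
    have \<zeta>0: "0 \<le> \<zeta>" using \<zeta> z0 by linarith
    have ex: "C \<zeta> / x \<le> \<epsilon>" using \<epsilon> unfolding x_def by simp
    show ?thesis
    proof (intro conjI SUP_least)
      fix p assume "p \<in> P_chi2 l1 l2 L"
      then show "ennreal (expect n p (\<lambda>S N. psi n l1 l2 d (sqrt (\<zeta> * real d)) S N)) \<le> ennreal (1 / 10)"
        by (rule type_I_bound[OF assms \<zeta>[unfolded z0_def] R])
    next
      fix p assume "p \<in> Q_TV_far l1 l2 L \<epsilon>"
      then show "ennreal (expect n p (\<lambda>S N. 1 - psi n l1 l2 d (sqrt (\<zeta> * real d)) S N)) \<le> ennreal (1 / 10 + exp (- real n / 8))"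
        by (rule type_II_bound[OF assms \<zeta>0 R _ _ ex]) (simp add: C_def)
    qed
  qed
  have Cpos: "0 < C \<zeta>" if "z0 \<le> \<zeta>" for \<zeta>
    unfolding C_def using assms c1 that z0 by (intro add_pos_nonneg) (auto intro!: mult_nonneg_nonneg)
  show ?thesis
    by (rule exI[of _ z0], intro conjI allI impI z0, rule_tac x = "C \<zeta>" in exI) (use main Cpos in blast)
qed

end
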